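(* Let $(A,B)$ be a pair of real random variables with $A\ge 0$, $A\not\equiv 1$. Let $\kappa>0$ and $\alpha\in(0,1]$, and assume: (1) $\mathbf{E}A^\kappa=1$ and $\mathbf{E}[A^\kappa\log_+A]=\infty$; (2) $\overline F_\kappa(x)=1-F_\kappa(x)=\ell(x)x^{-\alpha}$ for $x>0$, where $\ell$ is a slowly varying function; (3) $\displaystyle \lim_{\delta\to0}\limsup_{x\to\infty} x\overline F_\kappa(x)\int_1^{\delta x}\frac{1}{y\,\overline F_\kappa(y)^2}\,F_\kappa(x-\mathrm{d}y)=0$; (4) the law of $\log A$ conditioned on $A\neq0$ is nonarithmetic; (5) $\mathbf{E}|B|^\nu<\infty$ for some $\nu>\kappa$; (6) $\mathbf{P}\{Ax+B=x\}<1$ for every $x\in\mathbb{R}$. Let $X$ be the solution of the perpetuity equation $X\stackrel{\mathcal D}{=}AX+B$, where on the right-hand side $(A,B)$ and $X$ are independent. Then $$\lim_{x\to\infty}m(\log x)\,x^\kappa\,\mathbf{P}\{X>x\}=\frac{C_\alpha}{\kappa}\,\mathbf{E}\big[(AX+B)_+^\kappa-(AX)_+^\kappa\big],$$ $$\lim_{x\to\infty}m(\log x)\,x^\kappa\,\mathbf{P}\{X\le -x\}=\frac{C_\alpha}{\kappa}\,\mathbf{E}\big[(AX+B)_-^\kappa-(AX)_-^\kappa\big].$$ Moreover, $$\mathbf{E}\big[(AX+B)_+^\kappa-(AX)_+^\kappa\big]+\mathbf{E}\big[(AX+B)_-^\kappa-(AX)_-^\kappa\big]>0.$$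
   Context: Notation: $x_+=\max\{x,0\}$, $x_-=\max\{-x,0\}$, $\log_+x=\max\{\log x,0\}$ (with $\log_+ 0=0$), $\log 0=-\infty$. $F_\kappa$ is the distribution function $F_\kappa(x)=\mathbf{E}[I(\log A\le x)A^\kappa]$, $x\in\mathbb{R}$ (a probability distribution function since $\mathbf{E}A^\kappa=1$), i.e. the law of $\log A$ under the measure $\mathbf{P}_\kappa\{\log A\in C\}=\mathbf{E}[I(\log A\in C)A^\kappa]$; $\overline F_\kappa=1-F_\kappa$. $m(x)=\int_0^x[F_\kappa(-u)+\overline F_\kappa(u)]\,\mathrm{d}u$ and $C_\alpha=[\Gamma(\alpha)\Gamma(2-\alpha)]^{-1}$. For a distribution function $H$, $\int_1^{\delta x}\varphi(y)\,H(x-\mathrm{d}y)$ means $\int \varphi(x-z)\,I(1\le x-z\le\delta x)\,H(\mathrm{d}z)$. "The solution" refers to the law of $X$; under these assumptions it is known to exist and be unique. In the expectations, $X$ is independent of $(A,B)$. *)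

theory Defs
  imports "HOL-Probability.Probability"
begin

text \<open>
  The law of \<open>log A\<close> under \<open>P\<^sub>\<kappa>(d\<omega>) = A(\<omega>)\<^sup>\<kappa> P(d\<omega>)\<close>. The value of \<^term>\<open>ln\<close> at \<open>0\<close> is irrelevant:
  \<^term>\<open>0 powr \<kappa>\<close> is \<open>0\<close>, so the event \<open>A = 0\<close> has density zero. This is why a law on the reals
  is adequate although the mathematical convention is \<open>log 0 = -\<infinity>\<close>.
\<close>

definition tilted_log_law :: "'a measure \<Rightarrow> ('a \<Rightarrow> real) \<Rightarrow> real \<Rightarrow> real measure" where
  "tilted_log_law M A \<kappa> = distr (density M (\<lambda>\<omega>. ennreal (A \<omega> powr \<kappa>))) borel (\<lambda>\<omega>. ln (A \<omega>))"

definition tilted_cdf :: "'a measure \<Rightarrow> ('a \<Rightarrow> real) \<Rightarrow> real \<Rightarrow> real \<Rightarrow> real" where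
  "tilted_cdf M A \<kappa> x = cdf (tilted_log_law M A \<kappa>) x"

definition tilted_tail :: "'a measure \<Rightarrow> ('a \<Rightarrow> real) \<Rightarrow> real \<Rightarrow> real \<Rightarrow> real" where
  "tilted_tail M A \<kappa> x = 1 - tilted_cdf M A \<kappa> x"

text \<open>
  \<open>F\<^sub>\<kappa>(x) = E[I(log A \<le> x) A\<^sup>\<kappa>]\<close>; the event \<open>log A \<le> x\<close> is written \<open>A \<le> exp x\<close>, which
  accounts for \<open>log 0 = -\<infinity>\<close>.
\<close>

lemma tilted_cdf_eq_expectation:
  fixes A :: "'a \<Rightarrow> real"
  assumes [measurable]: "A \<in> borel_measurable M"
    and nonneg: "AE \<omega> in M. 0 \<le> A \<omega>"
  shows "tilted_cdf M A \<kappa> x = (\<integral>\<omega>. indicator {\<omega>. A \<omega> \<le> exp x} \<omega> * A \<omega> powr \<kappa> \<partial>M)"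
proof -
  have "emeasure (tilted_log_law M A \<kappa>) {..x}
      = (\<integral>\<^sup>+\<omega>. ennreal (A \<omega> powr \<kappa>) * indicator ((\<lambda>\<omega>. ln (A \<omega>)) -` {..x} \<inter> space M) \<omega> \<partial>M)"
    unfolding tilted_log_law_def by (simp add: emeasure_distr emeasure_density)
  also have "\<dots> = (\<integral>\<^sup>+\<omega>. ennreal (indicator {\<omega>. A \<omega> \<le> exp x} \<omega> * A \<omega> powr \<kappa>) \<partial>M)"
  proof (rule nn_integral_cong_AE)
    show "AE \<omega> in M. ennreal (A \<omega> powr \<kappa>) * indicator ((\<lambda>\<omega>. ln (A \<omega>)) -` {..x} \<inter> space M) \<omega>
        = ennreal (indicator {\<omega>. A \<omega> \<le> exp x} \<omega> * A \<omega> powr \<kappa>)"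
      using nonneg AE_space
    proof eventually_elim
      case (elim \<omega>)
      have "ln (A \<omega>) \<le> x \<longleftrightarrow> A \<omega> \<le> exp x" if "A \<omega> \<noteq> 0"
        using elim that ln_le_cancel_iff[of "A \<omega>" "exp x"] by simp
      then show ?case
        using elim by (cases "A \<omega> = 0") (simp_all add: indicator_def)
    qed
  qed
  finally show ?thesis
    unfolding tilted_cdf_def cdf_def measure_def
    by (subst integral_eq_nn_integral) (auto simp: indicator_def)
qed

definition truncated_mean :: "'a measure \<Rightarrow> ('a \<Rightarrow> real) \<Rightarrow> real \<Rightarrow> real \<Rightarrow> real" where
  "truncated_mean M A \<kappa> x = (LBINT u=0..x. tilted_cdf M A \<kappa> (- u) + tilted_tail M A \<kappa> u)"

definition slowly_varying :: "(real \<Rightarrow> real) \<Rightarrow> bool" where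
  "slowly_varying l \<longleftrightarrow>
     (\<exists>a. set_borel_measurable borel {a..} l \<and> (\<forall>x\<ge>a. 0 < l x)) \<and>
     (\<forall>c>0. ((\<lambda>x. l (c * x) / l x) \<longlongrightarrow> 1) at_top)"

definition C_const :: "real \<Rightarrow> real" where
  "C_const \<alpha> = 1 / (Gamma \<alpha> * Gamma (2 - \<alpha>))"

definition nonarithmetic :: "real measure \<Rightarrow> bool" where
  "nonarithmetic \<mu> \<longleftrightarrow> (\<forall>h>0. \<not> (AE x in \<mu>. \<exists>k::int. x = h * of_int k))"

text \<open>
  \<open>\<integral>\<^sub>a\<^sup>b \<phi>(y) H(x - dy)\<close> for non-negative \<open>\<phi>\<close>, where \<open>H\<close> is given by its measure;
  the integration variable is \<open>z = x - y\<close>, and both endpoints are included.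
\<close>

definition reflected_integral ::
    "real measure \<Rightarrow> real \<Rightarrow> real \<Rightarrow> real \<Rightarrow> (real \<Rightarrow> real) \<Rightarrow> ennreal" where
  "reflected_integral H x a b \<phi> =
     (\<integral>\<^sup>+z. ennreal (\<phi> (x - z)) * indicator {z. a \<le> x - z \<and> x - z \<le> b} z \<partial>H)"

end

theory Submission
  imports Defs
begin

text \<open>
  Put \<open>f(s) = exp(\<kappa>s) P(X > exp s)\<close> and let \<open>F\<close> be the law of \<open>log A\<close> under the tilted measure. Then
  \<open>f = f * F + d\<close>, where \<open>d(s) = exp(\<kappa>s) (P(AX + B > exp s) - P(AX > exp s))\<close> is integrable, so \<open>f = d * U\<close>
  for the renewal measure \<open>U\<close> of \<open>F\<close> (Goldie's implicit renewal theory). Since \<open>F\<close> has infinite mean, the claim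
  amounts to a strong renewal theorem \<open>m(x) U(x + dv) \<rightarrow> C dv\<close>.

  The strong renewal theorem is proved for \<open>u\<^sub>0 = h * U\<close>, where \<open>h\<close> is a probability density whose Fourier
  transform has compact support. More generally let \<open>u\<^sub>k\<close> be \<open>h\<close> convolved with \<open>\<Sum>\<^sub>n (n + k choose k) F\<^sup>*\<^sup>n\<close>, whose Fourier
  transform is \<open>(1 - \<phi>)\<close> to the power \<open>- k - 1\<close> and whose size is \<open>b\<^sub>k(x) = a(x) ^ (k+1) / x\<close> with \<open>a(x) = x / m(x)\<close>. If
  \<open>(k + 2) \<alpha> > 1\<close>, Fourier inversion shows that \<open>u\<^sub>k\<close> oscillates slowly relative to \<open>b\<^sub>k\<close>. The size-bias identity
  \<open>x u\<^sub>k(x) \<approx> (k + 1) \<integral> w u\<^sub>k\<^sub>+\<^sub>1(x - w) F(dw)\<close> passes this property from \<open>k + 1\<close> to \<open>k\<close>; the contribution of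
  \<open>w \<approx> x\<close> is exactly what hypothesis (3) controls. Slow oscillation of \<open>u\<^sub>0\<close> and Karamata's theorem for the Laplace
  transform of \<open>U\<close> give the limit of \<open>m u\<^sub>0\<close>.

  For positivity, let \<open>v(q)\<close> be the probability that the multiplicative random walk with steps \<open>A\<close> started at \<open>q\<close>
  ever exceeds 1. It solves an implicit renewal equation with a nonnegative defect, so \<open>m(s) exp(\<kappa>s) v(exp(-s))\<close> has a positive
  limit, and a symmetrisation argument at the median of \<open>X\<close> bounds \<open>P(|X| > t)\<close> below by a multiple of \<open>v(\<epsilon> / t)\<close>.
\<close>

text \<open>The two conditions on k come from one integral. At frequency t the factor 1 / (1 -
  \<phi>) has size up to \<open>a (1 / abs t)\<close>, roughly abs t to the power -\<alpha>. Only a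
  modulus of continuity of \<phi> is at hand, so oscillation is exploited by shifting t by pi / x;
  this costs one more such factor and gains 1 / \<open>a x\<close>. High frequencies therefore
  converge when (k + 2) \<alpha> > 1, and low ones when (k + 1) \<alpha> < 2. For \<alpha> at most
  1/2 the case k = 0 violates the first condition, the familiar obstruction to a strong renewal
  theorem with infinite mean; this is why k is raised. The least k > 0 that meets the first
  condition satisfies (k + 1) \<alpha> <= 1.

  Slow oscillation, not a limit, is carried down to k = 0, because differences pass through the
  size-bias identity without any constant being known. The constant enters only at the end: Gamma (2
  - \<alpha>) from the Laplace transform of \<open>F\<close>, Gamma \<alpha> from inverting that of
  \<open>U 0\<close>.

  The smoothing by \<open>h\<close> is removed last; exp(\<kappa>s) times a tail need not be
  monotone, but its growth is bounded in one direction, and that suffices.\<close>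

lemmas Lint_bound = Bochner_Integration.integrable_bound
 and Lint_cong = Bochner_Integration.integral_cong
 and Lintable_add = Bochner_Integration.integrable_add
 and Lintable_diff = Bochner_Integration.integrable_diff

abbreviation NI :: "'a measure => ('a => ennreal) => ennreal" where "NI \<equiv> nn_integral"

abbreviation NE :: "'a measure => ('a => real) => ennreal" where "NE M f \<equiv> NI M (\<lambda>x. ennreal (f x))"

abbreviation ind :: "'a set \<Rightarrow> 'a \<Rightarrow> 'b::zero_neq_one" where "ind \<equiv> indicator"

abbreviation cx :: "real \<Rightarrow> complex" where "cx \<equiv> complex_of_real"

abbreviation br :: "real => real" where "br v \<equiv> 1 + abs v"

text \<open>Potter's bounds. Regularity of doubling is enough because monotonicity fills the gaps
  between dyadic points: past some threshold the doubling ratio lies between \<open>2 powr p\<close>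
  and \<open>2 powr q\<close>, and iteration gives both powers. The compact range above
  \<open>y0\<close> goes into the constant.\<close>

lemma potter_bounds:
 fixes f :: "real => real"
 assumes pos: "!!x. 0 < x ==> 0 < f x"
  and mono: "!!x y. 0 < x ==> x <= y ==> f x <= f y"
  and lim: "((\<lambda>x. f (2 * x) / f x) \<longlongrightarrow> 2 powr \<rho>) at_top"
  and pq: "0 <= p" "p < \<rho>" "\<rho> < q" and y0: "0 < y0"
 shows "\<exists>C\<ge>1. \<forall>x y. y0 <= y --> y <= x -->
  f x <= C * (x / y) powr q * f y \<and> (x / y) powr p * f y <= C * f x"
proof -
 have "2 powr p < 2 powr \<rho>" "2 powr \<rho> < 2 powr q" using pq by auto
 then have "\<forall>\<^sub>F x in at_top. 2 powr p < f (2 * x) / f x \<and> f (2 * x) / f x < 2 powr q" using order_tendstoD[OF lim] by (intro eventually_conj) auto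
 then obtain x1 where x1: "!!x. x >= x1 ==> 2 powr p < f (2 * x) / f x \<and> f (2 * x) / f x < 2 powr q" unfolding eventually_at_top_linorder by blast
 define x0 where "x0 = max x1 y0"
 have x0: "0 < x0" "y0 <= x0" using y0 by (auto simp: x0_def)
 have step: "2 powr p * f x <= f (2 * x) \<and> f (2 * x) <= 2 powr q * f x" if "x0 <= x" for x
 proof -
  have "0 < f x" using that x0 by (intro pos) auto
  then show ?thesis using x1[of x] that unfolding x0_def by (auto simp: field_simps)
 qed
 have iter: "(2 powr p) ^ n * f x <= f (2 ^ n * x) \<and> f (2 ^ n * x) <= (2 powr q) ^ n * f x"
  if "x0 <= x" for x n
 proof (induction n)
  case (Suc n)
  have "1 * x <= 2 ^ n * x" using that x0 by simp
  then have "x0 <= 2 ^ n * x" using that by simp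
  note s = step[OF this]
  have "(2 powr p) ^ Suc n * f x <= 2 powr p * f (2 ^ n * x)" using Suc by simp
  moreover have "2 powr q * f (2 ^ n * x) <= (2 powr q) ^ Suc n * f x" using Suc by simp
  ultimately have "(2 powr p) ^ Suc n * f x <= f (2 * (2 ^ n * x)) \<and> f (2 * (2 ^ n * x)) <= (2 powr q) ^ Suc n * f x" using s by linarith
  then show ?case by (simp add: mult.assoc)
 qed simp
 have main: "f x <= 2 powr q * (x / y) powr q * f y \<and> (x / y) powr p * f y <= 2 powr p * f x"
  if "x0 <= y" "y <= x" for x y
 proof -
  have y: "0 < y" using that x0 by auto
  \<comment> \<open>x / y lies between 2 ^ n and 2 ^ Suc n; rounding to a dyadic endpoint costs one
    factor \<open>2 powr q\<close> or \<open>2 powr p\<close>.\<close>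
  define n where "n = nat \<lfloor>log 2 (x / y)\<rfloor>"
  have xy: "1 <= x / y" using that y by simp
  then have "0 <= log 2 (x / y)" by simp
  then have n: "real n <= log 2 (x / y)" "log 2 (x / y) < real n + 1" unfolding n_def by auto
  have "2 ^ n <= x / y" using n(1) xy by (subst (asm) le_log_iff) (auto simp: powr_realpow)
  moreover have "x / y < 2 ^ Suc n" using n(2) xy by (subst (asm) log_less_iff) (auto simp: powr_realpow powr_add)
  ultimately have a: "2 ^ n * y <= x" "x <= 2 ^ Suc n * y" using y by (auto simp: field_simps)
  have "f x <= f (2 ^ Suc n * y)" using that x0 a by (intro mono) auto
  also have "... <= (2 powr q) ^ Suc n * f y" using iter[OF that(1), of "Suc n"] by blast
  also have "... = 2 powr q * (2 ^ n) powr q * f y" by (simp add: powr_realpow[symmetric] powr_powr mult_ac)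
  also have "... <= 2 powr q * (x / y) powr q * f y" using \<open>2 ^ n \<le> x / y\<close> pq pos[OF y] by (intro mult_right_mono mult_left_mono powr_mono2) auto
  finally have 1: "f x <= 2 powr q * (x / y) powr q * f y" .
  have "(x / y) powr p * f y <= (2 ^ Suc n) powr p * f y" using \<open>x / y < 2 ^ Suc n\<close> pq pos[OF y] xy by (intro mult_right_mono powr_mono2) auto
  also have "... = 2 powr p * ((2 powr p) ^ n * f y)" by (simp add: powr_realpow[symmetric] powr_powr powr_mult mult_ac)
  also have "... <= 2 powr p * f (2 ^ n * y)" using iter[OF that(1), of n] by simp
  also have "... <= 2 powr p * f x" using a y by (intro mult_left_mono mono) auto
  finally show ?thesis using 1 by blast
 qed
 \<comment> \<open>A product of factors that are all at least 1, so it dominates each constant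
   arising from the three positions of \<open>x0\<close> relative to y <= x.\<close>
 define B where "B = (2 powr q * 2 powr p) * (f x0 / f y0) * (x0 / y0) powr p"
 have fx: "0 < f x0" "0 < f y0" "f y0 <= f x0" using x0 y0 by (auto intro!: pos mono)
 have r1: "1 <= f x0 / f y0" "1 <= (x0 / y0) powr p" "1 <= 2 powr q" "1 <= 2 powr p" using fx x0 y0 pq by (auto intro!: ge_one_powr_ge_zero)
 have B_ge: "2 powr q * (f x0 / f y0) <= B" "2 powr p * (x0 / y0) powr p <= B" "(x0 / y0) powr p <= B"
  "f x0 / f y0 <= B" "1 <= B" "2 powr q <= B" "2 powr p <= B"
 proof -
  have *: "u <= u * v" "u <= v * u" if "1 <= v" "0 <= u" for u v :: real using mult_left_mono[OF that] by (auto simp: mult_ac)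
  let ?a = "2 powr q" and ?b = "2 powr p" and ?c = "f x0 / f y0" and ?d = "(x0 / y0) powr p"
  have ge: "1 <= ?a * ?b" "1 <= ?a * ?c" "1 <= ?b * ?d" "1 <= ?c * ?d" "1 <= ?a * ?d" "1 <= ?b * ?c"
   using r1 by (auto intro!: mult_ge1_I simp del: times_divide_eq_right times_divide_eq_left)
  have nn: "0 <= ?a" "0 <= ?b" "0 <= ?c" "0 <= ?d" using r1 by auto
  have 1: "?a * ?c <= (?a * ?c) * (?b * ?d)" using ge by (intro *) auto
  show "2 powr q * (f x0 / f y0) <= B" using 1 unfolding B_def by (simp add: mult_ac)
  have 2: "?b * ?d <= (?b * ?d) * (?a * ?c)" using ge by (intro *) auto
  show "2 powr p * (x0 / y0) powr p <= B" using 2 unfolding B_def by (simp add: mult_ac)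
  have "?d <= ?b * ?d" using r1 by (intro *) auto
  then show "(x0 / y0) powr p <= B" using 2 unfolding B_def by (simp add: mult_ac)
  have 3: "?c <= ?a * ?c" using r1 by (intro *) auto
  then show "f x0 / f y0 <= B" using 1 unfolding B_def by (simp add: mult_ac)
  then show "1 <= B" using r1 by simp
  have "?a <= ?a * ?c" using r1 by (intro *) auto
  then show "2 powr q <= B" using 1 unfolding B_def by (simp add: mult_ac)
  have "?b <= ?b * ?d" using r1 by simp
  moreover have "B = (?b * ?d) * (?a * ?c)" unfolding B_def by simp
  ultimately show "2 powr p <= B" using 2 by linarith
 qed
 have "f x <= B * (x / y) powr q * f y \<and> (x / y) powr p * f y <= B * f x"
  if y: "y0 <= y" "y <= x" for x y
 proof -
  have y': "0 < y" using y y0 by auto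
  have fy: "0 < f y" "0 < f x" using y y' by (auto intro!: pos)
  have xy: "1 <= x / y" using y y' by auto
  then have xyq: "1 <= (x / y) powr q" using pq by (intro ge_one_powr_ge_zero) auto
  have fy0: "f y0 <= f y" using y y0 by (intro mono) auto
  consider "x0 <= y" | "y < x0" "x0 <= x" | "x < x0" by linarith
  then show ?thesis
  proof cases
   case 1
   note m = main[OF 1 y(2)]
   have "2 powr q * (x / y) powr q * f y <= B * (x / y) powr q * f y" using B_ge fy by (intro mult_right_mono) auto
   moreover have "2 powr p * f x <= B * f x" using B_ge fy by simp
   ultimately show ?thesis using m by simp
  next
   case 2
   note m = main[OF order_refl 2(2)]
   have "f x <= 2 powr q * (x / x0) powr q * f x0" using m by blast
   also have "... <= 2 powr q * (x / y) powr q * ((f x0 / f y0) * f y)"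
   proof (intro mult_mono)
    show "(x / x0) powr q <= (x / y) powr q" using 2 y' pq by (intro powr_mono2) (auto intro!: divide_left_mono)
    show "f x0 <= f x0 / f y0 * f y" using fx fy0 by (simp add: field_simps)
   qed (use fx fy in auto)
   also have "... = 2 powr q * (f x0 / f y0) * ((x / y) powr q * f y)" by simp
   also have "... <= B * ((x / y) powr q * f y)" using B_ge(1) fy by (intro mult_right_mono) auto
   finally have l: "f x <= B * (x / y) powr q * f y" by simp
   have "(x / y) powr p * f y <= ((x / x0) * (x0 / y0)) powr p * f x0"
   proof (intro mult_mono powr_mono2)
    have "x / y <= x / y0" using y y0 by (intro divide_left_mono) auto
    then show "x / y <= x / x0 * (x0 / y0)" using x0 by simp
    show "f y <= f x0" using 2 y' by (intro mono) auto
   qed (use fx fy pq y y' 2 x0 in auto)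
   also have "... = (x0 / y0) powr p * ((x / x0) powr p * f x0)" by (subst powr_mult) auto
   also have "... <= (x0 / y0) powr p * (2 powr p * f x)" using m by (intro mult_left_mono) auto
   also have "... = 2 powr p * (x0 / y0) powr p * f x" by simp
   also have "... <= B * f x" using B_ge(2) fy by simp
   finally show ?thesis using l by blast
  next
   case 3
   have "f x <= f x0" using 3 y y' by (intro mono) auto
   also have "... <= f x0 / f y0 * f y" using fx fy0 by (simp add: field_simps)
   also have "... <= B * (1 * f y)" unfolding mult_1 using B_ge fy by (intro mult_right_mono) auto
   also have "... <= B * ((x / y) powr q * f y)" using xyq B_ge fy by simp
   finally have l: "f x <= B * (x / y) powr q * f y" by simp
   have "x / y <= x0 / y0" using 3 y y0 by (intro frac_le) auto
   then have "(x / y) powr p <= (x0 / y0) powr p" using xy pq by (intro powr_mono2) auto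
   moreover have "f y <= f x" using y y' by (intro mono) auto
   ultimately have "(x / y) powr p * f y <= (x0 / y0) powr p * f x" using fy by (intro mult_mono) auto
   also have "... <= B * f x" using B_ge fy by simp
   finally show ?thesis using l by blast
  qed
 qed
 then show ?thesis using B_ge(5) by blast
qed

text \<open>Induction on \<open>k\<close>: one more geometric factor replaces the coefficients by
  their partial sums, which the hockey-stick identity evaluates. Absolute summability is carried
  along for the Cauchy product and for later exchanges of sum and integral.\<close>

lemma negative_binomial_sums:
 fixes z :: "'a::{real_normed_field, banach}"
 assumes "norm z < 1"
 shows "summable (\<lambda>n. norm (of_nat ((n + k) choose k) * z ^ n)) \<and>
  (\<lambda>n. of_nat ((n + k) choose k) * z ^ n) sums (1 / (1 - z) ^ Suc k)"
proof (induction k)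
 case 0
 then show ?case using assms geometric_sums[OF assms] by (simp add: norm_power summable_geometric)
next
 case (Suc k)
 let ?a = "\<lambda>z n. of_nat ((n + k) choose k) * z ^ n"
 let ?A = "\<lambda>n. (n + Suc k) choose Suc k"
 have hockey: "(\<Sum>i\<le>n. ((i + k) choose k)) = ?A n" for n by (induction n) (auto simp: add.commute)
 have eq: "(\<Sum>i\<le>n. ?a w i * w ^ (n - i)) = of_nat (?A n) * w ^ n" for n and w :: "'b::{real_normed_field, banach}"
 proof -
  have "(\<Sum>i\<le>n. ?a w i * w ^ (n - i)) = (\<Sum>i\<le>n. of_nat ((i + k) choose k) * w ^ n)" by (intro sum.cong) (auto simp: mult.assoc simp flip: power_add)
  also have "... = of_nat (\<Sum>i\<le>n. ((i + k) choose k)) * w ^ n" by (simp add: sum_distrib_right)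
  finally show ?thesis using hockey by simp
 qed
 have g: "summable (\<lambda>n. norm (z ^ n))" using assms by (simp add: norm_power)
 have "(\<lambda>n. \<Sum>i\<le>n. ?a z i * z ^ (n - i)) sums ((\<Sum>n. ?a z n) * (\<Sum>n. z ^ n))" using Suc g by (intro Cauchy_product_sums) auto
 then have 1: "(\<lambda>n. of_nat (?A n) * z ^ n) sums (1 / (1 - z) ^ Suc (Suc k))" using Suc geometric_sums[OF assms] unfolding eq by (simp add: sums_iff)
 have "summable (\<lambda>n. \<Sum>i\<le>n. ?a (norm z) i * norm z ^ (n - i))"
 proof (rule summable_Cauchy_product)
  show "summable (\<lambda>n. norm (?a (norm z) n))" using Suc by (simp add: norm_mult norm_power)
  show "summable (\<lambda>n. norm (norm z ^ n))" using assms by simp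
 qed
 then have 2: "summable (\<lambda>n. norm (of_nat (?A n) * z ^ n))" unfolding eq by (simp add: norm_mult norm_power del: binomial_Suc_Suc)
 show ?case using 1 2 by blast
qed

lemma Icc_integrable: "integrable lborel (ind {a..b::real} :: real => real)" by (rule integrable_real_indicator) (auto simp: emeasure_lborel_Icc_eq)

section \<open>Band-limited smoothing kernels\<close>

definition sinc2 :: "real => real" where
 "sinc2 v = (if v = 0 then 1 else sin (v / 2) / (v / 2))"

definition rect :: "real => real" where
 "rect = ind {-(1/2)..1/2}"

text \<open>B-splines: the (n + 1)-fold convolution powers of the unit box, with Fourier transform
  \<open>sinc2\<close> to the power n + 1. An even power is nonnegative and can serve as a density
  whose transform has compact support.\<close>

primrec rects :: "nat => real => real" where
 "rects 0 = rect"
| "rects (Suc n) = (\<lambda>t. LBINT u. rects n u * rect (t - u))"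

lemma rect_meas [measurable]: "rect \<in> borel_measurable borel" unfolding rect_def by simp

lemma rects_meas [measurable]: "rects n \<in> borel_measurable borel" by (induction n) (auto intro!: lborel.borel_measurable_lebesgue_integral)

lemma sinc2_meas [measurable]: "sinc2 \<in> borel_measurable borel" unfolding sinc2_def[abs_def] by simp

lemma rect_le: "0 <= rect t" "rect t <= 1" by (auto simp: rect_def)

lemma rect_shift_integral: "integrable lborel (\<lambda>u. rect (t - u))" "(LBINT u. rect (t - u)) = 1"
proof -
 have *: "rect (t - u) = ind {t - 1/2..t + 1/2} u" for u by (auto simp: rect_def indicator_def)
 show "integrable lborel (\<lambda>u. rect (t - u))" "(LBINT u. rect (t - u)) = 1" unfolding * by auto
qed

lemma rects_bounds:
 "0 <= rects n t \<and> rects n t <= 1 \<and> (abs t > real (Suc n) / 2 --> rects n t = 0)"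
proof (induction n arbitrary: t)
 case 0
 then show ?case by (auto simp: rect_def indicator_def)
next
 case (Suc n)
 have "rects (Suc n) t <= (LBINT u. rect (t - u))" unfolding rects.simps
 proof (rule integral_mono')
  fix u show "rects n u * rect (t - u) <= rect (t - u)" using Suc[of u] rect_le[of "t - u"] by (simp add: mult_left_le_one_le)
 qed (use rect_shift_integral rect_le in auto)
 moreover have "0 <= rects (Suc n) t" using Suc rect_le by simp
 moreover have "rects (Suc n) t = 0" if "abs t > real (Suc (Suc n)) / 2"
 proof -
  have "rects n u * rect (t - u) = 0" for u
  proof (cases "abs (t - u) <= 1/2")
   case True
   then have "abs u > real (Suc n) / 2" using that by (auto simp: abs_if split: if_splits)
   then show ?thesis using Suc by simp
  next
   case False
   then show ?thesis by (auto simp: rect_def abs_if split: if_splits)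
  qed
  then have "(\<lambda>u. rects n u * rect (t - u)) = (\<lambda>u. 0)" by blast
  then show ?thesis by simp
 qed
 ultimately show ?case using rect_shift_integral by auto
qed

lemma rects_integrable: "integrable lborel (rects n)"
proof (rule Lint_bound)
 show "integrable lborel (ind {-(real (Suc n) / 2)..real (Suc n) / 2} :: real => real)" by (rule Icc_integrable)
 show "AE t in lborel. norm (rects n t) <= norm (ind {-(real (Suc n) / 2)..real (Suc n) / 2} t :: real)"
 proof (intro AE_I2)
  fix t show "norm (rects n t) <= norm (ind {-(real (Suc n) / 2)..real (Suc n) / 2} t :: real)"
   using rects_bounds[of n t] by (auto simp: indicator_def split: if_splits; (simp add: field_simps)?)
 qed
qed auto

lemma rect_diff: "t <= s ==> abs (rect (t - u) - rect (s - u)) <= ind {t - 1/2..s - 1/2} u + ind {t + 1/2..s + 1/2} u" by (auto simp: rect_def indicator_def)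

text \<open>Since \<open>rects n\<close> is at most 1, only the set where the two shifted unit
  windows disagree counts, and it is contained in two intervals of length abs (t - s).\<close>

lemma rects_lipschitz: "abs (rects (Suc n) t - rects (Suc n) s) <= 2 * abs (t - s)"
proof -
 have *: "abs (rects (Suc n) t - rects (Suc n) s) <= 2 * (s - t)" if "t <= s" for t s
 proof -
  have int: "integrable lborel (\<lambda>u. rects n u * rect (r - u))" for r
  proof (rule Lint_bound[OF rects_integrable[of n]])
   show "AE u in lborel. norm (rects n u * rect (r - u)) <= norm (rects n u)" using rect_le by (auto simp: abs_mult intro!: mult_right_le_one_le)
  qed measurable
  have "rects (Suc n) t - rects (Suc n) s = (LBINT u. rects n u * rect (t - u) - rects n u * rect (s - u))" using int by simp
  also have "abs ... <= (LBINT u. abs (rects n u * rect (t - u) - rects n u * rect (s - u)))" by simp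
  also have "... <= (LBINT u. ind {t - 1/2..s - 1/2} u + ind {t + 1/2..s + 1/2} u)"
  proof (rule integral_mono)
   show "integrable lborel (\<lambda>u. abs (rects n u * rect (t - u) - rects n u * rect (s - u)))" using int by auto
   show "integrable lborel (\<lambda>u. ind {t - 1/2..s - 1/2} u + ind {t + 1/2..s + 1/2} u :: real)" by (rule Lintable_add; rule Icc_integrable)
   fix u
   have "abs (rects n u * rect (t - u) - rects n u * rect (s - u)) = rects n u * abs (rect (t - u) - rect (s - u))"
    using rects_bounds[of n u] by (simp add: abs_mult flip: right_diff_distrib)
   also have "... <= 1 * abs (rect (t - u) - rect (s - u))" using rects_bounds[of n u] by (intro mult_right_mono) auto
   finally show "abs (rects n u * rect (t - u) - rects n u * rect (s - u)) <=
     ind {t - 1/2..s - 1/2} u + ind {t + 1/2..s + 1/2} u" using rect_diff[OF that, of u] by simp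
  qed
  also have "... = 2 * (s - t)" using that by simp
  finally show ?thesis .
 qed
 show ?thesis using *[of t s] *[of s t] by (cases "t <= s") (auto simp: abs_minus_commute)
qed

lemma rect_fourier: "(CLBINT t. cx (rect t) * iexp (t * v)) = cx (sinc2 v)"
proof -
 have "(CLBINT t. cx (rect t) * iexp (t * v)) = (CLBINT t:{-(1/2)..1/2}. iexp (t * v))" unfolding set_lebesgue_integral_def
  by (intro Lint_cong) (auto simp: rect_def indicator_def)
 also have "... = (CLBINT t=ereal (-(1/2))..ereal (1/2). iexp (t * v))" by (subst interval_integral_Icc) auto
 also have "... = cx (sinc2 v)"
 proof (cases "v = 0")
  case True
  have "(CLBINT t=ereal (-(1/2))..ereal (1/2). (1 :: complex)) = of_real (1/2) - of_real (-(1/2))"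
  proof (rule interval_integral_FTC_finite)
   fix t show "(cx has_vector_derivative 1) (at t within {min (- (1 / 2)) (1 / 2)..max (- (1 / 2)) (1 / 2)})"
    using has_vector_derivative_of_real[OF DERIV_ident] by auto
  qed simp
  then show ?thesis using True by (simp add: sinc2_def)
 next
  case False
  have "(CLBINT t=ereal (-(1/2))..ereal (1/2). iexp (t * v)) = iexp (1/2 * v) / (\<i> * v) - iexp (-(1/2) * v) / (\<i> * v)"
  proof (rule interval_integral_FTC_finite)
   show "continuous_on {min (- (1 / 2))(1 / 2)..max (- (1 / 2)) (1 / 2)} (\<lambda>x. iexp (x * v))" by (intro continuous_intros)
   fix t :: real
   have "((\<lambda>z. exp (\<i> * (z * of_real v)) / (\<i> * of_real v)) has_field_derivative exp (\<i> * (of_real t * of_real v))) (at (of_real t))"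
    using False by (auto intro!: derivative_eq_intros simp: mult_ac)
   from has_vector_derivative_real_field[OF this]
   show "((\<lambda>t. iexp (t * v) / (\<i> * v)) has_vector_derivative iexp (t * v)) (at t within {min (- (1 / 2)) (1 / 2)..max (- (1 / 2)) (1 / 2)})" by simp
  qed
  also have "... = cx (sinc2 v)" using False by (simp add: sinc2_def complex_eq_iff Re_divide Im_divide field_simps power2_eq_square Re_exp Im_exp)
  finally show ?thesis .
 qed
 finally show ?thesis .
qed


lemma rects_fourier: "(CLBINT t. cx (rects n t) * iexp (t * v)) = cx (sinc2 v ^ Suc n)"
proof (induction n)
 case 0
 then show ?case using rect_fourier by simp
next
 case (Suc n)
 let ?A = "\<lambda>u. cx (rects n u) * iexp (u * v)"
 let ?f = "\<lambda>t u. ?A u * (cx (rect (t - u)) * iexp ((t - u) * v))"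
 have nrm: "norm (?f t u) = rects n u * rect (t - u)" for t u using rects_bounds[of n u] rect_le by (simp add: norm_mult)
 have int: "integrable (lborel \<Otimes>\<^sub>M lborel) (case_prod ?f)"
 proof (rule lborel_pair.Fubini_integrable)
  show "integrable lborel (\<lambda>t. LBINT u. norm (case (t, u) of (t, u) => ?f t u))" unfolding prod.case nrm using rects_integrable[of "Suc n"] by simp
  show "AE t in lborel. integrable lborel (\<lambda>u. case (t, u) of (t, u) => ?f t u)"
  proof (intro AE_I2)
   fix t
   have "integrable lborel (\<lambda>u. ?f t u)"
   proof (rule Lint_bound[OF rects_integrable[of n]])
    show "AE u in lborel. norm (?f t u) <= norm (rects n u)" unfolding nrm using rects_bounds[of n] rect_le by (auto intro!: mult_right_le_one_le)
   qed measurable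
   then show "integrable lborel (\<lambda>u. case (t, u) of (t, u) => ?f t u)" by simp
  qed
 qed measurable
 have "(CLBINT t. cx (rects (Suc n) t) * iexp (t * v)) = (CLBINT t. CLBINT u. ?f t u)"
 proof (intro Lint_cong refl)
  fix t
  have "cx (rects (Suc n) t) * iexp (t * v) = (CLBINT u. cx (rects n u * rect (t - u)) * iexp (t * v))" by (simp del: of_real_mult)
  also have "... = (CLBINT u. ?f t u)" by (intro Lint_cong refl)
    (simp add: mult_ac flip: exp_add of_real_mult; simp add: algebra_simps)
  finally show "cx (rects (Suc n) t) * iexp (t * v) = (CLBINT u. ?f t u)" .
 qed
 also have "... = (CLBINT u. CLBINT t. ?f t u)" by (rule lborel_pair.Fubini_integral[OF int, symmetric])
 also have "... = (CLBINT u. ?A u * (CLBINT t. cx (rect (t - u)) * iexp ((t - u) * v)))" by simp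
 also have "(\<lambda>u. (CLBINT t. cx (rect (t - u)) * iexp ((t - u) * v))) = (\<lambda>u. cx (sinc2 v))"
 proof
  fix u
  show "(CLBINT t. cx (rect (t - u)) * iexp ((t - u) * v)) = cx (sinc2 v)"
   using lborel_integral_real_affine[of 1 "\<lambda>t. cx (rect t) * iexp (t * v)" "-u"] rect_fourier[of v] by simp
 qed
 also have "(CLBINT u. ?A u * cx (sinc2 v)) = cx (sinc2 v ^ Suc (Suc n))" using Suc by simp
 finally show ?case .
qed


text \<open>\<open>h\<close> is the smoothing density, the Fourier transform of \<open>g\<close>.
  The decay exponent 6 is spent in \<open>u_neg_bound\<close>: four powers on the argument of the
  smoothed density and two on integrability against the renewal measure. The Lipschitz bound on
  \<open>g\<close> is for the frequency shift in \<open>far_bound\<close>.\<close>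

definition band_kernel :: "(real => real) => (real => real) => real => real => bool" where
 "band_kernel h g T H \<longleftrightarrow> 0 < T \<and> h \<in> borel_measurable borel \<and> g \<in> borel_measurable borel \<and>
  (\<forall>v. 0 <= h v \<and> h v * br v ^ 6 <= H) \<and> integrable lborel h \<and> (LBINT v. h v) = 1 \<and>
  (\<forall>t. abs (g t) <= H \<and> (T < abs t --> g t = 0)) \<and> (\<forall>t s. abs (g t - g s) <= H * abs (t - s)) \<and>
  (\<forall>v. cx (h v) = (CLBINT t. cx (g t) * iexp (t * v)))"

lemma sinc2_abs_le: "abs (sinc2 v) * br v <= 3"
proof (cases "v = 0")
 case False
 have "abs (sin (v / 2)) <= 1" by simp
 moreover have "abs (sin (v / 2)) <= abs (v / 2)" by (rule abs_sin_x_le_abs_x)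
 ultimately have "abs (sin (v / 2)) * br v <= abs (v / 2) + 1 * abs v" unfolding distrib_left by (intro add_mono mult_right_mono) auto
 then show ?thesis by (simp add: sinc2_def abs_mult abs_divide divide_simps)
qed (simp add: sinc2_def)

lemma integrable_rational_decay:
 "integrable lborel (\<lambda>v. 1 / (1 + abs (v::real)) ^ 2)"
proof -
 have "integrable lborel (\<lambda>v::real. inverse (1 + v^2))" using integrable_inverse_1_plus_square by (simp add: set_integrable_def)
 then have "integrable lborel (\<lambda>v::real. 2 * inverse (1 + v^2))" by simp
 then show ?thesis
 proof (rule Lint_bound)
  show "AE v in lborel. norm (1 / (1 + abs (v::real)) ^ 2) <= norm (2 * inverse (1 + v^2))"
  proof (intro AE_I2)
   fix v :: real
   have "0 <= abs v" "0 <= v^2" by auto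
   then have "0 < 1 + v^2" "1 + v^2 <= 2 * br v^2" "0 < br v^2" by (auto simp: power2_eq_square algebra_simps add_pos_nonneg abs_mult_self_eq)
   then show "norm (1 / br v ^ 2) <= norm (2 * inverse (1 + v^2))" by (simp add: field_simps)
  qed
 qed measurable
qed

text \<open>The sixth power of \<open>sinc2\<close>, normalised and rescaled until its mass outside
  [-\<eta>, \<eta>] is at most \<eta>. Rescaling changes the frequency band but keeps it
  bounded.\<close>

lemma band_kernel_exists:
 assumes "0 < \<eta>"
 shows "\<exists>h g T H. band_kernel h g T H \<and> (LBINT v. h v * ind {v. \<eta> < abs v} v) <= \<eta>"
proof -
 define p where "p = (\<lambda>v. sinc2 v ^ 6)"
 have p_meas [measurable]: "p \<in> borel_measurable borel" unfolding p_def by simp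
 have p0: "0 <= p v" for v by (simp add: p_def)
 have p1: "p v * br v ^ 6 <= 729" for v
 proof -
  have "(abs (sinc2 v) * br v) ^ 6 <= 3 ^ 6" by (intro power_mono sinc2_abs_le) auto
  then show ?thesis by (simp add: p_def power_mult_distrib)
 qed
 have p_pos: "0 < p v" if "0 < v" "v < 6" for v
 proof -
  have "0 < sin (v / 2)" using that pi_gt3 by (intro sin_gt_zero) auto
  then show ?thesis by (simp add: p_def sinc2_def)
 qed
 have p_int: "integrable lborel p"
 proof (rule Lint_bound)
  show "integrable lborel (\<lambda>v. 729 * (1 / (1 + abs (v::real)) ^ 2))" using integrable_rational_decay by (rule integrable_mult_right)
  show "AE v in lborel. norm (p v) <= norm (729 * (1 / br v ^ 2))"
  proof (intro AE_I2)
   fix v :: real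
   have "p v * br v ^ 2 <= p v * br v ^ 6" using p0 by (intro mult_left_mono power_increasing) auto
   also note p1
   finally show "norm (p v) <= norm (729 * (1 / br v ^ 2))" using p0[of v] by (simp add: field_simps)
  qed
 qed measurable
 define I where "I = (LBINT v. p v)"
 have "I \<noteq> 0"
 proof
  assume "I = 0"
  then have "AE v in lborel. p v = 0" using integral_nonneg_eq_0_iff_AE[OF p_int] p0 by (auto simp: I_def)
  then have "AE v in lborel. v \<notin> {1..2::real}"
  proof eventually_elim
   case (elim v)
   then show ?case using p_pos[of v] by auto
  qed
  then have "emeasure lborel {1..2::real} = 0" by (subst (asm) AE_iff_measurable[of "{1..2}"]) auto
  then show False by simp
 qed
 then have I: "0 < I" using p0 by (simp add: I_def less_le integral_nonneg_AE)
 have "((\<lambda>R. LBINT v. p v * ind {v. R < abs v} v) \<longlongrightarrow> (LBINT v::real. (0::real))) at_top"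
 proof (rule integral_dominated_convergence_at_top[where w=p and s="\<lambda>R v. p v * ind {v. R < abs v} v" and f="\<lambda>v. 0"])
  show "AE v in lborel. ((\<lambda>R. p v * ind {v. R < abs v} v) \<longlongrightarrow> 0) at_top"
  proof (intro AE_I2 tendsto_eventually)
   fix v show "\<forall>\<^sub>F R in at_top. p v * ind {v. R < abs v} v = 0" using eventually_ge_at_top[of "abs v"] by eventually_elim auto
  qed
  show "\<forall>\<^sub>F R in at_top. AE v in lborel. norm (p v * ind {v. R < abs v} v) <= p v" using p0 by (auto simp: indicator_def)
 qed (use p_int in auto)
 then have "\<forall>\<^sub>F R in at_top. (LBINT v. p v * ind {v. R < abs v} v) < \<eta> * I" using assms I by (intro order_tendstoD) auto
 then obtain R where R: "(LBINT v. p v * ind {v. R < abs v} v) < \<eta> * I" "0 < R"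
  using eventually_happens[OF eventually_conj[OF _ eventually_gt_at_top[of 0]]] by auto
 \<comment> \<open>Beyond \<open>R\<close> the unscaled profile has relative mass below \<eta>;
   scaling by \<epsilon> moves this cut-off to \<eta>.\<close>
 define \<epsilon> where "\<epsilon> = \<eta> / R"
 have e: "0 < \<epsilon>" "R = \<eta> / \<epsilon>" using R assms by (auto simp: \<epsilon>_def)
 let ?A = "\<lambda>v. p (v / \<epsilon>)"
 define h where "h = (\<lambda>v. ?A v / (\<epsilon> * I))"
 define g where "g = (\<lambda>t. rects 5 (\<epsilon> * t) / I)"
 define N where "N = max 1 \<epsilon>"
 have N: "1 <= N" "1 <= N / \<epsilon>" using e by (auto simp: N_def field_simps)
 define H where "H = 729 * N ^ 6 / (\<epsilon> * I) + 1 / I + 2 * \<epsilon> / I"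
 have scale: "(LBINT v. f (v / \<epsilon>)) = \<epsilon> * (LBINT v. f v)" "integrable lborel f ==> integrable lborel (\<lambda>v. f (v / \<epsilon>))"
  for f :: "real => real" using lborel_integral_real_affine[of "1/\<epsilon>" f 0] lborel_integrable_real_affine[of f "1/\<epsilon>" 0] e by auto
 have "band_kernel h g (3 / \<epsilon>) H" unfolding band_kernel_def
 proof (intro conjI allI impI)
  show "0 < 3 / \<epsilon>" using e by simp
  show "h \<in> borel_measurable borel" "g \<in> borel_measurable borel" unfolding h_def g_def by auto
  fix v t s :: real
  show "0 <= h v" using e I p0 by (simp add: h_def)
  have "1 + abs v <= N * (1 + abs (v / \<epsilon>))" using N e mult_right_mono[OF N(2), of "abs v"] by (simp add: distrib_left)
  then have "?A v * br v ^ 6 <= ?A v * (N * (1 + abs (v / \<epsilon>))) ^ 6" using p0 by (intro mult_left_mono) auto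
  also have "... = (?A v * (1 + abs (v / \<epsilon>)) ^ 6) * N ^ 6" by (simp add: power_mult_distrib)
  also have "... <= 729 * N ^ 6" using p1[of "v / \<epsilon>"] N by simp
  finally have "h v * br v ^ 6 <= 729 * N ^ 6 / (\<epsilon> * I)" using e I by (simp add: h_def field_simps)
  also have "... <= H" using I e by (simp add: H_def)
  finally show "h v * br v ^ 6 <= H" .
  show "integrable lborel h" using scale(2)[OF p_int] by (simp add: h_def)
  show "(LBINT v. h v) = 1" using scale(1)[of p] e I by (simp add: h_def I_def)
  have H: "1 / I <= H" "2 * \<epsilon> / I <= H" using I e N by (auto simp: H_def)
  show "abs (g t) <= H" using rects_bounds[of 5 "\<epsilon> * t"] I by (intro order_trans[OF _ H(1)]) (simp add: g_def divide_right_mono)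
  show "g t = 0" if "3 / \<epsilon> < abs t" using that rects_bounds[of 5 "\<epsilon> * t"] e by (simp add: g_def abs_mult field_simps)
  have "abs (g t - g s) = abs (rects (Suc 4) (\<epsilon> * t) - rects (Suc 4) (\<epsilon> * s)) / I"
   using I by (simp add: g_def flip: diff_divide_distrib numeral_eq_Suc)
  also have "... <= 2 * abs (\<epsilon> * t - \<epsilon> * s) / I" using I by (intro divide_right_mono rects_lipschitz) auto
  also have "... = (2 * \<epsilon> / I) * abs (t - s)" using e by (simp add: abs_mult flip: right_diff_distrib)
  also have "... <= H * abs (t - s)" using H by (intro mult_right_mono) auto
  finally show "abs (g t - g s) <= H * abs (t - s)" .
  have "cx (?A v) = (CLBINT t. cx (rects 5 t) * iexp (t * (v / \<epsilon>)))" using rects_fourier[of 5 "v / \<epsilon>"] by (simp add: p_def)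
  also have "... = \<epsilon> *\<^sub>R (CLBINT t. cx (rects 5 (\<epsilon> * t)) * iexp (\<epsilon> * t * (v / \<epsilon>)))"
   using e by (subst lborel_integral_real_affine[of \<epsilon> _ 0]) auto
  also have "... = \<epsilon> *\<^sub>R (CLBINT t. I *\<^sub>R (cx (g t) * iexp (t * v)))"
   using e I by (intro arg_cong2[where f=scaleR] refl Lint_cong) (auto simp: g_def scaleR_conv_of_real)
  finally show "cx (h v) = (CLBINT t. cx (g t) * iexp (t * v))" using e I by (simp add: h_def scaleR_conv_of_real field_simps)
 qed
 moreover have "(LBINT v. h v * ind {v. \<eta> < abs v} v) <= \<eta>"
 proof -
  have "(LBINT v. h v * ind {v. \<eta> < abs v} v) =
    (LBINT v. (\<lambda>v. p v * ind {v. R < abs v} v / (\<epsilon> * I)) (v / \<epsilon>))" using e by (intro Lint_cong) (auto simp: h_def indicator_def field_simps)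
  also have "... = (LBINT v. p v * ind {v. R < abs v} v) / I" using e by (subst scale) simp
  also have "... <= \<eta>" using R I by (simp add: field_simps)
  finally show ?thesis .
 qed
 ultimately show ?thesis by blast
qed

section \<open>Truncated mean and characteristic function of the step law\<close>

definition trunc_mean :: "real measure => real => real" where
 "trunc_mean F x = (LINT y|F. min (abs y) x)"

text \<open>Up to constants the renewal mass of [0, x], while its reciprocal is the size of 1 -
  \<phi> at frequency 1 / x. The truncated mean is taken as E min (abs y) x, which makes
  monotonicity and sublinearity evident; \<open>trunc_mean_eq\<close> identifies it with the
  integral m of the theorem.\<close>

definition renewal_scale :: "real measure => real => real" where
 "renewal_scale F x = x / trunc_mean F x"

lemma powr_at_top: "0 < b ==> filterlim (\<lambda>x::real. x powr b) at_top at_top"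
proof -
 assume b: "0 < b"
 have "filterlim (\<lambda>x::real. exp (b * ln x)) at_top at_top"
  using b by (intro filterlim_compose[OF exp_at_top] filterlim_tendsto_pos_mult_at_top[OF tendsto_const _ ln_at_top])
 moreover have "\<forall>\<^sub>F x::real in at_top. exp (b * ln x) = x powr b" using eventually_gt_at_top[of 0] by eventually_elim (simp add: powr_def)
 ultimately show ?thesis by (rule filterlim_cong[THEN iffD1, OF refl refl, rotated])
qed

text \<open>What the strong renewal theorem uses about \<open>F\<close>. The exponential moment
  makes the left tail harmless. \<open>local_cond\<close> is hypothesis (3) expressed through
  \<open>renewal_scale\<close>; its guard keeps \<alpha> < 1, which is what allows the tail to be
  compared with the truncated mean in \<open>m_le_tail\<close>.\<close>

locale renewal_law = real_distribution F for F :: "real measure" +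
 fixes \<alpha> \<theta> :: real
 assumes alpha: "0 < \<alpha>" "\<alpha> <= 1"
  and theta: "0 < \<theta>"
  and exp_int_theta: "integrable F (\<lambda>y. exp (- \<theta> * y))"
  and laplace_less: "!!\<beta>. 0 < \<beta> ==> \<beta> <= \<theta> ==> (LINT y|F. exp (- \<beta> * y)) < 1"
  and m_rv: "!!c. 0 < c ==> ((\<lambda>x. trunc_mean F (c * x) / trunc_mean F x) \<longlongrightarrow> c powr (1 - \<alpha>)) at_top"
  and m_inf: "filterlim (trunc_mean F) at_top at_top"
  and nonarith: "!!t. t \<noteq> 0 ==> char F t \<noteq> 1"
  and local_cond: "!!\<epsilon>. \<alpha> <= 1/2 ==> 0 < \<epsilon> ==> \<exists>\<eta>>0. \<exists>x0. \<forall>x\<ge>x0.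
   NI F (\<lambda>w. ennreal ((renewal_scale F (x - w))^2 / (x - w)) * ind {w. 1 <= x - w \<and> x - w <= \<eta> * x} w)
    <= ennreal (\<epsilon> * renewal_scale F x / x)"
begin

abbreviation m :: "real => real" where "m \<equiv> trunc_mean F"
abbreviation a :: "real => real" where "a \<equiv> renewal_scale F"
definition L :: "real => real" where "L \<beta> = (LINT y|F. exp (- \<beta> * y))"


lemma integrable_min: "0 <= x ==> integrable F (\<lambda>y. min (abs y) x)" by (rule integrable_const_bound[where B=x]) auto

lemma m_mono: "0 <= x ==> x <= y ==> m x <= m y" unfolding trunc_mean_def by (intro integral_mono integrable_min) auto

lemma m_nonneg: "0 <= x ==> 0 <= m x" unfolding trunc_mean_def by simp

lemma m_scale: "1 <= c ==> 0 <= x ==> m (c * x) <= c * m x"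
proof -
 assume c: "1 <= c" "0 <= x"
 have "m (c * x) <= (LINT y|F. c * min (abs y) x)" unfolding trunc_mean_def
 proof (intro integral_mono integrable_mult_right integrable_min)
  fix y :: real
  have "abs y <= c * abs y" using c mult_right_mono[of 1 c "abs y"] by simp
  then show "min (abs y) (c * x) <= c * min (abs y) x" by simp
 qed (use c in auto)
 then show ?thesis by (simp add: trunc_mean_def)
qed

lemma m_le: "0 <= x ==> m x <= x"
proof -
 assume "0 <= x"
 then have "m x <= (LINT y|F. x)" unfolding trunc_mean_def by (intro integral_mono integrable_min) auto
 then show ?thesis using prob_space by simp
qed

lemma m_pos: "0 < x ==> 0 < m x"
proof -
 assume x: "0 < x"
 have "\<forall>\<^sub>F z in at_top. 0 < m z \<and> x <= z" using m_inf by (intro eventually_conj) (auto simp: filterlim_at_top_dense)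
 then obtain z where z: "0 < m z" "x <= z" by (auto dest: eventually_happens)
 then have "m ((z / x) * x) <= (z / x) * m x" using x by (intro m_scale) auto
 then have "0 < (z / x) * m x" using x z by simp
 then show ?thesis using x z by (simp add: zero_less_mult_iff zero_less_divide_iff)
qed

lemma a_pos: "0 < x ==> 0 < a x" using m_pos by (simp add: renewal_scale_def)

lemma a_ge_1: "0 < x ==> 1 <= a x" using m_pos m_le[of x] by (simp add: renewal_scale_def)

lemma a_mono: "0 < x ==> x <= y ==> a x <= a y"
proof -
 assume x: "0 < x" "x <= y"
 have "m ((y / x) * x) <= (y / x) * m x" using x by (intro m_scale) auto
 then show ?thesis using x m_pos[of x] m_pos[of y] by (simp add: renewal_scale_def field_simps)
qed

lemma a_scale: "1 <= c ==> 0 < x ==> a (c * x) <= c * a x"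
proof -
 assume c: "1 <= c" "0 < x"
 have "x <= c * x" using c by simp
 then have "m x <= m (c * x)" using c by (intro m_mono) auto
 then show ?thesis using c by (auto simp: renewal_scale_def intro!: divide_left_mono mult_pos_pos m_pos)
qed

lemma a_rv: "((\<lambda>x. a (2 * x) / a x) \<longlongrightarrow> 2 powr \<alpha>) at_top"
proof -
 have "((\<lambda>x. 2 / (m (2 * x) / m x)) \<longlongrightarrow> 2 / 2 powr (1 - \<alpha>)) at_top" by (intro tendsto_intros m_rv) auto
 moreover have "2 / 2 powr (1 - \<alpha>) = 2 powr \<alpha>" by (simp add: powr_diff)
 moreover have "\<forall>\<^sub>F x in at_top. 2 / (m (2 * x) / m x) = a (2 * x) / a x" using eventually_gt_at_top[of 0]
 proof eventually_elim
  case (elim x)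
  then show ?case by (simp add: renewal_scale_def)
 qed
 ultimately show ?thesis by (auto dest: tendsto_cong)
qed

lemma a_potter:
 assumes "0 <= p" "p < \<alpha>" "\<alpha> < q" "0 < y0"
 obtains C where "1 <= C" "!!x y. y0 <= y ==> y <= x ==> a x <= C * (x / y) powr q * a y"
  "!!x y. y0 <= y ==> y <= x ==> (x / y) powr p * a y <= C * a x" using potter_bounds[of a \<alpha> p q y0, OF a_pos a_mono a_rv assms] by auto

lemma a_inf: "filterlim a at_top at_top"
proof -
 have pq: "0 <= \<alpha> / 2" "\<alpha> / 2 < \<alpha>" "\<alpha> < \<alpha> + 1" "(0::real) < 1" using alpha by auto
 obtain C where C: "1 <= C" "!!x y. 1 <= y ==> y <= x ==> (x / y) powr (\<alpha>/2) * a y <= C * a x" by (rule a_potter[OF pq]) (rule that)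
 have "filterlim (\<lambda>x::real. (1 / C) * x powr (\<alpha>/2)) at_top at_top"
  using C alpha by (intro filterlim_tendsto_pos_mult_at_top[OF tendsto_const] powr_at_top) auto
 then show ?thesis
 proof (rule filterlim_at_top_mono)
  show "\<forall>\<^sub>F x in at_top. (1 / C) * x powr (\<alpha>/2) <= a x" using eventually_ge_at_top[of 1]
  proof eventually_elim
   case (elim x)
   have "x powr (\<alpha>/2) * 1 <= x powr (\<alpha>/2) * a 1" using a_ge_1[of 1] by (intro mult_left_mono) auto
   also have "... <= C * a x" using C(2)[of 1 x] elim by simp
   finally show ?case using C by (simp add: field_simps)
  qed
 qed
qed

lemma exp_int: "0 <= \<beta> ==> \<beta> <= \<theta> ==> integrable F (\<lambda>y. exp (- \<beta> * y))"
proof (rule Lint_bound)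
 assume l: "0 <= \<beta>" "\<beta> <= \<theta>"
 let ?A = "\<lambda>y. exp (- \<theta> * y)"
 show "integrable F (\<lambda>y. 1 + ?A y)" using exp_int_theta by simp
 show "AE y in F. norm (exp (- \<beta> * y)) <= norm (1 + ?A y)"
 proof (intro AE_I2)
  fix y :: real
  show "norm (exp (- \<beta> * y)) <= norm (1 + ?A y)"
  proof (cases "0 <= y")
   case True
   then have "exp (- \<beta> * y) <= 1" using l by simp
   moreover have "0 < exp (- \<beta> * y)" "0 < ?A y" by auto
   ultimately show ?thesis unfolding real_norm_def by linarith
  next
   case False
   then have "exp (- \<beta> * y) <= ?A y" using l by simp
   moreover have "0 < exp (- \<beta> * y)" by simp
   ultimately show ?thesis unfolding real_norm_def by linarith
  qed
 qed
qed measurable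

lemma integrable_neg_part: "integrable F (\<lambda>y. max (- y) 0)"
proof (rule Lint_bound)
 let ?A = "\<lambda>y. exp (- \<theta> * y)"
 show "integrable F (\<lambda>y. 1 / \<theta> * ?A y)" using exp_int_theta by simp
 show "AE y in F. norm (max (- y) 0) <= norm (1 / \<theta> * ?A y)"
 proof (intro AE_I2)
  fix y :: real
  have "\<theta> * (- y) <= ?A y" using exp_ge_add_one_self[of "- \<theta> * y"] by simp
  then have "- y <= 1 / \<theta> * ?A y" using theta by (simp add: field_simps)
  then show "norm (max (- y) 0) <= norm (1 / \<theta> * ?A y)" using theta by simp
 qed
qed measurable

lemma norm_iexp_diff: "norm (iexp (t * y) - iexp (s * y)) <= 2 * min 1 (abs (t - s) * abs y)"
proof -
 let ?A = "norm (iexp (t * y) - iexp (s * y))"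
 have "?A = norm (iexp (s * y) * (iexp ((t - s) * y) - 1))" by (simp add: algebra_simps flip: exp_add)
 also have "... = norm (iexp ((t - s) * y) - 1)" by (simp add: norm_mult)
 also have "... <= abs ((t - s) * y)" using iexp_approx1[of "(t - s) * y" 0] by simp
 finally have 1: "?A <= abs (t - s) * abs y" by (simp add: abs_mult)
 have "?A <= 1 + 1" by (rule order_trans[OF norm_triangle_ineq4]) simp
 moreover have "0 <= abs (t - s) * abs y" by simp
 ultimately show ?thesis using 1 by (simp only: min_def split: if_split) linarith
qed

text \<open>With d = abs (t - s) the integrand is at most 2 * min 1 (d * abs y), that is 2 * d * min
  (abs y) (1 / d), and its mean is the truncated mean at 1 / d. This modulus of continuity replaces
  a derivative of the characteristic function.\<close>

lemma char_diff: "t \<noteq> s ==> norm (char F t - char F s) <= 2 / a (1 / abs (t - s))"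
proof -
 assume ts: "t \<noteq> s"
 define d where "d = abs (t - s)"
 have d: "0 < d" using ts by (simp add: d_def)
 have "norm (char F t - char F s) = norm (CLINT y|F. iexp (t * y) - iexp (s * y))"
  unfolding char_def by (subst Bochner_Integration.integral_diff) (auto intro!: integrable_iexp)
 also have "... <= (LINT y|F. norm (iexp (t * y) - iexp (s * y)))" by simp
 also have "... <= (LINT y|F. (2 * d) * min (abs y) (1 / d))"
 proof (rule integral_mono)
  show "integrable F (\<lambda>y. norm (iexp (t * y) - iexp (s * y)))" by (intro integrable_norm Lintable_diff integrable_iexp) auto
  show "integrable F (\<lambda>y. (2 * d) * min (abs y) (1 / d))" using d by (intro integrable_mult_right integrable_min) auto
  fix y
  have "d * min (abs y) (1 / d) = min 1 (abs (t - s) * abs y)" by (auto simp: min_def d_def field_simps)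
  then show "norm (iexp (t * y) - iexp (s * y)) <= (2 * d) * min (abs y) (1 / d)" using norm_iexp_diff[of t y s] by simp
 qed
 also have "... = 2 / a (1 / d)" by (simp add: trunc_mean_def renewal_scale_def)
 finally show ?thesis by (simp add: d_def)
qed

lemma integrable_sin_cos: "integrable F (\<lambda>y. sin (t * y))" "integrable F (\<lambda>y. cos (t * y))" by (auto intro!: integrable_const_bound[where B=1])

lemma Re_Im_char: "Re (char F t) = (LINT y|F. cos (t * y))" "Im (char F t) = (LINT y|F. sin (t * y))"
proof -
 have int: "integrable F (\<lambda>y. iexp (t * y))" by (rule integrable_iexp) auto
 show "Re (char F t) = (LINT y|F. cos (t * y))" unfolding char_def using integral_Re[OF int] by (simp add: Re_exp)
 show "Im (char F t) = (LINT y|F. sin (t * y))" unfolding char_def using integral_Im[OF int] by (simp add: Im_exp)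
qed

lemma m_ratio_tendsto: "0 < c ==> 0 < d ==> ((\<lambda>x. m (c * x) / m x - m (d * x) / m x) \<longlongrightarrow> c powr (1 - \<alpha>) - d powr (1 - \<alpha>)) at_top"
 by (intro tendsto_diff m_rv)

text \<open>The real part suffices. On [1, 5], inside the open period (0, 2 pi), 1 - cos is bounded
  below, so it is enough that E of a test function living on x <= abs y <= 5 x has order m x. That
  holds because u powr (1 - \<alpha>) is strictly concave, which is where \<alpha> < 1
  enters.\<close>

lemma char_lower_less:
 assumes "\<alpha> < 1"
 shows "\<exists>c>0. \<exists>x0>0. \<forall>t. t \<noteq> 0 --> x0 <= 1 / abs t --> c / a (1 / abs t) <= norm (1 - char F t)"
proof -
 let ?f = "\<lambda>u::real. u powr (1 - \<alpha>)"
 define d where "d = (?f 2 - ?f 1) - (?f 5 - ?f 4)"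
 have der: "(?f has_real_derivative (1 - \<alpha>) * u powr (- \<alpha>)) (at u)" if "0 < u" for u using that by (auto intro!: derivative_eq_intros)
 obtain z1 where z1: "1 < z1" "z1 < 2" "?f 2 - ?f 1 = (2 - 1) * ((1 - \<alpha>) * z1 powr (- \<alpha>))"
  using MVT2[of 1 2 ?f "\<lambda>u. (1 - \<alpha>) * u powr (- \<alpha>)"] der by force
 obtain z2 where z2: "4 < z2" "z2 < 5" "?f 5 - ?f 4 = (5 - 4) * ((1 - \<alpha>) * z2 powr (- \<alpha>))"
  using MVT2[of 4 5 ?f "\<lambda>u. (1 - \<alpha>) * u powr (- \<alpha>)"] der by force
 have "z2 powr (- \<alpha>) < z1 powr (- \<alpha>)" using z1 z2 alpha by (intro powr_less_mono2_neg) auto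
 then have d: "0 < d" using z1 z2 assms by (simp add: d_def)
 let ?B = "\<lambda>x. m (5 * x) / m x - m (4 * x) / m x"
 let ?C = "\<lambda>x. m (2 * x) / m x - m (1 * x) / m x"
 have "((\<lambda>x. ?C x - ?B x) \<longlongrightarrow> d) at_top" unfolding d_def by (intro tendsto_diff m_ratio_tendsto) auto
 then have "\<forall>\<^sub>F x in at_top. d / 2 < ?C x - ?B x" using d by (intro order_tendstoD) auto
 then obtain x1 where x1: "!!x. x1 <= x ==> d / 2 < ?C x - ?B x" unfolding eventually_at_top_linorder by blast
 have "\<exists>z\<in>{1..5::real}. \<forall>y\<in>{1..5}. 1 - cos z <= 1 - cos y" by (intro continuous_attains_inf) (auto intro!: continuous_intros)
 then obtain z :: real where z: "z \<in> {1..5}" "\<forall>y\<in>{1..5}. 1 - cos z <= 1 - cos y" by blast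
 define c0 where "c0 = 1 - cos z"
 have "cos z \<noteq> 1"
 proof
  assume "cos z = 1"
  then obtain n :: int where n: "z = real_of_int n * (2 * pi)" by (auto simp: cos_one_2pi_int)
  have "0 < n"
  proof (rule ccontr)
   assume "\<not> 0 < n"
   then have "real_of_int n * (2 * pi) <= 0" by (intro mult_nonpos_nonneg) auto
   then show False using n z(1) unfolding atLeastAtMost_iff by linarith
  qed
  then have "1 * (2 * pi) <= real_of_int n * (2 * pi)" by simp
  then show False using n z(1) pi_gt3 unfolding atLeastAtMost_iff by linarith
 qed
 then have c0: "0 < c0" using cos_le_one[of z] unfolding c0_def by linarith
 define x0 where "x0 = max x1 1"
 have "c0 * d / 2 / a (1 / abs t) <= norm (1 - char F t)" if t: "t \<noteq> 0" "x0 <= 1 / abs t" for t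
 proof -
  define x where "x = 1 / abs t"
  have x: "0 < x" "x1 <= x" using t by (auto simp: x_def x0_def)
  \<comment> \<open>As a function of abs y a trapezoid: it climbs to x on [x, 2 x], stays there
    until 4 x and returns to 0 at 5 x.\<close>
  let ?g = "\<lambda>y. (min (abs y) (2 * x) - min (abs y) (1 * x)) - (min (abs y) (5 * x) - min (abs y) (4 * x))"
  have gi: "integrable F ?g" using x by (intro Lintable_diff integrable_min) auto
  let ?A = "(m (2 * x) - m (1 * x)) - (m (5 * x) - m (4 * x))"
  have "c0 / x * ?A = (LINT y|F. c0 / x * ?g y)" unfolding trunc_mean_def using x gi by (simp add: integrable_min)
  also have "... <= (LINT y|F. 1 - cos (t * y))"
  proof (rule integral_mono)
   fix y
   have *: "?g y <= x" "abs y < x \<or> 5 * x < abs y ==> ?g y <= 0"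
    by (use x in \<open>cases "abs y <= x"; cases "abs y <= 2 * x"; cases "abs y <= 4 * x"; cases "abs y <= 5 * x"; simp\<close>)+
   show "c0 / x * ?g y <= 1 - cos (t * y)"
   proof (cases "abs y < x \<or> 5 * x < abs y")
    case True
    then have "?g y <= 0" by auto
    then have "c0 / x * ?g y <= 0" using c0 x by (intro mult_nonneg_nonpos divide_nonneg_pos) auto
    then show ?thesis using cos_le_one[of "t * y"] by linarith
   next
    case False
    have "c0 / x * ?g y <= c0 / x * x" using c0 x by (intro mult_left_mono[OF *(1)] divide_nonneg_pos) auto
    also have "... <= 1 - cos (abs (t * y))" using bspec[OF z(2), of "abs (t * y)"] False t by (simp add: c0_def x_def abs_mult field_simps)
    finally show ?thesis by simp
   qed
  qed (use gi integrable_sin_cos in auto)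
  also have "... = Re (1 - char F t)" using integrable_sin_cos prob_space by (simp add: Re_Im_char)
  also have "... <= norm (1 - char F t)" by (rule complex_Re_le_cmod)
  finally have 1: "c0 / x * ?A <= norm (1 - char F t)" .
  have "d / 2 * m x <= (m (2 * x) - m (1 * x)) - (m (5 * x) - m (4 * x))"
   using x1[OF x(2)] m_pos[OF x(1)] unfolding diff_divide_distrib[symmetric] by (simp only: pos_less_divide_eq)
  then have "c0 / x * (d / 2 * m x) <= c0 / x * ?A" using c0 x by (intro mult_left_mono) auto
  moreover have "c0 * d / 2 / a x = c0 / x * (d / 2 * m x)" by (simp add: renewal_scale_def)
  ultimately show ?thesis using 1 unfolding x_def[symmetric] by simp
 qed
 then show ?thesis using c0 d by (intro exI[of _ "c0 * d / 2"] conjI exI[of _ x0]) (auto simp: x0_def)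
qed

text \<open>Expressed by truncations so that integration produces m x and m (x / 2), whose
  difference is negligible for \<alpha> = 1. For z > 1 the left side equals -1; for z <= 1 it is at
  most z / 2.\<close>

lemma sin_lower: "0 <= z ==> min z 1 / 2 - 3 * (min z 1 - min z (1/2)) <= sin (z::real)"
proof -
 assume z: "0 <= z"
 show ?thesis
 proof (cases "z <= 1")
  case True
  have "z / 2 <= sin z"
  proof (cases "z = 0")
   case False
   then obtain y where y: "0 < y" "y < z" "sin z - sin 0 = (z - 0) * cos y" using MVT2[of 0 z sin cos] z by force
   have "cos (pi / 3) <= cos y" using y True pi_gt3 by (intro cos_monotone_0_pi_le) auto
   then have "z * (1 / 2) <= z * cos y" using z by (intro mult_left_mono) (auto simp: cos_60)
   then show ?thesis using y by simp
  qed simp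
  then show ?thesis by simp
 next
  case False
  then show ?thesis by simp
 qed
qed

text \<open>For \<alpha> = 1 the real part of 1 - \<phi> may have smaller order, so the imaginary
  part is used. \<open>sin_lower\<close> leaves m x / 2, minus a multiple of m x - m (x / 2),
  negligible by slow variation, minus the finite mean of the negative part. The factor 2 on that
  mean turns a bound for sin (t * abs y) into one for its negative.\<close>

lemma char_lower_one:
 assumes "\<alpha> = 1"
 shows "\<exists>c>0. \<exists>x0>0. \<forall>t. t \<noteq> 0 --> x0 <= 1 / abs t --> c / a (1 / abs t) <= norm (1 - char F t)"
proof -
 define N where "N = (LINT y|F. max (- y) 0)"
 have "((\<lambda>x. 1 / 2 - 3 * (1 - m (1/2 * x) / m x) - 2 * N / m x) \<longlongrightarrow> 1 / 2 - 3 * (1 - (1/2) powr (1 - \<alpha>)) - 0) at_top"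
  by (intro tendsto_intros m_rv tendsto_divide_0[OF tendsto_const] filterlim_at_top_imp_at_infinity m_inf) auto
 then have "\<forall>\<^sub>F x in at_top. 1 / 4 < 1 / 2 - 3 * (1 - m (1/2 * x) / m x) - 2 * N / m x" using assms by (intro order_tendstoD) auto
 then obtain x1 where x1: "!!x. x1 <= x ==> 1 / 4 < 1 / 2 - 3 * (1 - m (1/2 * x) / m x) - 2 * N / m x" unfolding eventually_at_top_linorder by blast
 define x0 where "x0 = max x1 1"
 have pos: "1 / 4 / a (1 / t) <= Im (char F t)" if t: "0 < t" "x0 <= 1 / t" for t
 proof -
  define x where "x = 1 / t"
  have x: "0 < x" "x1 <= x" "t = 1 / x" using t by (auto simp: x_def x0_def)
  let ?g = "\<lambda>y. t * (1 / 2 * min (abs y) x - 3 * (min (abs y) x - min (abs y) (1/2 * x)) - 2 * max (- y) 0)"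
  have gi: "integrable F ?g" using x by (intro integrable_mult_right Lintable_diff integrable_min integrable_neg_part) auto
  let ?B = "1 / 2 * m x - 3 * (m x - m (1/2 * x)) - 2 * N"
  have "t * ?B = (LINT y|F. ?g y)" unfolding trunc_mean_def N_def using x gi by (simp add: integrable_min integrable_neg_part)
  also have "... <= (LINT y|F. sin (t * y))"
  proof (rule integral_mono)
   fix y
   let ?A = "t * abs y"
   have eq: "t * min (abs y) x = min ?A 1" "t * min (abs y) (1/2 * x) = min ?A (1/2)" unfolding mult_min_right[OF less_imp_le[OF t(1)]] by (simp_all add: x(3))
   have g: "?g y = min ?A 1 / 2 - 3 * (min ?A 1 - min ?A (1/2)) - 2 * (t * max (- y) 0)" unfolding eq[symmetric] by (simp add: algebra_simps)
   have s: "min ?A 1 / 2 - 3 * (min ?A 1 - min ?A (1/2)) <= sin ?A" using t by (intro sin_lower) auto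
   show "?g y <= sin (t * y)"
   proof (cases "0 <= y")
    case True then show ?thesis unfolding g using s by simp
   next
    case False
    have "sin ?A <= t * abs y" using t by (intro sin_x_le_x) auto
    then show ?thesis unfolding g using s False by simp
   qed
  qed (use gi integrable_sin_cos in auto)
  also have "... = Im (char F t)" by (simp add: Re_Im_char)
  finally have 1: "t * ?B <= Im (char F t)" .
  have "1 / 4 * m x <= 1 / 2 * m x - 3 * (m x - m (1/2 * x)) - 2 * N"
   using mult_strict_right_mono[OF x1[OF x(2)] m_pos[OF x(1)]] m_pos[OF x(1)] by (simp add: left_diff_distrib right_diff_distrib)
  then have "t * (1 / 4 * m x) <= t * ?B" using t by simp
  then show ?thesis using 1 x by (simp add: renewal_scale_def)
 qed
 have neg: "Im (char F (- t)) = - Im (char F t)" for t by (simp add: Re_Im_char)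
 have "1 / 4 / a (1 / abs t) <= norm (1 - char F t)" if t: "t \<noteq> 0" "x0 <= 1 / abs t" for t
 proof -
  have "1 / 4 / a (1 / abs t) <= Im (char F (abs t))" using t by (intro pos) auto
  also have "... <= abs (Im (char F t))" using neg[of t] by simp
  also have "... = abs (Im (1 - char F t))" by simp
  also have "... <= norm (1 - char F t)" by (rule abs_Im_le_cmod)
  finally show ?thesis .
 qed
 then show ?thesis by (intro exI[of _ "1/4"] conjI exI[of _ x0]) (auto simp: x0_def)
qed

text \<open>Near 0 by the two cases for \<alpha>; on the compact remainder by continuity, as the
  characteristic function takes the value 1 only at 0. Since a >= 1 there, a constant lower bound
  has the required form.\<close>

lemma char_lower:
 obtains c where "0 < c" "!!t. t \<noteq> 0 ==> abs t <= T ==> c / a (1 / abs t) <= norm (1 - char F t)"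
proof -
 let ?A = "\<lambda>t. a (1 / abs t)"
 let ?B = "\<lambda>t. norm (1 - char F t)"
 have "\<exists>c>0. \<exists>x0>0. \<forall>t. t \<noteq> 0 --> x0 <= 1 / abs t --> c / ?A t <= ?B t"
  using alpha char_lower_less char_lower_one by (cases "\<alpha> = 1") auto
 then obtain c x0 where c: "0 < c" "0 < x0" "!!t. t \<noteq> 0 ==> x0 <= 1 / abs t ==> c / ?A t <= ?B t" by blast
 define K where "K = {t::real. 1 / x0 <= abs t \<and> abs t <= T}"
 have "\<exists>c2>0. \<forall>t\<in>K. c2 <= ?B t"
 proof (cases "K = {}")
  case False
  have "K = {-T..T} \<inter> {t. 1 / x0 <= abs t}" by (auto simp: K_def)
  also have "compact ..." by (intro compact_Int_closed compact_Icc closed_Collect_le continuous_intros)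
  finally have K: "compact K" .
  have "continuous_on K (\<lambda>t. ?B t)" by (intro continuous_intros continuous_at_imp_continuous_on) (auto intro: isCont_char)
  from continuous_attains_inf[OF K False this]
  obtain t0 where t0: "t0 \<in> K" "!!t. t \<in> K ==> norm (1 - char F t0) <= ?B t" by blast
  have "t0 \<noteq> 0" using t0(1) c by (auto simp: K_def)
  then have "0 < norm (1 - char F t0)" using nonarith by auto
  then show ?thesis using t0 by blast
 qed (auto intro: exI[of _ 1])
 then obtain c2 where c2: "0 < c2" "!!t. t \<in> K ==> c2 <= ?B t" by blast
 have "min c c2 / ?A t <= ?B t" if t: "t \<noteq> 0" "abs t <= T" for t
 proof -
  have a: "1 <= ?A t" using t by (intro a_ge_1) auto
  show ?thesis
  proof (cases "x0 <= 1 / abs t")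
   case True
   have "min c c2 / ?A t <= c / ?A t" using a by (intro divide_right_mono) auto
   then show ?thesis using c(3)[OF t(1) True] by simp
  next
   case False
   then have "t \<in> K" using t c by (auto simp: K_def field_simps)
   have "min c c2 / ?A t <= c2 / 1" using a c2 by (intro frac_le) auto
   then show ?thesis using c2(2)[OF \<open>t \<in> K\<close>] by simp
  qed
 qed
 then show ?thesis using c c2 by (intro that[of "min c c2"]) auto
qed

end

section \<open>Abelian theorem for the Laplace transform of the step law\<close>

lemma exp_min_integral:
 assumes z: "0 <= (z::real)"
 shows "NI lborel (\<lambda>s. ennreal (exp (- s) * min z s) * ind {0..} s) = ennreal (1 - exp (- z))"
proof -
 let ?A = "\<lambda>s. ennreal (exp (- s) * z)"
 let ?B = "\<lambda>s. ennreal (exp (- s) * s)"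
 have "NI lborel (\<lambda>s. ennreal (exp (- s) * min z s) * ind {0..} s) =
   NI lborel (\<lambda>s. ?B s * ind {0..z} s + ?A s * ind {z..} s)"
 proof (rule nn_integral_cong_AE)
  have "AE s in lborel. s \<noteq> z" by (rule AE_lborel_singleton)
  then show "AE s in lborel. ennreal (exp (- s) * min z s) * ind {0..} s =
   (?B s) * ind {0..z} s + ?A s * ind {z..} s" by eventually_elim (use z in \<open>auto simp: indicator_def\<close>)
 qed
 also have "... = NI lborel (\<lambda>s. ?B s * ind {0..z} s) + NI lborel (\<lambda>s. ?A s * ind {z..} s)" by (rule nn_integral_add) auto
 also have "NI lborel (\<lambda>s. ?B s * ind {0..z} s) = ennreal (- (1 + z) * exp (- z) - (- (1 + 0) * exp (- 0)))"
  using z by (intro nn_integral_FTC_Icc[where F="\<lambda>s. - (1 + s) * exp (- s)"])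
   (auto intro!: derivative_eq_intros simp: algebra_simps)
 also have "NI lborel (\<lambda>s. ?A s * ind {z..} s) = ennreal (0 - (- z * exp (- z)))"
 proof (rule nn_integral_FTC_atLeast[where F="\<lambda>s. - z * exp (- s)"])
  show "((\<lambda>s. - z * exp (- s)) \<longlongrightarrow> 0) at_top"
   by (intro tendsto_mult_right_zero filterlim_compose[OF exp_at_bot] filterlim_uminus_at_bot_at_top)
 qed (use z in \<open>auto intro!: derivative_eq_intros\<close>)
 also have "ennreal (- (1 + z) * exp (- z) - (- (1 + 0) * exp (- 0))) + ennreal (0 - (- z * exp (- z))) = ennreal (1 - exp (- z))"
 proof -
  have "(1 + z) * exp (- z) <= exp z * exp (- z)" by simp
  then have "0 <= - (1 + z) * exp (- z) - (- (1 + 0) * exp (- 0))" by (simp add: exp_minus algebra_simps)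
  then show ?thesis using z by (subst ennreal_plus[symmetric]) (auto simp: algebra_simps)
 qed
 finally show ?thesis .
qed

context renewal_law
begin

text \<open>By \<open>exp_min_integral\<close>, mixing the truncations at level s with weight exp (-
  s) gives 1 - exp. The transform is thus a direct average of the truncated mean, and dominated
  convergence alone yields its asymptotics.\<close>

lemma one_minus_exp_integral:
 assumes X: "0 < X"
 shows "(LINT y|F. 1 - exp (- abs y / X)) = (LBINT s. ind {0..} s * (exp (- s) * (m (s * X) / X)))"
proof -
 let ?A = "\<lambda>s y. exp (- s) * min (abs y / X) s"
 have "NE F (\<lambda>y. 1 - exp (- abs y / X)) =
   NI F (\<lambda>y. NI lborel (\<lambda>s. ennreal (?A s y) * ind {0..} s))" using X by (simp add: exp_min_integral)
 also have "... = NI lborel (\<lambda>s. NI F (\<lambda>y. ennreal (?A s y) * ind {0..} s))"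
 proof -
  interpret pair_sigma_finite F lborel ..
  show ?thesis by (rule Fubini'[symmetric]) measurable
 qed
 also have "... = NE lborel (\<lambda>s. ind {0..} s * (exp (- s) * (m (s * X) / X)))"
 proof (rule nn_integral_cong)
  fix s :: real
  show "NI F (\<lambda>y. ennreal (?A s y) * ind {0..} s) = ennreal (ind {0..} s * (exp (- s) * (m (s * X) / X)))"
  proof (cases "0 <= s")
   case True
   have eq: "min (abs y / X) s = min (abs y) (s * X) / X" for y using X by (auto simp: min_def field_simps)
   have "NI F (\<lambda>y. ennreal (?A s y) * ind {0..} s) = NE F (\<lambda>y. exp (- s) * (min (abs y) (s * X) / X))" using True by (simp add: eq)
   also have "... = ennreal (LINT y|F. exp (- s) * (min (abs y) (s * X) / X))"
    using True X by (intro nn_integral_eq_integral integrable_mult_right integrable_divide integrable_min) auto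
   finally show ?thesis using True by (simp add: trunc_mean_def)
  qed simp
 qed
 finally have eq: "NE F (\<lambda>y. 1 - exp (- abs y / X)) = NE lborel (\<lambda>s. ind {0..} s * (exp (- s) * (m (s * X) / X)))" .
 have meas: "(\<lambda>s. m (s * X)) \<in> borel_measurable borel" unfolding trunc_mean_def by simp
 show ?thesis using eq X meas m_nonneg by (subst (1 2) integral_eq_nn_integral) (auto simp: indicator_def)
qed

lemma m_measurable [measurable]: "m \<in> borel_measurable borel" unfolding trunc_mean_def[abs_def] by simp

lemma m_laplace: "((\<lambda>X. \<integral>s. ind {0..} s * (exp (- s) * (m (s * X) / m X)) \<partial>lborel) \<longlongrightarrow> Gamma (2 - \<alpha>)) at_top"
proof -
 let ?A = "\<lambda>r s. exp (- s) * s powr (r - 1)"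
 let ?C = "\<lambda>r. integrable lborel (\<lambda>s. ind {0..} s * ?A r s)"
 have G: "?C r \<and>
   (LBINT s. ind {0..} s * ?A r s) = Gamma r" if "0 < r" for r :: real
 proof -
  have eq: "NE lborel (\<lambda>s. ind {0..} s * ?A r s) = ennreal (Gamma r)" using Gamma_conv_nn_integral_real[OF that] by (simp add: exp_minus field_simps)
  have "?C r" by (rule integrableI_nonneg) (auto simp: eq)
  moreover have "(LBINT s. ind {0..} s * ?A r s) = Gamma r" using that by (subst integral_eq_nn_integral) (auto simp: eq)
  ultimately show ?thesis by blast
 qed
 let ?B = "\<lambda>X s. exp (- s) * (m (s * X) / m X)"
 have "((\<lambda>X. \<integral>s. ind {0..} s * ?B X s \<partial>lborel) \<longlongrightarrow>
   (LBINT s. ind {0..} s * (exp (- s) * s powr ((2 - \<alpha>) - 1)))) at_top"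
 proof (rule integral_dominated_convergence_at_top)
  show "integrable lborel (\<lambda>s::real. ind {0..} s * (exp (- s) * s powr (1 - 1)) + ind {0..} s * (exp (- s) * s powr (2 - 1)))" using G[of 1] G[of 2] by simp
  have "AE s in lborel. s \<noteq> (0::real)" by (rule AE_lborel_singleton)
  then show "AE s in lborel. ((\<lambda>X. ind {0..} s * ?B X s) \<longlongrightarrow> ind {0..} s * (exp (- s) * s powr (2 - \<alpha> - 1))) at_top"
  proof eventually_elim
   case (elim s)
   then show ?case using tendsto_mult[OF tendsto_const m_rv[of s]] by (cases "0 < s") (auto simp: indicator_def)
  qed
  show "\<forall>\<^sub>F X in at_top. AE s in lborel. norm (ind {0..} s * ?B X s)
    <= ind {0..} s * (exp (- s) * s powr (1 - 1)) + ind {0..} s * (exp (- s) * s powr (2 - 1))" using eventually_gt_at_top[of 0]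
  proof eventually_elim
   case (elim X)
   have "AE s in lborel. s \<noteq> (0::real)" by (rule AE_lborel_singleton)
   then show ?case
   proof eventually_elim
    case (elim s)
    show ?case
    proof (cases "0 < s")
     case True
     have "m (s * X) / m X <= 1 + s"
     proof (cases "1 <= s")
      case True
      then have "m (s * X) <= s * m X" using \<open>0 < X\<close> by (intro m_scale) auto
      then show ?thesis using m_pos[OF \<open>0 < X\<close>] by (simp add: field_simps)
     next
      case False
      then have "m (s * X) <= m X" using \<open>0 < X\<close> \<open>0 < s\<close> by (intro m_mono) auto
      then have "m (s * X) / m X <= 1" using m_pos[OF \<open>0 < X\<close>] by simp
      then show ?thesis using True by simp
     qed
     then have "exp (- s) * (m (s * X) / m X) <= exp (- s) * (1 + s)" by (intro mult_left_mono) auto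
     moreover have "0 <= m (s * X) / m X" using True \<open>0 < X\<close> by (intro divide_nonneg_nonneg m_nonneg) auto
     moreover have "0 <= exp (- s) * (m (s * X) / m X)" using calculation(2) by (intro mult_nonneg_nonneg) auto
     ultimately have "norm (?B X s) <= exp (- s) + exp (- s) * s" by (simp only: real_norm_def distrib_left)
     then show ?thesis using True by simp
    qed (use elim in auto)
   qed
  qed
 qed measurable
 then show ?thesis using G[of "2 - \<alpha>"] alpha by simp
qed

text \<open>Replacing y by abs y in the exponent changes the transform by O(1 / X), because the left
  tail has an exponential moment. Multiplied by a X this is O(1 / m X), which vanishes.\<close>

lemma laplace_asymp: "((\<lambda>X. a X * (1 - L (1 / X))) \<longlongrightarrow> Gamma (2 - \<alpha>)) at_top"
proof -
 define N where "N = (LINT y|F. exp (- \<theta> * y))"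
 let ?B = "\<lambda>X. LBINT s. ind {0..} s * (exp (- s) * (m (s * X) / m X))"
 let ?C = "1 / \<theta> * N * 2"
 have main: "abs (a X * (1 - L (1 / X)) - (?B X)) <= ?C / m X"
  if X: "0 < X" "1 / X <= \<theta>" for X
 proof -
  have int1: "integrable F (\<lambda>y. exp (- (1 / X) * y))" using X by (intro exp_int) auto
  let ?A = "\<lambda>y. exp (- abs y / X)"
  have int2: "integrable F (\<lambda>y. ?A y)" using X by (intro integrable_const_bound[where B=1]) auto
  have "L (1 / X) - (LINT y|F. ?A y) = (LINT y|F. exp (- (1 / X) * y) - ?A y)" unfolding L_def using int1 int2 by simp
  also have "abs ... <= (LINT y|F. abs (exp (- (1 / X) * y) - (?A y)))" by simp
  also have "... <= (LINT y|F. (1 / \<theta> * 2) / X * exp (- \<theta> * y))"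
  proof (rule integral_mono)
   fix y :: real
   show "abs (exp (- (1 / X) * y) - (?A y)) <= (1 / \<theta> * 2) / X * exp (- \<theta> * y)"
   proof (cases "0 <= y")
    case True
    then show ?thesis using theta X by simp
   next
    case False
    define z where "z = - y"
    have z: "0 < z" using False by (simp add: z_def)
    let ?D = "1 / X / \<theta>"
    have b: "1 / X = ?D * \<theta>" "1 / X / \<theta> <= 1" using X by (auto simp: field_simps)
    let ?E = "exp (\<theta> * z)"
    \<comment> \<open>Convexity: z / X lies between 0 and \<theta> * z, so the chord bounds the
      increment by a multiple of 1 / X.\<close>
    have "exp (z / X) - 1 <= ?D * (?E - 1)" using convex_onD[OF exp_convex, of "1 / X / \<theta>" 0 "\<theta> * z"] b X theta by (simp add: algebra_simps)
    moreover have "1 - exp (- (z / X)) <= z / X" using exp_ge_add_one_self[of "- (z / X)"] by simp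
    moreover have "z / X <= ?D * (?E - 1)" using X by (simp add: field_simps)
    moreover have "exp (- (z / X)) <= exp (z / X)" using z X by simp
    moreover have "?D * (?E - 1) <= ?D * ?E" using X theta by (intro mult_left_mono) auto
    ultimately have "exp (z / X) - exp (- (z / X)) <= 2 * (?D * ?E)" "0 <= exp (z / X) - exp (- (z / X))" by auto
    then show ?thesis using False by (simp add: z_def mult.commute)
   qed
  qed (use int1 int2 exp_int_theta in \<open>auto intro!: integrable_abs Lintable_diff\<close>)
  also have "... = ?C / X" by (simp add: N_def)
  finally have "abs (L (1 / X) - (LINT y|F. ?A y)) <= ?C / X" .
  then have "abs ((1 - L (1 / X)) - (LINT y|F. 1 - ?A y)) <= ?C / X" using int2 prob_space by simp
  then have "a X * abs ((1 - L (1 / X)) - (LINT y|F. 1 - ?A y)) <= a X * (?C / X)" using a_pos[OF X(1)] by (intro mult_left_mono) auto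
  moreover have eq: "a X * (LINT y|F. 1 - ?A y) = ?B X" unfolding one_minus_exp_integral[OF X(1)] integral_mult_right_zero[symmetric]
   using X by (intro Lint_cong) (auto simp: renewal_scale_def)
  moreover have "a X * (?C / X) = ?C / m X" using X by (simp add: renewal_scale_def)
  ultimately have "a X * abs ((1 - L (1 / X)) - (LINT y|F. 1 - ?A y)) <= ?C / m X" by simp
  moreover have "abs (a X * (1 - L (1 / X)) - a X * (LINT y|F. 1 - ?A y)) = a X * abs ((1 - L (1 / X)) - (LINT y|F. 1 - ?A y))"
   using a_pos[OF X(1)] by (simp add: abs_mult flip: right_diff_distrib)
  ultimately show ?thesis unfolding eq by simp
 qed
 have lim0: "((\<lambda>X. ?C / m X) \<longlongrightarrow> 0) at_top" by (intro tendsto_divide_0[OF tendsto_const] filterlim_at_top_imp_at_infinity m_inf)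
 have "((\<lambda>X. a X * (1 - L (1 / X)) - ?B X) \<longlongrightarrow> 0) at_top"
 proof (rule Lim_null_comparison[OF _ lim0])
  show "\<forall>\<^sub>F X in at_top. norm (a X * (1 - L (1 / X)) - ?B X) <= ?C / m X" using eventually_gt_at_top[of 0] eventually_ge_at_top[of "1 / \<theta>"]
  proof eventually_elim
   case (elim X)
   then have "1 / X <= \<theta>" using theta by (simp add: field_simps)
   then show ?case using main[of X] elim by simp
  qed
 qed
 from tendsto_add[OF this m_laplace] show ?thesis by simp
qed

end

section \<open>Weighted renewal measures\<close>

context renewal_law
begin

primrec Fn :: "nat => real measure" where
 "Fn 0 = return borel 0"
| "Fn (Suc n) = convolution F (Fn n)"

lemma sets_Fn [simp, measurable_cong]: "sets (Fn n) = sets borel" by (cases n) auto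

lemma space_Fn [simp]: "space (Fn n) = UNIV" using sets_eq_imp_space_eq[OF sets_Fn] by simp

lemma prob_Fn: "prob_space (Fn n)"
proof (induction n)
 case 0
 then show ?case by (auto intro!: prob_space_return)
next
 case (Suc n)
 interpret n: prob_space "Fn n" by (rule Suc)
 interpret pair_prob_space F "Fn n" ..
 have "emeasure (Fn (Suc n)) (space (Fn (Suc n))) = 1" unfolding Fn.simps convolution_def by (subst emeasure_distr) (auto simp: emeasure_space_1)
 then show ?case by (rule prob_spaceI)
qed

lemma nn_integral_Fn_Suc:
 assumes [measurable]: "f \<in> borel_measurable borel"
 shows "NI (Fn (Suc n)) (\<lambda>y. f y) = NI F (\<lambda>w. NI (Fn n) (\<lambda>z. f (w + z)))" unfolding Fn.simps using prob_Fn[of n]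
 by (intro nn_integral_convolution) (auto intro: prob_space.finite_measure)

lemma nn_integral_Fn_0: "f \<in> borel_measurable borel ==> NI (Fn 0) f = f 0" by (simp add: nn_integral_return)

definition weight :: "nat => nat => real" where
 "weight k n = real ((n + k) choose k)"

lemma weight_pos: "0 < weight k n" "1 <= weight k n" by (auto simp: weight_def Suc_le_eq)

text \<open>The renewal measure for k = 0, otherwise the convolution powers with negative binomial
  weights. It is encoded as a bind over a weighted counting measure, so that sets are those of the
  Borel algebra by construction and integrals unfold to series.\<close>

definition U :: "nat => real measure" where
 "U k = density (count_space UNIV) (\<lambda>n. ennreal (weight k n)) \<bind> Fn"

lemma Fn_kernel: "Fn \<in> density (count_space UNIV) f \<rightarrow>\<^sub>M subprob_algebra borel"
 using prob_Fn by (auto simp: measurable_def space_subprob_algebra prob_space_imp_subprob_space)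

lemma sets_U [simp, measurable_cong]: "sets (U k) = sets borel" unfolding U_def by simp

lemma space_U [simp]: "space (U k) = UNIV" using sets_eq_imp_space_eq[OF sets_U] by simp

lemma nn_integral_U:
 assumes [measurable]: "f \<in> borel_measurable borel"
 shows "NI (U k) f = (\<Sum>n. ennreal (weight k n) * NI (Fn n) f)" unfolding U_def
 by (subst nn_integral_bind[OF assms Fn_kernel]) (simp add: nn_integral_density nn_integral_count_space_nat)

lemma exp_Fn: "0 <= \<beta> ==> \<beta> <= \<theta> ==> NE (Fn n) (\<lambda>y. exp (- \<beta> * y)) = ennreal (L \<beta> ^ n)"
proof (induction n)
 case 0
 then show ?case by (subst nn_integral_Fn_0) auto
next
 case (Suc n)
 have L0: "0 <= L \<beta>" unfolding L_def by simp
 have "NE (Fn (Suc n)) (\<lambda>y. exp (- \<beta> * y)) = NI F (\<lambda>w. NI (Fn n) (\<lambda>z. ennreal (exp (- \<beta> * w)) * ennreal (exp (- \<beta> * z))))"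
  by (subst nn_integral_Fn_Suc) (auto simp: ennreal_mult[symmetric] mult_exp_exp algebra_simps)
 also have "... = NI F (\<lambda>w. ennreal (exp (- \<beta> * w)) * ennreal (L \<beta> ^ n))" using Suc by (simp add: nn_integral_cmult)
 also have "... = ennreal (L \<beta>) * ennreal (L \<beta> ^ n)" using exp_int[OF Suc.prems] by (simp add: nn_integral_multc nn_integral_eq_integral L_def)
 finally show ?case using L0 by (simp add: ennreal_mult)
qed

lemma L_bounds: "0 < \<beta> ==> \<beta> <= \<theta> ==> 0 <= L \<beta> \<and> L \<beta> < 1" using laplace_less[of \<beta>] by (auto simp: L_def)

lemma exp_U: "0 < \<beta> ==> \<beta> <= \<theta> ==> NE (U k) (\<lambda>y. exp (- \<beta> * y)) = ennreal (1 / (1 - L \<beta>) ^ Suc k)"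
proof -
 assume b: "0 < \<beta>" "\<beta> <= \<theta>"
 have "norm (L \<beta>) < 1" using L_bounds[OF b] by simp
 from negative_binomial_sums[OF this, of k]
 have "(\<lambda>n. weight k n * L \<beta> ^ n) sums (1 / (1 - L \<beta>) ^ Suc k)" by (simp add: weight_def)
 then have "(\<Sum>n. ennreal (weight k n * L \<beta> ^ n)) = ennreal (1 / (1 - L \<beta>) ^ Suc k)"
  using L_bounds[OF b] weight_pos(1)[THEN less_imp_le] by (intro suminf_ennreal_eq) auto
 moreover have "NE (U k) (\<lambda>y. exp (- \<beta> * y)) = (\<Sum>n. ennreal (weight k n) * NE (Fn n) (\<lambda>y. exp (- \<beta> * y)))"
  by (rule nn_integral_U) measurable
 moreover have "ennreal (weight k n) * NE (Fn n) (\<lambda>y. exp (- \<beta> * y)) = ennreal (weight k n * L \<beta> ^ n)" for n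
  using b weight_pos(1)[of k n] by (subst exp_Fn) (auto simp: ennreal_mult')
 ultimately show ?thesis by simp
qed

lemma neg_U: "NE (U k) (\<lambda>y. exp (- \<theta> * y)) < \<infinity>" using exp_U[of \<theta> k] theta by simp

text \<open>The transform of \<open>U k\<close> at 1 / X is 1 - L (1 / X) to the power -(k + 1),
  hence of order a X ^ Suc k by \<open>laplace_asymp\<close>. For small X the integral is increasing
  in X and is compared with its value at the threshold.\<close>

lemma exp_U_half_line:
 "\<exists>C\<ge>1. \<forall>X\<ge>1. NI (U k) (\<lambda>z. ennreal (exp (- z / X)) * ind {0..} z) <= ennreal (C * a X ^ Suc k)"
proof -
 define G where "G = Gamma (2 - \<alpha>)"
 have G: "0 < G" using alpha by (auto simp: G_def)
 have "\<forall>\<^sub>F X in at_top. G / 2 < a X * (1 - L (1 / X))" using laplace_asymp G by (intro order_tendstoD) (auto simp: G_def)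
 then obtain X1 where X1: "!!X. X1 <= X ==> G / 2 < a X * (1 - L (1 / X))" unfolding eventually_at_top_linorder by blast
 define X0 where "X0 = max (max X1 1) (1 / \<theta>)"
 have X0: "1 <= X0" "X1 <= X0" "1 / \<theta> <= X0" by (auto simp: X0_def)
 let ?A = "\<lambda>X. NI (U k) (\<lambda>z. ennreal (exp (- z / X)) * ind {0..} z)"
 have main: "?A X <= ennreal ((2 / G) ^ Suc k * a X ^ Suc k)" if "X0 <= X" for X
 proof -
  have X: "0 < X" "1 / X <= \<theta>" using that X0 theta by (auto simp: field_simps intro: order_trans)
  have L: "L (1 / X) < 1" using L_bounds[of "1 / X"] X by auto
  have "?A X <= NE (U k) (\<lambda>z. exp (- (1 / X) * z))" by (intro nn_integral_mono) (auto simp: indicator_def)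
  also have "... = ennreal (1 / (1 - L (1 / X)) ^ Suc k)" using X by (intro exp_U) auto
  also have "... = ennreal ((1 / (1 - L (1 / X))) ^ Suc k)" by (simp add: power_one_over)
  also have "... <= ennreal ((2 / G * a X) ^ Suc k)"
  proof (intro ennreal_leI power_mono)
   show "1 / (1 - L (1 / X)) <= 2 / G * a X" using X1[of X] that X0 L G by (simp add: field_simps)
  qed (use L in auto)
  finally show ?thesis by (simp only: power_mult_distrib)
 qed
 define C where "C = max 1 ((2 / G) ^ Suc k * a X0 ^ Suc k + (2 / G) ^ Suc k)"
 have "?A X <= ennreal (C * a X ^ Suc k)" if "1 <= X" for X
 proof -
  have aX: "1 <= a X" "0 < a X0" using that X0 by (auto intro!: a_ge_1 a_pos)
  have aXk: "1 <= a X ^ Suc k" using aX(1) by (rule one_le_power)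
  have nn: "0 <= (2 / G) ^ Suc k * a X0 ^ Suc k" "0 <= (2 / G) ^ Suc k" using G aX by auto
  show ?thesis
  proof (cases "X0 <= X")
   case True
   have "(2 / G) ^ Suc k <= C" using nn unfolding C_def by simp
   then have "(2 / G) ^ Suc k * a X ^ Suc k <= C * a X ^ Suc k" using aXk by (intro mult_right_mono) auto
   then show ?thesis using main[OF True] by (meson ennreal_leI order_trans)
  next
   case False
   have "?A X <= NI (U k) (\<lambda>z. ennreal (exp (- z / X0)) * ind {0..} z)"
    using False that by (intro nn_integral_mono) (auto simp: indicator_def intro!: divide_left_mono)
   also have "... <= ennreal ((2 / G) ^ Suc k * a X0 ^ Suc k)" by (rule main) simp
   also have "... <= ennreal (C * a X ^ Suc k)"
   proof (rule ennreal_leI)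
    have "(2 / G) ^ Suc k * a X0 ^ Suc k <= C" using nn unfolding C_def by simp
    also have "... = C * 1" by simp
    also have "... <= C * a X ^ Suc k" using aXk unfolding C_def by (intro mult_left_mono) auto
    finally show "(2 / G) ^ Suc k * a X0 ^ Suc k <= C * a X ^ Suc k" .
   qed
   finally show ?thesis .
  qed
 qed
 then show ?thesis by (intro exI[of _ C]) (auto simp: C_def)
qed

text \<open>Bounds a quadratic weight by exponentials at dyadic scales, for which the Laplace
  transform is available. At the first j with z <= 2 ^ Suc j * X the weight is at most 4 ^ (-j), and
  the exponential at that scale is at least exp (-1).\<close>

lemma weight_dyadic_bound:
 fixes z X :: real
 assumes z: "0 <= z" and X: "0 < X"
 shows "1 / (1 + z / X) ^ 2 <= exp 1 * (1/4) ^ (LEAST j. z <= 2 ^ Suc j * X) * exp (- z / (2 ^ Suc (LEAST j. z <= 2 ^ Suc j * X) * X))"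
proof -
 define j where "j = (LEAST j. z <= 2 ^ Suc j * X)"
 obtain n where n: "z / X < 2 ^ n" using real_arch_pow[of 2 "z / X"] by auto
 have "(2::real) ^ n <= 2 ^ Suc n" by simp
 then have "z / X <= 2 ^ Suc n" using n by linarith
 then have "z <= 2 ^ Suc n * X" using X by (simp add: field_simps)
 then have j: "z <= 2 ^ Suc j * X" unfolding j_def by (rule LeastI)
 have "(2 ^ j)^2 <= (1 + z / X) ^ 2"
 proof (cases j)
  case (Suc i)
  have "\<not> z <= 2 ^ Suc i * X" using not_less_Least[of i "\<lambda>j. z <= 2 ^ Suc j * X"] Suc unfolding j_def by simp
  then have "2 ^ j <= z / X" using X Suc by (simp add: field_simps)
  then show ?thesis by (intro power_mono) auto
 qed (use z X in auto)
 then have "4 ^ j <= (1 + z / X) ^ 2" by (simp add: power2_eq_square flip: power_mult_distrib)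
 moreover have "0 < 1 + z / X" using z X by (simp add: add_pos_nonneg)
 ultimately have "1 / (1 + z / X) ^ 2 <= 1 / 4 ^ j" by (intro divide_left_mono) (auto)
 also have "... <= (1/4) ^ j * (exp 1 * exp (- z / (2 ^ Suc j * X)))"
 proof -
  have "z / (2 ^ Suc j * X) <= 1" using j X by simp
  then have "1 <= exp 1 * exp (- z / (2 ^ Suc j * X))" by (simp flip: exp_add)
  then have "(1/4) ^ j * 1 <= (1/4) ^ j * (exp 1 * exp (- z / (2 ^ Suc j * X)))" by simp
  then show ?thesis by (simp add: power_one_over)
 qed
 finally show ?thesis unfolding j_def[symmetric] by (simp add: mult_ac)
qed

text \<open>Summation over the dyadic scales: scale 2 ^ j costs a factor (2 ^ j) powr ((k + 1) q) by
  Potter against 4 ^ (-j). As (k + 1) \<alpha> < 2, the midpoint \<open>q\<close> of \<alpha> and 2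
  / (k + 1) keeps the ratio \<open>r\<close> below 1. Negative z are covered by the exponential
  moment.\<close>

lemma U_quadratic_decay:
 assumes "real (Suc k) * \<alpha> < 2"
 shows "\<exists>C>0. \<forall>X\<ge>1. NE (U k) (\<lambda>z. 1 / (1 + abs z / X) ^ 2) <= ennreal (C * a X ^ Suc k)"
proof -
 define q where "q = (\<alpha> + 2 / real (Suc k)) / 2"
 have q: "\<alpha> < q" "real (Suc k) * q < 2" "0 < q"
 proof -
  define K where "K = real (Suc k)"
  have K: "0 < K" "K * \<alpha> < 2" "q = (\<alpha> + 2 / K) / 2" using assms by (auto simp: K_def q_def)
  then have "\<alpha> < 2 / K" by (simp add: field_simps)
  then show "\<alpha> < q" using K by simp
  then show "0 < q" using alpha by simp
  have "K * q = (K * \<alpha> + 2) / 2" using K by (simp add: field_simps)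
  then show "real (Suc k) * q < 2" using K(2) unfolding K_def[symmetric] by simp
 qed
 have pq: "0 <= (0::real)" "0 < \<alpha>" "\<alpha> < q" "(0::real) < 1" using q alpha by auto
 obtain D where D: "1 <= D" "!!x y. 1 <= y ==> y <= x ==> a x <= D * (x / y) powr q * a y" by (rule a_potter[OF pq]) (rule that)
 obtain C where C: "1 <= C" "!!X. 1 <= X ==> NI (U k) (\<lambda>z. ennreal (exp (- z / X)) * ind {0..} z) <= ennreal (C * a X ^ Suc k)"
  using exp_U_half_line[of k] by blast
 let ?B = "NE (U k) (\<lambda>y. exp (- \<theta> * y))"
 define N where "N = enn2real ?B"
 have N: "?B = ennreal N" "0 <= N" using neg_U[of k] by (auto simp: N_def)
 define r where "r = 2 powr (real (Suc k) * q) / 4"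
 have "2 powr (real (Suc k) * q) < 2 powr 2" using q by (intro powr_less_mono) auto
 then have r: "0 < r" "r < 1" by (auto simp: r_def)
 define B where "B = N + exp 1 * C * D ^ Suc k * 4 * r * (1 / (1 - r))"
 let ?A = "\<lambda>X z. ennreal (1 / (1 + abs z / X) ^ 2)"
 have "NI (U k) (\<lambda>z. ?A X z) <= ennreal (B * a X ^ Suc k)" if X: "1 <= X" for X
 proof -
  have aX: "1 <= a X" using X by (intro a_ge_1) auto
  let ?D = "\<lambda>j. ennreal (exp 1 * (1/4) ^ j)"
  let ?t = "\<lambda>j z. ?D j * (ennreal (exp (- z / (2 ^ Suc j * X))) * ind {0..} z)"
  let ?C = "\<lambda>z. ennreal (exp (- \<theta> * z))"
  have "NI (U k) (\<lambda>z. ?A X z) <= NI (U k) (\<lambda>z. ?C z + (\<Sum>j. ?t j z))"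
  proof (rule nn_integral_mono)
   fix z
   show "?A X z <= ?C z + (\<Sum>j. ?t j z)"
   proof (cases "0 <= z")
    case True
    define j where "j = (LEAST j. z <= 2 ^ Suc j * X)"
    have "?A X z <= ?t j z" using weight_dyadic_bound[OF True, of X] X True unfolding j_def[symmetric] by (simp add: ennreal_mult[symmetric])
    also have "?t j z <= (\<Sum>j. ?t j z)" using sum_le_suminf[of "\<lambda>j. ?t j z" "{j}"] by simp
    finally show ?thesis by (rule order_trans) simp
   next
    case False
    have "1 <= 1 + abs z / X" using X by simp
    then have "1 / (1 + abs z / X) ^ 2 <= 1 / 1" by simp
    also have "... <= exp (- \<theta> * z)" using False theta by (simp add: mult_nonneg_nonpos)
    finally have "?A X z <= ?C z" by simp
    then show ?thesis by (rule order_trans) simp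
   qed
  qed
  also have "... = ennreal N + (\<Sum>j. NI (U k) (\<lambda>z. ?t j z))" by (subst nn_integral_add, measurable, subst nn_integral_suminf) (use N in simp_all)
  also have "... <= ennreal N + (\<Sum>j. ennreal (exp 1 * C * D ^ Suc k * 4 * r * a X ^ Suc k * r ^ j))"
  proof (intro add_left_mono suminf_le)
   fix j
   have X2: "1 <= 2 ^ Suc j * X" "X <= 2 ^ Suc j * X" using X mult_mono[of 1 "2 ^ Suc j" 1 X] by (auto simp del: power_Suc)
   have "NI (U k) (\<lambda>z. ?t j z) = ?D j * NI (U k) (\<lambda>z. ennreal (exp (- z / (2 ^ Suc j * X))) * ind {0..} z)" by (rule nn_integral_cmult) measurable
   also have "... <= ?D j * ennreal (C * a (2 ^ Suc j * X) ^ Suc k)" by (intro mult_left_mono C X2) auto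
   also have "... <= ?D j * ennreal (C * (D * (2 ^ Suc j) powr q * a X) ^ Suc k)"
   proof (intro mult_left_mono ennreal_leI power_mono)
    show "a (2 ^ Suc j * X) <= D * (2 ^ Suc j) powr q * a X" using D(2)[OF X X2(2)] X by simp
    show "0 <= a (2 ^ Suc j * X)" using X2(1) by (intro less_imp_le a_pos) linarith
   qed (use C in auto)
   also have "... = ennreal (exp 1 * (1/4) ^ j * (C * (D * (2 ^ Suc j) powr q * a X) ^ Suc k))" by (rule ennreal_mult'[symmetric]) auto
   also have "exp 1 * (1/4) ^ j * (C * (D * (2 ^ Suc j) powr q * a X) ^ Suc k) = exp 1 * C * D ^ Suc k * 4 * r * a X ^ Suc k * r ^ j"
   proof -
    have "((2 ^ Suc j) powr q) ^ Suc k = (2 powr (real (Suc k) * q)) ^ Suc j" by (simp add: powr_realpow[symmetric] powr_powr mult_ac del: power_Suc)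
    also have "... = 4 ^ Suc j * r ^ Suc j" by (simp add: r_def flip: power_mult_distrib)
    finally have e: "((2 ^ Suc j) powr q) ^ Suc k = 4 ^ Suc j * r ^ Suc j" .
    show ?thesis unfolding power_mult_distrib e by (simp add: power_one_over)
   qed
   finally show "NI (U k) (\<lambda>z. ?t j z) <= ennreal (exp 1 * C * D ^ Suc k * 4 * r * a X ^ Suc k * r ^ j)" .
  qed auto
  also have "(\<Sum>j. ennreal (exp 1 * C * D ^ Suc k * 4 * r * a X ^ Suc k * r ^ j)) = ennreal (exp 1 * C * D ^ Suc k * 4 * r * a X ^ Suc k * (1 / (1 - r)))"
   using r C D aX geometric_sums[of r] by (intro suminf_ennreal_eq sums_mult) auto
  also have "ennreal N + ... = ennreal (N + exp 1 * C * D ^ Suc k * 4 * r * a X ^ Suc k * (1 / (1 - r)))" using r C D aX N by simp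
  also have "... <= ennreal (B * a X ^ Suc k)"
  proof (rule ennreal_leI)
   have "N * 1 <= N * a X ^ Suc k" using N aX by (intro mult_left_mono one_le_power) auto
   then show "N + exp 1 * C * D ^ Suc k * 4 * r * a X ^ Suc k * (1 / (1 - r)) <= B * a X ^ Suc k" unfolding B_def distrib_right by simp
  qed
  finally show ?thesis .
 qed
 moreover have "0 < B" unfolding B_def using N C D r by (intro add_nonneg_pos) auto
 ultimately show ?thesis by blast
qed

end

lemma one_plus_mult_ge: "0 <= p ==> 0 <= q ==> 1 + p + q <= (1 + p) * (1 + q :: real)" by (simp add: algebra_simps)

lemma one_plus_abs_mult: "1 + abs z <= br x * (1 + abs (x - z :: real))" using one_plus_mult_ge[of "abs x" "abs (x - z)"] by simp

lemma inverse_le_mult_inverse: "0 < a ==> 0 < c ==> c <= a * b ==> 1 / a <= b * (1 / c :: real)" by (simp add: field_simps)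

context renewal_law
begin

lemma U_finite_atMost: "emeasure (U k) {..x} < \<infinity>"
proof -
 have "emeasure (U k) {..x} = NI (U k) (\<lambda>y. ind {..x} y)" by simp
 also have "... <= NI (U k) (\<lambda>y. ennreal (exp (\<theta> * x)) * ennreal (exp (- \<theta> * y)))"
 proof (rule nn_integral_mono)
  fix y :: real
  show "ind {..x} y <= ennreal (exp (\<theta> * x)) * ennreal (exp (- \<theta> * y))"
  proof (cases "y <= x")
   case True
   then have "1 <= exp (\<theta> * x) * exp (- \<theta> * y)" using theta by (simp add: mult_exp_exp)
   then show ?thesis using True by (simp add: ennreal_mult[symmetric])
  qed simp
 qed
 also have "... = ennreal (exp (\<theta> * x)) * NE (U k) (\<lambda>y. exp (- \<theta> * y))" by (rule nn_integral_cmult) measurable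
 also have "... < \<infinity>" using neg_U[of k] by (simp add: ennreal_mult_less_top)
 finally show ?thesis .
qed

sublocale U: sigma_finite_measure "U k" for k
proof
 have "(\<Union>n::nat. {..real n}) = UNIV" using real_arch_simple by auto
 then show "\<exists>A. countable A \<and> A \<subseteq> sets (U k) \<and> \<Union> A = space (U k) \<and> (\<forall>a\<in>A. emeasure (U k) a \<noteq> \<infinity>)"
  using U_finite_atMost[of k] by (intro exI[of _ "range (\<lambda>n. {..real n})"]) (auto simp: less_top)
qed

end

section \<open>Smoothed renewal densities and their a priori bounds\<close>

locale renewal_kernel = renewal_law +
 fixes h g :: "real => real" and T H :: real
 assumes kernel: "band_kernel h g T H"
begin

lemma T_pos: "0 < T" and h_nonneg: "0 <= h v" and h_le': "h v * br v ^ 6 <= H"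
 and h_meas [measurable]: "h \<in> borel_measurable borel" and g_meas [measurable]: "g \<in> borel_measurable borel"
 and h_integrable: "integrable lborel h" and h_integral: "(LBINT v. h v) = 1"
 and g_bound: "abs (g t) <= H" and g_zero: "T < abs t ==> g t = 0" and g_lipschitz: "abs (g t - g s) <= H * abs (t - s)"
 and h_fourier: "cx (h v) = (CLBINT t. cx (g t) * iexp (t * v))" using kernel by (auto simp: band_kernel_def)

lemma H_nonneg: "0 <= H" using g_bound[of 0] by simp

lemma h_le: "j <= 6 ==> h v * br v ^ j <= H"
proof -
 assume "j <= 6"
 then have "h v * br v ^ j <= h v * br v ^ 6" by (intro mult_left_mono power_increasing h_nonneg) auto
 also note h_le'
 finally show ?thesis .
qed

lemma h_le_div: "j <= 6 ==> h v <= H * (1 / br v ^ j)" using h_le[of j v] by (simp add: pos_le_divide_eq)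

lemma h_shift_le: "h (x - z) <= H * br x^2 * (1 / (1 + abs z / 1) ^ 2)"
proof -
 have "br z^2 <= (br x * br (x - z))^2" by (intro power_mono one_plus_abs_mult) auto
 then have "h (x - z) * br z^2 <= h (x - z) * (br x * br (x - z))^2" by (intro mult_left_mono h_nonneg)
 also have "... = br x^2 * (h (x - z) * br (x - z)^2)" by (simp add: power_mult_distrib)
 also have "... <= br x^2 * H" by (intro mult_left_mono h_le) auto
 finally show ?thesis by (simp add: pos_le_divide_eq mult.commute)
qed

definition u :: "nat => real => real" where
 "u k x = (LINT z|U k. h (x - z))"

lemma u_integrable: "real (Suc k) * \<alpha> < 2 ==> integrable (U k) (\<lambda>z. h (x - z))"
proof (rule integrableI_nonneg)
 assume k: "real (Suc k) * \<alpha> < 2"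
 obtain C where C: "!!X. 1 <= X ==> NE (U k) (\<lambda>z. 1 / (1 + abs z / X) ^ 2) <= ennreal (C * a X ^ Suc k)" using U_quadratic_decay[OF k] by blast
 let ?A = "NE (U k) (\<lambda>z. h (x - z))"
 have "?A <= NI (U k) (\<lambda>z. ennreal (H * br x^2) * ennreal (1 / (1 + abs z / 1) ^ 2))"
  using h_shift_le H_nonneg by (intro nn_integral_mono) (simp add: ennreal_mult[symmetric] ennreal_leI)
 also have "... = ennreal (H * br x^2) * NE (U k) (\<lambda>z. 1 / (1 + abs z / 1) ^ 2)" by (rule nn_integral_cmult) measurable
 also have "... < \<infinity>" using C[of 1] by (auto simp: ennreal_mult_less_top intro: le_less_trans)
 finally show "?A < \<infinity>" .
qed (auto simp: h_nonneg)

lemma u_nonneg: "0 <= u k x" unfolding u_def by (intro integral_nonneg_AE) (auto simp: h_nonneg)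

lemma u_nn: "real (Suc k) * \<alpha> < 2 ==> NE (U k) (\<lambda>z. h (x - z)) = ennreal (u k x)"
 unfolding u_def by (intro nn_integral_eq_integral u_integrable) (auto simp: h_nonneg)

lemma u_meas [measurable]: "u k \<in> borel_measurable borel"
proof -
 have "(\<lambda>x. \<integral>z. h (x - z) \<partial>U k) \<in> borel_measurable borel" by simp
 then show ?thesis by (simp add: u_def[abs_def])
qed

text \<open>The averaged bound survives smoothing. The inequality 1 + abs z / X <= (1 + abs s / X) *
  (1 + abs (s - z)) moves the weight from s to z for two powers of the decay of \<open>h\<close>;
  two further powers make the integral over s finite.\<close>

lemma u_smooth:
 assumes k: "real (Suc k) * \<alpha> < 2"
 shows "\<exists>C>0. \<forall>X\<ge>1. NE lborel (\<lambda>s. u k s * (1 / (1 + abs s / X) ^ 2)) <= ennreal (C * a X ^ Suc k)"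
proof -
 obtain C where C: "0 < C" "!!X. 1 <= X ==> NE (U k) (\<lambda>z. 1 / (1 + abs z / X) ^ 2) <= ennreal (C * a X ^ Suc k)" using U_quadratic_decay[OF k] by blast
 define J where "J = (LBINT v::real. 1 / br v ^ 2)"
 have J: "0 <= J" unfolding J_def by simp
 let ?B = "\<lambda>X s. 1 + abs s / X"
 have "NE lborel (\<lambda>s. u k s * (1 / ?B X s ^ 2)) <= ennreal ((H * J + 1) * C * a X ^ Suc k)" if X: "1 <= X" for X
 proof -
  let ?w = "\<lambda>s::real. 1 / ?B X s ^ 2"
  interpret pair_sigma_finite lborel "U k" ..
  let ?A = "\<lambda>s z. ennreal (h (s - z))"
  have "NE lborel (\<lambda>s. u k s * ?w s) = NI lborel (\<lambda>s. NI (U k) (\<lambda>z. ?A s z * ennreal (?w s)))"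
  proof (intro nn_integral_cong)
   fix s
   have "ennreal (u k s * ?w s) = NI (U k) (\<lambda>z. ?A s z) * ennreal (?w s)" by (simp only: u_nn[OF k] ennreal_mult'[OF u_nonneg])
   also have "... = NI (U k) (\<lambda>z. ?A s z * ennreal (?w s))" by (rule nn_integral_multc[symmetric]) measurable
   finally show "ennreal (u k s * ?w s) = NI (U k) (\<lambda>z. ?A s z * ennreal (?w s))" .
  qed
  also have "... = NI (U k) (\<lambda>z. NI lborel (\<lambda>s. ?A s z * ennreal (?w s)))" by (rule Fubini'[symmetric]) measurable
  also have "... <= NI (U k) (\<lambda>z. NI lborel (\<lambda>s. ennreal (H * ?w z) * ennreal (1 / br (s - z) ^ 2)))"
  proof (intro nn_integral_mono)
   fix z s :: real
   have "1 + abs z / X <= ?B X s * br (s - z)"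
   proof -
    have "abs z / X <= abs s / X + abs (s - z) / X" using X by (simp add: divide_right_mono flip: add_divide_distrib)
    moreover have "abs (s - z) / X <= abs (s - z)" using X by (simp add: divide_le_eq mult_le_cancel_left1)
    moreover have "1 + abs s / X + abs (s - z) <= ?B X s * br (s - z)" using X by (intro one_plus_mult_ge) auto
    ultimately show ?thesis by simp
   qed
   then have "(1 + abs z / X)^2 <= (?B X s)^2 * br (s - z)^2" using X unfolding power_mult_distrib[symmetric] by simp
   moreover have p: "0 < 1 + abs z / X" "0 < 1 + abs s / X" "0 < 1 + abs (s - z)" using X by (auto intro!: add_pos_nonneg)
   ultimately have w: "?w s <= br (s - z)^2 * ?w z" by (intro inverse_le_mult_inverse zero_less_power)
   have "h (s - z) * ?w s <= h (s - z) * (br (s - z)^2 * ?w z)" by (intro mult_left_mono w h_nonneg)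
   also have "... = (h (s - z) * br (s - z) ^ 4) * (1 / br (s - z)^2) * ?w z" using that by (auto simp: field_simps)
   also have "... <= H * (1 / br (s - z)^2) * ?w z" by (intro mult_right_mono h_le) auto
   finally have "h (s - z) * ?w s <= H * ?w z * (1 / br (s - z)^2)" by (simp add: mult_ac)
   then have "ennreal (h (s - z) * ?w s) <= ennreal (H * ?w z * (1 / br (s - z)^2))" by (rule ennreal_leI)
   then show "?A s z * ennreal (?w s) <= ennreal (H * ?w z) * ennreal (1 / br (s - z) ^ 2)" using H_nonneg h_nonneg by (subst (1 2) ennreal_mult[symmetric]) auto
  qed
  also have "... = NI (U k) (\<lambda>z. ennreal (H * ?w z) * ennreal J)"
  proof (intro nn_integral_cong)
   fix z
   have "NE lborel (\<lambda>s. 1 / br (s - z) ^ 2) = NE lborel (\<lambda>v. 1 / br v ^ 2)"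
    using nn_integral_real_affine[of "\<lambda>v. ennreal (1 / br v ^ 2)" 1 "-z"] by simp
   also have "... = ennreal J" unfolding J_def by (intro nn_integral_eq_integral integrable_rational_decay) auto
   finally show "NI lborel (\<lambda>s. ennreal (H * ?w z) * ennreal (1 / br (s - z) ^ 2)) = ennreal (H * ?w z) * ennreal J" by (subst nn_integral_cmult) auto
  qed
  also have "... = NI (U k) (\<lambda>z. ennreal (H * J) * ennreal (?w z))" using H_nonneg J by (intro nn_integral_cong) (simp add: ennreal_mult[symmetric] mult_ac)
  also have "... = ennreal (H * J) * NE (U k) (\<lambda>z. ?w z)" by (rule nn_integral_cmult) measurable
  also have "... <= ennreal (H * J) * ennreal (C * a X ^ Suc k)" by (intro mult_left_mono C X) auto
  also have "... = ennreal (H * J * (C * a X ^ Suc k))" using H_nonneg J by (intro ennreal_mult'[symmetric]) auto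
  also have "... <= ennreal ((H * J + 1) * C * a X ^ Suc k)"
  proof (rule ennreal_leI)
   have "0 <= C * a X ^ Suc k" using C X by (intro mult_nonneg_nonneg zero_le_power) (auto intro!: less_imp_le a_pos)
   then show "H * J * (C * a X ^ Suc k) <= (H * J + 1) * C * a X ^ Suc k" by (simp add: algebra_simps)
  qed
  finally show ?thesis .
 qed
 moreover have "0 < (H * J + 1) * C" using C H_nonneg J by (intro mult_pos_pos add_nonneg_pos) auto
 ultimately show ?thesis by blast
qed

text \<open>Mass at z >= 0 is at distance at least max (abs y) z from y <= 0, so six powers of decay
  split into four in y and two in z. Mass at z < 0 has an exponential moment, which absorbs four
  powers of abs z.\<close>

lemma u_neg_bound:
 assumes k: "real (Suc k) * \<alpha> < 2"
 shows "\<exists>C>0. \<forall>y\<le>0. u k y <= C / br y ^ 4"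
proof -
 obtain C where C: "0 < C" "!!X. 1 <= X ==> NE (U k) (\<lambda>z. 1 / (1 + abs z / X) ^ 2) <= ennreal (C * a X ^ Suc k)" using U_quadratic_decay[OF k] by blast
 let ?B = "NE (U k) (\<lambda>y. exp (- \<theta> * y))"
 define N where "N = enn2real ?B"
 have N: "?B = ennreal N" "0 <= N" using neg_U[of k] by (auto simp: N_def)
 define E where "E = fact 4 * (max 1 (1/\<theta>)) ^ 4 * exp \<theta>"
 have E: "0 <= E" by (simp add: E_def)
 have poly: "(1 + v) ^ 4 <= E * exp (\<theta> * v)" if "0 <= v" for v
 proof -
  let ?A = "\<theta> * (1 + v)"
  have "1 + v <= max 1 (1/\<theta>) * ?A"
  proof -
   have "1 / \<theta> * ?A <= max 1 (1/\<theta>) * ?A" using theta that by (intro mult_right_mono) auto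
   then show ?thesis using theta by simp
  qed
  then have "(1 + v) ^ 4 <= (max 1 (1/\<theta>) * ?A) ^ 4" using that by (intro power_mono) auto
  also have "... = (max 1 (1/\<theta>)) ^ 4 * ?A ^ 4" by (simp add: power_mult_distrib)
  also have "... <= (max 1 (1/\<theta>)) ^ 4 * (fact 4 * exp ?A)"
  proof (rule mult_left_mono)
   have "?A ^ 4 /\<^sub>R fact 4 <= exp ?A" unfolding exp_def using theta that
    by (rule_tac order_trans[OF _ sum_le_suminf[of _ "{4::nat}"]]) (auto intro!: summable_exp)
   then show "?A ^ 4 <= fact 4 * exp ?A" by (simp add: field_simps)
  qed simp
  finally show ?thesis unfolding E_def by (simp add: exp_add distrib_left mult_ac)
 qed
 define B where "B = H * C * a 1 ^ Suc k + H * E * N + 1"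
 have aone: "0 <= a 1 ^ Suc k" by (intro zero_le_power less_imp_le a_pos) auto
 have "u k y <= B / br y ^ 4" if y: "y <= 0" for y
 proof -
  have "ennreal (u k y) = NE (U k) (\<lambda>z. h (y - z))" by (simp add: u_nn[OF k])
  also have "... <= NI (U k) (\<lambda>z. ennreal (H / br y ^ 4) * (ennreal (1 / (1 + abs z / 1) ^ 2)) + ennreal (H * E / br y ^ 4) * ennreal (exp (- \<theta> * z)))"
  proof (intro nn_integral_mono)
   fix z
   show "ennreal (h (y - z)) <= ennreal (H / br y ^ 4) * (ennreal (1 / (1 + abs z / 1) ^ 2)) + ennreal (H * E / br y ^ 4) * ennreal (exp (- \<theta> * z))"
   proof (cases "0 <= z")
    case True
    have "br y ^ 4 * br z ^ 2 <= br (y - z) ^ 4 * br (y - z) ^ 2" using True y by (intro mult_mono power_mono) auto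
    also have "... = br (y - z) ^ 6" by simp
    finally have "h (y - z) * (br y ^ 4 * br z ^ 2) <= h (y - z) * br (y - z) ^ 6" by (intro mult_left_mono h_nonneg)
    also note h_le'
    finally have "h (y - z) <= H / br y ^ 4 * (1 / (1 + abs z / 1) ^ 2)" by (simp add: pos_le_divide_eq)
    then have "ennreal (h (y - z)) <= ennreal (H / br y ^ 4 * (1 / (1 + abs z / 1) ^ 2))" by (rule ennreal_leI)
    also have "... = ennreal (H / br y ^ 4) * (ennreal (1 / (1 + abs z / 1) ^ 2))" using H_nonneg by (intro ennreal_mult) auto
    finally show ?thesis by (rule order_trans) simp
   next
    case False
    have "br y ^ 4 <= (br (y - z) * br z) ^ 4" using one_plus_mult_ge[of "abs (y - z)" "abs z"] by auto
    also have "... = br (y - z) ^ 4 * br z ^ 4" by (simp add: power_mult_distrib)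
    also have "... <= br (y - z) ^ 4 * (E * exp (- \<theta> * z))" using poly[of "abs z"] False by (intro mult_left_mono) auto
    finally have "h (y - z) * br y ^ 4 <= h (y - z) * (br (y - z) ^ 4 * (E * exp (- \<theta> * z)))" by (intro mult_left_mono h_nonneg)
    also have "... = (h (y - z) * br (y - z) ^ 4) * (E * exp (- \<theta> * z))" by simp
    also have "... <= H * (E * exp (- \<theta> * z))" using E by (intro mult_right_mono h_le) auto
    finally have "h (y - z) <= H * E / br y ^ 4 * exp (- \<theta> * z)" by (simp add: pos_le_divide_eq)
    then have "ennreal (h (y - z)) <= ennreal (H * E / br y ^ 4 * exp (- \<theta> * z))" by (rule ennreal_leI)
    also have "... = ennreal (H * E / br y ^ 4) * ennreal (exp (- \<theta> * z))" using H_nonneg E by (intro ennreal_mult) auto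
    finally show ?thesis by (rule order_trans) simp
   qed
  qed
  also have "... = ennreal (H / br y ^ 4) * NE (U k) (\<lambda>z. 1 / (1 + abs z / 1) ^ 2) + ennreal (H * E / br y ^ 4) * ennreal N"
   unfolding N(1)[symmetric] by (subst nn_integral_add; (subst nn_integral_cmult)?) (auto simp: nn_integral_cmult)
  also have "... <= ennreal (H / br y ^ 4) * ennreal (C * a 1 ^ Suc k) + ennreal (H * E / br y ^ 4) * ennreal N" by (intro add_right_mono mult_left_mono C) auto
  also have "... = ennreal (H / br y ^ 4 * (C * a 1 ^ Suc k) + H * E / br y ^ 4 * N)"
  proof -
   have nn: "0 <= H / br y ^ 4" "0 <= C * a 1 ^ Suc k" "0 <= H * E / br y ^ 4" "0 <= N" using H_nonneg C aone E N by auto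
   show ?thesis using nn by (simp only: ennreal_plus ennreal_mult mult_nonneg_nonneg)
  qed
  also have "... <= ennreal (B / br y ^ 4)" by (rule ennreal_leI) (simp add: B_def add_divide_distrib mult_ac)
  finally have "ennreal (u k y) <= ennreal (B / br y ^ 4)" .
  moreover have "0 <= B" unfolding B_def using H_nonneg C aone E N by simp
  ultimately show ?thesis by simp
 qed
 moreover have "0 < B" unfolding B_def using H_nonneg C aone E N by (intro add_nonneg_pos) auto
 ultimately show ?thesis by blast
qed

end

section \<open>Fourier inversion with Abel summation\<close>

context renewal_law
begin

lemma char_Fn: "(CLINT z|Fn n. iexp (t * z)) = char F t ^ n"
proof (induction n)
 case 0
 then show ?case by (simp add: integral_return)
next
 case (Suc n)
 interpret n: prob_space "Fn n" by (rule prob_Fn)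
 interpret P: pair_prob_space F "Fn n" ..
 have "(CLINT z|Fn (Suc n). iexp (t * z)) = (CLINT p|(F \<Otimes>\<^sub>M Fn n). iexp (t * (fst p + snd p)))"
  unfolding Fn.simps convolution_def by (subst integral_distr) (auto simp: split_beta')
 also have "... = (CLINT w|F. CLINT z|Fn n. iexp (t * (fst (w, z) + snd (w, z))))" by (rule P.integral_fst'[symmetric], rule P.integrable_const_bound[where B=1]) auto
 also have "... = (CLINT w|F. CLINT z|Fn n. iexp (t * w) * iexp (t * z))" by (simp add: distrib_left exp_add)
 also have "... = char F t ^ Suc n" using Suc by (simp add: char_def)
 finally show ?case .
qed

end

context renewal_kernel
begin

definition hn :: "nat => real => real" where
 "hn n x = (LINT z|Fn n. h (x - z))"

lemma h_le_H: "h v <= H" using h_le[of 0 v] by simp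

lemma hn_nonneg: "0 <= hn n x" and hn_le: "hn n x <= H" and hn_integrable: "integrable (Fn n) (\<lambda>z. h (x - z))"
proof -
 interpret n: prob_space "Fn n" by (rule prob_Fn)
 show "0 <= hn n x" unfolding hn_def by (intro integral_nonneg_AE) (auto simp: h_nonneg)
 show int: "integrable (Fn n) (\<lambda>z. h (x - z))" by (intro n.integrable_const_bound[where B=H]) (auto simp: h_nonneg h_le_H)
 have "hn n x <= (LINT z|Fn n. H)" unfolding hn_def by (intro integral_mono int) (auto simp: h_le_H)
 then show "hn n x <= H" using n.prob_space by simp
qed

lemma g_integrable: "integrable lborel g"
proof (rule Lint_bound)
 show "integrable lborel (\<lambda>t. H * ind {-T..T} t)" by (intro integrable_mult_right Icc_integrable)
 show "AE t in lborel. norm (g t) <= norm (H * ind {-T..T} t)" using g_bound g_zero H_nonneg by (intro AE_I2) (auto simp: indicator_def)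
qed measurable

lemma g_integrable_times:
 assumes [measurable]: "f \<in> borel_measurable borel" and "!!t. norm (f t) <= B"
 shows "integrable lborel (\<lambda>t. cx (g t) * f t)"
proof (rule Lint_bound)
 show "integrable lborel (\<lambda>t. B * g t)" using g_integrable by simp
 show "AE t in lborel. norm (cx (g t) * f t) <= norm (B * g t)"
 proof (intro AE_I2)
  fix t
  have "abs (g t) * norm (f t) <= abs (g t) * abs B" using assms(2)[of t] by (intro mult_left_mono) auto
  then show "norm (cx (g t) * f t) <= norm (B * g t)" by (simp add: norm_mult mult.commute)
 qed
qed measurable

lemma hn_fourier: "cx (hn n x) = (CLBINT t. cx (g t) * (iexp (t * x) * char F (- t) ^ n))"
proof -
 interpret n: prob_space "Fn n" by (rule prob_Fn)
 interpret P: pair_sigma_finite "Fn n" lborel ..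
 let ?f = "\<lambda>z t. cx (g t) * iexp (t * (x - z))"
 have nrm: "norm (?f z t) = norm (g t)" for z t by (simp add: norm_mult)
 have int: "integrable (Fn n \<Otimes>\<^sub>M lborel) (case_prod ?f)"
 proof (rule P.Fubini_integrable)
  show "integrable (Fn n) (\<lambda>z. LBINT t. norm (case (z, t) of (z, t) => ?f z t))" unfolding prod.case nrm by simp
  show "AE z in Fn n. integrable lborel (\<lambda>t. case (z, t) of (z, t) => ?f z t)" unfolding prod.case by (intro AE_I2 g_integrable_times[where B=1]) auto
 qed measurable
 have "cx (hn n x) = (CLINT z|Fn n. cx (h (x - z)))" unfolding hn_def by simp
 also have "... = (CLINT z|Fn n. CLBINT t. ?f z t)" by (simp only: h_fourier)
 also have "... = (LBINT t. (LINT z|Fn n. ?f z t))" by (rule P.Fubini_integral[OF int, symmetric])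
 also have "... = (CLBINT t. cx (g t) * (iexp (t * x) * char F (- t) ^ n))"
 proof (intro Lint_cong refl)
  fix t
  have "?f z t = (cx (g t) * iexp (t * x)) * iexp (- t * z)" for z by (simp add: mult.assoc exp_diff exp_minus field_simps)
  then have "(CLINT z|Fn n. ?f z t) = (cx (g t) * iexp (t * x)) * (CLINT z|Fn n. iexp (- t * z))" by (simp only: integral_mult_right_zero)
  then show "(CLINT z|Fn n. ?f z t) = cx (g t) * (iexp (t * x) * char F (- t) ^ n)" unfolding char_Fn by simp
 qed
 finally show ?thesis .
qed

text \<open>Abel means: for r < 1 the transform 1 / (1 - r \<phi>) ^ Suc k is bounded and can be
  inverted, although at r = 1 it may fail to be integrable near 0. The estimates that follow are
  uniform in r.\<close>

definition abel :: "nat => real => real => real" where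
 "abel k r x = (\<Sum>n. weight k n * r ^ n * hn n x)"

text \<open>Passing from r \<phi> to \<phi> costs at most 1 - r, and 1 - r is itself at most norm (1
  - r \<phi>). Lower bounds for 1 - \<phi> thereby become uniform in the Abel parameter.\<close>

lemma one_minus_char_ge: "0 <= r ==> r <= 1 ==> norm (1 - char F t) <= 2 * norm (1 - cx r * char F t)"
proof -
 assume r: "0 <= r" "r <= 1"
 have c: "norm (char F t) <= 1" by (rule cmod_char_le_1)
 let ?A = "1 - cx r * char F t"
 have "1 - char F t = ?A - cx (1 - r) * char F t" by (simp add: algebra_simps)
 then have "norm (1 - char F t) <= norm ?A + norm (cx (1 - r) * char F t)" by (metis norm_triangle_ineq4)
 also have "norm (cx (1 - r) * char F t) <= 1 - r" unfolding norm_mult norm_of_real using r c by (simp add: mult_left_le)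
 also have "1 - r <= norm ?A"
 proof -
  have "norm (cx r * char F t) <= r" unfolding norm_mult using r c by (simp add: mult_left_le)
  then show ?thesis using norm_triangle_ineq2[of 1 "cx r * char F t"] by simp
 qed
 finally show ?thesis by simp
qed

lemma char_uminus_meas [measurable]: "(\<lambda>t. char F (- t)) \<in> borel_measurable borel" by simp

lemma abel_summable: "0 <= r ==> r < 1 ==> summable (\<lambda>n. weight k n * r ^ n * hn n x)"
proof (rule summable_comparison_test')
 assume r: "0 <= r" "r < 1"
 have "summable (\<lambda>n. norm (of_nat ((n + k) choose k) * r ^ n))" using negative_binomial_sums[of r k] r by simp
 then show "summable (\<lambda>n. weight k n * r ^ n * H)" using r by (intro summable_mult2) (simp add: weight_def)
 fix n
 show "norm (weight k n * r ^ n * hn n x) <= weight k n * r ^ n * H" using r hn_nonneg[of n x] hn_le[of n x] weight_pos(1)[of k n] by (simp add: abs_mult mult_left_mono)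
qed

lemma abel_fourier:
 assumes r: "0 <= r" "r < 1"
 shows "cx (abel k r x) =
  (CLBINT t. cx (g t) * (iexp (t * x) * (1 / (1 - cx r * char F (- t)) ^ Suc k)))"
proof -
 have c: "norm (char F t) <= 1" for t by (rule cmod_char_le_1)
 have rc: "norm (cx r * char F t) <= r" for t unfolding norm_mult using r c[of t] by (simp add: mult_left_le)
 let ?A = "\<lambda>n. of_nat ((n + k) choose k)"
 let ?C = "\<lambda>n t. ?A n * (cx r * char F (- t)) ^ n"
 let ?D = "\<lambda>t. cx (g t)"
 let ?f = "\<lambda>n t. ?D t * (iexp (t * x) * ?C n t)"
 let ?B = "\<lambda>n. norm (?A n * r ^ n :: real)"
 have sumr: "summable (\<lambda>n. ?B n)" using negative_binomial_sums[of r k] r by simp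
 have bnd: "norm (?C n t) <= ?B n" for n t unfolding norm_mult[of "of_nat _"] norm_power[of "_ * char F _"] using rc[of "-t"] r by (simp add: mult_left_mono power_mono)
 have f_int: "integrable lborel (?f n)" for n by (rule g_integrable_times[where B="?B n"])
    (use bnd in \<open>simp_all add: norm_mult[of "exp _"]\<close>)
 have "(\<lambda>n. CLBINT t. ?f n t) sums (CLBINT t. (\<Sum>n. ?f n t))"
 proof (rule sums_integral[OF f_int])
  have sm: "summable (\<lambda>n. norm (?f n t))" for t
  proof -
   have "summable (\<lambda>n. abs (g t) * norm (?C n t))" using rc[of "-t"] r by (intro summable_mult negative_binomial_sums[THEN conjunct1]) auto
   then show ?thesis by (simp add: norm_mult)
  qed
  show "AE t in lborel. summable (\<lambda>n. norm (?f n t))" using sm by simp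
  have "norm (?f n t) <= abs (g t) * ?B n" for n t using bnd[of n t] unfolding norm_mult[of "?D t"] norm_mult[of "exp _"] by (simp add: mult_left_mono)
  then have "(LBINT t. norm (?f n t)) <= (LBINT t. abs (g t) * ?B n)" for n using f_int g_integrable by (intro integral_mono) auto
  then show "summable (\<lambda>n. LBINT t. norm (?f n t))" by (intro summable_comparison_test'[OF summable_mult[OF sumr, of "LBINT t. abs (g t)"]])
     (simp add: integral_nonneg_AE)
 qed
 also have "(\<lambda>n. CLBINT t. ?f n t) = (\<lambda>n. cx (weight k n * r ^ n * hn n x))"
 proof
  fix n
  have "?f n t = (?A n * cx r ^ n) * (?D t * (iexp (t * x) * char F (- t) ^ n))" for t by (simp add: power_mult_distrib)
  then have "(CLBINT t. ?f n t) = (?A n * cx r ^ n) * cx (hn n x)" unfolding hn_fourier by (simp only: integral_mult_right_zero)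
  then show "(CLBINT t. ?f n t) = cx (weight k n * r ^ n * hn n x)" by (simp only: weight_def of_real_mult of_real_power of_real_of_nat_eq)
 qed
 also have "(CLBINT t. (\<Sum>n. ?f n t)) = (CLBINT t. ?D t * (iexp (t * x) * (1 / (1 - cx r * char F (- t)) ^ Suc k)))"
 proof (intro Lint_cong refl)
  fix t
  have "(\<lambda>n. ?f n t) sums (?D t * (iexp (t * x) * (1 / (1 - cx r * char F (- t)) ^ Suc k)))"
   using rc[of "-t"] r by (intro sums_mult negative_binomial_sums[THEN conjunct2]) auto
  then show "(\<Sum>n. ?f n t) = ?D t * (iexp (t * x) * (1 / (1 - cx r * char F (- t)) ^ Suc k))" by (rule sums_unique[symmetric])
 qed
 finally have "(\<lambda>n. cx (weight k n * r ^ n * hn n x)) sums (CLBINT t. ?D t * (iexp (t * x) * (1 / (1 - cx r * char F (- t)) ^ Suc k)))" .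
 moreover have "(\<lambda>n. cx (weight k n * r ^ n * hn n x)) sums cx (abel k r x)" unfolding abel_def using abel_summable[OF r] by (intro sums_of_real summable_sums)
 ultimately show ?thesis by (rule sums_unique2[symmetric])
qed

lemma u_series:
 assumes k: "real (Suc k) * \<alpha> < 2"
 shows "summable (\<lambda>n. weight k n * hn n x)" "u k x = (\<Sum>n. weight k n * hn n x)"
proof -
 have nn: "0 <= weight k n * hn n x" for n using weight_pos(1)[of k n] hn_nonneg by simp
 have "ennreal (u k x) = NE (U k) (\<lambda>z. h (x - z))" by (simp add: u_nn[OF k])
 also have "... = (\<Sum>n. ennreal (weight k n) * NE (Fn n) (\<lambda>z. h (x - z)))" by (rule nn_integral_U) measurable
 also have "... = (\<Sum>n. ennreal (weight k n * hn n x))" using weight_pos(1)[of k] hn_integrable h_nonneg unfolding hn_def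
  by (intro suminf_cong) (simp add: nn_integral_eq_integral ennreal_mult' less_imp_le)
 finally have eq: "(\<Sum>n. ennreal (weight k n * hn n x)) = ennreal (u k x)" ..
 show s: "summable (\<lambda>n. weight k n * hn n x)" by (rule summable_suminf_not_top[OF nn]) (simp add: eq)
 have "ennreal (\<Sum>n. weight k n * hn n x) = ennreal (u k x)" using suminf_ennreal2[OF nn s] eq by simp
 then show "u k x = (\<Sum>n. weight k n * hn n x)" using u_nonneg[of k x] suminf_nonneg[OF s nn] by simp
qed

text \<open>All terms are nonnegative and the series at r = 1 converges, so it dominates the Abel
  series and Tannery's theorem applies.\<close>

lemma abel_tendsto:
 assumes k: "real (Suc k) * \<alpha> < 2"
 shows "((\<lambda>r. abel k r x) \<longlongrightarrow> u k x) (at_left 1)"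
proof -
 have nn: "0 <= weight k n * hn n x" for n using weight_pos(1)[of k n] hn_nonneg by simp
 have "\<forall>\<^sub>F r in at_left (1::real). 0 < r \<and> r < 1" using eventually_at_left_real[of 0 1] by simp
 then have "\<forall>\<^sub>F (n, r) in at_top \<times>\<^sub>F at_left (1::real). norm (weight k n * r ^ n * hn n x) <= weight k n * hn n x"
  unfolding eventually_prod_filter
 proof (intro exI conjI allI impI)
  show "\<forall>\<^sub>F n in at_top. True" by simp
  fix n :: nat and r :: real assume r: "0 < r \<and> r < 1"
  then have "r ^ n <= 1" by (intro power_le_one) auto
  then have "r ^ n * (weight k n * hn n x) <= 1 * (weight k n * hn n x)" using nn by (intro mult_right_mono) auto
  then show "case (n, r) of (n, r) => norm (weight k n * r ^ n * hn n x) <= weight k n * hn n x" using r weight_pos(1)[of k n] hn_nonneg[of n x] by simp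
 qed
 moreover have "((\<lambda>r. weight k n * r ^ n * hn n x) \<longlongrightarrow> weight k n * 1 ^ n * hn n x) (at_left 1)" for n by (intro tendsto_intros)
 ultimately have "((\<lambda>r. \<Sum>n. weight k n * r ^ n * hn n x) \<longlongrightarrow> (\<Sum>n. weight k n * 1 ^ n * hn n x)) (at_left 1)"
  using u_series(1)[OF k, of x] by (intro tannerys_theorem[where M="\<lambda>n. weight k n * hn n x", THEN conjunct2, THEN conjunct2]) auto
 then show ?thesis by (simp add: abel_def u_series(2)[OF k])
qed

lemma u_diff_le:
 assumes k: "real (Suc k) * \<alpha> < 2"
  and B: "!!r. 0 < r ==> r < 1 ==> abs (abel k r x - abel k r y) <= B"
 shows "abs (u k x - u k y) <= B"
proof (rule tendsto_upperbound)
 show "((\<lambda>r. abs (abel k r x - abel k r y)) \<longlongrightarrow> abs (u k x - u k y)) (at_left 1)" by (intro tendsto_intros abel_tendsto k)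
 have "\<forall>\<^sub>F r in at_left (1::real). 0 < r \<and> r < 1" using eventually_at_left_real[of 0 1] by simp
 then show "\<forall>\<^sub>F r in at_left 1. abs (abel k r x - abel k r y) <= B" by eventually_elim (use B in auto)
qed simp

end

section \<open>High and low frequencies of the inversion integral\<close>

lemma nn_integral_even:
 assumes [measurable]: "f \<in> borel_measurable borel"
 shows "NI lborel (\<lambda>t. f (abs t)) = 2 * NI lborel (\<lambda>t. f t * ind {0..} (t::real))"
proof -
 have "NI lborel (\<lambda>t. f (abs t)) = NI lborel (\<lambda>t. f t * ind {0..} t + f (- t) * ind {0..} (- t))"
 proof (rule nn_integral_cong_AE)
  have "AE t in lborel. t \<noteq> (0::real)" by (rule AE_lborel_singleton)
  then show "AE t in lborel. f (abs t) = f t * ind {0..} t + f (- t) * ind {0..} (- t)" by eventually_elim (auto simp: indicator_def)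
 qed
 also have "... = NI lborel (\<lambda>t. f t * ind {0..} t) + NI lborel (\<lambda>t. f (- t) * ind {0..} (- t))" by (rule nn_integral_add) measurable
 also have "NI lborel (\<lambda>t. f (- t) * ind {0..} (- t)) = NI lborel (\<lambda>t. f t * ind {0..} t)"
  using nn_integral_real_affine[of "\<lambda>t. f t * ind {0..} t" "-1" 0] by simp
 finally show ?thesis by (simp add: mult_2)
qed

lemma powr_near_integral:
 assumes "-1 < e" "0 <= (c::real)"
 shows "NE lborel (\<lambda>t. abs t powr e * ind {..c} (abs t)) = ennreal (2 * (c powr (e + 1) / (e + 1)))"
proof -
 let ?A = "NE lborel (\<lambda>t. ind {0..c} t * t powr e)"
 let ?B = "c powr (e + 1) / (e + 1)"
 have "?A = ennreal ?B" using nn_integral_has_integral_lebesgue[OF _ has_integral_powr_from_0[OF assms]] by simp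
 moreover have "NE lborel (\<lambda>t. abs t powr e * ind {..c} (abs t)) =
   2 * NI lborel (\<lambda>t. ennreal (t powr e * ind {..c} t) * ind {0..} t)" by (rule nn_integral_even) measurable
 moreover have "NI lborel (\<lambda>t. ennreal (t powr e * ind {..c} t) * ind {0..} t) = ?A" by (intro nn_integral_cong) (auto simp: indicator_def)
 moreover have "2 * ennreal ?B = ennreal (2 * ?B)" using assms by (subst ennreal_mult) auto
 ultimately show ?thesis by simp
qed

lemma powr_far_integral:
 assumes "e < -1" "0 < (c::real)"
 shows "NE lborel (\<lambda>t. abs t powr e * ind {c<..} (abs t)) <= ennreal (2 * (c powr (e + 1) / (- e - 1)))"
proof -
 let ?A = "NE lborel (\<lambda>t. ind {c..} t * t powr e)"
 have "?A = ennreal (- (c powr (e + 1)) / (e + 1))" using nn_integral_has_integral_lebesgue[OF _ has_integral_powr_to_inf[OF assms]] by simp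
 moreover have "- (c powr (e + 1)) / (e + 1) = c powr (e + 1) / (- e - 1)" using assms by (simp add: field_simps)
 moreover have "NE lborel (\<lambda>t. abs t powr e * ind {c<..} (abs t)) =
   2 * NI lborel (\<lambda>t. ennreal (t powr e * ind {c<..} t) * ind {0..} t)" by (rule nn_integral_even) measurable
 moreover have "NI lborel (\<lambda>t. ennreal (t powr e * ind {c<..} t) * ind {0..} t) <= ?A" by (intro nn_integral_mono) (auto simp: indicator_def)
 moreover have "2 * ennreal (c powr (e + 1) / (- e - 1)) = ennreal (2 * (c powr (e + 1) / (- e - 1)))"
  using assms by (subst ennreal_mult) (auto intro!: divide_nonneg_nonneg)
 ultimately show ?thesis by (simp only:) (rule order_trans[OF mult_left_mono], auto)
qed

lemma combine_aux: "(h * (p * b / y)) * (c / 2 * (P * Q)) + h * (n * P * (Q * (2 * p / y))) = (h * p * b * (c / 2) + h * n * 2 * p) / y * (P * Q :: real)"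
 by (simp add: add_divide_distrib distrib_left mult_ac)

lemma ennreal_aux: "0 <= k ==> 0 <= l ==> 0 <= V ==> 0 <= s ==>
 (ennreal k * ennreal V + ennreal k * ennreal V) + (ennreal l * ennreal s + ennreal l * ennreal s) = ennreal (2 * (k * V + l * s))"
 by (simp add: ennreal_mult[symmetric] ennreal_plus[symmetric] del: ennreal_plus)

lemma norm_power_diff_le:
 fixes z w :: complex
 assumes "norm z <= M" "norm w <= M"
 shows "norm (z ^ Suc n - w ^ Suc n) <= real (Suc n) * M ^ n * norm (z - w)"
proof (induction n)
 case (Suc n)
 have M: "0 <= M" using assms(1) norm_ge_zero order_trans by blast
 have "z ^ Suc (Suc n) - w ^ Suc (Suc n) = z * (z ^ Suc n - w ^ Suc n) + (z - w) * w ^ Suc n" by (simp add: algebra_simps)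
 then have "norm (z ^ Suc (Suc n) - w ^ Suc (Suc n)) <= norm z * norm (z ^ Suc n - w ^ Suc n) + norm (z - w) * norm w ^ Suc n"
  by (metis norm_mult norm_power norm_triangle_ineq)
 also have "... <= M * (real (Suc n) * M ^ n * norm (z - w)) + norm (z - w) * M ^ Suc n" using assms Suc M by (intro add_mono mult_mono power_mono) auto
 also have "... = real (Suc (Suc n)) * M ^ Suc n * norm (z - w)" by (simp add: algebra_simps)
 finally show ?case .
qed simp

context renewal_kernel
begin

text \<open>Shift argument: for s = pi / x the oscillating factor changes sign, so twice the
  integral is that of Q t - Q (t + s). By \<open>char_diff\<close> such a difference is bounded by k
  + 2 factors of size at most a multiple of a x * (x * abs t) powr (- p), divided by a x. With p
  below \<alpha> but (k + 2) p > 1 the integral over abs t > c converges and leaves a negative power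
  of c x.\<close>

lemma far_bound:
 assumes k: "1 < real (k + 2) * \<alpha>"
 shows "\<exists>C>0. \<exists>\<gamma>>0. \<forall>r x c. 0 < r --> r < 1 --> 1 <= x --> 1 <= c * x -->
  norm (CLBINT t. (cx (g t) * (1 / (1 - cx r * char F (- t)) ^ Suc k)) *
    of_real (ind {c<..} (abs t)) * iexp (t * x))
  <= C * (a x ^ Suc k / x) * (c * x) powr (- \<gamma>)"
proof -
 \<comment> \<open>Since s <= pi < 4, either both t and t + s are within \<open>T1\<close> or
   \<open>g\<close> vanishes at both.\<close>
 define T1 where "T1 = T + 4"
 have T1: "4 < T1" using T_pos by (simp add: T1_def)
 let ?A = "\<lambda>t. a (1 / abs t)"
 obtain c0 where c0: "0 < c0" "!!t. t \<noteq> 0 ==> abs t <= T1 ==> c0 / ?A t <= norm (1 - char F t)" by (rule char_lower[of T1]) (rule that)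
 define K where "K = real (k + 2)"
 have K: "0 < K" "1 < K * \<alpha>" using k by (auto simp: K_def)
 define p where "p = (\<alpha> + 1 / K) / 2"
 have "1 / K < \<alpha>" using K by (simp add: field_simps)
 then have p: "0 < p" "p < \<alpha>" using K by (auto simp: p_def add_pos_pos alpha)
 have pK: "1 < K * p" using K by (simp add: p_def field_simps)
 define \<beta> where "\<beta> = K * p"
 have pq: "0 <= p" "p < \<alpha>" "\<alpha> < \<alpha> + 1" "0 < 1 / T1" using p T1 by auto
 obtain D where D: "1 <= D" "!!x y. 1 / T1 <= y ==> y <= x ==> (x / y) powr p * a y <= D * a x" by (rule a_potter[OF pq]) (rule that)
 define W where "W = 2 / c0 * D"
 have W: "0 < W" using c0 D by (simp add: W_def)
 let ?C = "H * pi * a 1 * (c0 / 2) + H * real (Suc k) * 2 * pi"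
 define K1 where "K1 = ?C * W ^ (k + 2)"
 define K2 where "K2 = H * W ^ Suc k"
 have a1: "1 <= a 1" by (rule a_ge_1) simp
 have K12: "0 <= K1" "0 <= K2" using H_nonneg W c0 a1 by (auto simp: K1_def K2_def)
 let ?G = "p * real (Suc k)"
 define \<gamma> where "\<gamma> = min (\<beta> - 1) ?G"
 have \<gamma>: "0 < \<gamma>" using p pK by (auto simp: \<gamma>_def \<beta>_def)
 define C where "C = K1 * 2 / (\<beta> - 1) + K2 * 2 * pi + 1"
 have C: "0 < C" unfolding C_def using K12 pK by (intro add_nonneg_pos) (auto simp: \<beta>_def)
 have main: "norm (CLBINT t. (cx (g t) * (1 / (1 - cx r * char F (- t)) ^ Suc k)) *
    of_real (ind {c<..} (abs t)) * iexp (t * x))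
  <= C * (a x ^ Suc k / x) * (c * x) powr (- \<gamma>)"
  if r: "0 < r" "r < 1" and x: "1 <= x" and c: "1 <= c * x" for r x c
 proof -
  define s where "s = pi / x"
  have c_pos: "0 < c" using c x by (smt (verit) mult_nonpos_nonneg)
  have s: "0 < s" "s <= 4" using x pi_less_4 by (auto simp: s_def divide_le_eq)
  have ax: "1 <= a x" using x by (intro a_ge_1) auto
  define z where "z = (\<lambda>t. 1 / (1 - cx r * char F (- t)))"
  have z_meas [measurable]: "z \<in> borel_measurable borel" unfolding z_def by simp
  have z_le: "norm (z t) <= 1 / (1 - r)" for t
  proof -
   have "norm (cx r * char F (- t)) <= r" unfolding norm_mult using r cmod_char_le_1[of "-t"] by auto
   then have "1 - r <= norm (1 - cx r * char F (- t))" using norm_triangle_ineq2[of 1 "cx r * char F (- t)"] by simp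
   then show ?thesis unfolding z_def norm_divide using r by (intro frac_le) auto
  qed
  define ze where "ze = (\<lambda>t. 2 / c0 * ?A t)"
  have z_ze: "norm (z t) <= ze t" if t: "t \<noteq> 0" "abs t <= T1" for t
  proof -
   have apos: "0 < ?A t" using t by (intro a_pos) auto
   have "c0 / ?A t <= 2 * norm (1 - cx r * char F (- t))" using c0(2)[of "-t"] one_minus_char_ge[of r "-t"] r t by simp
   then have "c0 / ?A t / 2 <= norm (1 - cx r * char F (- t))" by simp
   moreover have "0 < c0 / ?A t / 2" using c0 apos by simp
   ultimately have "norm (z t) <= 1 / (c0 / ?A t / 2)" unfolding z_def norm_divide norm_one by (intro divide_left_mono mult_pos_pos) linarith+
   then show ?thesis by (simp add: ze_def mult.commute)
  qed
  have ze_ge: "2 / c0 <= ze t" if "t \<noteq> 0" for t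
  proof -
   have "2 / c0 * 1 <= ze t" unfolding ze_def using c0 that by (intro mult_left_mono a_ge_1) auto
   then show ?thesis by simp
  qed
  let ?B = "\<lambda>t. x * abs t"
  have ze_le: "ze t <= W * a x * (?B t) powr (- p)" if t: "c < abs t" "abs t <= T1" for t
  proof -
   have t0: "0 < abs t" using t c_pos by simp
   have "c * x <= abs t * x" using t x by simp
   then have "1 <= x * abs t" using c by (simp add: mult.commute)
   then have "1 / T1 <= 1 / abs t" "1 / abs t <= x" using t t0 T1 by (auto simp: field_simps)
   from D(2)[OF this] have "(?B t) powr p * ?A t <= D * a x" by simp
   then have "?A t <= D * a x * (?B t) powr (- p)" using t0 x by (simp add: powr_minus field_simps)
   then have "2 / c0 * ?A t <= 2 / c0 * (D * a x * (?B t) powr (- p))" using c0 by (intro mult_left_mono) auto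
   then show ?thesis by (simp add: ze_def W_def)
  qed
  define Q where "Q = (\<lambda>t. (cx (g t) * z t ^ Suc k) * of_real (ind {c<..} (abs t)))"
  define P where "P = (\<lambda>t. abs t powr (- \<beta>) * ind {c<..} (abs t))"
  \<comment> \<open>The strip of width s just beyond the cut-off, where the cut-off may remove one
    of the two shifted values; there the supremum \<open>k2\<close> replaces the difference
    estimate.\<close>
  define E where "E = (\<lambda>t. ind {c<..c + s} (abs t) :: real)"
  have PE_nn: "0 <= P t" "0 <= E t" for t by (auto simp: P_def E_def)
  define k1 where "k1 = K1 * a x ^ Suc k * x powr (- \<beta>)"
  define k2 where "k2 = K2 * a x ^ Suc k * (c * x) powr (- ?G)"
  have k12: "0 <= k1" "0 <= k2" using K12 ax by (auto simp: k1_def k2_def)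
  have ze_pow: "ze t ^ (k + 2) <= W ^ (k + 2) * a x ^ (k + 2) * x powr (- \<beta>) * P t" if t: "c < abs t" "abs t <= T1" for t
  proof -
   have t0: "0 < abs t" using t c_pos by simp
   have "0 <= ze t" using ze_ge[of t] c0 t0 by (smt (verit) divide_pos_pos abs_0)
   then have "ze t ^ (k + 2) <= (W * a x * (?B t) powr (- p)) ^ (k + 2)" using ze_le[OF t] by (intro power_mono) auto
   also have "((?B t) powr (- p)) ^ (k + 2) = x powr (- \<beta>) * abs t powr (- \<beta>)"
    using x t0 by (simp add: powr_realpow[symmetric] powr_powr powr_mult \<beta>_def K_def mult_ac del: add_2_eq_Suc')
   then have "(W * a x * (?B t) powr (- p)) ^ (k + 2) = W ^ (k + 2) * a x ^ (k + 2) * x powr (- \<beta>) * P t"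
    using t by (simp only: power_mult_distrib P_def) (simp add: mult_ac)
   finally show ?thesis .
  qed
  have E_bound: "norm (Q t) <= k2" if t: "c < abs t" for t
  proof (cases "abs t <= T")
   case True
   have t0: "0 < abs t" using t c_pos by simp
   have t1: "abs t <= T1" using True by (simp add: T1_def)
   have "norm (Q t) = abs (g t) * norm (z t) ^ Suc k" using t by (simp add: Q_def norm_mult norm_power)
   also have "... <= H * (W * a x * (?B t) powr (- p)) ^ Suc k" using g_bound z_ze[of t] ze_le[of t] t t1 t0 H_nonneg by (intro mult_mono power_mono) (auto)
   also have "... <= H * (W * a x * (c * x) powr (- p)) ^ Suc k"
   proof (intro mult_left_mono power_mono)
    have "c * x <= x * abs t" using t x by simp
    then show "(?B t) powr (- p) <= (c * x) powr (- p)" using p c by (intro powr_mono2') auto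
   qed (use H_nonneg W ax in auto)
   also have "((c * x) powr (- p)) ^ Suc k = (c * x) powr (- ?G)" using c_pos x by (subst powr_power) (auto simp: mult_ac)
   then have "H * (W * a x * (c * x) powr (- p)) ^ Suc k = k2" by (simp only: power_mult_distrib k2_def K2_def mult_ac)
   finally show ?thesis .
  next
   case False
   then show ?thesis using g_zero[of t] k12 by (simp add: Q_def)
  qed
  let ?K = "\<lambda>t. Q t - Q (t + s)"
  have pt: "norm (?K t) <= k1 * (P t + P (t + s)) + k2 * (E t + E (t + s))" for t
  proof -
   define t' where "t' = t + s"
   have tt: "abs t <= abs t' + s" "abs t' <= abs t + s" using s by (auto simp: t'_def)
   have nn: "0 <= k1 * (P t + P t')" "0 <= k2 * (E t + E t')" using k12 PE_nn by auto
   consider "abs t <= c" "abs t' <= c" | "c < abs t" "abs t' <= c" | "abs t <= c" "c < abs t'" | "c < abs t" "c < abs t'" by linarith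
   then have "norm (Q t - Q t') <= k1 * (P t + P t') + k2 * (E t + E t')"
   proof cases
    case 1
    then have "Q t = 0" "Q t' = 0" by (auto simp: Q_def)
    then show ?thesis using nn by simp
   next
    case 2
    then have "Q t' = 0" "E t = 1" using tt by (auto simp: Q_def E_def)
    moreover have "k2 * 1 <= k2 * (1 + E t')" using PE_nn k12 by (intro mult_left_mono) auto
    ultimately show ?thesis using E_bound[OF 2(1)] nn by simp
   next
    case 3
    then have "Q t = 0" "E t' = 1" using tt by (auto simp: Q_def E_def)
    moreover have "k2 * 1 <= k2 * (E t + 1)" using PE_nn k12 by (intro mult_left_mono) auto
    ultimately show ?thesis using E_bound[OF 3(2)] nn by simp
   next
    case 4
    show ?thesis
    proof (cases "abs t <= T1 \<and> abs t' <= T1")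
     case False
     then have "T < abs t" "T < abs t'" using tt s by (auto simp: T1_def)
     then have "Q t = 0" "Q t' = 0" using g_zero by (auto simp: Q_def)
     then show ?thesis using nn by simp
    next
     case True
     have t0: "t \<noteq> 0" "t' \<noteq> 0" using 4 c_pos by auto
     define M where "M = max (ze t) (ze t')"
     have zM: "norm (z t) <= M" "norm (z t') <= M" using z_ze[of t] z_ze[of t'] t0 True by (auto simp: M_def)
     have c0': "0 < 2 / c0" using c0 by simp
     have ze0: "0 <= ze t" "0 <= ze t'" using ze_ge[OF t0(1)] ze_ge[OF t0(2)] c0' by linarith+
     have M: "2 / c0 <= M" "0 <= M" using ze_ge[OF t0(1)] ze0 by (auto simp: M_def)
     have M_pow: "M ^ (k + 2) <= W ^ (k + 2) * a x ^ (k + 2) * x powr (- \<beta>) * (P t + P t')"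
     proof -
      have "M ^ (k + 2) <= ze t ^ (k + 2) + ze t' ^ (k + 2)" using zero_le_power[OF ze0(1), of "k + 2"] zero_le_power[OF ze0(2), of "k + 2"] unfolding M_def max_def
  by simp
      also have "... <= W ^ (k + 2) * a x ^ (k + 2) * x powr (- \<beta>) * P t + W ^ (k + 2) * a x ^ (k + 2) * x powr (- \<beta>) * P t'"
       using 4 True by (intro add_mono ze_pow) auto
      finally show ?thesis by (simp add: distrib_left)
     qed
     \<comment> \<open>Raises the exponent to k + 2, so that the error from \<open>g\<close> has the
       same form as that from the characteristic function; possible because M >= 2 / c0.\<close>
     have M_pow1: "M ^ Suc k <= c0 / 2 * M ^ (k + 2)"
     proof -
      have "2 / c0 * M ^ Suc k <= M * M ^ Suc k" using M by (intro mult_right_mono) auto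
      then show ?thesis using c0 by (simp add: field_simps)
     qed
     have ax_pi: "1 / a (1 / abs (- t - - t')) <= pi / a x"
     proof -
      have "abs (- t - - t') = pi / x" using s x by (simp add: t'_def s_def)
      moreover have "a (pi * (x / pi)) <= pi * a (x / pi)" using x pi_ge_two by (intro a_scale) auto
      moreover have "0 < a (x / pi)" using x by (intro a_pos) auto
      ultimately show ?thesis using ax by (simp add: field_simps)
     qed
     have zdiff: "norm (z t - z t') <= M ^ 2 * (2 * pi / a x)"
     proof -
      have nz: "1 - cx r * char F (- t) \<noteq> 0" for t
      proof -
       have "norm (cx r * char F (- t)) <= r" unfolding norm_mult using r cmod_char_le_1[of "-t"] by auto
       then show ?thesis using r by auto
      qed
      have "z t - z t' = z t * z t' * (cx r * (char F (- t) - char F (- t')))" using nz[of t] nz[of t'] by (simp add: z_def field_simps)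
      then have "norm (z t - z t') = norm (z t) * norm (z t') * (r * norm (char F (- t) - char F (- t')))" using r by (simp add: norm_mult)
      also have "... <= M * M * (1 * (2 * (1 / a (1 / abs (- t - - t')))))" using zM M r char_diff[of "-t" "-t'"] s by (intro mult_mono) (auto simp: t'_def)
      also have "... <= M * M * (1 * (2 * (pi / a x)))" by (intro mult_left_mono ax_pi) auto
      finally show ?thesis by (simp add: power2_eq_square)
     qed
     \<comment> \<open>The Lipschitz error of \<open>g\<close> has order 1 / x. As a x <= x * a 1,
       it is no larger than a multiple of 1 / a x.\<close>
     have sx: "s <= pi * a 1 / a x"
     proof -
      have "a (x * 1) <= x * a 1" using x by (intro a_scale) auto
      then show ?thesis using x ax by (simp add: s_def field_simps)
     qed
     let ?E = "z t ^ Suc k - z t' ^ Suc k"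
     have "Q t - Q t' = (cx (g t - g t')) * z t ^ Suc k + cx (g t') * ?E" using 4 by (simp add: Q_def algebra_simps del: power_Suc)
     then have "norm (Q t - Q t') <= abs (g t - g t') * norm (z t) ^ Suc k + abs (g t') * norm ?E" by (metis norm_mult norm_of_real norm_power norm_triangle_ineq)
     also have "... <= (H * s) * M ^ Suc k + H * (real (Suc k) * M ^ k * (M ^ 2 * (2 * pi / a x)))"
     proof (intro add_mono mult_mono)
      show "abs (g t - g t') <= H * s" using g_lipschitz[of t t'] s by (simp add: t'_def)
      have "norm ?E <= real (Suc k) * M ^ k * norm (z t - z t')" by (rule norm_power_diff_le[OF zM])
      also have "... <= real (Suc k) * M ^ k * (M ^ 2 * (2 * pi / a x))" using M by (intro mult_left_mono zdiff) auto
      finally show "norm ?E <= real (Suc k) * M ^ k * (M ^ 2 * (2 * pi / a x))" .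
     qed (use H_nonneg s zM M g_bound in \<open>auto intro!: power_mono simp del: power_Suc\<close>)
     also have "... <= (H * (pi * a 1 / a x)) * (c0 / 2 * M ^ (k + 2)) + H * (real (Suc k) * M ^ k * (M ^ 2 * (2 * pi / a x)))"
      using M H_nonneg a1 ax by (intro add_right_mono mult_mono M_pow1 mult_left_mono sx) (auto intro!: divide_nonneg_nonneg)
     also have "... = ?C / a x * M ^ (k + 2)" unfolding power_add by (rule combine_aux)
     also have "... <= ?C / a x * (W ^ (k + 2) * a x ^ (k + 2) * x powr (- \<beta>) * (P t + P t'))"
      using H_nonneg a1 c0 ax by (intro mult_left_mono M_pow mult_nonneg_nonneg) auto
     also have "... = k1 * (P t + P t')" by (simp add: k1_def K1_def)
     finally show ?thesis using nn by simp
    qed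
   qed
   then show ?thesis by (simp add: t'_def)
  qed
  have Q_meas [measurable]: "Q \<in> borel_measurable borel" unfolding Q_def by simp
  have Q_int: "integrable lborel (\<lambda>t. Q t * f t)" if [measurable]: "f \<in> borel_measurable borel" and f: "!!t. norm (f t) <= 1" for f
  proof -
   let ?J = "\<lambda>t. z t ^ Suc k * of_real (ind {c<..} (abs t)) * f t"
   have "integrable lborel (\<lambda>t. cx (g t) * ?J t)"
   proof (rule g_integrable_times[where B="(1 / (1 - r)) ^ Suc k * 1 * 1"])
    fix t
    show "norm (?J t) <= (1 / (1 - r)) ^ Suc k * 1 * 1" unfolding norm_mult norm_power using z_le[of t] f[of t] r by (intro mult_mono power_mono) (auto)
   qed measurable
   then show ?thesis by (simp add: Q_def mult.assoc)
  qed
  let ?I = "CLBINT t. Q t * iexp (t * x)"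
  have "?I = (CLBINT t. Q (t + s) * iexp ((t + s) * x))" using lborel_integral_real_affine[of 1 "\<lambda>t. Q t * iexp (t * x)" s] by (simp add: add.commute)
  also have "... = (CLBINT t. - (Q (t + s) * iexp (t * x)))"
  proof (intro Lint_cong refl)
   fix t
   have "\<i> * cx ((t + s) * x) = \<i> * cx (t * x) + \<i> * cx pi" using x by (simp add: s_def field_simps)
   then have "iexp ((t + s) * x) = - iexp (t * x)" by (simp only: exp_add exp_pi_i' mult_minus_right mult_1_right)
   then show "Q (t + s) * iexp ((t + s) * x) = - (Q (t + s) * iexp (t * x))" by simp
  qed
  finally have shift: "?I = (CLBINT t. - (Q (t + s) * iexp (t * x)))" .
  have int1: "integrable lborel (\<lambda>t. Q t * iexp (t * x))" by (rule Q_int) auto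
  have "integrable lborel (\<lambda>t. Q t * iexp ((t - s) * x))" by (rule Q_int) auto
  from lborel_integrable_real_affine[OF this, of 1 s]
  have int2: "integrable lborel (\<lambda>t. Q (t + s) * iexp (t * x))" by (simp add: add.commute)
  have "2 * ?I = (CLBINT t. Q t * iexp (t * x)) + (CLBINT t. - (Q (t + s) * iexp (t * x)))" using shift by simp
  also have "... = (CLBINT t. ?K t * iexp (t * x))" using int1 int2 by (simp add: left_diff_distrib)
  finally have two: "2 * ?I = (CLBINT t. ?K t * iexp (t * x))" .
  have int3: "integrable lborel (\<lambda>t. ?K t * iexp (t * x))" unfolding left_diff_distrib using int1 int2 by simp
  have "ennreal (norm (2 * ?I)) <= NE lborel (\<lambda>t. norm (?K t * iexp (t * x)))" unfolding two by (rule integral_norm_bound_ennreal[OF int3])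
  also have "... <= NI lborel (\<lambda>t. (ennreal k1 * ennreal (P t) + ennreal k1 * ennreal (P (t + s))) + (ennreal k2 * ennreal (E t) + ennreal k2 * ennreal (E (t + s))))"
   using pt k12 PE_nn by (intro nn_integral_mono) (simp add: norm_mult ennreal_mult[symmetric] ennreal_plus[symmetric] distrib_left del: ennreal_plus)
  also have "... = (ennreal k1 * NE lborel P + ennreal k1 * NE lborel (\<lambda>t. P (t + s))) +
    (ennreal k2 * NE lborel E + ennreal k2 * NE lborel (\<lambda>t. E (t + s)))"
  proof -
   have [measurable]: "P \<in> borel_measurable borel" "E \<in> borel_measurable borel" unfolding P_def E_def by auto
   show ?thesis by (simp add: nn_integral_add nn_integral_cmult)
  qed
  also have "... <= (ennreal k1 * ennreal (2 * (c powr (- \<beta> + 1) / (\<beta> - 1))) + ennreal k1 * ennreal (2 * (c powr (- \<beta> + 1) / (\<beta> - 1)))) +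
    (ennreal k2 * ennreal (2 * s) + ennreal k2 * ennreal (2 * s))"
  proof -
   have P1: "NE lborel P <= ennreal (2 * (c powr (- \<beta> + 1) / (\<beta> - 1)))" using powr_far_integral[of "- \<beta>" c] pK c_pos by (simp add: P_def \<beta>_def)
   have [measurable]: "P \<in> borel_measurable borel" "E \<in> borel_measurable borel" unfolding P_def E_def by auto
   have P2: "NE lborel (\<lambda>t. P (t + s)) = NE lborel P" using nn_integral_real_affine[of "\<lambda>t. ennreal (P t)" 1 s] by (simp add: add.commute)
   have E2: "NE lborel (\<lambda>t. E (t + s)) = NE lborel E" using nn_integral_real_affine[of "\<lambda>t. ennreal (E t)" 1 s] by (simp add: add.commute)
   let ?D = "NI lborel (\<lambda>t. ennreal (ind {c<..c + s} t) * ind {0..} t)"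
   have "NE lborel E = 2 * ?D" unfolding E_def by (rule nn_integral_even) measurable
   also have "?D = NI lborel (\<lambda>t. ind {c<..c + s} t)" using c_pos by (intro nn_integral_cong) (auto simp: indicator_def)
   also have "... = ennreal s" using s by simp
   also have "2 * ennreal s = ennreal (2 * s)" using s by (subst ennreal_mult) auto
   finally have E1: "NE lborel E = ennreal (2 * s)" .
   show ?thesis unfolding P2 E2 E1 using P1 by (intro add_mono mult_left_mono) auto
  qed
  also have "... = ennreal (2 * (k1 * (2 * (c powr (- \<beta> + 1) / (\<beta> - 1))) + k2 * (2 * s)))"
  proof -
   have "0 <= 2 * (c powr (- \<beta> + 1) / (\<beta> - 1))" using pK by (simp add: \<beta>_def)
   then show ?thesis using k12 s by (intro ennreal_aux) auto
  qed
  finally have le1: "norm (2 * ?I) <= 2 * (k1 * (2 * (c powr (- \<beta> + 1) / (\<beta> - 1))) + k2 * (2 * s))"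
   by (subst (asm) ennreal_le_iff) (use k12 s pK in \<open>auto simp: \<beta>_def\<close>)
  have e1: "k1 * (2 * (c powr (- \<beta> + 1) / (\<beta> - 1))) = K1 * 2 / (\<beta> - 1) * (a x ^ Suc k / x) * (c * x) powr (- (\<beta> - 1))"
  proof -
   have "x powr (- \<beta>) = x powr (- \<beta> + 1) / x" using x powr_add[of x "- \<beta>" 1] by simp
   moreover have "(c * x) powr (- \<beta> + 1) = c powr (- \<beta> + 1) * x powr (- \<beta> + 1)" by (intro powr_mult)
   ultimately show ?thesis by (simp add: k1_def mult_ac)
  qed
  have e2: "k2 * (2 * s) = K2 * 2 * pi * (a x ^ Suc k / x) * (c * x) powr (- ?G)" by (simp add: k2_def s_def)
  have m: "(c * x) powr (- (\<beta> - 1)) <= (c * x) powr (- \<gamma>)" "(c * x) powr (- ?G) <= (c * x) powr (- \<gamma>)"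
   using c by (auto intro!: powr_mono simp: \<gamma>_def)
  have "norm ?I <= k1 * (2 * (c powr (- \<beta> + 1) / (\<beta> - 1))) + k2 * (2 * s)" using le1 by simp
  also have "... <= K1 * 2 / (\<beta> - 1) * (a x ^ Suc k / x) * (c * x) powr (- \<gamma>) + K2 * 2 * pi * (a x ^ Suc k / x) * (c * x) powr (- \<gamma>)"
   unfolding e1 e2 using K12 ax x pK by (intro add_mono mult_left_mono m divide_nonneg_nonneg) (auto simp: \<beta>_def)
  also have "... <= C * (a x ^ Suc k / x) * (c * x) powr (- \<gamma>)"
  proof -
   define V where "V = (a x ^ Suc k / x) * (c * x) powr (- \<gamma>)"
   have "0 <= V" using ax x by (auto simp: V_def)
   then have "K1 * 2 / (\<beta> - 1) * V + K2 * 2 * pi * V <= C * V" by (simp add: C_def distrib_right)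
   then show ?thesis by (simp only: V_def)
  qed
  finally show ?thesis by (simp add: Q_def z_def power_one_over)
 qed
 show ?thesis using main C \<gamma> by blast
qed

end

lemma split_aux:
 "q * e1 - q * e2 = (q * of_real (ind {..c} s) * (e1 - e2) +
  (q * of_real (ind {c<..} (s::real)) * e1 - q * of_real (ind {c<..} s) * e2) :: complex)" by (auto simp: indicator_def algebra_simps)

context renewal_kernel
begin

text \<open>The two exponentials differ by at most 2 * (y - x) * abs t, one power of t to set
  against the singularity abs t powr (- \<beta>) with \<beta> = (k + 1) q. Because (k + 1) \<alpha>
  < 2, some q > \<alpha> still gives \<beta> < 2, and abs t powr (1 - \<beta>) is integrable at
  0.\<close>

lemma near_bound:
 assumes k: "real (Suc k) * \<alpha> < 2"
 shows "\<exists>C>0. \<forall>r R x y. 0 < r --> r < 1 --> 1 <= R --> R <= x --> x <= y -->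
  norm (CLBINT t. (cx (g t) * (1 / (1 - cx r * char F (- t)) ^ Suc k)) *
    of_real (ind {..R / x} (abs t)) * (iexp (t * x) - iexp (t * y)))
  <= C * R^2 * ((y - x) / x) * (a x ^ Suc k / x)"
proof -
 let ?B = "\<lambda>t. a (1 / abs t)"
 obtain c0 where c0: "0 < c0" "!!t. t \<noteq> 0 ==> abs t <= 1 ==> c0 / ?B t <= norm (1 - char F t)" by (rule char_lower[of 1]) (rule that)
 define K where "K = real (Suc k)"
 have K: "0 < K" "K * \<alpha> < 2" using k by (auto simp: K_def)
 define q where "q = (\<alpha> + 2 / K) / 2"
 have "\<alpha> < 2 / K" using K by (simp add: field_simps)
 then have q: "\<alpha> < q" "0 < q" using alpha by (auto simp: q_def)
 define \<beta> where "\<beta> = K * q"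
 have \<beta>: "0 < \<beta>" "\<beta> < 2"
 proof -
  have "\<beta> = (K * \<alpha> + 2) / 2" using K by (simp add: \<beta>_def q_def field_simps)
  then show "\<beta> < 2" using K by simp
  show "0 < \<beta>" using K q by (simp add: \<beta>_def)
 qed
 have pq: "0 <= (0::real)" "0 < \<alpha>" "\<alpha> < q" "(0::real) < 1" using q alpha by auto
 obtain D where D: "1 <= D" "!!x y. 1 <= y ==> y <= x ==> a x <= D * (x / y) powr q * a y" by (rule a_potter[OF pq]) (rule that)
 define W where "W = 2 / c0 * D"
 have W: "0 < W" using c0 D by (simp add: W_def)
 define C where "C = H * W ^ Suc k * 4 / (2 - \<beta>) + 1"
 have C: "0 < C" unfolding C_def using H_nonneg W \<beta> by (intro add_nonneg_pos) auto
 have main: "norm (CLBINT t. (cx (g t) * (1 / (1 - cx r * char F (- t)) ^ Suc k)) *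
    of_real (ind {..R / x} (abs t)) * (iexp (t * x) - iexp (t * y)))
  <= C * R^2 * ((y - x) / x) * (a x ^ Suc k / x)"
  if r: "0 < r" "r < 1" and R: "1 <= R" "R <= x" and y: "x <= y" for r R x y
 proof -
  have x: "1 <= x" using R by simp
  have ax: "1 <= a x" using x by (intro a_ge_1) auto
  define z where "z = (\<lambda>t. 1 / (1 - cx r * char F (- t)))"
  have z_meas [measurable]: "z \<in> borel_measurable borel" unfolding z_def by simp
  have z_le: "norm (z t) <= 1 / (1 - r)" for t
  proof -
   have "norm (cx r * char F (- t)) <= r" unfolding norm_mult norm_of_real using r cmod_char_le_1[of "-t"] by simp
   then have "1 - r <= norm (1 - cx r * char F (- t))" using norm_triangle_ineq2[of 1 "cx r * char F (- t)"] by simp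
   then show ?thesis unfolding z_def norm_divide using r by (intro frac_le) auto
  qed
  have z_ze: "norm (z t) <= W * a x * (R / x) powr q * abs t powr (- q)" if t: "t \<noteq> 0" "abs t <= R / x" for t
  proof -
   have t1: "abs t <= 1" using t R by (smt (verit) divide_le_eq_1)
   have apos: "0 < ?B t" using t by (intro a_pos) auto
   have "c0 / ?B t <= 2 * norm (1 - cx r * char F (- t))" using c0(2)[of "-t"] one_minus_char_ge[of r "-t"] r t t1 by simp
   then have "c0 / ?B t / 2 <= norm (1 - cx r * char F (- t))" by simp
   moreover have "0 < c0 / ?B t / 2" using c0 apos by simp
   ultimately have "norm (z t) <= 1 / (c0 / ?B t / 2)" unfolding z_def norm_divide norm_one by (intro divide_left_mono mult_pos_pos) linarith+
   then have "norm (z t) <= 2 / c0 * ?B t" by (simp add: mult.commute)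
   also have "... <= 2 / c0 * (D * (R / abs t / x) powr q * a x)"
   proof (intro mult_left_mono)
    have "?B t <= a (R / abs t)" using t R by (intro a_mono divide_right_mono) auto
    also have "... <= D * (R / abs t / x) powr q * a x" using t x by (intro D) (auto simp: field_simps)
    finally show "?B t <= D * (R / abs t / x) powr q * a x" .
   qed (use c0 in auto)
   also have "(R / abs t / x) powr q = (R / x) powr q * abs t powr (- q)" using t by (simp add: powr_minus field_simps flip: powr_mult)
   finally show ?thesis by (simp add: W_def mult_ac)
  qed
  define Q where "Q = (\<lambda>t. (cx (g t) * z t ^ Suc k) * of_real (ind {..R / x} (abs t)) * (iexp (t * x) - iexp (t * y)))"
  have Q_int: "integrable lborel Q"
  proof -
   let ?C = "\<lambda>t. z t ^ Suc k * of_real (ind {..R / x} (abs t)) * (iexp (t * x) - iexp (t * y))"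
   have "integrable lborel (\<lambda>t. cx (g t) * ?C t)"
   proof (rule g_integrable_times[where B="(1 / (1 - r)) ^ Suc k * 1 * 2"])
    fix t
    have "norm (iexp (t * x) - iexp (t * y)) <= 2" using norm_iexp_diff[of x t y] by (simp add: mult.commute)
    then show "norm (?C t) <= (1 / (1 - r)) ^ Suc k * 1 * 2" unfolding norm_mult norm_power using z_le[of t] r by (intro mult_mono power_mono) (auto)
   qed measurable
   then show ?thesis by (simp add: Q_def mult.assoc)
  qed
  define k1 where "k1 = H * (W * a x) ^ Suc k * (R / x) powr \<beta> * 2 * (y - x)"
  have k1: "0 <= k1" using H_nonneg W ax y by (auto simp: k1_def)
  let ?A = "\<lambda>t. abs t powr (1 - \<beta>) * ind {..R / x} (abs t)"
  have pt: "norm (Q t) <= k1 * ?A t" if "t \<noteq> 0" for t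
  proof (cases "abs t <= R / x")
   case True
   have "norm (iexp (t * x) - iexp (t * y)) <= 2 * (abs (x - y) * abs t)" using norm_iexp_diff[of x t y] by (simp add: mult.commute)
   moreover have "abs (x - y) = y - x" using y by simp
   ultimately have e: "norm (iexp (t * x) - iexp (t * y)) <= 2 * (y - x) * abs t" by (simp only: mult.assoc)
   have "norm (Q t) = abs (g t) * norm (z t) ^ Suc k * norm (iexp (t * x) - iexp (t * y))" using True by (simp add: Q_def norm_mult norm_power)
   also have "... <= H * (W * a x * (R / x) powr q * abs t powr (- q)) ^ Suc k * (2 * (y - x) * abs t)"
    using g_bound z_ze[OF that True] e H_nonneg W ax by (intro mult_mono zero_le_power) (auto simp del: power_Suc)
   also have "(W * a x * (R / x) powr q * abs t powr (- q)) ^ Suc k = (W * a x) ^ Suc k * ((R / x) powr \<beta> * abs t powr (- \<beta>))"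
   proof -
    have "((R / x) powr q) ^ Suc k = (R / x) powr \<beta>" "(abs t powr (- q)) ^ Suc k = abs t powr (- \<beta>)"
     using R that by (auto simp: powr_power \<beta>_def K_def simp del: power_Suc)
    then show ?thesis by (simp only: power_mult_distrib)
   qed
   also have "H * ((W * a x) ^ Suc k * ((R / x) powr \<beta> * abs t powr (- \<beta>))) * (2 * (y - x) * abs t) = k1 * (abs t powr (- \<beta>) * abs t)"
    by (simp only: k1_def mult_ac)
   also have "abs t powr (- \<beta>) * abs t = abs t powr (1 - \<beta>)" using that powr_add[of "abs t" "- \<beta>" 1] by simp
   finally show ?thesis using True by simp
  next
   case False
   then show ?thesis by (simp add: Q_def)
  qed
  have "ennreal (norm (CLBINT t. Q t)) <= NE lborel (\<lambda>t. norm (Q t))" by (rule integral_norm_bound_ennreal[OF Q_int])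
  also have "... <= NI lborel (\<lambda>t. ennreal k1 * ennreal (?A t))"
  proof (rule nn_integral_mono_AE)
   have "AE t in lborel. t \<noteq> (0::real)" by (rule AE_lborel_singleton)
   then show "AE t in lborel. ennreal (norm (Q t)) <= ennreal k1 * ennreal (?A t)" by eventually_elim (use pt k1 in \<open>auto simp: ennreal_mult[symmetric]\<close>)
  qed
  also have "... = ennreal k1 * NE lborel (\<lambda>t. ?A t)" by (rule nn_integral_cmult) measurable
  also have "... = ennreal k1 * ennreal (2 * ((R / x) powr (1 - \<beta> + 1) / (1 - \<beta> + 1)))" using R \<beta> by (subst powr_near_integral) auto
  also have "1 - \<beta> + 1 = 2 - \<beta>" by simp
  also have "ennreal k1 * ennreal (2 * ((R / x) powr (2 - \<beta>) / (2 - \<beta>))) = ennreal (k1 * (2 * ((R / x) powr (2 - \<beta>) / (2 - \<beta>))))"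
   using k1 \<beta> by (intro ennreal_mult[symmetric]) auto
  finally have "norm (CLBINT t. Q t) <= k1 * (2 * ((R / x) powr (2 - \<beta>) / (2 - \<beta>)))" by (subst (asm) ennreal_le_iff) (use k1 \<beta> in auto)
  also have "... = (H * W ^ Suc k * 4 / (2 - \<beta>)) * ((R / x) powr \<beta> * (R / x) powr (2 - \<beta>) * (y - x) * a x ^ Suc k)"
   by (simp add: k1_def power_mult_distrib)
  also have "(R / x) powr \<beta> * (R / x) powr (2 - \<beta>) = R^2 / x^2"
  proof -
   have "(R / x) powr \<beta> * (R / x) powr (2 - \<beta>) = (R / x) powr 2" by (simp flip: powr_add)
   also have "... = (R / x)^2" using R x by simp
   finally show ?thesis by (simp add: power_divide)
  qed
  also have "(H * W ^ Suc k * 4 / (2 - \<beta>)) * (R^2 / x^2 * (y - x) * a x ^ Suc k) <= C * (R^2 / x^2 * (y - x) * a x ^ Suc k)"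
   using y ax by (intro mult_right_mono) (auto simp: C_def)
  also have "... = C * R^2 * ((y - x) / x) * (a x ^ Suc k / x)" by (simp add: power2_eq_square)
  finally show ?thesis by (simp add: Q_def z_def power_one_over)
 qed
 show ?thesis using main C by blast
qed

definition bb :: "nat => real => real" where
 "bb k x = a x ^ Suc k / x"

text \<open>Slow oscillation measured in units of the expected order \<open>bb k\<close>, not of
  \<open>u k\<close> itself, for which no lower bound is known at this stage.\<close>

definition osc :: "nat => bool" where
 "osc k \<longleftrightarrow> (\<forall>\<epsilon>>0. \<exists>\<rho>>0. \<exists>x0. \<forall>x y. x0 <= x --> x <= y --> y <= (1 + \<rho>) * x --> abs (u k x - u k y) <= \<epsilon> * bb k x)"

lemma bb_pos: "0 < x ==> 0 < bb k x" using a_pos by (simp add: bb_def)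

lemma bb_double: "0 < x ==> x <= y ==> y <= 2 * x ==> bb k y <= 2 ^ Suc k * bb k x"
proof -
 assume x: "0 < x" "x <= y" "y <= 2 * x"
 have "a y <= a (2 * x)" using x by (intro a_mono) auto
 also have "... <= 2 * a x" using x by (intro a_scale) auto
 finally have "a y ^ Suc k <= (2 * a x) ^ Suc k" using x by (intro power_mono less_imp_le[OF a_pos]) auto
 then have "bb k y <= (2 * a x) ^ Suc k / x" unfolding bb_def using x a_pos[of x] by (intro frac_le) auto
 then show ?thesis by (simp only: bb_def power_mult_distrib times_divide_eq_right)
qed

text \<open>In units of bb k x, frequencies above R / x contribute O(R powr (- \<gamma>)) to each
  value and those below contribute O(R^2 * \<rho>) to the difference. \<open>R\<close> is fixed
  before \<rho>, both independently of the Abel parameter.\<close>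

lemma osc_base:
 assumes k: "real (Suc k) * \<alpha> < 2" "1 < real (k + 2) * \<alpha>"
 shows "osc k" unfolding osc_def
proof (intro allI impI)
 fix \<epsilon> :: real assume \<epsilon>: "0 < \<epsilon>"
 let ?C = "\<lambda>r t. 1 - cx r * char F (- t)"
 let ?q = "\<lambda>r t. cx (g t) * (1 / ?C r t ^ Suc k)"
 obtain C1 \<gamma> where far: "0 < C1" "0 < \<gamma>" "!!r x c. 0 < r ==> r < 1 ==> 1 <= x ==> 1 <= c * x ==>
  norm (CLBINT t. ?q r t * of_real (ind {c<..} (abs t)) * iexp (t * x)) <= C1 * (a x ^ Suc k / x) * (c * x) powr (- \<gamma>)" using far_bound[OF k(2)] by blast
 obtain C2 where near: "0 < C2" "!!r R x y. 0 < r ==> r < 1 ==> 1 <= R ==> R <= x ==> x <= y ==>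
  norm (CLBINT t. ?q r t * of_real (ind {..R / x} (abs t)) * (iexp (t * x) - iexp (t * y))) <= C2 * R^2 * ((y - x) / x) * (a x ^ Suc k / x)"
  using near_bound[OF k(1)] by blast
 define C3 where "C3 = C1 * (1 + 2 ^ Suc k)"
 have C3: "0 < C3" using far(1) by (auto simp: C3_def intro!: mult_pos_pos add_pos_pos)
 have "((\<lambda>R. C3 * R powr (- \<gamma>)) \<longlongrightarrow> C3 * 0) at_top" using far(2) by (intro tendsto_mult tendsto_neg_powr filterlim_ident) auto
 then have "\<forall>\<^sub>F R in at_top. C3 * R powr (- \<gamma>) < \<epsilon> / 2 \<and> 1 <= R"
  using \<epsilon> by (intro eventually_conj order_tendstoD eventually_ge_at_top) auto
 then obtain R where R: "C3 * R powr (- \<gamma>) < \<epsilon> / 2" "1 <= R" by (auto dest: eventually_happens)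
 define \<rho> where "\<rho> = min 1 (\<epsilon> / (2 * C2 * R^2))"
 have \<rho>: "0 < \<rho>" "\<rho> <= 1" "C2 * R^2 * \<rho> <= \<epsilon> / 2"
 proof -
  show "0 < \<rho>" "\<rho> <= 1" using \<epsilon> near(1) R by (auto simp: \<rho>_def)
  have "C2 * R^2 * \<rho> <= C2 * R^2 * (\<epsilon> / (2 * C2 * R^2))" using near(1) by (intro mult_left_mono) (auto simp: \<rho>_def)
  then show "C2 * R^2 * \<rho> <= \<epsilon> / 2" using near(1) R by simp
 qed
 have main: "abs (u k x - u k y) <= \<epsilon> * bb k x" if x: "R <= x" "x <= y" "y <= (1 + \<rho>) * x" for x y
 proof (rule u_diff_le[OF k(1)])
  fix r :: real assume r: "0 < r" "r < 1"
  have x1: "1 <= x" "1 <= y" using x R by auto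
  define c where "c = R / x"
  have c: "1 <= c * x" "1 <= c * y" "R <= c * y" "c * x = R"
  proof -
   show e: "c * x = R" using x1 by (simp add: c_def)
   have "c * x <= c * y" using x R by (intro mult_left_mono) (auto simp: c_def)
   then show "1 <= c * x" "1 <= c * y" "R <= c * y" using e R by auto
  qed
  let ?A = "\<lambda>t. ?q r t * of_real (ind {..R / x} (abs t)) * (iexp (t * x) - iexp (t * y))"
  let ?B = "\<lambda>v t. ?q r t * of_real (ind {c<..} (abs t)) * iexp (t * v)"
  have nz: "norm (1 / ?C r t ^ Suc k) <= (1 / (1 - r)) ^ Suc k" for t
  proof -
   have "norm (cx r * char F (- t)) <= r" unfolding norm_mult norm_of_real using r cmod_char_le_1[of "-t"] by simp
   then have "1 - r <= norm (?C r t)" using norm_triangle_ineq2[of 1 "cx r * char F (- t)"] by simp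
   then have "1 / norm (?C r t) <= 1 / (1 - r)" using r by (intro frac_le) auto
   then have "(1 / norm (?C r t)) ^ Suc k <= (1 / (1 - r)) ^ Suc k" by (intro power_mono) auto
   then show ?thesis by (simp add: norm_divide norm_mult norm_power power_one_over)
  qed
  have int: "integrable lborel (\<lambda>t. ?q r t * f t)" if [measurable]: "f \<in> borel_measurable borel" and f: "!!t. norm (f t) <= 2" for f
  proof -
   have "integrable lborel (\<lambda>t. cx (g t) * ((1 / ?C r t ^ Suc k) * f t))"
   proof (rule g_integrable_times[where B="(1 / (1 - r)) ^ Suc k * 2"])
    fix t
    show "norm ((1 / ?C r t ^ Suc k) * f t) <= (1 / (1 - r)) ^ Suc k * 2" unfolding norm_mult using nz[of t] f[of t] r by (intro mult_mono) auto
   qed measurable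
   then show ?thesis by simp
  qed
  have intA: "integrable lborel ?A" unfolding mult.assoc[of "?q r _"] by (intro int) (auto simp: norm_mult indicator_def intro!: order_trans[OF norm_triangle_ineq4])
  have intB: "integrable lborel (?B v)" for v unfolding mult.assoc[of "?q r _"] by (intro int) (auto simp: norm_mult indicator_def)
  have "cx (abel k r x - abel k r y) = (CLBINT t. ?q r t * iexp (t * x)) - (CLBINT t. ?q r t * iexp (t * y))"
   using r by (simp only: of_real_diff abel_fourier less_imp_le mult_ac)
  also have "... = (CLBINT t. ?q r t * iexp (t * x) - ?q r t * iexp (t * y))" by (intro Bochner_Integration.integral_diff[symmetric] int) auto
  also have "... = (CLBINT t. ?A t + (?B x t - ?B y t))" unfolding c_def by (intro Lint_cong refl split_aux)
  also have "... = (CLBINT t. ?A t) + ((CLBINT t. ?B x t) - (CLBINT t. ?B y t))" using intA intB by simp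
  finally have "norm (cx (abel k r x - abel k r y)) <= norm (CLBINT t. ?A t) + (norm (CLBINT t. ?B x t) + norm (CLBINT t. ?B y t))"
   by (simp only:) (rule order_trans[OF norm_triangle_ineq add_left_mono[OF norm_triangle_ineq4]])
  also have "... <= C2 * R^2 * \<rho> * bb k x + (C1 * bb k x * R powr (- \<gamma>) + C1 * (2 ^ Suc k * bb k x) * R powr (- \<gamma>))"
  proof (intro add_mono)
   have "norm (CLBINT t. ?A t) <= C2 * R^2 * ((y - x) / x) * (a x ^ Suc k / x)" by (intro near r R x)
   also have "... <= C2 * R^2 * \<rho> * bb k x" unfolding bb_def using near(1) x x1 a_pos[of x] by (intro mult_right_mono mult_left_mono) (auto simp: field_simps)
   finally show "norm (CLBINT t. ?A t) <= C2 * R^2 * \<rho> * bb k x" .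
   show "norm (CLBINT t. ?B x t) <= C1 * bb k x * R powr (- \<gamma>)" using far(3)[OF r x1(1) c(1)] c by (simp add: bb_def)
   have "norm (CLBINT t. ?B y t) <= C1 * bb k y * (c * y) powr (- \<gamma>)" using far(3)[OF r x1(2) c(2)] by (simp add: bb_def)
   also have "... <= C1 * (2 ^ Suc k * bb k x) * R powr (- \<gamma>)"
   proof (intro mult_mono)
    have "(1 + \<rho>) * x <= 2 * x" using \<rho> x1 by simp
    then have "y <= 2 * x" using x by simp
    then show "bb k y <= 2 ^ Suc k * bb k x" using x x1 by (intro bb_double) auto
    show "(c * y) powr (- \<gamma>) <= R powr (- \<gamma>)" using c far(2) by (intro powr_mono2') auto
   qed (use far(1) bb_pos[of x k] bb_pos[of y k] x1 in auto)
   finally show "norm (CLBINT t. ?B y t) <= C1 * (2 ^ Suc k * bb k x) * R powr (- \<gamma>)" .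
  qed
  also have "... = (C2 * R^2 * \<rho> + C3 * R powr (- \<gamma>)) * bb k x" by (simp add: C3_def algebra_simps)
  also have "... <= (\<epsilon> / 2 + \<epsilon> / 2) * bb k x" using \<rho> R bb_pos[of x k] x1 by simp
  finally show "abs (abel k r x - abel k r y) <= \<epsilon> * bb k x" unfolding norm_of_real by simp
 qed
 show "\<exists>\<rho>>0. \<exists>x0. \<forall>x y. x0 <= x --> x <= y --> y <= (1 + \<rho>) * x --> abs (u k x - u k y) <= \<epsilon> * bb k x"
  using main \<rho>(1) by blast
qed

lemma u_crude:
 assumes k: "real (Suc k) * \<alpha> < 2"
 shows "\<exists>C>0. \<forall>x. u k x <= C * br x^2"
proof -
 obtain C where C: "0 < C" "!!X. 1 <= X ==> NE (U k) (\<lambda>z. 1 / (1 + abs z / X) ^ 2) <= ennreal (C * a X ^ Suc k)" using U_quadratic_decay[OF k] by blast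
 have a1: "0 < a 1" by (rule a_pos) simp
 let ?A = "C * a 1 ^ Suc k"
 have "u k x <= (H * ?A + 1) * br x^2" for x
 proof -
  have "ennreal (u k x) = NE (U k) (\<lambda>z. h (x - z))" by (simp add: u_nn[OF k])
  also have "... <= NI (U k) (\<lambda>z. ennreal (H * br x^2) * ennreal (1 / (1 + abs z / 1) ^ 2))"
   using h_shift_le H_nonneg by (intro nn_integral_mono) (simp add: ennreal_mult[symmetric])
  also have "... = ennreal (H * br x^2) * NE (U k) (\<lambda>z. 1 / (1 + abs z / 1) ^ 2)" by (rule nn_integral_cmult) measurable
  also have "... <= ennreal (H * br x^2) * ennreal ?A" by (intro mult_left_mono C) auto
  also have "... = ennreal (H * br x^2 * ?A)" using H_nonneg by (intro ennreal_mult'[symmetric]) auto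
  finally have "u k x <= H * br x^2 * ?A" by (subst (asm) ennreal_le_iff) (use H_nonneg C a1 in auto)
  also have "... = H * ?A * br x^2" by simp
  also have "... <= (H * ?A + 1) * br x^2" by (intro mult_right_mono) auto
  finally show ?thesis .
 qed
 moreover have "0 < H * ?A + 1" using H_nonneg C a1 by (intro add_nonneg_pos) auto
 ultimately show ?thesis by blast
qed

lemma u_upper_extend:
 assumes k: "real (Suc k) * \<alpha> < 2" and C: "!!x. x0 <= x ==> u k x <= C * bb k x"
 shows "\<exists>C>0. \<forall>x\<ge>1. u k x <= C * bb k x"
proof -
 obtain D where D: "0 < D" "!!x. u k x <= D * br x^2" using u_crude[OF k] by blast
 define x1 where "x1 = max x0 1"
 define B where "B = max 0 C + D * (1 + x1)^2 * x1"
 have "u k x <= B * bb k x" if x: "1 <= x" for x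
 proof (cases "x0 <= x")
  case True
  have "0 <= D * (1 + x1)^2 * x1" using D by (auto simp: x1_def)
  then have "C <= B" by (simp add: B_def)
  then have "C * bb k x <= B * bb k x" using bb_pos[of x k] x by simp
  then show ?thesis using C[OF True] by simp
 next
  case False
  have "u k x <= D * br x^2" by (rule D)
  also have "... <= D * (1 + x1)^2" using D x False by (intro mult_left_mono) (auto simp: x1_def)
  also have "... = D * (1 + x1)^2 * x1 * (1 / x1)" by (simp add: x1_def)
  also have "... <= D * (1 + x1)^2 * x1 * bb k x"
  proof (intro mult_left_mono)
   have "1 / x1 <= 1 / x" using False x by (intro divide_left_mono) (auto simp: x1_def)
   also have "... <= bb k x" unfolding bb_def using x a_ge_1[of x] by (intro divide_right_mono one_le_power) auto
   finally show "1 / x1 <= bb k x" .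
  qed (use D in \<open>auto simp: x1_def\<close>)
  also have "... <= B * bb k x" using bb_pos[of x k] x by (intro mult_right_mono) (auto simp: B_def)
  finally show ?thesis .
 qed
 moreover have "0 < B" unfolding B_def using D by (intro add_nonneg_pos) (auto simp: x1_def)
 ultimately show ?thesis by blast
qed

text \<open>A value of \<open>u k\<close> far above \<open>bb k\<close> at x would persist on
  [x, (1 + \<rho>) x] by slow oscillation and contradict the averaged bound of
  \<open>u_smooth\<close> at scale x.\<close>

lemma osc_upper:
 assumes k: "real (Suc k) * \<alpha> < 2" and osc: "osc k"
 shows "\<exists>C>0. \<forall>x\<ge>1. u k x <= C * bb k x"
proof -
 obtain \<rho>' x0' where r': "0 < \<rho>'" "!!x y. x0' <= x ==> x <= y ==> y <= (1 + \<rho>') * x ==> abs (u k x - u k y) <= 1 * bb k x"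
  using osc[unfolded osc_def, rule_format, of 1] by auto
 define \<rho> where "\<rho> = min 1 \<rho>'"
 have \<rho>: "0 < \<rho>" "\<rho> <= 1" "\<rho> <= \<rho>'" using r' by (auto simp: \<rho>_def)
 obtain C where C: "0 < C" "!!X. 1 <= X ==> NE lborel (\<lambda>s. u k s * (1 / (1 + abs s / X) ^ 2)) <= ennreal (C * a X ^ Suc k)" using u_smooth[OF k] by blast
 have "u k x <= (9 * C / \<rho> + 1) * bb k x" if x: "max x0' 1 <= x" for x
 proof -
  have x1: "1 <= x" "x0' <= x" using x by auto
  have ax: "0 < a x" using x1 by (intro a_pos) auto
  define v where "v = max 0 (u k x - bb k x)"
  have v: "0 <= v" "u k x - bb k x <= v" by (auto simp: v_def)
  have "x <= (1 + \<rho>) * x" using \<rho> x1 by simp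
  then have "emeasure lborel {x..(1 + \<rho>) * x} = ennreal (\<rho> * x)" by (simp add: algebra_simps)
  \<comment> \<open>On this interval 1 + s / x <= 3, hence the weight is at least 1 / 9.\<close>
  then have "ennreal (v * (1/9) * (\<rho> * x)) = NI lborel (\<lambda>s. ennreal (v * (1/9)) * ind {x..(1 + \<rho>) * x} s)"
   using v \<rho> x1 by (subst nn_integral_cmult_indicator) (auto simp: ennreal_mult[symmetric])
  also have "... <= NE lborel (\<lambda>s. u k s * (1 / (1 + abs s / x) ^ 2))"
  proof (rule nn_integral_mono)
   fix s
   show "ennreal (v * (1/9)) * ind {x..(1 + \<rho>) * x} s <= ennreal (u k s * (1 / (1 + abs s / x) ^ 2))"
   proof (cases "s \<in> {x..(1 + \<rho>) * x}")
    case True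
    have "(1 + \<rho>) * x <= (1 + \<rho>') * x" "(1 + \<rho>) * x <= 2 * x" using \<rho> x1 by auto
    then have s: "x <= s" "s <= (1 + \<rho>') * x" "s <= 2 * x" using True by auto
    have "u k x - bb k x <= u k s" using r'(2)[OF x1(2) s(1) s(2)] by simp
    then have vs: "v <= u k s" using u_nonneg[of k s] by (simp add: v_def)
    have "1 + abs s / x <= 3" using s by (simp add: divide_le_eq)
    moreover have p: "0 < 1 + abs s / x" using x1 by (intro add_pos_nonneg) auto
    ultimately have "(1 + abs s / x) ^ 2 <= 3 ^ 2" by (intro power_mono) auto
    then have "1 / 9 <= 1 / (1 + abs s / x) ^ 2" using p by simp
    then have "v * (1/9) <= u k s * (1 / (1 + abs s / x) ^ 2)" using v vs by (intro mult_mono) auto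
    then show ?thesis using True by (simp add: ennreal_leI)
   qed simp
  qed
  also have "... <= ennreal (C * a x ^ Suc k)" by (rule C(2)[OF x1(1)])
  finally have "v * (1/9) * (\<rho> * x) <= C * a x ^ Suc k" by (subst (asm) ennreal_le_iff) (use C ax in auto)
  then have "v <= 9 * C / \<rho> * bb k x" using \<rho> x1 by (simp add: bb_def field_simps)
  then show ?thesis using v by (simp add: distrib_right)
 qed
 then show ?thesis by (rule u_upper_extend[OF k])
qed

end

section \<open>Size-bias identity\<close>

context renewal_law
begin

lemma neg_part_le_exp: "max (- y) 0 <= 1 / \<theta> * exp (- \<theta> * y)"
proof -
 have "\<theta> * (- y) <= exp (- \<theta> * y)" using exp_ge_add_one_self[of "- \<theta> * y"] by simp
 then have "- y <= 1 / \<theta> * exp (- \<theta> * y)" using theta by (simp add: field_simps)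
 then show ?thesis using theta by simp
qed

lemma integrable_neg_Fn: "integrable (Fn n) (\<lambda>y. max (- y) 0)"
proof (rule integrableI_nonneg)
 let ?A = "NE (Fn n) (\<lambda>y. max (- y) 0)"
 have "?A <= NI (Fn n) (\<lambda>y. ennreal (1 / \<theta>) * ennreal (exp (- \<theta> * y)))"
  using neg_part_le_exp theta by (intro nn_integral_mono) (simp add: ennreal_mult[symmetric] ennreal_leI del: mult_minus_left)
 also have "... = ennreal (1 / \<theta>) * ennreal (L \<theta> ^ n)" using exp_Fn[of \<theta> n] theta by (simp add: nn_integral_cmult del: mult_minus_left)
 also have "... < \<infinity>" by (simp add: ennreal_mult_less_top)
 finally show "?A < \<infinity>" .
qed auto

lemma integral_Fn_Suc:
 fixes f :: "real => real"
 assumes [measurable]: "f \<in> borel_measurable borel" and B: "!!y. abs (f y) <= B"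
 shows "(LINT y|Fn (Suc n). f y) = (LINT w|F. (LINT z|Fn n. f (w + z)))"
proof -
 interpret n: prob_space "Fn n" by (rule prob_Fn)
 interpret P: pair_prob_space F "Fn n" ..
 have "(LINT y|Fn (Suc n). f y) = (LINT p|(F \<Otimes>\<^sub>M Fn n). f (fst p + snd p))"
  unfolding Fn.simps convolution_def by (subst integral_distr) (auto simp: split_beta')
 also have "... = (LINT w|F. (LINT z|Fn n. f (fst (w, z) + snd (w, z))))" by (rule P.integral_fst'[symmetric], rule P.integrable_const_bound[where B=B]) (auto simp: B)
 finally show ?thesis by simp
qed

end

context renewal_kernel
begin

lemma hn_meas [measurable]: "hn n \<in> borel_measurable borel"
proof -
 interpret n: prob_space "Fn n" by (rule prob_Fn)
 have "(\<lambda>x. \<integral>z. h (x - z) \<partial>Fn n) \<in> borel_measurable borel" by simp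
 then show ?thesis by (simp add: hn_def[abs_def])
qed

lemma abs_times_h_le: "abs v * h v <= H"
proof -
 have "h v * abs v <= h v * br v ^ 1" by (intro mult_left_mono h_nonneg) auto
 also have "... <= H" by (rule h_le) simp
 finally show ?thesis by (simp add: mult.commute)
qed

lemma id_times_h_bounded: "abs (y * h (x - y)) <= H * br x"
proof -
 have "abs y * h (x - y) <= (abs x + abs (x - y)) * h (x - y)" by (intro mult_right_mono h_nonneg) auto
 also have "... <= abs x * H + H" unfolding distrib_right by (intro add_mono mult_left_mono h_le_H abs_times_h_le) auto
 finally show ?thesis using h_nonneg by (simp add: abs_mult algebra_simps)
qed

lemma hn_Suc: "hn (Suc n) x = (LINT w|F. hn n (x - w))" unfolding hn_def using h_le_H h_nonneg by (subst integral_Fn_Suc[where B=H]) (auto simp: diff_diff_eq)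

text \<open>\<open>F\<close> has infinite mean, so a large positive jump w needs compensation:
  either the argument of \<open>h\<close> is large, where \<open>h\<close> decays, or another
  summand is very negative, and negative parts are integrable.\<close>

lemma jump_times_h_le: "abs w * h (x - v - w - z) <= H * (1 + abs x + max (- v) 0 + max (- w) 0 + max (- z) 0)"
proof (cases "0 <= w")
 case True
 let ?A = "abs x + max (- v) 0 + max (- z) 0"
 have "abs w <= abs (x - v - w - z) + ?A" using True by simp
 then have "abs w * h (x - v - w - z) <= (abs (x - v - w - z) + ?A) * h (x - v - w - z)" by (intro mult_right_mono h_nonneg)
 also have "... <= H + ?A * H" unfolding distrib_right[of "abs (x - v - w - z)"] by (intro add_mono mult_left_mono abs_times_h_le h_le_H) auto
 also have "... = H * (1 + abs x + max (- v) 0 + 0 + max (- z) 0)" by (simp add: algebra_simps)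
 also have "... <= H * (1 + abs x + max (- v) 0 + max (- w) 0 + max (- z) 0)" using H_nonneg by (intro mult_left_mono add_right_mono add_left_mono) auto
 finally show ?thesis .
next
 case False
 have "abs w * h (x - v - w - z) <= abs w * H" by (intro mult_left_mono h_le_H) auto
 also have "... <= H * (1 + abs x + max (- v) 0 + max (- w) 0 + max (- z) 0)" unfolding mult.commute[of _ H] using H_nonneg False by (intro mult_left_mono) auto
 finally show ?thesis .
qed

lemma jump_times_hn_le: "abs (w * hn n (x - v - w)) <= H * (1 + abs x + max (- v) 0 + max (- w) 0 + (LINT z|Fn n. max (- z) 0))"
proof -
 interpret n: prob_space "Fn n" by (rule prob_Fn)
 have "abs (w * hn n (x - v - w)) = (LINT z|Fn n. abs w * h (x - v - w - z))" using hn_nonneg by (simp add: abs_mult) (simp add: hn_def)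
 also have "... <= (LINT z|Fn n. H * (1 + abs x + max (- v) 0 + max (- w) 0 + max (- z) 0))"
  by (intro integral_mono jump_times_h_le integrable_mult_right Lintable_add integrable_neg_Fn hn_integrable) auto
 also have "... = H * (1 + abs x + max (- v) 0 + max (- w) 0 + (LINT z|Fn n. max (- z) 0))" using integrable_neg_Fn n.prob_space by simp
 finally show ?thesis .
qed

lemma jump_hn_integrable: "integrable F (\<lambda>w. w * hn n (x - w))"
proof (rule Lint_bound)
 let ?A = "\<lambda>w. 1 + abs x + max (- 0) 0 + max (- w) 0 + (LINT z|Fn n. max (- z) 0)"
 show "integrable F (\<lambda>w. H * ?A w)" by (intro integrable_mult_right Lintable_add integrable_neg_part) auto
 show "AE w in F. norm (w * hn n (x - w)) <= norm (H * ?A w)" using jump_times_hn_le[of _ n x 0] by (intro AE_I2) (auto intro: order_trans[OF _ abs_ge_self])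
qed measurable

text \<open>Exchangeability of the summands: each of the \<open>n + 1\<close> jumps contributes equally to the sum.\<close>

lemma size_bias: "(LINT y|Fn (Suc n). y * h (x - y)) = real (Suc n) * (LINT w|F. w * hn n (x - w))"
proof (induction n arbitrary: x)
 case 0
 have "(LINT y|Fn (Suc 0). y * h (x - y)) = (LINT w|F. (LINT z|Fn 0. (w + z) * h (x - (w + z))))" by (rule integral_Fn_Suc[OF _ id_times_h_bounded]) measurable
 also have "... = (LINT w|F. w * hn 0 (x - w))" by (simp add: hn_def integral_return)
 finally show ?case by simp
next
 case (Suc n)
 interpret n: prob_space "Fn (Suc n)" by (rule prob_Fn)
 interpret P: pair_prob_space F F ..
 let ?N = "\<integral>z. max (- z) 0 \<partial>Fn n"
 have bnd_int: "integrable (Fn (Suc n)) (\<lambda>z. z * h (v - z))" for v by (rule n.integrable_const_bound[where B="H * br v"]) (auto simp: id_times_h_bounded)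
 let ?B = "F \<Otimes>\<^sub>M F"
 have int: "integrable ?B (\<lambda>(v, w). w * hn n (x - v - w))"
 proof (rule Lint_bound)
  have "integrable ?B (\<lambda>p. max (- fst p) 0)" "integrable ?B (\<lambda>p. max (- snd p) 0)" using integrable_neg_part by (auto intro!: P.Fubini_integrable)
  then show "integrable ?B (\<lambda>p. H * (1 + abs x + max (- fst p) 0 + max (- snd p) 0 + ?N))" by simp
  show "AE p in F \<Otimes>\<^sub>M F. norm (case p of (v, w) => w * hn n (x - v - w)) <= norm (H * (1 + abs x + max (- fst p) 0 + max (- snd p) 0 + ?N))"
   using jump_times_hn_le[of _ n x] by (intro AE_I2) (auto intro: order_trans[OF _ abs_ge_self])
 qed measurable
 let ?A = "\<lambda>w. LINT z|Fn (Suc n). (w + z) * h (x - (w + z))"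
 have "(LINT y|Fn (Suc (Suc n)). y * h (x - y)) = (LINT w|F. ?A w)" by (rule integral_Fn_Suc[OF _ id_times_h_bounded]) measurable
 also have "... = (LINT w|F. w * hn (Suc n) (x - w) + real (Suc n) * (LINT v|F. v * hn n (x - w - v)))"
 proof (intro Lint_cong refl)
  fix w
  have "?A w = (LINT z|Fn (Suc n). w * h (x - w - z) + z * h (x - w - z))" by (simp add: algebra_simps del: Fn.simps)
  also have "... = w * hn (Suc n) (x - w) + (LINT z|Fn (Suc n). z * h (x - w - z))" unfolding hn_def using bnd_int hn_integrable[of "Suc n"] by simp
  finally show "?A w = w * hn (Suc n) (x - w) + real (Suc n) * (LINT v|F. v * hn n (x - w - v))" unfolding Suc .
 qed
 also have "... = (LINT w|F. w * hn (Suc n) (x - w)) + real (Suc n) * (LINT w|F. (LINT v|F. v * hn n (x - w - v)))"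
  using jump_hn_integrable[of "Suc n" x] P.integrable_fst'[OF int] by simp
 \<comment> \<open>Fubini exchanges the new jump with the marked one; averaging over the new jump
   then turns \<open>hn n\<close> into \<open>hn (Suc n)\<close>.\<close>
 also have "(LINT w|F. (LINT v|F. v * hn n (x - w - v))) = (LINT v|F. (LINT w|F. v * hn n (x - w - v)))" using P.Fubini_integral[OF int] by simp
 also have "... = (LINT v|F. v * hn (Suc n) (x - v))" by (intro Lint_cong refl) (simp add: hn_Suc algebra_simps)
 finally show ?case by (simp add: algebra_simps)
qed

definition drift :: "nat => real => real" where
 "drift k x = (LINT w|F. w * u k (x - w))"

text \<open>Error from replacing the position y by x in the size-bias identity; small because
  \<open>h\<close> is concentrated near 0.\<close>

definition rest :: "nat => real => real" where
 "rest k x = (LINT y|U k. (x - y) * h (x - y))"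

lemma cubic_exp_integrable: "integrable F (\<lambda>w. (1 + max (- w) 0) ^ j)"
proof (rule Lint_bound)
 let ?B = "\<lambda>w. 1 + exp (- \<theta> * w)"
 show "integrable F (\<lambda>w. fact j * (max 1 (1/\<theta>)) ^ j * exp \<theta> * ?B w)" using exp_int_theta by simp
 show "AE w in F. norm ((1 + max (- w) 0) ^ j) <= norm (fact j * (max 1 (1/\<theta>)) ^ j * exp \<theta> * ?B w)"
 proof (intro AE_I2)
  fix w :: real
  let ?v = "max (- w) 0" and ?M = "max 1 (1/\<theta>)"
  let ?A = "\<theta> * (1 + ?v)"
  have "1 / \<theta> * ?A <= ?M * ?A" using theta by (intro mult_right_mono) auto
  then have "1 + ?v <= ?M * ?A" using theta by simp
  then have "(1 + ?v) ^ j <= (?M * ?A) ^ j" by (intro power_mono) auto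
  also have "... = ?M ^ j * ?A ^ j" by (simp add: power_mult_distrib)
  also have "... <= ?M ^ j * (fact j * exp ?A)"
  proof (rule mult_left_mono)
   have "?A ^ j /\<^sub>R fact j <= exp ?A" unfolding exp_def using theta by (rule_tac order_trans[OF _ sum_le_suminf[of _ "{j}"]]) (auto intro!: summable_exp)
   then show "?A ^ j <= fact j * exp ?A" by (simp add: field_simps)
  qed simp
  also have "exp ?A <= exp \<theta> * ?B w"
  proof -
   have "exp (\<theta> * ?v) <= 1 + exp (- \<theta> * w)" using theta by (cases "0 <= w") (auto simp: max_def)
   then have "exp \<theta> * exp (\<theta> * ?v) <= exp \<theta> * ?B w" by simp
   then show ?thesis by (simp add: distrib_left exp_add)
  qed
  finally have "(1 + ?v) ^ j <= ?M ^ j * (fact j * (exp \<theta> * ?B w))" by simp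
  also have "... = fact j * ?M ^ j * exp \<theta> * ?B w" by simp
  finally show "norm ((1 + ?v) ^ j) <= norm (fact j * ?M ^ j * exp \<theta> * ?B w)" by simp
 qed
qed measurable

text \<open>There is no first moment of \<open>F\<close> on the right, but for w >= x the factor u k
  (x - w) decays like a fourth power. For w < x the crude quadratic bound is met by moments of the
  negative part.\<close>

lemma drift_integrable:
 assumes k: "real (Suc k) * \<alpha> < 2"
 shows "integrable F (\<lambda>w. w * u k (x - w))"
proof -
 obtain C1 where C1: "0 < C1" "!!y. y <= 0 ==> u k y <= C1 / br y ^ 4" using u_neg_bound[OF k] by blast
 obtain C2 where C2: "0 < C2" "!!y. u k y <= C2 * br y^2" using u_crude[OF k] by blast
 define C where "C = (C1 + C2) * br x ^ 3"
 let ?A = "\<lambda>w. 1 + max (- w) 0"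
 have bound: "abs w * u k (x - w) <= C * ?A w ^ 3" for w
 proof (cases "x <= w")
  case True
  have "abs w * u k (x - w) <= (br x * br (x - w)) * (C1 / br (x - w) ^ 4)" using one_plus_abs_mult[of w x] True C1(2)[of "x - w"] u_nonneg by (intro mult_mono) auto
  also have "... = br x * C1 * (1 / br (x - w) ^ 3)"
  proof -
   have "q * (C1 / q ^ 4) = C1 * (1 / q ^ 3)" if "0 < q" for q :: real using that by (simp add: power4_eq_xxxx power3_eq_cube)
   moreover have "0 < 1 + abs (x - w)" by simp
   ultimately show ?thesis by (simp only: mult.assoc)
  qed
  also have "... <= br x * C1 * 1" using C1(1) by (intro mult_left_mono) (auto intro!: one_le_power)
  also have "... <= br x ^ 3 * (C1 + C2) * ?A w ^ 3"
  proof (intro mult_mono)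
   show "1 + abs x <= br x ^ 3" using power_increasing[of 1 3 "1 + abs x"] by simp
  qed (use C1(1) C2(1) in \<open>auto intro!: one_le_power\<close>)
  finally show ?thesis by (simp add: C_def mult_ac)
 next
  case False
  have w: "abs w <= br x * ?A w" using False one_plus_mult_ge[of "abs x" "max (- w) 0"] by simp
  have xw: "1 + abs (x - w) <= br x * ?A w" using False one_plus_mult_ge[of "abs x" "max (- w) 0"] by simp
  have "u k (x - w) <= C2 * br (x - w)^2" by (rule C2)
  also have "... <= C2 * (br x * ?A w)^2" using C2(1) xw by simp
  finally have "abs w * u k (x - w) <= (br x * ?A w) * (C2 * (br x * ?A w)^2)" using w u_nonneg by (intro mult_mono) auto
  also have "... = C2 * br x ^ 3 * ?A w ^ 3" by (simp add: power2_eq_square power3_eq_cube)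
  also have "... <= C * ?A w ^ 3" using C1(1) unfolding C_def by (intro mult_right_mono) auto
  finally show ?thesis .
 qed
 show ?thesis
 proof (rule Lint_bound)
  show "integrable F (\<lambda>w. C * ?A w ^ 3)" using cubic_exp_integrable by simp
  show "AE w in F. norm (w * u k (x - w)) <= norm (C * ?A w ^ 3)"
  proof (intro AE_I2)
   fix w
   have "norm (w * u k (x - w)) <= C * ?A w ^ 3" using bound[of w] u_nonneg by (simp add: abs_mult)
   also have "... <= norm (C * ?A w ^ 3)" by simp
   finally show "norm (w * u k (x - w)) <= norm (C * ?A w ^ 3)" .
  qed
 qed measurable
qed

text \<open>Points with abs (x - y) <= \<eta> * x give at most \<eta> * x * u k x. For the others
  the sixth-power decay of \<open>h\<close> leaves a factor of order 1 / x times the quadratic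
  weight controlled by \<open>U_quadratic_decay\<close>.\<close>

lemma rest_bound:
 assumes k: "real (Suc k) * \<alpha> < 2" and \<eta>: "0 < \<eta>" "\<eta> <= 1"
 shows "\<exists>x0\<ge>1. \<forall>x\<ge>x0. integrable (U k) (\<lambda>y. (x - y) * h (x - y)) \<and> abs (rest k x) <= \<eta> * (x * u k x) + \<eta>"
proof -
 obtain C where C: "0 < C" "!!X. 1 <= X ==> NE (U k) (\<lambda>z. 1 / (1 + abs z / X) ^ 2) <= ennreal (C * a X ^ Suc k)" using U_quadratic_decay[OF k] by blast
 have a1: "0 < a 1" by (rule a_pos) simp
 let ?G = "C * a 1 ^ Suc k"
 define D where "D = H * ?G * 4 / \<eta> ^ 3"
 have D: "0 <= D" using H_nonneg C a1 \<eta> by (simp add: D_def)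
 define x0 where "x0 = max 1 (D / \<eta>)"
 have "integrable (U k) (\<lambda>y. (x - y) * h (x - y)) \<and> abs (rest k x) <= \<eta> * (x * u k x) + \<eta>" if x: "x0 <= x" for x
 proof -
  have x1: "1 <= x" "D / \<eta> <= x" using x by (auto simp: x0_def)
  let ?A = "\<lambda>y. 1 / (1 + abs y / 1) ^ 2"
  have pt: "abs (x - y) * h (x - y) <= \<eta> * x * h (x - y) + H * 4 / \<eta> ^ 3 / x * ?A y" for y
  proof (cases "abs (x - y) <= \<eta> * x")
   case True
   have "abs (x - y) * h (x - y) <= \<eta> * x * h (x - y)" by (intro mult_right_mono True h_nonneg)
   moreover have "0 <= H * 4 / \<eta> ^ 3 / x * ?A y" using H_nonneg \<eta> x1 by simp
   ultimately show ?thesis by simp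
  next
   case False
   define q where "q = 1 + abs (x - y)"
   have q: "0 < q" "\<eta> * x <= q" using False by (auto simp: q_def)
   have "abs (x - y) * h (x - y) * (q ^ 3 * q ^ 2) <= h (x - y) * q ^ 6"
   proof -
    have "abs (x - y) * (h (x - y) * (q ^ 3 * q ^ 2)) <= q * (h (x - y) * (q ^ 3 * q ^ 2))" using q h_nonneg by (intro mult_right_mono) (auto simp: q_def)
    also have "... = h (x - y) * q ^ 6" by (simp add: eval_nat_numeral)
    finally show ?thesis by simp
   qed
   also have "... <= H" unfolding q_def by (rule h_le) simp
   finally have le: "abs (x - y) * h (x - y) * (q ^ 3 * q ^ 2) <= H" .
   let ?C = "(\<eta> * x) ^ 3 * (br y / (1 + x)) ^ 2"
   have "abs (x - y) * h (x - y) * ?C <= abs (x - y) * h (x - y) * (q ^ 3 * q ^ 2)"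
   proof (intro mult_left_mono mult_mono power_mono)
    show "br y / (1 + x) <= q" using one_plus_abs_mult[of y x] x1 by (simp add: q_def divide_le_eq mult.commute)
   qed (use q \<eta> x1 h_nonneg in auto)
   also note le
   finally have "abs (x - y) * h (x - y) * ?C <= H" .
   then have "abs (x - y) * h (x - y) <= H / ?C" using \<eta> x1 by (subst pos_le_divide_eq) (auto intro!: mult_pos_pos divide_pos_pos add_pos_nonneg)
   also have "... = H * (1 + x) ^ 2 / (\<eta> ^ 3 * x ^ 3) * ?A y" by (simp add: power_divide power_mult_distrib)
   also have "... <= H * (2 * x) ^ 2 / (\<eta> ^ 3 * x ^ 3) * ?A y"
    using H_nonneg \<eta> x1 by (intro mult_right_mono divide_right_mono mult_left_mono power_mono) auto
   also have "H * (2 * x) ^ 2 / (\<eta> ^ 3 * x ^ 3) = H * 4 / \<eta> ^ 3 / x" using x1 \<eta> by (simp add: power2_eq_square power3_eq_cube)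
   finally have "abs (x - y) * h (x - y) <= H * 4 / \<eta> ^ 3 / x * ?A y" .
   moreover have "0 <= \<eta> * x * h (x - y)" using \<eta> x1 h_nonneg by simp
   ultimately show ?thesis by simp
  qed
  let ?D = "NE (U k) (\<lambda>y. abs (x - y) * h (x - y))"
  let ?E = "ennreal (\<eta> * (x * u k x) + \<eta>)"
  have nn: "?D <= ?E"
  proof -
   let ?B = "ennreal (H * 4 / \<eta> ^ 3 / x)"
   let ?I = "ennreal (\<eta> * x)"
   have "?D <= NI (U k) (\<lambda>y. ?I * ennreal (h (x - y)) + ?B * ennreal (?A y))"
   proof (intro nn_integral_mono)
    fix y
    have nn: "0 <= \<eta> * x" "0 <= h (x - y)" "0 <= H * 4 / \<eta> ^ 3 / x" "0 <= 1 / (1 + abs y / 1) ^ 2" using H_nonneg \<eta> x1 h_nonneg by auto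
    show "ennreal (abs (x - y) * h (x - y)) <= ?I * ennreal (h (x - y)) + ?B * ennreal (?A y)"
     using ennreal_leI[OF pt[of y]] nn by (simp only: ennreal_plus ennreal_mult mult_nonneg_nonneg)
   qed
   also have "... = ?I * ennreal (u k x) + ?B * NE (U k) (\<lambda>y. ?A y)"
    unfolding u_nn[OF k, symmetric] by (subst nn_integral_add; (subst nn_integral_cmult)?) (auto simp: nn_integral_cmult)
   also have "... <= ?I * ennreal (u k x) + ?B * ennreal ?G" by (intro add_left_mono mult_left_mono C) auto
   also have "... = ennreal (\<eta> * x * u k x + H * 4 / \<eta> ^ 3 / x * ?G)"
   proof -
    have nn: "0 <= \<eta> * x" "0 <= u k x" "0 <= H * 4 / \<eta> ^ 3 / x" "0 <= C * a 1 ^ Suc k" using H_nonneg \<eta> x1 u_nonneg C a1 by auto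
    then show ?thesis by (simp only: ennreal_plus ennreal_mult mult_nonneg_nonneg)
   qed
   also have "... <= ?E"
   proof (rule ennreal_leI)
    have "H * 4 / \<eta> ^ 3 / x * ?G = D / x" by (simp add: D_def)
    also have "... <= \<eta>" using x1 \<eta> by (simp add: field_simps)
    finally show "\<eta> * x * u k x + H * 4 / \<eta> ^ 3 / x * ?G <= \<eta> * (x * u k x) + \<eta>" by simp
   qed
   finally show ?thesis .
  qed
  have nrm: "norm ((x - y) * h (x - y)) = abs (x - y) * h (x - y)" for y using h_nonneg by (simp add: abs_mult)
  have int: "integrable (U k) (\<lambda>y. (x - y) * h (x - y))" using nn by (intro integrableI_bounded) (auto simp: nrm simp del: real_norm_def intro: le_less_trans)
  have "ennreal (norm (rest k x)) <= ?E" unfolding rest_def using integral_norm_bound_ennreal[OF int] nn unfolding nrm by simp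
  moreover have "0 <= \<eta> * (x * u k x) + \<eta>" using \<eta> x1 u_nonneg[of k x] by simp
  ultimately show ?thesis using int by simp
 qed
 then show ?thesis by (intro exI[of _ x0]) (auto simp: x0_def)
qed

text \<open>Sums \<open>size_bias\<close> over n. The factor n + 1 raises the index of the weights:
  weight k (n + 1) * (n + 1) = (k + 1) * weight (k + 1) n, which is why \<open>u (Suc k)\<close>
  appears under the integral.\<close>

lemma size_bias_U:
 assumes k: "real (Suc (Suc k)) * \<alpha> < 2" and int: "integrable (U k) (\<lambda>y. (x - y) * h (x - y))"
 shows "x * u k x = real (Suc k) * drift (Suc k) x + rest k x"
proof -
 have k': "real (Suc k) * \<alpha> < 2" using k alpha by (simp add: algebra_simps)
 let ?G = "\<lambda>n. LINT y|Fn n. (x - y) * h (x - y)"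
 let ?I = "\<lambda>n. LINT y|Fn n. y * h (x - y)"
 let ?P = "\<lambda>n. integrable (Fn n)"
 have split: "x * hn n x = ?I n + ?G n" for n
 proof -
  interpret n: prob_space "Fn n" by (rule prob_Fn)
  have i1: "(?P n) (\<lambda>y. y * h (x - y))" by (rule n.integrable_const_bound[where B="H * br x"]) (auto simp: id_times_h_bounded)
  have i2: "(?P n) (\<lambda>y. (x - y) * h (x - y))" by (rule n.integrable_const_bound[where B=H]) (use abs_times_h_le h_nonneg in \<open>auto simp: abs_mult\<close>)
  have "?I n + ?G n = (LINT y|Fn n. y * h (x - y) + (x - y) * h (x - y))" using i1 i2 by simp
  also have "... = (LINT y|Fn n. x * h (x - y))" by (simp add: algebra_simps)
  finally show ?thesis by (simp add: hn_def)
 qed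
 have U_sums: "(\<lambda>n. weight k n * (LINT y|Fn n. f y)) sums (LINT y|U k. f y)"
  if f: "integrable (U k) f" "!!y. 0 <= f y" for f
 proof -
  have [measurable]: "f \<in> borel_measurable borel" using f(1) by auto
  let ?K = "ennreal (LINT y|U k. f y)"
  have fin: "NE (U k) f = ?K" using f by (intro nn_integral_eq_integral) auto
  let ?B = "\<lambda>n. NE (Fn n) f"
  let ?D = "\<lambda>n. ennreal (weight k n)"
  have eq: "(\<Sum>n. ?D n * ?B n) = ?K" unfolding fin[symmetric] by (rule nn_integral_U[symmetric]) measurable
  have each: "?D n * ?B n = ennreal (weight k n * (LINT y|Fn n. f y))" for n
  proof -
   have "?D n * ?B n <= (\<Sum>n. ?D n * ?B n)" using sum_le_suminf[of "\<lambda>n. ?D n * ?B n" "{n}"] by simp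
   then have "?D n * ?B n < \<infinity>" unfolding eq by (rule le_less_trans) simp
   then have "?B n < \<infinity>" using weight_pos(1)[of k n] by (auto simp: ennreal_mult_less_top)
   then have "(?P n) f" using f(2) by (intro integrableI_nonneg) auto
   then show ?thesis using f(2) weight_pos(1)[of k n] by (simp add: nn_integral_eq_integral ennreal_mult')
  qed
  have nn: "0 <= weight k n * (LINT y|Fn n. f y)" for n using weight_pos(1)[of k n] f(2) by simp
  have s: "summable (\<lambda>n. weight k n * (LINT y|Fn n. f y))" by (rule summable_suminf_not_top[OF nn]) (simp add: each[symmetric] eq)
  have "ennreal (\<Sum>n. weight k n * (LINT y|Fn n. f y)) = ?K" using suminf_ennreal2[OF nn s] eq each by simp
  then have "(\<Sum>n. weight k n * (LINT y|Fn n. f y)) = (LINT y|U k. f y)" using suminf_nonneg[OF s nn] f(2) by simp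
  then show ?thesis using s by (simp add: sums_iff)
 qed
 have rest_sums: "(\<lambda>n. weight k n * ?G n) sums rest k x"
 proof -
  let ?p = "\<lambda>y. max ((x - y) * h (x - y)) 0" and ?m = "\<lambda>y. max (- ((x - y) * h (x - y))) 0"
  have ip: "integrable (U k) ?p" "integrable (U k) ?m" using int by auto
  have i: "?P n ?p" "?P n ?m" for n
  proof -
   interpret n: prob_space "Fn n" by (rule prob_Fn)
   have "(?P n) (\<lambda>y. (x - y) * h (x - y))" by (rule n.integrable_const_bound[where B=H]) (use abs_times_h_le h_nonneg in \<open>auto simp: abs_mult\<close>)
   then show "?P n ?p" "?P n ?m" by auto
  qed
  have eq: "(x - y) * h (x - y) = ?p y - ?m y" for y by simp
  have "(\<lambda>n. weight k n * (LINT y|Fn n. ?p y) - weight k n * (LINT y|Fn n. ?m y)) sums ((LINT y|U k. ?p y) - (LINT y|U k. ?m y))"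
   by (intro sums_diff U_sums ip) auto
  then show ?thesis unfolding rest_def
   by (subst (1 2) eq) (simp only: Bochner_Integration.integral_diff[OF i] Bochner_Integration.integral_diff[OF ip] right_diff_distrib)
 qed
 have "(\<lambda>n. x * (weight k n * hn n x)) sums (x * u k x)" using u_series[OF k', of x] by (intro sums_mult) (simp add: sums_iff)
 from sums_diff[OF this rest_sums]
 have 1: "(\<lambda>n. weight k n * ?I n) sums (x * u k x - rest k x)" by (rule sums_cong[THEN iffD1, rotated]) (simp add: mult.left_commute[of x] split distrib_left)
 let ?E = "\<lambda>n. weight k (Suc n) * (LINT y|Fn (Suc n). y * h (x - y))"
 have "?E sums (x * u k x - rest k x)"
 proof -
  \<comment> \<open>The term n = 0 vanishes because \<open>Fn 0\<close> is the point mass at 0; the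
    series can therefore be reindexed from n + 1.\<close>
  have z: "weight k 0 * (LINT y|Fn 0. y * h (x - y)) = 0" by (simp add: integral_return)
  show ?thesis using 1 by (subst sums_Suc_iff) (simp only: z, simp)
 qed
 also have "?E = (\<lambda>n. real (Suc k) * (weight (Suc k) n * (LINT w|F. w * hn n (x - w))))"
 proof
  fix n
  have "(Suc n + k choose k) * Suc n = Suc k * (n + Suc k choose Suc k)"
   using Suc_times_binomial_add[of n k] Suc_times_binomial_eq[of "n + k" k] binomial_absorb_comp[of "Suc n + k" k] by (simp add: ac_simps)
  then have "real (Suc n + k choose k) * real (Suc n) = real (Suc k) * real (n + Suc k choose Suc k)" by (metis of_nat_mult)
  then have "weight k (Suc n) * real (Suc n) = real (Suc k) * weight (Suc k) n" by (simp add: weight_def)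
  then show "weight k (Suc n) * (LINT y|Fn (Suc n). y * h (x - y)) = real (Suc k) * (weight (Suc k) n * (LINT w|F. w * hn n (x - w)))" unfolding size_bias by simp
 qed
 finally have 2: "(\<lambda>n. real (Suc k) * (weight (Suc k) n * (LINT w|F. w * hn n (x - w)))) sums (x * u k x - rest k x)" .
 let ?A = "\<lambda>n w. weight (Suc k) n * hn n (x - w)"
 let ?J = "\<lambda>n. \<integral>w. w * ?A n w \<partial>F"
 have "?J sums (LINT w|F. (\<Sum>n. w * ?A n w))"
 proof (rule sums_integral)
  have int_n: "integrable F (\<lambda>w. w * ?A n w)" for n using integrable_mult_right[OF jump_hn_integrable[of n x], of "weight (Suc k) n"] by (simp add: mult_ac)
  then show "integrable F (\<lambda>w. w * ?A n w)" for n .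
  let ?C = "\<lambda>n w. norm (w * ?A n w)"
  have nrm: "?C n w = abs w * ?A n w" for w n using weight_pos(1)[of "Suc k" n] hn_nonneg by (simp add: abs_mult)
  show "AE w in F. summable (\<lambda>n. ?C n w)" unfolding nrm by (intro AE_I2 summable_mult u_series k)
  have nn: "0 <= (LINT w|F. ?C n w)" for n by simp
  show "summable (\<lambda>n. \<integral>w. ?C n w \<partial>F)"
  proof (rule summable_suminf_not_top[OF nn])
   have "(\<Sum>n. ennreal (LINT w|F. ?C n w)) = (\<Sum>n. NE F (\<lambda>w. ?C n w))"
    by (intro suminf_cong nn_integral_eq_integral[symmetric] integrable_norm int_n) auto
   also have "... = NI F (\<lambda>w. (\<Sum>n. ennreal (?C n w)))" by (rule nn_integral_suminf[symmetric]) measurable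
   also have "... = NE F (\<lambda>w. norm (w * u (Suc k) (x - w)))"
   proof (intro nn_integral_cong)
    fix w
    have s: "summable (\<lambda>n. abs w * ?A n w)" by (intro summable_mult u_series k)
    have "(\<Sum>n. ennreal (?C n w)) = ennreal (\<Sum>n. abs w * ?A n w)"
     unfolding nrm using weight_pos(1)[of "Suc k"] hn_nonneg by (intro suminf_ennreal2 s) (auto simp: less_imp_le)
    also have "(\<Sum>n. abs w * ?A n w) = abs w * u (Suc k) (x - w)" by (simp add: suminf_mult[OF u_series(1)[OF k]] u_series(2)[OF k])
    also have "... = norm (w * u (Suc k) (x - w))" using u_nonneg by (simp add: abs_mult)
    finally show "(\<Sum>n. ennreal (?C n w)) = ennreal (norm (w * u (Suc k) (x - w)))" .
   qed
   also have "... < \<infinity>" using drift_integrable[OF k, of x] by (simp add: integrable_iff_bounded)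
   finally show "(\<Sum>n. ennreal (LINT w|F. ?C n w)) \<noteq> top" by simp
  qed
 qed
 also have "(LINT w|F. (\<Sum>n. w * ?A n w)) = drift (Suc k) x"
  unfolding drift_def by (intro Lint_cong refl) (simp add: suminf_mult[OF u_series(1)[OF k]] u_series(2)[OF k])
 also have "?J = (\<lambda>n. weight (Suc k) n * (LINT w|F. w * hn n (x - w)))" by (simp add: mult.left_commute[of _ "weight _ _"])
 finally have "(\<lambda>n. real (Suc k) * (weight (Suc k) n * (LINT w|F. w * hn n (x - w)))) sums (real (Suc k) * drift (Suc k) x)" by (rule sums_mult)
 from sums_unique2[OF this 2] show ?thesis by simp
qed

end

section \<open>Descent from k + 1 to k\<close>

context renewal_law
begin

text \<open>On 1 <= X - w <= 2 the integrand of \<open>local_cond\<close> is at least 1 / 2, because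
  a >= 1; so the condition also bounds the mass of unit cells.\<close>

lemma local_mass_small:
 assumes "\<alpha> <= 1/2" "0 < \<epsilon>"
 shows "\<exists>X0\<ge>1. \<forall>X\<ge>X0. emeasure F {w. 1 <= X - w \<and> X - w <= 2} <= ennreal (\<epsilon> * a X / X)"
proof -
 obtain \<eta> x0 where *: "0 < \<eta>" "!!x. x0 <= x ==>
   NI F (\<lambda>w. ennreal ((a (x - w))^2 / (x - w)) * ind {w. 1 <= x - w \<and> x - w <= \<eta> * x} w) <= ennreal (\<epsilon> / 2 * a x / x)"
  using local_cond[OF assms(1), of "\<epsilon> / 2"] assms(2) by auto
 define X0 where "X0 = max (max x0 1) (2 / \<eta>)"
 have "emeasure F {w. 1 <= X - w \<and> X - w <= 2} <= ennreal (\<epsilon> * a X / X)" if X: "X0 <= X" for X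
 proof -
  have X': "x0 <= X" "1 <= X" "2 <= \<eta> * X" using X *(1) by (auto simp: X0_def field_simps)
  have aX: "0 < a X" using X' by (intro a_pos) auto
  have "emeasure F {w. 1 <= X - w \<and> X - w <= 2} = NI F (\<lambda>w. ind {w. 1 <= X - w \<and> X - w <= 2} w)" by simp
  also have "... <= NI F (\<lambda>w. 2 * (ennreal ((a (X - w))^2 / (X - w)) * ind {w. 1 <= X - w \<and> X - w <= \<eta> * X} w))"
  proof (rule nn_integral_mono)
   fix w
   show "ind {w. 1 <= X - w \<and> X - w <= 2} w <= 2 * (ennreal ((a (X - w))^2 / (X - w)) * ind {w. 1 <= X - w \<and> X - w <= \<eta> * X} w)"
   proof (cases "1 <= X - w \<and> X - w <= 2")
    case True
    have "1 <= (a (X - w))^2" using True by (intro one_le_power a_ge_1) auto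
    then have "1 / 2 <= (a (X - w))^2 / (X - w)" using True by simp
    then have "1 <= 2 * ((a (X - w))^2 / (X - w))" by linarith
    then have "ennreal 1 <= ennreal (2 * ((a (X - w))^2 / (X - w)))" by simp
    moreover have "ennreal (2 * ((a (X - w))^2 / (X - w))) = 2 * ennreal ((a (X - w))^2 / (X - w))" using True by (subst ennreal_mult) auto
    ultimately have "1 <= 2 * ennreal ((a (X - w))^2 / (X - w))" by (simp only: ennreal_1)
    then show ?thesis using True X' by simp
   qed simp
  qed
  also have "... = 2 * NI F (\<lambda>w. ennreal ((a (X - w))^2 / (X - w)) * ind {w. 1 <= X - w \<and> X - w <= \<eta> * X} w)"
   unfolding renewal_scale_def by (rule nn_integral_cmult) measurable
  also have "... <= 2 * ennreal (\<epsilon> / 2 * a X / X)" by (intro mult_left_mono * X') auto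
  also have "... = ennreal (2 * (\<epsilon> / 2 * a X / X))" using assms aX X' by (subst ennreal_mult) auto
  finally show ?thesis by simp
 qed
 then show ?thesis by (intro exI[of _ X0]) (auto simp: X0_def)
qed

end

context renewal_kernel
begin

text \<open>Jumps of size about x. For y = x - w >= 1 the bound a y ^ (k + 2) / y of u (Suc k)
  splits into a y ^ k <= a x ^ k and a y ^ 2 / y, the integrand of \<open>local_cond\<close>. For y
  < 1 the fourth-power decay of u (Suc k) is summed over unit cells, whose mass is small by
  \<open>local_mass_small\<close>.\<close>

lemma tail_bound:
 assumes \<alpha>: "\<alpha> <= 1/2" and k: "real (Suc (Suc k)) * \<alpha> < 2" and \<epsilon>: "0 < \<epsilon>"
  and C: "0 < C" "!!y. 1 <= y ==> u (Suc k) y <= C * bb (Suc k) y"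
 shows "\<exists>\<eta>>0. \<eta> < 1 \<and> (\<exists>x0\<ge>1. \<forall>x\<ge>x0.
  NI F (\<lambda>w. ennreal (w * u (Suc k) (x - w)) * ind {w. (1 - \<eta>) * x < w} w) <= ennreal (\<epsilon> * a x ^ Suc k))"
proof -
 obtain C1 where C1: "0 < C1" "!!y. y <= 0 ==> u (Suc k) y <= C1 / br y ^ 4" using u_neg_bound[OF k] by blast
 obtain C2 where C2: "0 < C2" "!!y. u (Suc k) y <= C2 * br y^2" using u_crude[OF k] by blast
 \<comment> \<open>Extends the fourth-power bound from y <= 0 to y <= 1; 64 = 2 ^ 6 converts the
   crude quadratic bound on [0, 1].\<close>
 define C' where "C' = C1 + C2 * 64"
 have C': "0 < C'" "!!y. y <= 1 ==> u (Suc k) y <= C' / br y ^ 4"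
 proof -
  show "0 < C'" using C1 C2 by (simp add: C'_def)
  fix y :: real assume y: "y <= 1"
  show "u (Suc k) y <= C' / br y ^ 4"
  proof (cases "y <= 0")
   case True
   have "C1 / br y ^ 4 <= C' / br y ^ 4" using C2(1) by (intro divide_right_mono) (auto simp: C'_def)
   then show ?thesis using C1(2)[OF True] by simp
  next
   case False
   have "br y ^ 6 <= 2 ^ 6" using y False by (intro power_mono) auto
   then have "C2 * br y ^ 6 <= C2 * 2 ^ 6" using C2(1) by simp
   then have "C2 * br y ^ 6 <= C'" using C1(1) by (simp add: C'_def)
   then have "C2 * br y^2 * br y ^ 4 <= C'" by (simp add: mult.assoc)
   then have "C2 * br y^2 <= C' / br y ^ 4" by (subst pos_le_divide_eq) auto
   then show ?thesis using C2(2)[of y] by simp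
  qed
 qed
 define S where "S = (\<Sum>j. 1 / (real (Suc j))^2)"
 have S: "summable (\<lambda>j. 1 / (real (Suc j))^2)" "0 <= S"
 proof -
  show "summable (\<lambda>j. 1 / (real (Suc j))^2)" using inverse_power_summable[of 2, where 'a=real] by (subst summable_Suc_iff) (simp add: inverse_eq_divide)
  then show "0 <= S" unfolding S_def by (intro suminf_nonneg) auto
 qed
 \<comment> \<open>Chosen so that all cells together contribute at most \<epsilon> / 2 in units of a
   x.\<close>
 define \<delta> where "\<delta> = \<epsilon> / (2 * (32 * C' * (S + 1)))"
 have \<delta>: "0 < \<delta>" "32 * C' * \<delta> * S <= \<epsilon> / 2"
 proof -
  show "0 < \<delta>" using \<epsilon> C' S by (auto simp: \<delta>_def)
  have "32 * C' * \<delta> * S <= 32 * C' * \<delta> * (S + 1)" using C' \<open>0 < \<delta>\<close> by simp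
  also have "... = \<epsilon> / 2"
  proof -
   define Z where "Z = 32 * C' * (S + 1)"
   have "0 < Z" using C'(1) S(2) by (simp add: Z_def)
   have "32 * C' * \<delta> * (S + 1) = Z * \<delta>" by (simp add: Z_def)
   also have "... = \<epsilon> / 2" using \<open>0 < Z\<close> by (simp add: \<delta>_def flip: Z_def)
   finally show ?thesis .
  qed
  finally show "32 * C' * \<delta> * S <= \<epsilon> / 2" .
 qed
 obtain X0 where X0: "1 <= X0" "!!X. X0 <= X ==> emeasure F {w. 1 <= X - w \<and> X - w <= 2} <= ennreal (\<delta> * a X / X)"
  using local_mass_small[OF \<alpha> \<delta>(1)] by blast
 let ?D = "\<lambda>w x. (a (x - w))^2 / (x - w)"
 let ?E = "\<lambda>x. ennreal (\<epsilon> / (2 * C) * a x / x)"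
 obtain \<eta>' x0 where lc: "0 < \<eta>'" "!!x. x0 <= x ==>
   NI F (\<lambda>w. ennreal (?D w x) * ind {w. 1 <= x - w \<and> x - w <= \<eta>' * x} w) <= ?E x"
  using local_cond[OF \<alpha>, of "\<epsilon> / (2 * C)"] \<epsilon> C by auto
 define \<eta> where "\<eta> = min \<eta>' (1/2)"
 have \<eta>: "0 < \<eta>" "\<eta> < 1" "\<eta> <= \<eta>'" using lc(1) by (auto simp: \<eta>_def)
 have "NI F (\<lambda>w. ennreal (w * u (Suc k) (x - w)) * ind {w. (1 - \<eta>) * x < w} w) <= ennreal (\<epsilon> * a x ^ Suc k)"
  if x: "max x0 X0 <= x" for x
 proof -
  have x1: "1 <= x" "x0 <= x" "X0 <= x" using x X0(1) by auto
  have ax: "1 <= a x" using x1 by (intro a_ge_1) auto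
  let ?I = "\<lambda>w. ennreal (?D w x) * ind {w. 1 <= x - w \<and> x - w <= \<eta>' * x} w"
  let ?A = "\<lambda>j. x + real j + 1"
  let ?C = "\<lambda>j. 16 * C' * (x + real j) / (1 + real j) ^ 4"
  let ?J = "\<lambda>j w. ennreal (?C j) * ind {w. 1 <= ?A j - w \<and> ?A j - w <= 2} w"
  let ?B = "ennreal (x * C * a x ^ k)"
  have "NI F (\<lambda>w. ennreal (w * u (Suc k) (x - w)) * ind {w. (1 - \<eta>) * x < w} w) <=
   NI F (\<lambda>w. ?B * ?I w + (\<Sum>j. ?J j w))"
  proof (rule nn_integral_mono)
   fix w
   show "ennreal (w * u (Suc k) (x - w)) * ind {w. (1 - \<eta>) * x < w} w <= ?B * ?I w + (\<Sum>j. ?J j w)"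
   proof (cases "(1 - \<eta>) * x < w")
    case True
    have w0: "0 < w" using True \<eta> x1 by (smt (verit) mult_nonneg_nonneg)
    show ?thesis
    proof (cases "1 <= x - w")
     case y: True
     have "\<eta> * x <= \<eta>' * x" using \<eta> x1 by simp
     then have yx: "x - w <= \<eta>' * x" "x - w <= x" using True w0 by (auto simp: algebra_simps)
     have ay: "0 < a (x - w)" using y by (intro a_pos) auto
     have "w * u (Suc k) (x - w) <= x * (C * bb (Suc k) (x - w))" using w0 C(2)[OF y] u_nonneg y by (intro mult_mono) auto
     also have "... = x * C * (a (x - w)) ^ k * ?D w x" by (simp add: bb_def power2_eq_square)
     also have "... <= x * C * a x ^ k * ?D w x" using y yx x1 C ay by (intro mult_right_mono mult_left_mono power_mono a_mono) auto
     finally have "ennreal (w * u (Suc k) (x - w)) <= ennreal (x * C * a x ^ k * ?D w x)" by (rule ennreal_leI)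
     also have "... = ?B * ennreal (?D w x)" using x1 C ax by (intro ennreal_mult') auto
     finally have "ennreal (w * u (Suc k) (x - w)) <= ?B * ?I w" using y yx by simp
     then show ?thesis using True by (simp add: add_increasing2)
    next
     case y: False
     \<comment> \<open>Index of the cell: x + j - 1 < w <= x + j, which places X - w in [1, 2] for X
       = x + j + 1. The cell j = 0 covers x - 1 < w <= x.\<close>
     define j where "j = nat \<lceil>w - x\<rceil>"
     have "0 <= \<lceil>w - x\<rceil>" using y by simp
     then have j: "real j - 1 < w - x" "w - x <= real j" unfolding j_def by linarith+
     have "(1 + real j) / 2 <= 1 + abs (x - w)"
     proof (cases j)
      case (Suc i)
      then show ?thesis using j by simp
     qed auto
     then have p: "((1 + real j) / 2) ^ 4 <= br (x - w) ^ 4" by simp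
     have "u (Suc k) (x - w) <= C' / br (x - w) ^ 4" using y by (intro C') auto
     also have "... <= C' / ((1 + real j) / 2) ^ 4" using C'(1) p by (intro divide_left_mono) (auto intro!: mult_pos_pos)
     also have "... = 16 * C' / (1 + real j) ^ 4" by (simp add: power_divide)
     finally have "w * u (Suc k) (x - w) <= (x + real j) * (16 * C' / (1 + real j) ^ 4)" using j w0 u_nonneg by (intro mult_mono) auto
     then have "ennreal (w * u (Suc k) (x - w)) <= ennreal (?C j)" by (intro ennreal_leI) (simp add: mult_ac)
     also have "... = ?J j w" using j by simp
     also have "... = sum (\<lambda>j. ?J j w) {j}" by (simp only: sum.insert finite.emptyI empty_iff not_False_eq_True sum.empty add_0_right)
     also have "... <= (\<Sum>j. ?J j w)" by (rule sum_le_suminf) auto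
     finally show ?thesis using True by (simp add: add_increasing)
    qed
   qed simp
  qed
  also have "... = ?B * NI F (\<lambda>w. ?I w) + (\<Sum>j. NI F (\<lambda>w. ?J j w))"
   unfolding renewal_scale_def by (subst nn_integral_add; (subst nn_integral_cmult)?; (subst nn_integral_suminf)?) (auto simp: nn_integral_suminf nn_integral_cmult)
  also have "... <= ?B * ?E x + (\<Sum>j. ennreal (32 * C' * \<delta> * a x * (1 / (real (Suc j))^2)))"
  proof (intro add_mono mult_left_mono lc x1 suminf_le)
   fix j
   have xj: "1 <= x + real j + 1" "X0 <= x + real j + 1" using x1 by auto
   have axj: "a (?A j) <= (2 + real j) * a x"
   proof -
    have "real j <= real j * x" using x1 mult_left_mono[of 1 x "real j"] by simp
    then have "x + real j + 1 <= (2 + real j) * x" using x1 by (simp add: distrib_right)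
    then have "a (?A j) <= a ((2 + real j) * x)" using xj by (intro a_mono) auto
    also have "... <= (2 + real j) * a x" using x1 by (intro a_scale) auto
    finally show ?thesis .
   qed
   have "NI F (\<lambda>w. ?J j w) = ennreal (?C j) * emeasure F {w. 1 <= ?A j - w \<and> ?A j - w <= 2}" by (rule nn_integral_cmult_indicator) auto
   also have "... <= ennreal (?C j) * ennreal (\<delta> * a (?A j) / ?A j)" by (intro mult_left_mono X0 xj) auto
   also have "... = ennreal (16 * C' * (x + real j) / (1 + real j) ^ 4 * (\<delta> * a (?A j) / ?A j))" using C' x1 by (intro ennreal_mult'[symmetric]) auto
   also have "... <= ennreal (32 * C' * \<delta> * a x * (1 / (real (Suc j))^2))"
   proof (rule ennreal_leI)
    have "16 * C' * (x + real j) / (1 + real j) ^ 4 * (\<delta> * a (?A j) / ?A j) =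
     (16 * C' * \<delta>) * ((x + real j) / ?A j) * a (?A j) / (1 + real j) ^ 4" by (simp add: mult_ac)
    also have "... <= (16 * C' * \<delta>) * 1 * ((2 * (1 + real j)) * a x) / (1 + real j) ^ 4"
    proof (intro divide_right_mono mult_mono mult_left_mono)
     show "(x + real j) / ?A j <= 1" using x1 by simp
     have "(2 + real j) * a x <= (2 * (1 + real j)) * a x" using ax by simp
     then show "a (?A j) <= (2 * (1 + real j)) * a x" using axj by simp
    qed (use C' \<delta> x1 xj in \<open>auto intro!: less_imp_le[OF a_pos]\<close>)
    also have "... = 32 * C' * \<delta> * a x * (1 / (1 + real j) ^ 3)"
    proof -
     have "c * ((2 * q) * b) / q ^ 4 = 2 * c * b * (1 / q ^ 3)" if "0 < q" for c q b :: real by (simp add: power4_eq_xxxx power3_eq_cube mult_ac)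
     from this[of "1 + real j" "16 * C' * \<delta>" "a x"] show ?thesis by simp
    qed
    also have "... <= 32 * C' * \<delta> * a x * (1 / (real (Suc j))^2)"
    proof (intro mult_left_mono)
     have "(1 + real j) ^ 2 <= (1 + real j) ^ 3" by (intro power_increasing) auto
     then show "1 / (1 + real j) ^ 3 <= 1 / (real (Suc j))^2" by (intro frac_le) auto
    qed (use C' \<delta> ax in auto)
    finally show "16 * C' * (x + real j) / (1 + real j) ^ 4 * (\<delta> * a (?A j) / ?A j) <= 32 * C' * \<delta> * a x * (1 / (real (Suc j))^2)" .
   qed
   finally show "NI F (\<lambda>w. ?J j w) <= ennreal (32 * C' * \<delta> * a x * (1 / (real (Suc j))^2))" .
  qed auto
  also have "(\<Sum>j. ennreal (32 * C' * \<delta> * a x * (1 / (real (Suc j))^2))) = ennreal (32 * C' * \<delta> * a x * S)"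
   unfolding S_def using C' \<delta> ax S(1) by (intro suminf_ennreal_eq sums_mult) auto
  also have "?B * ?E x = ennreal (\<epsilon> / 2 * a x ^ Suc k)" using x1 C ax \<epsilon> by (subst ennreal_mult[symmetric]) auto
  also have "ennreal (\<epsilon> / 2 * a x ^ Suc k) + ennreal (32 * C' * \<delta> * a x * S) = ennreal (\<epsilon> / 2 * a x ^ Suc k + 32 * C' * \<delta> * a x * S)"
   using \<epsilon> ax C' \<delta> S by simp
  also have "... <= ennreal (\<epsilon> * a x ^ Suc k)"
  proof (rule ennreal_leI)
   have "32 * C' * \<delta> * a x * S = (32 * C' * \<delta> * S) * a x" by simp
   also have "... <= \<epsilon> / 2 * a x ^ Suc k"
   proof (intro mult_mono \<delta>)
    show "a x <= a x ^ Suc k" using power_increasing[of 1 "Suc k" "a x"] ax by simp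
   qed (use \<epsilon> ax in auto)
   finally show "\<epsilon> / 2 * a x ^ Suc k + 32 * C' * \<delta> * a x * S <= \<epsilon> * a x ^ Suc k" by simp
  qed
  finally show ?thesis .
 qed
 then show ?thesis using \<eta> X0(1) by (intro exI[of _ \<eta>]) (auto intro!: exI[of _ "max x0 X0"])
qed

text \<open>For 0 <= w <= (1 - \<eta>) x the distance x - w is at least \<eta> x, so bb (Suc k) (x -
  w) <= bb (Suc k) x / \<eta>, and bb (Suc k) x * m x = a x ^ Suc k. Negative w cost a power of 1 +
  abs w, which is integrable. The free factor e serves boundedness with a constant and oscillation
  with a small number.\<close>

lemma body_bound:
 assumes \<eta>: "0 < \<eta>" "\<eta> <= 1"
 shows "\<exists>C>0. \<forall>x\<ge>1. \<forall>e\<ge>0. NI F (\<lambda>w. ennreal (abs w * (e * bb (Suc k) (x - w))) * ind {..(1 - \<eta>) * x} w) <= ennreal (e * C * a x ^ Suc k)"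
proof -
 define N where "N = (LINT w|F. (1 + max (- w) 0) ^ (k + 2))"
 have N: "0 <= N" unfolding N_def by simp
 have m1: "0 < m 1" by (rule m_pos) simp
 define C where "C = 1 / \<eta> + N / m 1"
 have C: "0 < C" unfolding C_def using \<eta> N m1 by (intro add_pos_nonneg) auto
 have "NI F (\<lambda>w. ennreal (abs w * (e * bb (Suc k) (x - w))) * ind {..(1 - \<eta>) * x} w) <= ennreal (e * C * a x ^ Suc k)"
  if x: "1 <= x" and e: "0 <= e" for x e
 proof -
  have ax: "1 <= a x" using x by (intro a_ge_1) auto
  have b: "0 <= bb (Suc k) x" using bb_pos[of x "Suc k"] x by simp
  let ?f = "\<lambda>w. e * bb (Suc k) x * (1 / \<eta> * min (abs w) x + (1 + max (- w) 0) ^ (k + 2))"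
  have pt: "abs w * (e * bb (Suc k) (x - w)) <= ?f w" if w: "w <= (1 - \<eta>) * x" for w
  proof (cases "0 <= w")
   case True
   have s: "\<eta> * x <= x - w" "x - w <= x" "w <= x" proof -
    have "0 <= \<eta> * x" using \<eta> x by simp
    then show "\<eta> * x <= x - w" "x - w <= x" "w <= x" using w True by (auto simp: algebra_simps)
   qed
   have s0: "0 < x - w" using s \<eta> x by (smt (verit) mult_pos_pos)
   have "bb (Suc k) (x - w) <= a x ^ Suc (Suc k) / (\<eta> * x)"
    unfolding bb_def using s s0 \<eta> x by (intro frac_le power_mono a_mono zero_le_power less_imp_le[OF a_pos]) auto
   also have "... = 1 / \<eta> * bb (Suc k) x" by (simp add: bb_def)
   finally have "abs w * (e * bb (Suc k) (x - w)) <= abs w * (e * (1 / \<eta> * bb (Suc k) x))" using e by (intro mult_left_mono) auto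
   also have "... = e * bb (Suc k) x * (1 / \<eta> * min (abs w) x + 0)" using s by simp
   also have "... <= ?f w" using e b by (intro mult_left_mono) auto
   finally show ?thesis .
  next
   case False
   define s where "s = (x - w) / x"
   have xw: "x - w = s * x" using x by (simp add: s_def)
   have s: "1 <= s" "s <= 1 + abs w"
   proof -
    show "1 <= s" using False x by (simp add: s_def)
    have "- w / x <= - w / 1" using False x by (intro divide_left_mono) auto
    then show "s <= 1 + abs w" using False x by (simp add: s_def diff_divide_distrib)
   qed
   have "a (x - w) <= s * a x" unfolding xw using s x by (intro a_scale) auto
   then have "bb (Suc k) (x - w) <= (s * a x) ^ Suc (Suc k) / (x - w)"
    unfolding bb_def using False x by (intro divide_right_mono power_mono less_imp_le[OF a_pos]) auto
   also have "... = s ^ Suc k * bb (Suc k) x" unfolding xw using s by (simp add: bb_def power_mult_distrib)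
   also have "... <= br w ^ Suc k * bb (Suc k) x" using s b by (intro mult_right_mono power_mono) auto
   finally have "abs w * (e * bb (Suc k) (x - w)) <= br w * (e * (br w ^ Suc k * bb (Suc k) x))" using e bb_pos[of "x - w" "Suc k"] False x by (intro mult_mono) auto
   also have "... = e * bb (Suc k) x * (0 + (1 + max (- w) 0) ^ (k + 2))" using False by simp
   also have "... <= ?f w" using e b \<eta> x by (intro mult_left_mono) auto
   finally show ?thesis .
  qed
  have int: "integrable F ?f" using x cubic_exp_integrable[of "k + 2"] by (intro integrable_mult_right Lintable_add integrable_min) auto
  have f_nn: "0 <= ?f w" for w using e b \<eta> x by simp
  have "NI F (\<lambda>w. ennreal (abs w * (e * bb (Suc k) (x - w))) * ind {..(1 - \<eta>) * x} w) <= NE F (\<lambda>w. ?f w)"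
   using pt by (intro nn_integral_mono) (auto simp: indicator_def ennreal_leI)
  also have "... = ennreal (LINT w|F. ?f w)" using int f_nn by (intro nn_integral_eq_integral) auto
  also have "(LINT w|F. ?f w) = e * bb (Suc k) x * (1 / \<eta> * m x + N)"
   unfolding N_def trunc_mean_def using x cubic_exp_integrable[of "k + 2"] by (simp add: integrable_min)
  also have "... <= e * C * a x ^ Suc k"
  proof -
   have mx: "m 1 <= m x" "0 < m x" using x by (auto intro!: m_mono m_pos)
   have "bb (Suc k) x = a x ^ Suc k / m x" by (simp add: bb_def renewal_scale_def)
   then have "e * bb (Suc k) x * (1 / \<eta> * m x + N) = e * (1 / \<eta> + N / m x) * a x ^ Suc k" using mx by (simp add: field_simps)
   also have "... <= e * C * a x ^ Suc k" unfolding C_def using e mx m1 N ax by (intro mult_right_mono mult_left_mono add_left_mono divide_left_mono) auto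
   finally show ?thesis .
  qed
  finally show ?thesis by (simp add: ennreal_leI)
 qed
 then show ?thesis using C by blast
qed

text \<open>Body and tail bounds control the drift in the size-bias identity; the half of x * u k x
  that enters through \<open>rest\<close> is absorbed on the left side.\<close>

lemma descent_upper:
 assumes \<alpha>: "\<alpha> <= 1/2" and k: "real (Suc (Suc k)) * \<alpha> < 2"
  and up: "\<exists>C>0. \<forall>y\<ge>1. u (Suc k) y <= C * bb (Suc k) y"
 shows "\<exists>C>0. \<forall>y\<ge>1. u k y <= C * bb k y"
proof -
 have k': "real (Suc k) * \<alpha> < 2" using k alpha by (simp add: algebra_simps)
 obtain C where C: "0 < C" "!!y. 1 <= y ==> u (Suc k) y <= C * bb (Suc k) y" using up by blast
 let ?A = "\<lambda>w x. w * u (Suc k) (x - w)"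
 obtain \<eta> x0 where tl: "0 < \<eta>" "\<eta> < 1" "1 <= x0" "!!x. x0 <= x ==>
  NI F (\<lambda>w. ennreal (?A w x) * ind {w. (1 - \<eta>) * x < w} w) <= ennreal (1 * a x ^ Suc k)" using tail_bound[OF \<alpha> k, of 1 C] C by auto
 obtain B where B: "0 < B" "!!x e. 1 <= x ==> 0 <= e ==> NI F (\<lambda>w. ennreal (abs w * (e * bb (Suc k) (x - w))) * ind {..(1 - \<eta>) * x} w) <= ennreal (e * B * a x ^ Suc k)"
  using body_bound[of \<eta> k] tl by auto
 obtain x1 where x1: "1 <= x1" "!!x. x1 <= x ==> integrable (U k) (\<lambda>y. (x - y) * h (x - y)) \<and> abs (rest k x) <= 1/2 * (x * u k x) + 1/2"
  using rest_bound[OF k', of "1/2"] by auto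
 show ?thesis
 proof (rule u_upper_extend[OF k'])
  fix x assume x: "max (max x0 x1) (1 / \<eta>) <= x"
  have x': "1 <= x" "x0 <= x" "x1 <= x" "1 <= \<eta> * x" using x tl x1 by (auto simp: field_simps)
  have ax: "1 <= a x" using x' by (intro a_ge_1) auto
  have "ennreal (abs (drift (Suc k) x)) <= NE F (\<lambda>w. norm (?A w x))"
   unfolding drift_def real_norm_def[symmetric] by (rule integral_norm_bound_ennreal[OF drift_integrable[OF k]])
  also have "... <= NI F (\<lambda>w. ennreal (abs w * (C * bb (Suc k) (x - w))) * ind {..(1 - \<eta>) * x} w + ennreal (?A w x) * ind {w. (1 - \<eta>) * x < w} w)"
  proof (rule nn_integral_mono)
   fix w
   show "ennreal (norm (?A w x)) <= ennreal (abs w * (C * bb (Suc k) (x - w))) * ind {..(1 - \<eta>) * x} w + ennreal (?A w x) * ind {w. (1 - \<eta>) * x < w} w"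
   proof (cases "w <= (1 - \<eta>) * x")
    case True
    then have "1 <= x - w" using x' by (simp add: algebra_simps)
    then have "norm (?A w x) <= abs w * (C * bb (Suc k) (x - w))" using u_nonneg C(2)[of "x - w"] by (simp add: abs_mult mult_left_mono)
    then show ?thesis using True by simp
   next
    case False
    then have "0 <= w" using tl x' by (smt (verit) mult_nonneg_nonneg)
    then show ?thesis using False u_nonneg by simp
   qed
  qed
  also have "... = NI F (\<lambda>w. ennreal (abs w * (C * bb (Suc k) (x - w))) * ind {..(1 - \<eta>) * x} w) + NI F (\<lambda>w. ennreal (?A w x) * ind {w. (1 - \<eta>) * x < w} w)"
   unfolding bb_def renewal_scale_def by (rule nn_integral_add) measurable
  also have "... <= ennreal (C * B * a x ^ Suc k) + ennreal (1 * a x ^ Suc k)" using C by (intro add_mono B tl x') auto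
  also have "... = ennreal (C * B * a x ^ Suc k + 1 * a x ^ Suc k)" using C B ax by simp
  finally have d: "abs (drift (Suc k) x) <= C * B * a x ^ Suc k + 1 * a x ^ Suc k" by (subst (asm) ennreal_le_iff) (use C B ax in auto)
  have r: "integrable (U k) (\<lambda>y. (x - y) * h (x - y))" "abs (rest k x) <= 1/2 * (x * u k x) + 1/2" using x1(2)[OF x'(3)] by auto
  have "x * u k x <= real (Suc k) * abs (drift (Suc k) x) + abs (rest k x)" unfolding size_bias_U[OF k r(1)] by (intro add_mono mult_left_mono) auto
  also have "... <= real (Suc k) * (C * B * a x ^ Suc k + 1 * a x ^ Suc k) + (1/2 * (x * u k x) + 1/2)" by (intro add_mono mult_left_mono d r) auto
  finally have "x * u k x <= 2 * (real (Suc k) * (C * B * a x ^ Suc k + 1 * a x ^ Suc k)) + 1" by simp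
  moreover have "1 <= a x ^ Suc k" using ax by (rule one_le_power)
  moreover have "(2 * (real (Suc k) * (C * B + 1)) + 1) * a x ^ Suc k = 2 * (real (Suc k) * (C * B * a x ^ Suc k + 1 * a x ^ Suc k)) + a x ^ Suc k"
   by (simp add: algebra_simps del: power_Suc)
  ultimately have "x * u k x <= (2 * (real (Suc k) * (C * B + 1)) + 1) * a x ^ Suc k" by simp
  then show "u k x <= (2 * (real (Suc k) * (C * B + 1)) + 1) * bb k x" using x' by (simp add: bb_def pos_le_divide_eq mult.commute)
 qed
qed

text \<open>On the body, y - x <= \<rho> x is small compared with x - w >= \<eta> x, so slow
  oscillation of u (Suc k) compares the values at x - w and y - w. Outside the body both integrals
  are small separately. The remainders and the mismatch (y - x) * u k y are controlled by
  \<open>descent_upper\<close>.\<close>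

lemma descent_osc:
 assumes \<alpha>: "\<alpha> <= 1/2" and k: "real (Suc (Suc k)) * \<alpha> < 2"
  and up: "\<exists>C>0. \<forall>y\<ge>1. u (Suc k) y <= C * bb (Suc k) y" and osc: "osc (Suc k)"
 shows "osc k" unfolding osc_def
proof (intro allI impI)
 fix \<epsilon> :: real assume \<epsilon>: "0 < \<epsilon>"
 have k': "real (Suc k) * \<alpha> < 2" using k alpha by (simp add: algebra_simps)
 obtain C where C: "0 < C" "!!y. 1 <= y ==> u (Suc k) y <= C * bb (Suc k) y" using up by blast
 obtain D where D: "0 < D" "!!y. 1 <= y ==> u k y <= D * bb k y" using descent_upper[OF \<alpha> k up] by blast
 define P where "P = (2 ^ Suc k :: real)"
 have P: "1 <= P" unfolding P_def by (rule one_le_power) simp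
 \<comment> \<open>Collects the coefficients of \<delta> * a x ^ Suc k coming from the drift, the
   two remainders and (y - x) * u k y.\<close>
 define K where "K = real (Suc k) * (1 + 1 + P) + (D + 1) + (P * D + 1) + P * D"
 have K: "0 < K" unfolding K_def using D P by (intro add_pos_pos) auto
 define \<delta> where "\<delta> = min 1 (\<epsilon> / K)"
 have \<delta>: "0 < \<delta>" "\<delta> <= 1" "K * \<delta> <= \<epsilon>" using \<epsilon> K by (auto simp: \<delta>_def min_def field_simps)
 let ?A = "\<lambda>w x. ennreal (w * u (Suc k) (x - w))"
 obtain \<eta>0 x0 where tl: "0 < \<eta>0" "\<eta>0 < 1" "1 <= x0" "!!x. x0 <= x ==>
  NI F (\<lambda>w. ?A w x * ind {w. (1 - \<eta>0) * x < w} w) <= ennreal (\<delta> * a x ^ Suc k)" using tail_bound[OF \<alpha> k \<delta>(1) C] by auto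
 \<comment> \<open>Halved so that the complement of the body lies in the tail regions of both x and
   y, that is (1 - \<eta>0) * y <= (1 - \<eta>) * x.\<close>
 define \<eta> where "\<eta> = \<eta>0 / 2"
 have \<eta>: "0 < \<eta>" "\<eta> <= 1" "\<eta> <= \<eta>0" using tl by (auto simp: \<eta>_def)
 obtain B where B: "0 < B" "!!x e. 1 <= x ==> 0 <= e ==> NI F (\<lambda>w. ennreal (abs w * (e * bb (Suc k) (x - w))) * ind {..(1 - \<eta>) * x} w) <= ennreal (e * B * a x ^ Suc k)"
  using body_bound[OF \<eta>(1,2), of k] by auto
 obtain \<rho>' x2 where os: "0 < \<rho>'" "!!x y. x2 <= x ==> x <= y ==> y <= (1 + \<rho>') * x ==> abs (u (Suc k) x - u (Suc k) y) <= \<delta> / B * bb (Suc k) x"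
  using osc[unfolded osc_def, rule_format, of "\<delta> / B", OF divide_pos_pos[OF \<delta>(1) B(1)]] by blast
 obtain x1 where x1: "1 <= x1" "!!x. x1 <= x ==> integrable (U k) (\<lambda>y. (x - y) * h (x - y)) \<and> abs (rest k x) <= \<delta> * (x * u k x) + \<delta>"
  using rest_bound[OF k' \<delta>(1,2)] by auto
 define \<rho> where "\<rho> = min (min \<delta> \<eta>) (\<rho>' * \<eta>)"
 have \<rho>: "0 < \<rho>" "\<rho> <= \<delta>" "\<rho> <= \<eta>" "\<rho> <= \<rho>' * \<eta>" using \<delta> \<eta> os by (auto simp: \<rho>_def)
 define X where "X = max (max x0 x1) (max (x2 / \<eta>) 1)"
 have main: "abs (u k x - u k y) <= \<epsilon> * bb k x" if x: "X <= x" "x <= y" "y <= (1 + \<rho>) * x" for x y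
 proof -
  have x': "1 <= x" "x0 <= x" "x1 <= x" "x2 <= \<eta> * x" "1 <= y" "x0 <= y" "x1 <= y" using x \<eta> by (auto simp: X_def field_simps)
  have y2: "y <= 2 * x"
  proof -
   have "(1 + \<rho>) * x <= 2 * x" using \<rho> \<delta> x' by simp
   then show ?thesis using x by simp
  qed
  have ax: "1 <= a x" "1 <= a y" using x' by (auto intro!: a_ge_1)
  have ay: "a y ^ Suc k <= P * a x ^ Suc k"
  proof -
   have "a y <= a (2 * x)" using y2 x' by (intro a_mono) auto
   also have "... <= 2 * a x" using x' by (intro a_scale) auto
   finally have "a y ^ Suc k <= (2 * a x) ^ Suc k" using ax by (intro power_mono) auto
   then show ?thesis by (simp only: P_def power_mult_distrib)
  qed
  have u_x: "x * u k x <= D * a x ^ Suc k" "y * u k y <= D * a y ^ Suc k" using D(2)[of x] D(2)[of y] x' by (auto simp: bb_def pos_le_divide_eq mult.commute)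
  have cy: "(1 - \<eta>0) * y <= (1 - \<eta>) * x"
  proof -
   have "(1 - \<eta>0) * y <= (1 - \<eta>0) * ((1 + \<rho>) * x)" using x tl by simp
   also have "... = ((1 - \<eta>0) * (1 + \<rho>)) * x" by simp
   also have "... <= (1 - \<eta>) * x"
   proof (intro mult_right_mono)
    have "(1 - \<eta>0) * \<rho> <= 1 * \<eta>" using tl \<rho> by (intro mult_mono) auto
    then show "(1 - \<eta>0) * (1 + \<rho>) <= 1 - \<eta>" by (simp add: algebra_simps \<eta>_def)
   qed (use x' in auto)
   finally show ?thesis .
  qed
  have cx: "(1 - \<eta>0) * x <= (1 - \<eta>) * x" using \<eta> x' by simp
  have "drift (Suc k) x - drift (Suc k) y = (LINT w|F. w * u (Suc k) (x - w) - w * u (Suc k) (y - w))" unfolding drift_def using drift_integrable[OF k] by simp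
  then have "ennreal (abs (drift (Suc k) x - drift (Suc k) y)) <= NE F (\<lambda>w. norm (w * u (Suc k) (x - w) - w * u (Suc k) (y - w)))"
   unfolding real_norm_def[symmetric] using integral_norm_bound_ennreal[OF Lintable_diff[OF drift_integrable[OF k, of x] drift_integrable[OF k, of y]]] by simp
  also have "... <= NI F (\<lambda>w. ennreal (abs w * (\<delta> / B * bb (Suc k) (x - w))) * ind {..(1 - \<eta>) * x} w +
    (?A w x * ind {w. (1 - \<eta>0) * x < w} w + ennreal (w * u (Suc k) (y - w)) * ind {w. (1 - \<eta>0) * y < w} w))"
  proof (rule nn_integral_mono)
   fix w
   show "ennreal (norm (w * u (Suc k) (x - w) - w * u (Suc k) (y - w))) <= ennreal (abs w * (\<delta> / B * bb (Suc k) (x - w))) * ind {..(1 - \<eta>) * x} w +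
    (?A w x * ind {w. (1 - \<eta>0) * x < w} w + ennreal (w * u (Suc k) (y - w)) * ind {w. (1 - \<eta>0) * y < w} w)"
   proof (cases "w <= (1 - \<eta>) * x")
    case True
    then have s: "\<eta> * x <= x - w" by (simp add: algebra_simps)
    have "\<rho> * x <= \<rho>' * \<eta> * x" using \<rho> x' by simp
    also have "... = \<rho>' * (\<eta> * x)" by simp
    also have "... <= \<rho>' * (x - w)" using os(1) by (intro mult_left_mono s) auto
    finally have "y - w <= (1 + \<rho>') * (x - w)" using x by (simp add: algebra_simps)
    then have "abs (u (Suc k) (x - w) - u (Suc k) (y - w)) <= \<delta> / B * bb (Suc k) (x - w)" using s x' x by (intro os) auto
    then have "norm (w * u (Suc k) (x - w) - w * u (Suc k) (y - w)) <= abs w * (\<delta> / B * bb (Suc k) (x - w))"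
     by (simp only: real_norm_def right_diff_distrib[symmetric] abs_mult) (intro mult_left_mono, auto)
    then show ?thesis using True by (simp add: add_increasing2 ennreal_leI)
   next
    case False
    have w0: "0 <= w" using False \<eta> x' by (smt (verit) mult_nonneg_nonneg)
    have "norm (w * u (Suc k) (x - w) - w * u (Suc k) (y - w)) <= w * u (Suc k) (x - w) + w * u (Suc k) (y - w)"
     using mult_nonneg_nonneg[OF w0 u_nonneg[of "Suc k" "x - w"]] mult_nonneg_nonneg[OF w0 u_nonneg[of "Suc k" "y - w"]] by simp
    then have "ennreal (norm (w * u (Suc k) (x - w) - w * u (Suc k) (y - w))) <= ?A w x + ennreal (w * u (Suc k) (y - w))"
     using w0 u_nonneg ennreal_plus[of "w * u (Suc k) (x - w)" "w * u (Suc k) (y - w)"] by (metis ennreal_leI mult_nonneg_nonneg)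
    then show ?thesis using False cx cy by simp
   qed
  qed
  also have "... = NI F (\<lambda>w. ennreal (abs w * (\<delta> / B * bb (Suc k) (x - w))) * ind {..(1 - \<eta>) * x} w) +
    (NI F (\<lambda>w. ?A w x * ind {w. (1 - \<eta>0) * x < w} w) + NI F (\<lambda>w. ennreal (w * u (Suc k) (y - w)) * ind {w. (1 - \<eta>0) * y < w} w))"
   unfolding bb_def renewal_scale_def by (simp add: nn_integral_add)
  also have "... <= ennreal (\<delta> / B * B * a x ^ Suc k) + (ennreal (\<delta> * a x ^ Suc k) + ennreal (\<delta> * a y ^ Suc k))"
   using \<delta> B by (intro add_mono B tl x') auto
  also have "... = ennreal (\<delta> / B * B * a x ^ Suc k + (\<delta> * a x ^ Suc k + \<delta> * a y ^ Suc k))"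
  proof -
   have nn: "0 <= \<delta> / B * B * a x ^ Suc k" "0 <= \<delta> * a x ^ Suc k" "0 <= \<delta> * a y ^ Suc k" using \<delta> ax by auto
   then show ?thesis by simp
  qed
  finally have "abs (drift (Suc k) x - drift (Suc k) y) <= \<delta> / B * B * a x ^ Suc k + (\<delta> * a x ^ Suc k + \<delta> * a y ^ Suc k)"
   by (subst (asm) ennreal_le_iff) (use \<delta> B ax in auto)
  also have "... <= \<delta> * a x ^ Suc k + (\<delta> * a x ^ Suc k + \<delta> * (P * a x ^ Suc k))" using B \<delta> ay by simp
  finally have dr: "abs (drift (Suc k) x - drift (Suc k) y) <= \<delta> * (1 + 1 + P) * a x ^ Suc k" by (simp add: algebra_simps)
  have A1: "1 <= a x ^ Suc k" using ax(1) by (rule one_le_power)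
  have r1: "integrable (U k) (\<lambda>z. (x - z) * h (x - z))" "abs (rest k x) <= \<delta> * (x * u k x) + \<delta>"
   and r2: "integrable (U k) (\<lambda>z. (y - z) * h (y - z))" "abs (rest k y) <= \<delta> * (y * u k y) + \<delta>" using x1(2) x' by auto
  have rx: "abs (rest k x) <= \<delta> * (D + 1) * a x ^ Suc k"
  proof -
   have "\<delta> * (x * u k x) + \<delta> * 1 <= \<delta> * (D * a x ^ Suc k) + \<delta> * a x ^ Suc k" using \<delta> by (intro add_mono mult_left_mono u_x A1) auto
   then show ?thesis using r1(2) by (simp add: algebra_simps)
  qed
  have ry: "abs (rest k y) <= \<delta> * (P * D + 1) * a x ^ Suc k"
  proof -
   have "\<delta> * (y * u k y) + \<delta> * 1 <= \<delta> * (D * (P * a x ^ Suc k)) + \<delta> * a x ^ Suc k"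
    using \<delta> D by (intro add_mono mult_left_mono A1 order_trans[OF u_x(2)] ay) auto
   then show ?thesis using r2(2) by (simp add: algebra_simps)
  qed
  have yx: "(y - x) * u k y <= \<delta> * (P * D) * a x ^ Suc k"
  proof -
   have "(y - x) <= \<rho> * x" using x by (simp add: algebra_simps)
   also have "... <= \<delta> * y" using \<rho> x x' by (intro mult_mono) auto
   finally have "(y - x) * u k y <= \<delta> * y * u k y" using u_nonneg by (intro mult_right_mono) auto
   also have "... = \<delta> * (y * u k y)" by simp
   also have "... <= \<delta> * (D * (P * a x ^ Suc k))" using \<delta> D by (intro mult_left_mono order_trans[OF u_x(2)] ay) auto
   finally show ?thesis by (simp add: mult_ac)
  qed
  have "x * (u k x - u k y) = (x * u k x - y * u k y) + (y - x) * u k y" by (simp add: algebra_simps)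
  also have "... = real (Suc k) * (drift (Suc k) x - drift (Suc k) y) + (rest k x - rest k y) + (y - x) * u k y"
   unfolding size_bias_U[OF k r1(1)] size_bias_U[OF k r2(1)] by (simp add: algebra_simps)
  finally have "abs (x * (u k x - u k y)) <= abs (real (Suc k) * (drift (Suc k) x - drift (Suc k) y)) + (abs (rest k x) + abs (rest k y)) + abs ((y - x) * u k y)"
   by simp
  also have "... <= real (Suc k) * (\<delta> * (1 + 1 + P) * a x ^ Suc k) + (\<delta> * (D + 1) * a x ^ Suc k + \<delta> * (P * D + 1) * a x ^ Suc k) + \<delta> * (P * D) * a x ^ Suc k"
  proof (intro add_mono rx ry)
   show "abs (real (Suc k) * (drift (Suc k) x - drift (Suc k) y)) <= real (Suc k) * (\<delta> * (1 + 1 + P) * a x ^ Suc k)"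
    unfolding abs_mult abs_of_nat by (intro mult_left_mono dr) auto
   show "abs ((y - x) * u k y) <= \<delta> * (P * D) * a x ^ Suc k" using yx x u_nonneg[of k y] by simp
  qed
  also have "... = (K * \<delta>) * a x ^ Suc k" by (simp add: K_def algebra_simps del: power_Suc)
  also have "... <= \<epsilon> * a x ^ Suc k" using ax by (intro mult_right_mono \<delta>) auto
  finally have "x * abs (u k x - u k y) <= \<epsilon> * a x ^ Suc k" by simp
  then show ?thesis using x' by (simp add: bb_def pos_le_divide_eq mult.commute)
 qed
 show "\<exists>\<rho>>0. \<exists>x0. \<forall>x y. x0 <= x --> x <= y --> y <= (1 + \<rho>) * x --> abs (u k x - u k y) <= \<epsilon> * bb k x"
  using main \<rho>(1) by blast
qed

text \<open>Start at the least K with (K + 2) \<alpha> > 1. If K > 0, minimality gives (K + 1)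
  \<alpha> <= 1; hence the low-frequency condition holds at every index up to K, and \<alpha> <=
  1/2, which makes \<open>local_cond\<close> available for the descent to 0.\<close>

lemma osc_zero: "osc 0"
proof -
 have "\<exists>k. 1 < real (k + 2) * \<alpha>"
 proof -
  obtain n where "1 < real n * \<alpha>" using reals_Archimedean3[OF alpha(1)] by blast
  moreover have "real n * \<alpha> <= real (n + 2) * \<alpha>" using alpha by simp
  ultimately show ?thesis by (intro exI[of _ n]) linarith
 qed
 define K where "K = (LEAST k. 1 < real (k + 2) * \<alpha>)"
 have K: "1 < real (K + 2) * \<alpha>" unfolding K_def by (rule LeastI_ex) fact
 show ?thesis
 proof (cases K)
  case 0
  then show ?thesis using K alpha osc_base[of 0] by simp
 next
  case (Suc K')
  have "\<not> 1 < real (K' + 2) * \<alpha>" using not_less_Least[of K' "\<lambda>k. 1 < real (k + 2) * \<alpha>"] Suc unfolding K_def by simp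
  then have le1: "real (Suc K) * \<alpha> <= 1" using Suc by simp
  have "2 * \<alpha> <= real (Suc K) * \<alpha>" using alpha Suc by simp
  then have half: "\<alpha> <= 1/2" using le1 by simp
  have lt2: "real (Suc j) * \<alpha> < 2" if "j <= K" for j
  proof -
   have "real (Suc j) * \<alpha> <= real (Suc K) * \<alpha>" using that alpha by simp
   then show ?thesis using le1 by simp
  qed
  have "osc (K - j) \<and> (\<exists>C>0. \<forall>y\<ge>1. u (K - j) y <= C * bb (K - j) y)" if "j <= K" for j using that
  proof (induction j)
   case 0
   have "osc K" using lt2[of K] K by (intro osc_base) auto
   then show ?case using osc_upper[of K] lt2[of K] by simp
  next
   case (Suc j)
   have e: "Suc (K - Suc j) = K - j" using Suc.prems by simp
   have "real (Suc (Suc (K - Suc j))) * \<alpha> < 2" using lt2[of "K - j"] unfolding e by simp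
   then show ?case using Suc descent_osc[OF half, of "K - Suc j"] descent_upper[OF half, of "K - Suc j"] unfolding e by simp
  qed
  from this[of K] show ?thesis by simp
 qed
qed

end

section \<open>Karamata's theorem and the limit of the renewal density\<close>

lemma gamma_scaled:
 assumes "0 < c" "0 < (r::real)"
 shows "integrable lborel (\<lambda>s. ind {0..} s * (exp (- c * s) * s powr (r - 1)))"
  "(LBINT s. ind {0..} s * (exp (- c * s) * s powr (r - 1))) = Gamma r * c powr (- r)"
proof -
 let ?f = "\<lambda>s::real. ind {0..} s * (exp (- s) * s powr (r - 1)) :: real"
 have eq: "NE lborel (\<lambda>s. ?f s) = ennreal (Gamma r)" using Gamma_conv_nn_integral_real[OF assms(2)] by (simp add: exp_minus field_simps)
 have int: "integrable lborel ?f" by (rule integrableI_nonneg) (auto simp: eq)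
 have val: "(LBINT s. ?f s) = Gamma r" using assms by (subst integral_eq_nn_integral) (auto simp: eq less_imp_le)
 let ?A = "\<lambda>s. exp (- c * s) * s powr (r - 1)"
 have sc: "?f (c * s) = c powr (r - 1) * (ind {0..} s * ?A s)" for s using assms by (auto simp: indicator_def powr_mult zero_le_mult_iff)
 have "integrable lborel (\<lambda>s. ?f (0 + c * s))" using int assms by (intro lborel_integrable_real_affine) auto
 then have "integrable lborel (\<lambda>s. c powr (r - 1) * (ind {0..} s * ?A s))" by (simp only: add_0_left sc)
 then show "integrable lborel (\<lambda>s. ind {0..} s * ?A s)" using assms by simp
 have "Gamma r = c * (LBINT s. ?f (0 + c * s))" using lborel_integral_real_affine[of c ?f 0] assms val by simp
 also have "... = c * (c powr (r - 1) * (LBINT s. ind {0..} s * ?A s))" by (simp only: add_0_left sc integral_mult_right_zero)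
 also have "... = c powr r * (LBINT s. ind {0..} s * ?A s)" using assms by (simp add: powr_diff)
 finally show "(LBINT s. ind {0..} s * ?A s) = Gamma r * c powr (- r)" using assms by (simp add: powr_minus)
qed

text \<open>A hat with peak at 1 + \<rho> / 2 and support [1, 1 + \<rho>]: continuous, as polynomial
  approximation demands, and Lipschitz, as the passage between \<open>U 0\<close> and its smoothing
  demands.\<close>

definition tent :: "real => real => real" where
 "tent \<rho> s = max 0 (1 - abs (s - (1 + \<rho> / 2)) * (2 / \<rho>))"

lemma tent_props:
 assumes "0 < \<rho>" "\<rho> <= 1"
 shows "0 <= tent \<rho> s" "tent \<rho> s <= 1" "tent \<rho> s \<noteq> 0 ==> 1 <= s \<and> s <= 1 + \<rho>"
  "abs (tent \<rho> s - tent \<rho> r) <= 2 / \<rho> * abs (s - r)" "continuous_on A (tent \<rho>)"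
proof -
 let ?A = "1 + \<rho> / 2"
 have p: "0 <= abs (s - ?A) * (2 / \<rho>)" using assms by simp
 show "0 <= tent \<rho> s" "tent \<rho> s <= 1" using p by (auto simp: tent_def)
 show "1 <= s \<and> s <= 1 + \<rho>" if "tent \<rho> s \<noteq> 0"
 proof -
  have "abs (s - ?A) * (2 / \<rho>) < 1" 
  proof (rule ccontr)
   assume "\<not> abs (s - ?A) * (2 / \<rho>) < 1"
   then have "max 0 (1 - abs (s - ?A) * (2 / \<rho>)) = 0" by simp
   then show False using that unfolding tent_def by simp
  qed
  then have "abs (s - ?A) < \<rho> / 2" using assms by simp
  then show ?thesis by (intro conjI) linarith+
 qed
 have lip: "abs (max 0 (1 - x) - max 0 (1 - y)) <= abs (x - y)" for x y :: real by simp
 have "\<bar>\<bar>s - ?A\<bar> * (2 / \<rho>) - \<bar>r - ?A\<bar> * (2 / \<rho>)\<bar> = \<bar>\<bar>s - ?A\<bar> - \<bar>r - ?A\<bar>\<bar> * (2 / \<rho>)"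
  unfolding left_diff_distrib[symmetric] abs_mult using assms by simp
 also have "... <= abs (s - r) * (2 / \<rho>)" using assms by (intro mult_right_mono) auto
 finally show "abs (tent \<rho> s - tent \<rho> r) <= 2 / \<rho> * abs (s - r)"
  unfolding tent_def using lip[of "abs (s - ?A) * (2 / \<rho>)" "abs (r - ?A) * (2 / \<rho>)"] by (simp only: mult.commute[of "2 / \<rho>"])
 show "continuous_on A (tent \<rho>)" unfolding tent_def[abs_def] by (intro continuous_intros)
qed

lemma tent_meas [measurable]: "tent \<rho> \<in> borel_measurable borel" unfolding tent_def[abs_def] by simp

text \<open>The Lipschitz bound with decay in s inserted: if one of the values is nonzero, s is
  within abs r of [1, 2], so 1 + abs s <= 3 * (1 + abs r). The constant 18 is 2 times 3
  squared.\<close>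

lemma tent_shift:
 assumes "0 < \<rho>" "\<rho> <= 1"
 shows "abs (tent \<rho> (s + r) - tent \<rho> s) <= 18 / \<rho> * (abs r * br r^2) * (1 / br s^2)"
proof -
 note t = tent_props[OF assms]
 have L: "abs (tent \<rho> (s + r) - tent \<rho> s) <= 2 / \<rho> * abs r" using t(4)[of "s + r" s] by simp
 show ?thesis
 proof (cases "tent \<rho> (s + r) = 0 \<and> tent \<rho> s = 0")
  case True
  then show ?thesis using assms by simp
 next
  case False
  have "1 + abs s <= 3 * br r"
  proof (cases "tent \<rho> s = 0")
   case True
   then have "1 <= s + r" "s + r <= 2" using False t(3)[of "s + r"] assms by auto
   then have "abs s <= 2 + abs r" by simp
   then show ?thesis by simp
  next
   case False
   then have "1 <= s" "s <= 2" using t(3)[of s] assms by auto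
   then show ?thesis by simp
  qed
  then have "br s^2 <= (3 * br r)^2" by simp
  then have "br s^2 <= 9 * br r^2" unfolding power_mult_distrib by simp
  moreover have "0 < br s^2" by simp
  ultimately have "1 <= 9 * br r^2 / br s^2" by simp
  then have "1 <= 9 * br r^2 * (1 / br s^2)" by simp
  then have "2 / \<rho> * abs r * 1 <= 2 / \<rho> * abs r * (9 * br r^2 * (1 / br s^2))" using assms by (intro mult_left_mono) auto
  then show ?thesis using L by simp
 qed
qed

context renewal_law
begin

lemma a_rv_gen: "0 < c ==> ((\<lambda>x. a (c * x) / a x) \<longlongrightarrow> c powr \<alpha>) at_top"
proof -
 assume c: "0 < c"
 have "((\<lambda>x. c / (m (c * x) / m x)) \<longlongrightarrow> c / c powr (1 - \<alpha>)) at_top" using c by (intro tendsto_intros m_rv) auto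
 moreover have "c / c powr (1 - \<alpha>) = c powr \<alpha>" using c by (simp add: powr_diff)
 moreover have "\<forall>\<^sub>F x in at_top. c / (m (c * x) / m x) = a (c * x) / a x" using eventually_gt_at_top[of 0]
 proof eventually_elim
  case (elim x)
  then show ?case by (simp add: renewal_scale_def)
 qed
 ultimately show ?thesis by (auto dest: tendsto_cong)
qed

lemma half_line_integrable:
 assumes "0 < c" "1 <= X"
 shows "integrable (U 0) (\<lambda>z. ind {0..} z * exp (- c * (z / X)))"
proof (rule integrableI_nonneg)
 obtain C where C: "1 <= C" "!!X. 1 <= X ==> NI (U 0) (\<lambda>z. ennreal (exp (- z / X)) * ind {0..} z) <= ennreal (C * a X ^ Suc 0)"
  using exp_U_half_line[of 0] by blast
 define Y where "Y = max 1 (X / c)"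
 let ?A = "\<lambda>z. ennreal (ind {0..} z * exp (- c * (z / X)))"
 have "NI (U 0) (\<lambda>z. ?A z) <= NI (U 0) (\<lambda>z. ennreal (exp (- z / Y)) * ind {0..} z)"
 proof (rule nn_integral_mono)
  fix z :: real
  have "z / Y <= c * (z / X)" if "0 <= z"
  proof -
   have "z / Y <= z / (X / c)" using assms that by (intro divide_left_mono) (auto simp: Y_def)
   then show ?thesis by (simp add: mult.commute)
  qed
  then show "?A z <= ennreal (exp (- z / Y)) * ind {0..} z" by (auto simp: indicator_def)
 qed
 also have "... < \<infinity>" using C(2)[of Y] by (auto simp: Y_def intro: le_less_trans)
 finally show "NI (U 0) (\<lambda>z. ?A z) < \<infinity>" .
qed (auto simp: indicator_def)

text \<open>Negative z contribute at most the constant \<open>N\<close>, negligible against a X, and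
  the argument c enters through regular variation of a.\<close>

lemma laplace_half_line:
 assumes c: "0 < c"
 shows "((\<lambda>X. (LINT z|U 0. ind {0..} z * exp (- c * (z / X))) / a X) \<longlongrightarrow> c powr (- \<alpha>) / Gamma (2 - \<alpha>)) at_top"
proof -
 define G where "G = Gamma (2 - \<alpha>)"
 have G: "0 < G" using alpha by (auto simp: G_def)
 let ?B = "NE (U 0) (\<lambda>y. exp (- \<theta> * y))"
 define N where "N = enn2real ?B"
 have N: "?B = ennreal N" "0 <= N" using neg_U[of 0] by (auto simp: N_def)
 let ?V = "\<lambda>X. 1 / (1 - L (c / X))" and ?W = "\<lambda>X. (LINT z|U 0. ind {0..} z * exp (- c * (z / X)))"
 have bounds: "?V X - N <= ?W X \<and> ?W X <= ?V X" if X: "1 <= X" "c / X <= \<theta>" for X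
 proof -
  have Lb: "0 < c / X" "L (c / X) < 1" using L_bounds[of "c / X"] X c by auto
  have V: "NE (U 0) (\<lambda>z. exp (- (c / X) * z)) = ennreal (?V X)" using exp_U[of "c / X" 0] X c by simp
  let ?A = "\<lambda>z. ennreal (ind {0..} z * exp (- c * (z / X)))"
  have W: "NI (U 0) (\<lambda>z. ?A z) = ennreal (?W X)" by (intro nn_integral_eq_integral half_line_integrable c X) auto
  have W0: "0 <= ?W X" by simp
  have "ennreal (?W X) <= ennreal (?V X)" unfolding W[symmetric] V[symmetric] by (intro nn_integral_mono) (auto)
  then have 1: "?W X <= ?V X" using Lb by simp
  have "ennreal (?V X) <= NI (U 0) (\<lambda>z. ?A z + ennreal (exp (- \<theta> * z)))" unfolding V[symmetric]
  proof (intro nn_integral_mono)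
   fix z :: real
   show "ennreal (exp (- (c / X) * z)) <= ?A z + ennreal (exp (- \<theta> * z))"
   proof (cases "0 <= z")
    case True
    then show ?thesis by simp
   next
    case False
    then have "- (c / X) * z <= - \<theta> * z" using mult_right_mono[OF X(2), of "- z"] by simp
    then show ?thesis using False by simp
   qed
  qed
  also have "... = ennreal (?W X) + ennreal N" unfolding W[symmetric] N(1)[symmetric] by (rule nn_integral_add) measurable
  also have "... = ennreal (?W X + N)" using N by simp
  finally have "?V X <= ?W X + N" using W0 N by (subst (asm) ennreal_le_iff) auto
  then show ?thesis using 1 by simp
 qed
 have ev: "\<forall>\<^sub>F X in at_top. 1 <= X \<and> c / X <= \<theta>" using eventually_ge_at_top[of 1] eventually_ge_at_top[of "c / \<theta>"]
  by eventually_elim (use theta c in \<open>auto simp: field_simps\<close>)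
 have V_lim: "((\<lambda>X. ?V X / a X) \<longlongrightarrow> c powr (- \<alpha>) / G) at_top"
 proof -
  have 1: "((\<lambda>X. a (1 / c * X) * (1 - L (1 / (1 / c * X)))) \<longlongrightarrow> G) at_top"
   unfolding G_def using c by (intro filterlim_compose[OF laplace_asymp] filterlim_tendsto_pos_mult_at_top[OF tendsto_const] filterlim_ident) auto
  have 2: "((\<lambda>X. (a (1 / c * X) / a X) / (a (1 / c * X) * (1 - L (1 / (1 / c * X))))) \<longlongrightarrow> (1 / c) powr \<alpha> / G) at_top"
   using c G by (intro tendsto_divide a_rv_gen 1) auto
  have 3: "\<forall>\<^sub>F X in at_top. (a (1 / c * X) / a X) / (a (1 / c * X) * (1 - L (1 / (1 / c * X)))) = ?V X / a X" using eventually_gt_at_top[of 0]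
  proof eventually_elim
   case (elim X)
   then show ?case using a_pos[of "1 / c * X"] c by simp
  qed
  have "(1 / c) powr \<alpha> = c powr (- \<alpha>)" by (simp add: powr_minus powr_divide inverse_eq_divide)
  then show ?thesis using 2 tendsto_cong[OF 3] by simp
 qed
 have N_lim: "((\<lambda>X. N / a X) \<longlongrightarrow> 0) at_top" by (intro tendsto_divide_0[OF tendsto_const] filterlim_at_top_imp_at_infinity a_inf)
 have low: "((\<lambda>X. ?V X / a X - N / a X) \<longlongrightarrow> c powr (- \<alpha>) / G) at_top" using tendsto_diff[OF V_lim N_lim] by simp
 show ?thesis unfolding G_def[symmetric]
 proof (rule tendsto_sandwich[OF _ _ low V_lim])
  show "\<forall>\<^sub>F X in at_top. ?V X / a X - N / a X <= ?W X / a X" using ev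
  proof eventually_elim
   case (elim X)
   then show ?case using bounds[of X] a_pos[of X] unfolding diff_divide_distrib[symmetric] by (intro divide_right_mono) auto
  qed
  show "\<forall>\<^sub>F X in at_top. ?W X / a X <= ?V X / a X" using ev
  proof eventually_elim
   case (elim X)
   then show ?case using bounds[of X] a_pos[of X] by (intro divide_right_mono) auto
  qed
 qed
qed

text \<open>Karamata's argument: approximate \<open>\<psi> s / exp (- s)\<close> by a polynomial in \<open>exp (- s)\<close>.\<close>

lemma karamata_tent:
 assumes \<rho>: "0 < \<rho>" "\<rho> <= 1"
 shows "((\<lambda>X. (LINT z|U 0. tent \<rho> (z / X)) / a X) \<longlongrightarrow>
  (LBINT s. ind {0..} s * (tent \<rho> s * s powr (\<alpha> - 1))) / (Gamma \<alpha> * Gamma (2 - \<alpha>))) at_top"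
proof -
 note t = tent_props[OF \<rho>]
 define G where "G = Gamma (2 - \<alpha>)"
 define g where "g = Gamma \<alpha>"
 have G: "0 < G" "0 < g" using alpha by (auto simp: G_def g_def intro!: Gamma_real_pos)
 let ?I = "\<lambda>q X. (LINT z|U 0. ind {0..} z * q (z / X)) / a X"
 let ?S = "\<lambda>q. (LBINT s. ind {0..} s * (q s * s powr (\<alpha> - 1))) / (g * G)"
 have tent_bound: "tent \<rho> s <= exp 2 * exp (- s)" for s
 proof (cases "tent \<rho> s = 0")
  case False
  then have "s <= 2" using t(3) \<rho> by force
  then have "1 <= exp 2 * exp (- s)" by (simp flip: exp_add)
  then show ?thesis using t(2)[of s] by simp
 qed simp
 let ?C = "\<lambda>X z. tent \<rho> (z / X)"
 have fun_eq: "(LINT z|U 0. ?C X z) / a X = ?I (tent \<rho>) X" if "0 < X" for X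
 proof -
  have "?C X z = ind {0..} z * ?C X z" for z using t(3)[of "z / X"] that by (cases "0 <= z") (force simp: divide_neg_pos)+
  then have "(LINT z|U 0. ?C X z) = (LINT z|U 0. ind {0..} z * ?C X z)" by (intro Lint_cong refl)
  then show ?thesis by simp
 qed
 have e_int: "integrable (U 0) (\<lambda>z. ind {0..} z * exp (- c * (z / X)))" if "0 < c" "1 <= X" for c X by (rule half_line_integrable[OF that])
 have t_int: "integrable (U 0) (\<lambda>z. ind {0..} z * ?C X z)" if "1 <= X" for X
 proof (rule Lint_bound)
  show "integrable (U 0) (\<lambda>z. exp 2 * (ind {0..} z * exp (- 1 * (z / X))))" using that by (intro integrable_mult_right e_int) auto
  show "AE z in U 0. norm (ind {0..} z * ?C X z) <= norm (exp 2 * (ind {0..} z * exp (- 1 * (z / X))))"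
   using tent_bound t(1) by (intro AE_I2) (auto simp: indicator_def)
 qed measurable
 let ?A = "\<lambda>s. ind {0..} s * (exp (- 1 * s) * s powr (\<alpha> - 1))"
 let ?B = "\<lambda>s. tent \<rho> s * s powr (\<alpha> - 1)"
 have ts_int: "integrable lborel (\<lambda>s. ind {0..} s * ?B s)"
 proof (rule Lint_bound)
  show "integrable lborel (\<lambda>s. exp 2 * ?A s)" using alpha by (intro integrable_mult_right gamma_scaled) auto
  show "AE s in lborel. norm (ind {0..} s * ?B s) <= norm (exp 2 * ?A s)"
   using tent_bound t(1) by (intro AE_I2) (auto simp: indicator_def abs_mult mult.assoc[symmetric] intro!: mult_right_mono)
 qed measurable
 have e_lim: "((\<lambda>X. ?I (\<lambda>s. exp (- c * s)) X) \<longlongrightarrow> ?S (\<lambda>s. exp (- c * s))) at_top" if "0 < c" for c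
  using laplace_half_line[OF that] gamma_scaled(2)[OF that alpha(1)] G unfolding G_def[symmetric] g_def[symmetric] by simp
 have "((\<lambda>X. ?I (tent \<rho>) X) \<longlongrightarrow> ?S (tent \<rho>)) at_top"
 proof (rule tendstoI)
  fix e :: real assume e: "0 < e"
  let ?E = "\<lambda>s. exp (- 1 * s)"
  define E where "E = ?S ?E + 1"
  have S1: "0 <= ?S ?E" using G by simp
  then have E: "0 < E" by (simp add: E_def)
  \<comment> \<open>Three errors of about e / 4 will be added: the polynomial approximation on
    either side and the convergence for the polynomial.\<close>
  define \<epsilon> where "\<epsilon> = e / (4 * E)"
  have \<epsilon>: "0 < \<epsilon>" "\<epsilon> * E < e / 2" using e E by (auto simp: \<epsilon>_def)
  let ?G = "\<lambda>y. tent \<rho> (- ln y)"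
  define q where "q = (\<lambda>y::real. if y <= 0 then 0 else (?G y) / y)"
  have tent2: "tent \<rho> 2 = 0" using \<rho> by (auto simp: tent_def field_simps)
  \<comment> \<open>Only 0 is critical. The hat vanishes beyond 2, so \<open>q\<close> is 0 on
    [0, exp (- 2)], and the two pieces are glued at exp (- 2).\<close>
  have q_cont: "continuous_on {0..1} q"
  proof -
   have "continuous_on ({..exp (- 2)} \<union> {exp (- 2)..}) (\<lambda>y. if y <= exp (- 2) then 0 else (?G y) / y)"
   proof (rule continuous_on_cases)
    show "continuous_on {exp (- 2)..} (\<lambda>y. ?G y / y)"
    proof (rule continuous_on_divide)
     have pos: "0 < y" if "y \<in> {exp (- 2)..}" for y :: real using that exp_gt_zero[of "- 2 :: real"] by (simp del: exp_gt_zero)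
     have "continuous_on {exp (- 2)..} (\<lambda>y::real. - ln y)" by (intro continuous_on_minus continuous_on_ln continuous_on_id) auto
     then show "continuous_on {exp (- 2)..} (\<lambda>y. ?G y)" by (rule continuous_on_compose2[OF t(5)[of UNIV]]) auto
     show "\<forall>y\<in>{exp (- 2)..}. y \<noteq> (0::real)" by auto
    qed (rule continuous_on_id)
    show "\<forall>y. y \<in> {..exp (- 2)} \<and> \<not> y <= exp (- 2) \<or> y \<in> {exp (- 2)..} \<and> y <= exp (- 2) --> 0 = ?G y / y" using tent2 by auto
   qed (auto intro: continuous_intros)
   moreover have "q y = (if y <= exp (- 2) then 0 else (?G y) / y)" for y
   proof (cases "0 < y \<and> y <= exp (- 2)")
    case True
    then have "ln y <= -2" using ln_mono[of y "exp (- 2)"] by simp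
    then have "2 <= - ln y" by simp
    then have "?G y = 0" using t(3)[of "- ln y"] \<rho> tent2 by (cases "- ln y = 2") fastforce+
    then show ?thesis by (simp add: q_def)
   next
    case False
    then have "y <= 0 \<and> y <= exp (- 2) \<or> \<not> y <= 0 \<and> \<not> y <= exp (- 2)" using exp_gt_zero[of "-2::real"] by linarith
    then show ?thesis by (auto simp: q_def)
   qed
   ultimately have "continuous_on ({..exp (- 2)} \<union> {exp (- 2)..}) q" by simp
   then show ?thesis by (rule continuous_on_subset) auto
  qed
  obtain p where p: "real_polynomial_function p" "!!y. y \<in> {0..1} ==> abs (q y - p y) < \<epsilon>"
   using Stone_Weierstrass_real_polynomial_function[OF compact_Icc q_cont \<epsilon>(1)] by blast
  obtain b n where b: "p = (\<lambda>y. \<Sum>i\<le>n. b i * y ^ i)" using p(1) unfolding real_polynomial_function_iff_sum by blast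
  define P where "P = (\<lambda>s::real. \<Sum>i\<le>n. b i * exp (- real (Suc i) * s))"
  have P_eq: "P s = exp (- s) * p (exp (- s))" for s unfolding P_def b sum_distrib_left
   by (intro sum.cong refl) (simp add: exp_of_nat_mult[symmetric] mult_exp_exp algebra_simps)
  have tP: "abs (tent \<rho> s - P s) <= \<epsilon> * exp (- 1 * s)" if "0 <= s" for s
  proof -
   have "tent \<rho> s - P s = exp (- s) * (q (exp (- s)) - p (exp (- s)))" by (simp add: P_eq q_def right_diff_distrib)
   then have "abs (tent \<rho> s - P s) = exp (- s) * abs (q (exp (- s)) - p (exp (- s)))" by (simp add: abs_mult)
   also have "... <= exp (- s) * \<epsilon>" using p(2)[of "exp (- s)"] that by simp
   finally show ?thesis by (simp add: mult.commute)
  qed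
  have P_int: "integrable (U 0) (\<lambda>z. ind {0..} z * P (z / X))" if "1 <= X" for X
  proof -
   have "integrable (U 0) (\<lambda>z. \<Sum>i\<le>n. b i * (ind {0..} z * exp (- real (Suc i) * (z / X))))"
    using that by (intro Bochner_Integration.integrable_sum integrable_mult_right e_int) auto
   moreover have "(\<Sum>i\<le>n. b i * (ind {0..} z * exp (- real (Suc i) * (z / X)))) = ind {0..} z * P (z / X)" for z
    unfolding P_def sum_distrib_left by (intro sum.cong refl) (simp only: mult_ac)
   ultimately show ?thesis by simp
  qed
  let ?D = "\<lambda>s. P s * s powr (\<alpha> - 1)"
  let ?J = "\<lambda>s. \<Sum>i\<le>n. b i * (ind {0..} s * (exp (- real (Suc i) * s) * s powr (\<alpha> - 1)))"
  have Ps_int: "integrable lborel (\<lambda>s. ind {0..} s * ?D s)"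
  proof -
   have "integrable lborel (\<lambda>s. \<Sum>i\<le>n. b i * (ind {0..} s * (exp (- real (Suc i) * s) * s powr (\<alpha> - 1))))"
    using alpha by (intro Bochner_Integration.integrable_sum integrable_mult_right gamma_scaled) auto
   moreover have "?J s = ind {0..} s * ?D s" for s unfolding P_def sum_distrib_left sum_distrib_right by (intro sum.cong refl) (simp only: mult_ac)
   ultimately show ?thesis by simp
  qed
  have P_lim: "((\<lambda>X. ?I P X) \<longlongrightarrow> ?S P) at_top"
  proof -
   let ?K = "\<Sum>i\<le>n. b i * ?S (\<lambda>s. exp (- real (Suc i) * s))"
   have "((\<lambda>X. \<Sum>i\<le>n. b i * ?I (\<lambda>s. exp (- real (Suc i) * s)) X) \<longlongrightarrow> ?K) at_top"
    by (intro tendsto_sum tendsto_mult e_lim) auto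
   moreover have "?K = ?S P"
   proof -
    have "ind {0..} s * ?D s = ?J s" for s unfolding P_def sum_distrib_left sum_distrib_right by (intro sum.cong refl) (simp only: mult_ac)
    then have "(LBINT s. ind {0..} s * ?D s) = (\<Sum>i\<le>n. b i * (LBINT s. ind {0..} s * (exp (- real (Suc i) * s) * s powr (\<alpha> - 1))))"
     using alpha gamma_scaled(1)[OF _ alpha(1)]
     by (simp only:) (subst Bochner_Integration.integral_sum, auto intro!: integrable_mult_right simp del: of_nat_Suc mult_minus_left)
    then show ?thesis by (simp add: sum_divide_distrib)
   qed
   moreover have "\<forall>\<^sub>F X in at_top. (\<Sum>i\<le>n. b i * ?I (\<lambda>s. exp (- real (Suc i) * s)) X) = ?I P X" using eventually_ge_at_top[of 1]
   proof eventually_elim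
    case (elim X)
    have "ind {0..} z * P (z / X) = (\<Sum>i\<le>n. b i * (ind {0..} z * exp (- real (Suc i) * (z / X))))" for z
     unfolding P_def sum_distrib_left by (intro sum.cong refl) (simp only: mult_ac)
    then have "(LINT z|U 0. ind {0..} z * P (z / X)) = (\<Sum>i\<le>n. b i * (LINT z|U 0. ind {0..} z * exp (- real (Suc i) * (z / X))))" using e_int[OF _ elim]
     by (simp only:) (subst Bochner_Integration.integral_sum, auto intro!: integrable_mult_right simp del: of_nat_Suc mult_minus_left)
    then show ?case by (simp add: sum_divide_distrib)
   qed
   ultimately show ?thesis by (auto dest: tendsto_cong)
  qed
  have SP: "abs (?S (tent \<rho>) - ?S P) <= \<epsilon> * ?S ?E"
  proof -
   have "abs ((LBINT s. ind {0..} s * ?B s) - (LBINT s. ind {0..} s * ?D s))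
     = abs (\<integral>s. ind {0..} s * ?B s - ind {0..} s * ?D s \<partial>lborel)" using ts_int Ps_int by simp
   also have "... <= (LBINT s. abs (ind {0..} s * ?B s - ind {0..} s * (?D s)))" by simp
   also have "... <= (LBINT s. \<epsilon> * ?A s)"
   proof (rule integral_mono)
    show "integrable lborel (\<lambda>s. abs (ind {0..} s * ?B s - ind {0..} s * (?D s)))" using ts_int Ps_int by simp
    show "integrable lborel (\<lambda>s. \<epsilon> * ?A s)" using alpha by (intro integrable_mult_right gamma_scaled) auto
    fix s :: real
    show "abs (ind {0..} s * ?B s - ind {0..} s * (?D s)) <= \<epsilon> * ?A s" using mult_right_mono[OF tP[of s], of "s powr (\<alpha> - 1)"]
     by (auto simp: indicator_def abs_mult mult.assoc simp flip: left_diff_distrib)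
   qed
   finally show ?thesis using G by (simp add: divide_right_mono flip: diff_divide_distrib)
  qed
  have IP: "abs (?I (tent \<rho>) X - ?I P X) <= \<epsilon> * ?I ?E X" if X: "1 <= X" for X
  proof -
   have aX: "0 < a X" using X by (intro a_pos) auto
   have "abs ((LINT z|U 0. ind {0..} z * ?C X z) - (LINT z|U 0. ind {0..} z * P (z / X)))
     = abs (\<integral>z. ind {0..} z * ?C X z - ind {0..} z * P (z / X) \<partial>U 0)" using t_int[OF X] P_int[OF X] by simp
   also have "... <= (LINT z|U 0. abs (ind {0..} z * ?C X z - ind {0..} z * P (z / X)))" by simp
   also have "... <= (LINT z|U 0. \<epsilon> * (ind {0..} z * exp (- 1 * (z / X))))"
   proof (rule integral_mono)
    show "integrable (U 0) (\<lambda>z. abs (ind {0..} z * ?C X z - ind {0..} z * P (z / X)))" using t_int[OF X] P_int[OF X] by simp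
    show "integrable (U 0) (\<lambda>z. \<epsilon> * (ind {0..} z * exp (- 1 * (z / X))))" using X by (intro integrable_mult_right e_int) auto
    fix z :: real
    show "abs (ind {0..} z * ?C X z - ind {0..} z * P (z / X)) <= \<epsilon> * (ind {0..} z * exp (- 1 * (z / X)))"
     using tP[of "z / X"] X by (auto simp: indicator_def)
   qed
   finally have "abs ((LINT z|U 0. ind {0..} z * ?C X z) - (LINT z|U 0. ind {0..} z * P (z / X))) <= \<epsilon> * (LINT z|U 0. ind {0..} z * exp (- 1 * (z / X)))" by simp
   from divide_right_mono[OF this, of "a X"] show ?thesis using aX by (simp add: abs_divide flip: diff_divide_distrib)
  qed
  have "\<forall>\<^sub>F X in at_top. ?I ?E X < E" using e_lim[of 1] by (intro order_tendstoD) (auto simp: E_def)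
  moreover have "\<forall>\<^sub>F X in at_top. dist (?I P X) (?S P) < e / 4" using P_lim e by (intro tendstoD) auto
  ultimately show "\<forall>\<^sub>F X in at_top. dist (?I (tent \<rho>) X) (?S (tent \<rho>)) < e" using eventually_ge_at_top[of 1]
  proof eventually_elim
   case (elim X)
   have "\<epsilon> * ?I ?E X <= \<epsilon> * E" using elim \<epsilon> by (intro mult_left_mono) auto
   moreover have "\<epsilon> * ?S ?E <= \<epsilon> * E" using \<epsilon> by (intro mult_left_mono) (auto simp: E_def)
   moreover have "\<epsilon> * E = e / 4" using E by (simp add: \<epsilon>_def)
   ultimately show ?case using IP[OF elim(3)] SP elim(2) e unfolding dist_real_def by linarith
  qed
 qed
 then show ?thesis unfolding g_def[symmetric] G_def[symmetric]
 proof (rule Lim_transform_eventually)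
  show "\<forall>\<^sub>F X in at_top. ?I (tent \<rho>) X = (LINT z|U 0. ?C X z) / a X" using eventually_gt_at_top[of 0] by eventually_elim (simp only: fun_eq)
 qed
qed

end

lemma tent_integrable: "0 < \<rho> ==> \<rho> <= 1 ==> integrable lborel (tent \<rho>)"
proof -
 assume \<rho>: "0 < \<rho>" "\<rho> <= 1"
 note t = tent_props[OF \<rho>]
 show ?thesis
 proof (rule Lint_bound[OF Icc_integrable[of 1 2]])
  have "norm (tent \<rho> s) <= norm (ind {1..2} s :: real)" for s using t(1)[of s] t(2)[of s] t(3)[of s] \<rho> by (cases "tent \<rho> s = 0") (auto)
  then show "AE s in lborel. norm (tent \<rho> s) <= norm (ind {1..2} s :: real)" by simp
 qed measurable
qed

lemma tent_integral_pos:
 assumes \<rho>: "0 < \<rho>" "\<rho> <= 1"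
 shows "0 < (LBINT s. tent \<rho> s)"
proof -
 note t = tent_props[OF \<rho>]
 have "1 / 2 * (\<rho> / 2) = (LBINT s. 1 / 2 * ind {1 + \<rho> / 4..1 + 3 * \<rho> / 4} s)" using \<rho> by simp
 also have "... <= (LBINT s. tent \<rho> s)"
 proof (rule integral_mono)
  show "integrable lborel (\<lambda>s. 1 / 2 * ind {1 + \<rho> / 4..1 + 3 * \<rho> / 4} s :: real)" by (intro integrable_mult_right Icc_integrable)
  fix s :: real
  show "1 / 2 * ind {1 + \<rho> / 4..1 + 3 * \<rho> / 4} s <= tent \<rho> s"
  proof (cases "s \<in> {1 + \<rho> / 4..1 + 3 * \<rho> / 4}")
   case True
   then have "abs (s - (1 + \<rho> / 2)) <= \<rho> / 4" unfolding atLeastAtMost_iff by linarith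
   then have "abs (s - (1 + \<rho> / 2)) * (2 / \<rho>) <= 1 / 2" using \<rho> by simp
   then show ?thesis using True by (simp add: tent_def)
  qed (use t in simp)
 qed (rule tent_integrable[OF \<rho>])
 finally show ?thesis using \<rho> by simp
qed

text \<open>On the support of the hat the weight s powr (\<alpha> - 1) lies between 1 - \<rho> and
  1.\<close>

lemma tent_power_integral:
 assumes \<rho>: "0 < \<rho>" "\<rho> <= 1" and \<alpha>: "0 <= \<alpha>" "\<alpha> <= 1"
 shows "abs ((LBINT s. ind {0..} s * (tent \<rho> s * s powr (\<alpha> - 1))) - (LBINT s. tent \<rho> s)) <= \<rho> * (LBINT s. tent \<rho> s)"
proof -
 note t = tent_props[OF \<rho>]
 let ?A = "\<lambda>s. tent \<rho> s * s powr (\<alpha> - 1)"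
 have bnd: "(1 - \<rho>) * tent \<rho> s <= ind {0..} s * ?A s \<and>
   ind {0..} s * ?A s <= tent \<rho> s" for s
 proof (cases "tent \<rho> s = 0")
  case False
  then have s: "1 <= s" "s <= 1 + \<rho>" using t(3) by auto
  have "s powr (\<alpha> - 1) <= s powr 0" using s \<alpha> by (intro powr_mono) auto
  then have 1: "s powr (\<alpha> - 1) <= 1" using s by simp
  have "s powr (-1) <= s powr (\<alpha> - 1)" using s \<alpha> by (intro powr_mono) auto
  then have 2: "1 / s <= s powr (\<alpha> - 1)" using s by simp
  have "(1 - \<rho>) * s <= (1 - \<rho>) * (1 + \<rho>)" using s \<rho> by (intro mult_left_mono) auto
  also have "... <= 1" by (simp add: algebra_simps)
  finally have "1 - \<rho> <= 1 / s" using s by (simp add: pos_le_divide_eq)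
  then have 3: "1 - \<rho> <= s powr (\<alpha> - 1)" using 2 by simp
  show ?thesis using mult_left_mono[OF 1 t(1)[of s]] mult_left_mono[OF 3 t(1)[of s]] s by (simp add: mult.commute)
 qed simp
 have int: "integrable lborel (\<lambda>s. ind {0..} s * ?A s)"
 proof (rule Lint_bound[OF tent_integrable[OF \<rho>]])
  show "AE s in lborel. norm (ind {0..} s * ?A s) <= norm (tent \<rho> s)"
  proof (rule AE_I2)
   fix s
   have "0 <= ind {0..} s * ?A s" using t(1)[of s] by simp
   then show "norm (ind {0..} s * ?A s) <= norm (tent \<rho> s)" using bnd[of s] by simp
  qed
 qed measurable
 have "(LBINT s. ind {0..} s * ?A s) <= (LBINT s. tent \<rho> s)" using bnd by (intro integral_mono int tent_integrable \<rho>) auto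
 moreover have "(LBINT s. (1 - \<rho>) * tent \<rho> s) <= (LBINT s. ind {0..} s * ?A s)"
  using bnd by (intro integral_mono int integrable_mult_right tent_integrable \<rho>) auto
 moreover have "0 <= (LBINT s. tent \<rho> s)" using t by simp
 ultimately show ?thesis using \<rho> mult_nonneg_nonneg[OF less_imp_le[OF \<rho>(1)] \<open>0 \<le> (LBINT s. tent \<rho> s)\<close>] left_diff_distrib[of 1 \<rho> "\<integral>s. tent \<rho> s \<partial>lborel"]
  by simp
qed

context renewal_kernel
begin

text \<open>By Fubini the integral against \<open>u 0\<close> is the \<open>U 0\<close>-integral of
  the hat smoothed by \<open>h\<close> on scale 1 / X. \<open>tent_shift\<close> bounds the change
  by O(1 / X) times a quadratic weight, whose \<open>U 0\<close>-integral is O(a X).\<close>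

lemma tent_swap:
 assumes \<rho>: "0 < \<rho>" "\<rho> <= 1"
 shows "\<exists>C>0. \<forall>X\<ge>1. integrable lborel (\<lambda>s. tent \<rho> (s / X) * u 0 s) \<and>
  abs ((LBINT s. tent \<rho> (s / X) * u 0 s) - (LINT z|U 0. tent \<rho> (z / X))) <= C * a X / X"
proof -
 note t = tent_props[OF \<rho>]
 have k0: "real (Suc 0) * \<alpha> < 2" using alpha by simp
 obtain C1 where C1: "0 < C1" "!!X. 1 <= X ==> NE (U 0) (\<lambda>z. 1 / (1 + abs z / X) ^ 2) <= ennreal (C1 * a X ^ Suc 0)" using U_quadratic_decay[OF k0] by blast
 define J where "J = (LBINT v. 1 / (1 + abs (v::real)) ^ 2)"
 have J: "0 <= J" unfolding J_def by simp
 define K where "K = 18 / \<rho> * H * J"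
 have K: "0 <= K" using \<rho> H_nonneg J by (simp add: K_def)
 let ?A = "\<lambda>X z. tent \<rho> (z / X)"
 let ?G = "\<lambda>X. integrable lborel (\<lambda>s. tent \<rho> (s / X) * u 0 s)"
 have main: "?G X \<and>
   abs ((LBINT s. tent \<rho> (s / X) * u 0 s) - (LINT z|U 0. ?A X z)) <= K * C1 * a X / X" if X: "1 <= X" for X
 proof -
  define w where "w = (\<lambda>z. 1 / (1 + abs z / X) ^ 2)"
  have [measurable]: "w \<in> borel_measurable borel" unfolding w_def by simp
  have w0: "0 <= w z" for z unfolding w_def by simp
  have w_int: "integrable (U 0) w" using C1(2)[OF X] by (intro integrableI_nonneg) (auto simp: w_def intro: le_less_trans)
  have w_val: "(LINT z|U 0. w z) <= C1 * a X"
  proof -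
   have "ennreal (LINT z|U 0. w z) <= ennreal (C1 * a X)" using C1(2)[OF X] nn_integral_eq_integral[OF w_int AE_I2[OF w0]] by (simp add: w_def)
   then show ?thesis using C1 a_pos[of X] X by simp
  qed
  let ?I = "\<lambda>v z. tent \<rho> ((z + v) / X)"
  define p where "p = (\<lambda>z. LBINT v. ?I v z * h v)"
  have p_int: "integrable lborel (\<lambda>v. ?I v z * h v)" for z
  proof (rule Lint_bound[OF h_integrable])
   show "AE v in lborel. norm (?I v z * h v) <= norm (h v)" using t(1,2) by (auto simp: abs_mult intro!: mult_left_le_one_le)
  qed measurable
  have [measurable]: "p \<in> borel_measurable borel" unfolding p_def by simp
  have p0: "0 <= p z" for z unfolding p_def using t(1) h_nonneg by simp
  have close: "abs (p z - (?A X z)) <= K / X * w z" for z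
  proof -
   have "abs (p z - (?A X z)) = abs (LBINT v. ?I v z * h v - ?A X z * h v)" unfolding p_def using p_int h_integrable by (simp add: h_integral)
   also have "... <= (LBINT v. abs ((?I v z) * h v - ?A X z * h v))" by simp
   also have "... <= (LBINT v. 18 / \<rho> * H / X * w z * (1 / br v ^ 2))"
   proof (rule integral_mono)
    show "integrable lborel (\<lambda>v. abs ((?I v z) * h v - ?A X z * h v))" using p_int h_integrable by simp
    show "integrable lborel (\<lambda>v. 18 / \<rho> * H / X * w z * (1 / br v ^ 2))" by (intro integrable_mult_right integrable_rational_decay)
    fix v :: real
    let ?E = "1 + abs (v / X)"
    have "abs (v / X) * ?E^2 <= br v / X * br v^2"
    proof (intro mult_mono power_mono)
     show "abs (v / X) <= br v / X" using X by (simp add: abs_divide divide_right_mono)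
     have "abs (v / X) <= abs v" using X by (simp add: abs_divide divide_le_eq mult_left_mono[of 1 X "abs v", simplified])
     then show "1 + abs (v / X) <= 1 + abs v" by simp
    qed (use X in auto)
    also have "... = br v ^ 3 / X" by (simp add: power3_eq_cube power2_eq_square)
    finally have 1: "abs (v / X) * ?E^2 <= br v ^ 3 / X" .
    have 2: "h v * br v ^ 3 <= H * (1 / br v ^ 2)" using h_le[of 5 v] by (auto simp: field_simps)
    have "abs ((?I v z) * h v - ?A X z * h v) = abs (tent \<rho> (z / X + v / X) - (?A X z)) * h v"
     using h_nonneg[of v] by (simp add: add_divide_distrib abs_mult flip: left_diff_distrib)
    also have "... <= (18 / \<rho> * (abs (v / X) * ?E^2) * (1 / (1 + abs (z / X))^2)) * h v" by (intro mult_right_mono tent_shift \<rho> h_nonneg)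
    also have "... = (abs (v / X) * ?E^2) * (18 / \<rho> * w z * h v)" using X by (simp only: w_def abs_divide abs_of_nonneg[of X] mult_ac)
    also have "... <= (br v ^ 3 / X) * (18 / \<rho> * w z * h v)" using \<rho> w0 h_nonneg by (intro mult_right_mono 1) auto
    also have "... = 18 / \<rho> / X * w z * (h v * br v ^ 3)" by (simp add: mult_ac)
    also have "... <= 18 / \<rho> / X * w z * (H * (1 / br v ^ 2))" using \<rho> w0 X by (intro mult_left_mono 2) auto
    finally show "abs ((?I v z) * h v - ?A X z * h v) <= 18 / \<rho> * H / X * w z * (1 / br v ^ 2)" by (simp add: mult_ac)
   qed
   also have "... = K / X * w z" unfolding K_def J_def integral_mult_right_zero by simp
   finally show ?thesis .
  qed
  have tw: "?A X z <= 9 * w z" for z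
  proof (cases "?A X z = 0")
   case False
   then have "1 <= z / X" "z / X <= 2" using t(3)[of "z / X"] \<rho> by auto
   then have "abs z / X <= 2" "0 <= abs z / X" using X by auto
   then have "(1 + abs z / X)^2 <= 3^2" "0 < (1 + abs z / X)^2" by (intro power_mono zero_less_power; linarith)+
   then have "1 <= 9 * w z" unfolding w_def by simp
   then show ?thesis using t(2)[of "z / X"] by simp
  qed (use w0 in simp)
  have t_int: "integrable (U 0) (\<lambda>z. ?A X z)"
  proof (rule Lint_bound)
   show "integrable (U 0) (\<lambda>z. 9 * w z)" using w_int by simp
   show "AE z in U 0. norm (?A X z) <= norm (9 * w z)" using tw t(1) w0 by simp
  qed measurable
  have pU: "integrable (U 0) p"
  proof (rule Lint_bound)
   show "integrable (U 0) (\<lambda>z. (9 + K / X) * w z)" using w_int by simp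
   show "AE z in U 0. norm (p z) <= norm ((9 + K / X) * w z)"
   proof (rule AE_I2)
    fix z
    have "p z <= (9 + K / X) * w z" using close[of z] tw[of z] by (simp add: distrib_right)
    then show "norm (p z) <= norm ((9 + K / X) * w z)" using p0[of z] by simp
   qed
  qed measurable
  let ?C = "NE (U 0) p"
  let ?D = "NE lborel (\<lambda>s. tent \<rho> (s / X) * u 0 s)"
  have nn: "?D = ?C"
  proof -
   interpret pair_sigma_finite lborel "U 0" ..
   let ?B = "\<lambda>s z. ennreal (tent \<rho> (s / X) * h (s - z))"
   have "?D = NI lborel (\<lambda>s. NI (U 0) (\<lambda>z. ?B s z))" using t(1) h_nonneg u_nonneg
    by (intro nn_integral_cong) (simp add: ennreal_mult u_nn[OF k0, symmetric] nn_integral_cmult)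
   also have "... = NI (U 0) (\<lambda>z. NI lborel (\<lambda>s. ?B s z))" by (rule Fubini'[symmetric]) measurable
   also have "... = ?C"
   proof (rule nn_integral_cong)
    fix z :: real
    let ?J = "NI lborel (\<lambda>s. ?B s z)"
    have "?J = NE lborel (\<lambda>v. ?I v z * h v)" using nn_integral_real_affine[of "\<lambda>s. ?B s z" 1 z] by simp
    also have "... = ennreal (p z)" unfolding p_def using t(1) h_nonneg by (intro nn_integral_eq_integral p_int) auto
    finally show "?J = ennreal (p z)" .
   qed
   finally show ?thesis .
  qed
  have nn2: "?C = ennreal (LINT z|U 0. p z)" using p0 by (intro nn_integral_eq_integral pU) auto
  have A_int: "?G X" using nn nn2 t(1) u_nonneg by (intro integrableI_nonneg) auto
  have A_eq: "(LBINT s. tent \<rho> (s / X) * u 0 s) = (LINT z|U 0. p z)" using nn nn2 t(1) u_nonneg p0 by (subst integral_eq_nn_integral) (auto)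
  have "abs ((LINT z|U 0. p z) - (LINT z|U 0. ?A X z)) = abs (\<integral>z. p z - ?A X z \<partial>U 0)" using pU t_int by simp
  also have "... <= (LINT z|U 0. abs (p z - (?A X z)))" by simp
  also have "... <= (LINT z|U 0. K / X * w z)" using close by (intro integral_mono integrable_mult_right w_int integrable_abs Lintable_diff pU t_int) auto
  also have "... = K / X * (LINT z|U 0. w z)" by simp
  also have "... <= K / X * (C1 * a X)" using K X by (intro mult_left_mono w_val) auto
  finally show ?thesis using A_int A_eq by simp
 qed
 have "K * C1 * a X / X <= (K * C1 + 1) * a X / X" if "1 <= X" for X using that a_pos[of X] by (intro divide_right_mono mult_right_mono) auto
 moreover have "0 < K * C1 + 1" using K C1(1) by (simp add: add_nonneg_pos)
 ultimately show ?thesis using main by (intro exI[of _ "K * C1 + 1"]) (auto intro: order_trans)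
qed

text \<open>Slow oscillation replaces u 0 X by its average against the hat over [X, (1 + \<rho>) X],
  with error \<epsilon> / m X. The averages converge by \<open>karamata_tent\<close>, to a limit
  within relative error \<rho> of the claimed constant.\<close>

theorem renewal_density_limit: "((\<lambda>x. m x * u 0 x) \<longlongrightarrow> 1 / (Gamma \<alpha> * Gamma (2 - \<alpha>))) at_top"
proof (rule tendstoI)
 fix e :: real assume e: "0 < e"
 define D where "D = 1 / (Gamma \<alpha> * Gamma (2 - \<alpha>))"
 have D: "0 < D" using alpha unfolding D_def by simp
 \<comment> \<open>Oscillation, convergence and the width of the hat cost \<epsilon>, \<epsilon> and
   \<epsilon> * D, in total e / 2.\<close>
 define \<epsilon> where "\<epsilon> = e / (2 * (2 + D))"
 have \<epsilon>: "0 < \<epsilon>" using e D by (simp add: \<epsilon>_def)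
 have \<epsilon>2: "\<epsilon> * (2 + D) = e / 2" using D by (simp add: \<epsilon>_def field_simps)
 obtain \<rho>0 x0 where osc: "0 < \<rho>0" "!!x y. x0 <= x ==> x <= y ==> y <= (1 + \<rho>0) * x ==> abs (u 0 x - u 0 y) <= \<epsilon> * bb 0 x"
  using osc_zero \<epsilon> unfolding osc_def by blast
 define \<rho> where "\<rho> = min \<rho>0 (min 1 \<epsilon>)"
 have \<rho>: "0 < \<rho>" "\<rho> <= 1" "\<rho> <= \<rho>0" "\<rho> <= \<epsilon>" using osc(1) \<epsilon> by (auto simp: \<rho>_def)
 note t = tent_props[OF \<rho>(1,2)]
 define I where "I = (LBINT s. tent \<rho> s)"
 have I: "0 < I" unfolding I_def by (rule tent_integral_pos[OF \<rho>(1,2)])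
 define J where "J = (LBINT s. ind {0..} s * (tent \<rho> s * s powr (\<alpha> - 1)))"
 have J: "abs (J - I) <= \<rho> * I" unfolding I_def J_def using alpha by (intro tent_power_integral \<rho>) auto
 let ?B = "\<lambda>X. LINT z|U 0. tent \<rho> (z / X)"
 let ?C = "\<lambda>X s. tent \<rho> (s / X)"
 obtain C where C: "0 < C" "!!X. 1 <= X ==> integrable lborel (\<lambda>s. ?C X s * u 0 s)"
  "!!X. 1 <= X ==> abs ((LBINT s. ?C X s * u 0 s) - (?B X)) <= C * a X / X" using tent_swap[OF \<rho>(1,2)] by blast
 let ?A = "\<lambda>X. (LBINT s. ?C X s * u 0 s)"
 have A_lim: "((\<lambda>X. ?A X / a X) \<longlongrightarrow> J * D) at_top"
 proof -
  have 1: "((\<lambda>X. ?B X / a X) \<longlongrightarrow> J * D) at_top" using karamata_tent[OF \<rho>(1,2)] by (simp add: J_def D_def)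
  have "((\<lambda>X. ?A X / a X - ?B X / a X) \<longlongrightarrow> 0) at_top"
  proof (rule Lim_null_comparison)
   show "((\<lambda>X. C / X) \<longlongrightarrow> 0) at_top" by (intro tendsto_divide_0[OF tendsto_const] filterlim_at_top_imp_at_infinity filterlim_ident)
   show "\<forall>\<^sub>F X in at_top. norm (?A X / a X - ?B X / a X) <= C / X" using eventually_ge_at_top[of 1]
   proof eventually_elim
    case (elim X)
    have aX: "0 < a X" using elim by (intro a_pos) auto
    have "norm (?A X / a X - ?B X / a X) = abs (?A X - (?B X)) / a X" using aX by (simp add: abs_divide flip: diff_divide_distrib)
    also have "... <= (C * a X / X) / a X" using aX by (intro divide_right_mono C(3) elim) auto
    finally show ?case using aX by simp
   qed
  qed
  from tendsto_add[OF this 1] show ?thesis by simp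
 qed
 have near: "abs (?A X / a X / I - m X * u 0 X) <= \<epsilon>" if X: "1 <= X" "x0 <= X" for X
 proof -
  have aX: "0 < a X" "0 < m X" using X by (auto intro: a_pos m_pos)
  have ti: "integrable lborel (\<lambda>s. ?C X s)" using lborel_integrable_real_affine[OF tent_integrable[OF \<rho>(1,2)], of "1 / X" 0] X by simp
  have tI: "(LBINT s. ?C X s) = X * I" using lborel_integral_real_affine[of "1 / X" "tent \<rho>" 0] X by (simp add: I_def field_simps)
  have "abs (?A X - u 0 X * (X * I)) = abs (?A X - (LBINT s. ?C X s * u 0 X))" using tI by (simp add: mult.commute)
  also have "... = abs (\<integral>s. ?C X s * u 0 s - ?C X s * u 0 X \<partial>lborel)" using C(2)[OF X(1)] ti by simp
  also have "... <= (LBINT s. abs ((?C X s) * u 0 s - ?C X s * u 0 X))" by simp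
  also have "... <= (LBINT s. ?C X s * (\<epsilon> * bb 0 X))"
  proof (rule integral_mono)
   show "integrable lborel (\<lambda>s. abs ((?C X s) * u 0 s - ?C X s * u 0 X))" using C(2)[OF X(1)] ti by simp
   show "integrable lborel (\<lambda>s. ?C X s * (\<epsilon> * bb 0 X))" using ti by simp
   fix s :: real
   show "abs ((?C X s) * u 0 s - ?C X s * u 0 X) <= ?C X s * (\<epsilon> * bb 0 X)"
   proof (cases "?C X s = 0")
    case False
    then have "1 <= s / X" "s / X <= 1 + \<rho>" using t(3)[of "s / X"] by auto
    then have s: "X <= s" "s <= (1 + \<rho>) * X" using X by (auto simp: field_simps)
    have "(1 + \<rho>) * X <= (1 + \<rho>0) * X" using X \<rho> by simp
    then have "abs (u 0 X - u 0 s) <= \<epsilon> * bb 0 X" using s X by (intro osc(2)) linarith+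
    from mult_left_mono[OF this t(1)[of "s / X"]] show ?thesis using t(1)[of "s / X"] by (simp add: abs_mult abs_minus_commute flip: right_diff_distrib)
   qed simp
  qed
  also have "... = X * I * (\<epsilon> * bb 0 X)" using tI by simp
  also have "... = \<epsilon> * I * a X" using X by (simp add: bb_def)
  finally have "abs (?A X - u 0 X * (X * I)) / (a X * I) <= \<epsilon> * I * a X / (a X * I)" using aX I by (intro divide_right_mono) auto
  moreover have "abs (?A X / a X / I - m X * u 0 X) = abs (?A X - u 0 X * (X * I)) / (a X * I)"
  proof -
   have "?A X / a X / I - m X * u 0 X = (?A X - u 0 X * (X * I)) / (a X * I)" using aX I X by (simp add: renewal_scale_def field_simps)
   then show ?thesis using aX I by simp
  qed
  ultimately show ?thesis using aX I by simp
 qed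
 have lim2: "((\<lambda>X. ?A X / a X / I) \<longlongrightarrow> J * D / I) at_top" using I by (intro tendsto_divide A_lim tendsto_const) auto
 have JD: "abs (J * D / I - D) <= \<epsilon> * D"
 proof -
  have "abs (J * D / I - D) = abs (J - I) * (D / I)"
  proof -
   have "J * D / I - D = (J - I) * (D / I)" using I by (simp add: field_simps)
   then show ?thesis using I D by (simp add: abs_mult)
  qed
  also have "... <= (\<rho> * I) * (D / I)" using J I D by (intro mult_right_mono) auto
  also have "... <= \<epsilon> * D" using D \<rho> by simp
  finally show ?thesis .
 qed
 show "\<forall>\<^sub>F x in at_top. dist (m x * u 0 x) (1 / (Gamma \<alpha> * Gamma (2 - \<alpha>))) < e"
  using eventually_ge_at_top[of 1] eventually_ge_at_top[of x0] tendstoD[OF lim2 \<epsilon>]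
 proof eventually_elim
  case (elim X)
  have tri: "abs (p - q) <= \<epsilon> ==> abs (r - D) <= k ==> abs (p - r) < \<epsilon> ==> abs (q - D) < \<epsilon> + \<epsilon> + k" for p q r k :: real by simp
  have "abs (m X * u 0 X - D) < \<epsilon> + \<epsilon> + \<epsilon> * D" by (rule tri[OF near[OF elim(1,2)] JD elim(3)[unfolded dist_real_def]])
  also have "... = \<epsilon> * (2 + D)" by (simp add: algebra_simps)
  also have "... < e" using \<epsilon>2 e by simp
  finally show ?case by (simp add: dist_real_def D_def)
 qed
qed

end

section \<open>Implicit renewal equations\<close>

context renewal_law
begin

lemma nn_integral_U_renewal:
 assumes [measurable]: "\<phi> \<in> borel_measurable borel"
 shows "NI (U 0) \<phi> = \<phi> 0 + NI F (\<lambda>w. NI (U 0) (\<lambda>y. \<phi> (w + y)))"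
proof -
 have w: "weight 0 n = 1" for n by (simp add: weight_def)
 have [measurable]: "(\<lambda>x. NI (Fn n) (\<lambda>z. \<phi> (x + z))) \<in> borel_measurable F" for n
 proof -
  interpret P: prob_space "Fn n" by (rule prob_Fn)
  show ?thesis by simp
 qed
 have "NI (U 0) \<phi> = (\<Sum>n. NI (Fn n) \<phi>)" by (simp add: nn_integral_U w)
 also have "... = NI (Fn 0) \<phi> + (\<Sum>n. NI (Fn (Suc n)) (\<lambda>y. \<phi> y))" using suminf_offset[of "\<lambda>n. NI (Fn n) \<phi>" 1] by simp
 also have "... = \<phi> 0 + (\<Sum>n. NI F (\<lambda>w. NI (Fn n) (\<lambda>z. \<phi> (w + z))))" by (simp add: nn_integral_Fn_0 nn_integral_Fn_Suc del: Fn.simps)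
 also have "(\<Sum>n. NI F (\<lambda>w. NI (Fn n) (\<lambda>z. \<phi> (w + z)))) = NI F (\<lambda>w. (\<Sum>n. NI (Fn n) (\<lambda>z. \<phi> (w + z))))"
  by (rule nn_integral_suminf[symmetric]) measurable
 also have "... = NI F (\<lambda>w. NI (U 0) (\<lambda>y. \<phi> (w + y)))" by (simp add: nn_integral_U w)
 finally show ?thesis .
qed

lemma m_lipschitz: "0 <= x ==> 0 <= y ==> m x <= m y + abs (x - y)"
proof -
 assume xy: "0 <= x" "0 <= y"
 have "m x <= (LINT z|F. min (abs z) y + abs (x - y))" unfolding trunc_mean_def using xy by (intro integral_mono Lintable_add integrable_min) (auto)
 then show ?thesis using xy using prob_space by (simp add: trunc_mean_def integrable_min)
qed

text \<open>The truncated mean is 1-Lipschitz and tends to infinity.\<close>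

lemma m_shift: "((\<lambda>s. m (s + c) / m s) \<longlongrightarrow> 1) at_top"
proof -
 have "((\<lambda>s. m (s + c) / m s - 1) \<longlongrightarrow> 0) at_top"
 proof (rule Lim_null_comparison)
  show "((\<lambda>s. abs c / m s) \<longlongrightarrow> 0) at_top" by (intro tendsto_divide_0[OF tendsto_const] filterlim_at_top_imp_at_infinity m_inf)
  show "\<forall>\<^sub>F s in at_top. norm (m (s + c) / m s - 1) <= abs c / m s" using eventually_gt_at_top[of 0] eventually_ge_at_top[of "- c"]
  proof eventually_elim
   case (elim s)
   have "m (s + c) <= m s + abs c" "m s <= m (s + c) + abs c" using m_lipschitz[of "s + c" s] m_lipschitz[of s "s + c"] elim by auto
   then have "abs (m (s + c) - m s) <= abs c" by simp
   moreover have "m (s + c) / m s - 1 = (m (s + c) - m s) / m s" using m_pos[of s] elim by (simp add: diff_divide_distrib)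
   ultimately show ?case using m_pos[of s] elim by (simp add: abs_divide divide_right_mono)
  qed
 qed
 from tendsto_add[OF this tendsto_const[of 1]] show ?thesis by simp
qed

end

context renewal_kernel
begin

text \<open>The domination for the limit of m s * u 0 (s - v). If s - v >= 1, the loss m s / m (s -
  v) is at most 1 + abs v / m 1; otherwise m s <= s <= 1 + abs v. This linear growth in v explains
  the weight \<open>br v\<close> demanded of defects.\<close>

lemma u_bounds: "\<exists>C>0. (\<forall>x. u 0 x <= C) \<and> (\<forall>s\<ge>1. \<forall>v. m s * u 0 (s - v) <= C * br v)"
proof -
 have k0: "real (Suc 0) * \<alpha> < 2" using alpha by simp
 obtain C1 where C1: "0 < C1" "!!x. 1 <= x ==> u 0 x <= C1 * bb 0 x" using osc_upper[OF k0 osc_zero] by blast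
 have up: "u 0 x <= C1 / m x" if "1 <= x" for x using C1(2)[OF that] that by (simp add: bb_def renewal_scale_def)
 obtain C2 where C2: "0 < C2" "!!x. u 0 x <= C2 * br x^2" using u_crude[OF k0] by blast
 obtain C3 where C3: "0 < C3" "!!y. y <= 0 ==> u 0 y <= C3 / br y ^ 4" using u_neg_bound[OF k0] by blast
 have m1: "0 < m 1" by (intro m_pos) auto
 define K where "K = C1 / m 1 + 4 * C2 + C3"
 have K0: "0 < C1 / m 1" "0 < K" using C1 C2 C3 m1 by (auto simp: K_def intro!: add_pos_pos)
 have K: "u 0 x <= K" for x
 proof (cases "1 <= x")
  case True
  have "C1 / m x <= C1 / m 1" using True C1 m1 m_mono[of 1 x] m_pos[of x] by (intro divide_left_mono) auto
  then show ?thesis using up[OF True] C2 C3 by (simp add: K_def)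
 next
  case False
  show ?thesis
  proof (cases "0 <= x")
   case True
   have "br x^2 <= 2^2" using True False by (intro power_mono) auto
   then have "C2 * br x^2 <= C2 * 4" using C2 by simp
   then show ?thesis using C2(2)[of x] K0 C3 by (simp add: K_def)
  next
   case False
   have "C3 / br x ^ 4 <= C3 / 1" using C3 by (intro divide_left_mono) auto
   then show ?thesis using C3(2)[of x] False K0 C2 by (simp add: K_def)
  qed
 qed
 define C where "C = K + C1 + C1 / m 1"
 have C: "0 < C" "K <= C" "C1 <= C" "C1 / m 1 <= C" using K0 C1 by (auto simp: C_def)
 have "m s * u 0 (s - v) <= C * br v" if s: "1 <= s" for s v
 proof (cases "1 <= s - v")
  case True
  have p: "0 < m (s - v)" "m 1 <= m (s - v)" using True by (auto intro: m_pos m_mono)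
  have ms: "m s <= m (s - v) + abs v" using m_lipschitz[of s "s - v"] s True by simp
  have "m s * u 0 (s - v) <= (m (s - v) + abs v) * (C1 / m (s - v))" using p by (intro mult_mono ms up True u_nonneg) auto
  also have "... = C1 + C1 / m (s - v) * abs v" using p by (simp add: field_simps)
  also have "... <= C + C * abs v"
  proof (intro add_mono mult_right_mono C)
   have "C1 / m (s - v) <= C1 / m 1" using C1 m1 p by (intro divide_left_mono) auto
   then show "C1 / m (s - v) <= C" using C by simp
  qed simp
  finally show ?thesis by (simp add: distrib_left)
 next
  case False
  then have "m s <= 1 + abs v" using m_le[of s] s by simp
  then have "m s * u 0 (s - v) <= br v * K" by (intro mult_mono K u_nonneg) auto
  also have "... <= br v * C" by (intro mult_left_mono C) auto
  finally show ?thesis by (simp add: mult.commute)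
 qed
 then show ?thesis using C K by (intro exI[of _ C]) (auto intro: order_trans)
qed

lemma smoothing_swap:
 assumes [measurable]: "p \<in> borel_measurable borel" and p: "!!x. 0 <= p x"
 shows "NI lborel (\<lambda>x. ennreal (h (s - x)) * NE (U 0) (\<lambda>y. p (x - y))) = NE lborel (\<lambda>v. p v * u 0 (s - v))"
proof -
 interpret pair_sigma_finite lborel "U 0" ..
 have k0: "real (Suc 0) * \<alpha> < 2" using alpha by simp
 let ?A = "\<lambda>x y. ennreal (h (s - x) * p (x - y))"
 have "NI lborel (\<lambda>x. ennreal (h (s - x)) * NE (U 0) (\<lambda>y. p (x - y)))
   = NI lborel (\<lambda>x. NI (U 0) (\<lambda>y. ?A x y))" using h_nonneg p by (intro nn_integral_cong) (simp add: ennreal_mult nn_integral_cmult)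
 also have "... = NI (U 0) (\<lambda>y. NI lborel (\<lambda>x. ?A x y))" by (rule Fubini'[symmetric]) measurable
 also have "... = NI (U 0) (\<lambda>y. NE lborel (\<lambda>v. p v * h (s - v - y)))"
 proof (rule nn_integral_cong)
  fix y :: real
  show "NI lborel (\<lambda>x. ?A x y) = NE lborel (\<lambda>v. p v * h (s - v - y))"
   using nn_integral_real_affine[of "\<lambda>x. ?A x y" 1 y] by (simp add: algebra_simps)
 qed
 also have "... = NI lborel (\<lambda>v. NE (U 0) (\<lambda>y. p v * h (s - v - y)))" by (rule Fubini') measurable
 also have "... = NE lborel (\<lambda>v. p v * u 0 (s - v))" using h_nonneg p u_nonneg by (intro nn_integral_cong) (simp add: ennreal_mult nn_integral_cmult u_nn[OF k0])
 finally show ?thesis .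
qed

end

text \<open>Modelled on exp (\<kappa> * s) times a tail probability. \<open>f_growth\<close> says
  that exp (- \<kappa> * s) * f s is nonincreasing, the regularity by which smoothing is undone;
  \<open>f_exp\<close> makes the integral of \<open>f\<close> against \<open>U 0\<close>
  finite.\<close>

locale implicit_renewal = renewal_law +
 fixes f :: "real => real" and \<kappa> C \<beta> :: real
 assumes f_meas [measurable]: "f \<in> borel_measurable borel" and f_nonneg: "!!s. 0 <= f s" and kappa: "0 < \<kappa>"
  and f_growth: "!!s t. s <= t ==> f t <= exp (\<kappa> * (t - s)) * f s"
  and \<beta>: "0 < \<beta>" "\<beta> <= \<theta>" and f_exp: "!!s. f s <= C * exp (\<beta> * s)"
  and defect_integrable: "integrable lborel (\<lambda>v. (f v - (LINT w|F. f (v - w))) * br v)"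
begin

definition Tf :: "real => real" where "Tf s = (LINT w|F. f (s - w))"

definition d :: "real => real" where "d s = f s - Tf s"

lemma C_nonneg: "0 <= C" using f_nonneg[of 0] f_exp[of 0] by simp

lemma Tf_integrable: "integrable F (\<lambda>w. f (s - w))"
proof (rule Lint_bound)
 show "integrable F (\<lambda>w. C * exp (\<beta> * s) * exp (- \<beta> * w))" using \<beta> by (intro integrable_mult_right exp_int) auto
 show "AE w in F. norm (f (s - w)) <= norm (C * exp (\<beta> * s) * exp (- \<beta> * w))"
  using f_exp[of "s - _"] f_nonneg C_nonneg by (auto simp: abs_mult mult.assoc mult_exp_exp right_diff_distrib)
qed measurable

lemma Tf_meas [measurable]: "Tf \<in> borel_measurable borel" unfolding Tf_def[abs_def] by simp

lemma d_meas [measurable]: "d \<in> borel_measurable borel" unfolding d_def[abs_def] by simp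

lemma Tf_nonneg: "0 <= Tf s" unfolding Tf_def using f_nonneg by simp

lemma d_integrable: "integrable lborel (\<lambda>v. d v * br v)" "integrable lborel d"
proof -
 show 1: "integrable lborel (\<lambda>v. d v * br v)" using defect_integrable by (simp add: d_def Tf_def)
 show "integrable lborel d"
 proof (rule Lint_bound[OF 1])
  show "AE v in lborel. norm (d v) <= norm (d v * br v)"
  proof (rule AE_I2)
   fix v
   have "abs (d v) * 1 <= abs (d v) * br v" by (intro mult_left_mono) auto
   then show "norm (d v) <= norm (d v * br v)" by simp
  qed
 qed measurable
qed

text \<open>\<open>U 0\<close> is the point mass at 0 plus its convolution with \<open>F\<close>, so
  the integrals of \<open>f\<close> and \<open>Tf\<close> against it differ by f s. Both are finite,
  hence can be cancelled, and no convergence of iterates of \<open>Tf\<close> to 0 has to be shown.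
  Splitting the defect into its two signs keeps all integrals nonnegative.\<close>

lemma renewal_equation:
 "NE (U 0) (\<lambda>y. f (s - y)) < \<infinity>"
 "ennreal (f s) + NE (U 0) (\<lambda>y. max (- d (s - y)) 0) = NE (U 0) (\<lambda>y. max (d (s - y)) 0)"
proof -
 interpret pair_sigma_finite F "U 0" ..
 let ?B = "\<lambda>y. ennreal (f (s - y))"
 let ?C = "NI (U 0) (\<lambda>y. ?B y)"
 let ?E = "\<lambda>y. ennreal (Tf (s - y))"
 have fU: "?C = ennreal (f s) + NI (U 0) (\<lambda>y. ?E y)"
 proof -
  let ?D = "NI F (\<lambda>w. NE (U 0) (\<lambda>y. f (s - (w + y))))"
  have "?C = ennreal (f s) + ?D" using nn_integral_U_renewal[of "\<lambda>y. ?B y"] by simp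
  also have "?D = NI (U 0) (\<lambda>y. NE F (\<lambda>w. f (s - (w + y))))" by (rule Fubini'[symmetric]) measurable
  also have "... = NI (U 0) (\<lambda>y. ?E y)"
  proof (rule nn_integral_cong)
   fix y
   have "NE F (\<lambda>w. f (s - y - w)) = ?E y" unfolding Tf_def using f_nonneg by (intro nn_integral_eq_integral Tf_integrable) auto
   then show "NE F (\<lambda>w. f (s - (w + y))) = ?E y" by (simp add: algebra_simps)
  qed
  finally show ?thesis .
 qed
 have "?C <= NI (U 0) (\<lambda>y. ennreal (C * exp (\<beta> * s)) * ennreal (exp (- \<beta> * y)))"
  using f_exp[of "s - _"] C_nonneg by (intro nn_integral_mono) (auto simp: ennreal_mult[symmetric] mult.assoc mult_exp_exp right_diff_distrib)
 also have "... = ennreal (C * exp (\<beta> * s)) * NE (U 0) (\<lambda>y. exp (- \<beta> * y))" by (rule nn_integral_cmult) measurable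
 also have "... < \<infinity>" using exp_U[OF \<beta>, of 0] by (simp add: ennreal_mult_less_top)
 finally show fin: "?C < \<infinity>" .
 let ?T = "NI (U 0) (\<lambda>y. ?E y)"
 have Tfin: "?T \<noteq> \<top>" using fU fin by auto
 let ?A = "NE (U 0) (\<lambda>y. max (d (s - y)) 0)"
 have "?A + ?T = NI (U 0) (\<lambda>y. ennreal (max (d (s - y)) 0) + ?E y)" by (rule nn_integral_add[symmetric]) measurable
 also have "... = NI (U 0) (\<lambda>y. ?B y + ennreal (max (- d (s - y)) 0))"
  using f_nonneg Tf_nonneg by (intro nn_integral_cong) (auto simp: d_def max_def simp flip: ennreal_plus)
 also have "... = ?C + NE (U 0) (\<lambda>y. max (- d (s - y)) 0)" by (rule nn_integral_add) measurable
 also have "... = ?T + (ennreal (f s) + NE (U 0) (\<lambda>y. max (- d (s - y)) 0))" unfolding fU by simp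
 finally have "?T + ?A = ?T + (ennreal (f s) + NE (U 0) (\<lambda>y. max (- d (s - y)) 0))" by simp
 then show "ennreal (f s) + NE (U 0) (\<lambda>y. max (- d (s - y)) 0) = ?A" using Tfin by simp
qed

text \<open>Fubini moves the smoothing from \<open>f\<close> to the renewal measure:
  \<open>f\<close> smoothed by \<open>h\<close> is the convolution of \<open>d\<close> with
  \<open>u 0\<close>. Then \<open>renewal_density_limit\<close> gives the pointwise limit and
  \<open>u_bounds\<close> the domination.\<close>

lemma smoothed_limit:
 assumes ker: "band_kernel h g T H"
 shows "integrable lborel (\<lambda>v. h v * f (s - v))"
  and "((\<lambda>s. m s * (LBINT v. h v * f (s - v))) \<longlongrightarrow> (LBINT v. d v) / (Gamma \<alpha> * Gamma (2 - \<alpha>))) at_top"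
proof -
 interpret K: renewal_kernel F \<alpha> \<theta> h g T H by unfold_locales (rule ker)
 obtain B where B: "0 < B" "!!x. K.u 0 x <= B" "!!s v. 1 <= s ==> m s * K.u 0 (s - v) <= B * br v" using K.u_bounds by blast
 let ?p = "\<lambda>v. max (d v) 0" and ?n = "\<lambda>v. max (- d v) 0"
 have int: "integrable lborel (\<lambda>v. q v * K.u 0 (s - v))" if q: "!!v. 0 <= q v \<and> q v <= abs (d v)" "q \<in> borel_measurable borel" for q s
 proof (rule Lint_bound)
  show "integrable lborel (\<lambda>v. B * d v)" using d_integrable by simp
  show "AE v in lborel. norm (q v * K.u 0 (s - v)) <= norm (B * d v)"
  proof (rule AE_I2)
   fix v
   have "q v * K.u 0 (s - v) <= abs (d v) * B" using q(1)[of v] B K.u_nonneg by (intro mult_mono) auto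
   then show "norm (q v * K.u 0 (s - v)) <= norm (B * d v)" using q(1)[of v] B K.u_nonneg[of 0 "s - v"] by (simp add: abs_mult mult.commute)
  qed
  show "(\<lambda>v. q v * K.u 0 (s - v)) \<in> borel_measurable lborel" using q(2) by simp
 qed
 have p_int: "integrable lborel (\<lambda>v. ?p v * K.u 0 (s - v))" for s by (intro int) auto
 have n_int: "integrable lborel (\<lambda>v. ?n v * K.u 0 (s - v))" for s by (intro int) auto
 let ?E = "\<lambda>s. LBINT x. h (s - x) * f x"
 have eq: "integrable lborel (\<lambda>x. h (s - x) * f x) \<and> ?E s = (LBINT v. d v * K.u 0 (s - v))" for s
 proof -
  let ?A = "NE lborel (\<lambda>x. h (s - x) * f x)"
  let ?C = "NE lborel (\<lambda>v. ?n v * K.u 0 (s - v))"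
  let ?J = "\<lambda>x. NE (U 0) (\<lambda>y. ?n (x - y))"
  have "?A + ?C
    = ?A + NI lborel (\<lambda>x. ennreal (h (s - x)) * ?J x)" by (subst K.smoothing_swap) auto
  also have "... = NI lborel (\<lambda>x. ennreal (h (s - x) * f x) + ennreal (h (s - x)) * ?J x)" by (rule nn_integral_add[symmetric]) measurable
  also have "... = NI lborel (\<lambda>x. ennreal (h (s - x)) * NE (U 0) (\<lambda>y. ?p (x - y)))"
   by (intro nn_integral_cong) (simp only: ennreal_mult[OF K.h_nonneg f_nonneg] renewal_equation(2)[symmetric] distrib_left)
  also have "... = NE lborel (\<lambda>v. ?p v * K.u 0 (s - v))" by (subst K.smoothing_swap) auto
  finally have E: "?A + ?C = NE lborel (\<lambda>v. ?p v * K.u 0 (s - v))" .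
  let ?G = "LBINT v. ?p v * K.u 0 (s - v)"
  have P: "NE lborel (\<lambda>v. ?p v * K.u 0 (s - v)) = ennreal ?G" using K.u_nonneg by (intro nn_integral_eq_integral p_int) auto
  let ?I = "LBINT v. ?n v * K.u 0 (s - v)"
  have N: "?C = ennreal ?I" using K.u_nonneg by (intro nn_integral_eq_integral n_int) auto
  have fi: "integrable lborel (\<lambda>x. h (s - x) * f x)" using E P K.h_nonneg f_nonneg by (intro integrableI_nonneg) (auto simp: less_top[symmetric])
  have Fv: "?A = ennreal (?E s)" using K.h_nonneg f_nonneg by (intro nn_integral_eq_integral fi) auto
  have "ennreal (?E s + ?I) = ennreal ?G" using E unfolding P N Fv using K.h_nonneg f_nonneg K.u_nonneg by simp
  then have "?E s + ?I = ?G" using K.h_nonneg f_nonneg K.u_nonneg by (subst (asm) ennreal_inj) (auto intro!: integral_nonneg_AE add_nonneg_nonneg)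
  moreover have "(LBINT v. d v * K.u 0 (s - v)) = (LBINT v. ?p v * K.u 0 (s - v) - ?n v * K.u 0 (s - v))" by (intro Lint_cong) (auto simp: max_def)
  ultimately show ?thesis using fi p_int n_int by simp
 qed
 have flip: "integrable lborel (\<lambda>v. h v * f (s - v))" "(LBINT v. h v * f (s - v)) = ?E s" for s
  using lborel_integrable_real_affine[of "\<lambda>x. h (s - x) * f x" "-1" s] lborel_integral_real_affine[of "-1" "\<lambda>x. h (s - x) * f x" s] eq[of s] by auto
 show "integrable lborel (\<lambda>v. h v * f (s - v))" by (rule flip)
 let ?B = "Gamma \<alpha> * Gamma (2 - \<alpha>)"
 have lim: "((\<lambda>s. m s * K.u 0 (s - v)) \<longlongrightarrow> 1 / ?B) at_top" for v
 proof -
  have "((\<lambda>s. m (s + - v) / m s) \<longlongrightarrow> 1) at_top" by (rule m_shift)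
  moreover have "((\<lambda>s. m (s - v) * K.u 0 (s - v)) \<longlongrightarrow> 1 / ?B) at_top" by (rule filterlim_compose[OF K.renewal_density_limit]) real_asymp
  ultimately have "((\<lambda>s. m (s - v) * K.u 0 (s - v) / (m (s + - v) / m s)) \<longlongrightarrow> 1 / ?B / 1) at_top" by (intro tendsto_divide) auto
  moreover have "\<forall>\<^sub>F s in at_top. m (s - v) * K.u 0 (s - v) / (m (s + - v) / m s) = m s * K.u 0 (s - v)" using eventually_gt_at_top[of v]
  proof eventually_elim
   case (elim s)
   then show ?case using m_pos[of "s - v"] by simp
  qed
  ultimately show ?thesis by (auto dest: tendsto_cong)
 qed
 let ?D = "\<lambda>s v. m s * K.u 0 (s - v)"
 have "((\<lambda>s. \<integral>v. d v * ?D s v \<partial>lborel) \<longlongrightarrow> (LBINT v. d v * (1 / ?B))) at_top"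
 proof (rule integral_dominated_convergence_at_top)
  show "integrable lborel (\<lambda>v. abs (B * (d v * br v)))" using d_integrable by simp
  show "AE v in lborel. ((\<lambda>s. d v * ?D s v) \<longlongrightarrow> d v * (1 / ?B)) at_top" by (intro AE_I2 tendsto_mult tendsto_const lim)
  show "\<forall>\<^sub>F s in at_top. AE v in lborel. norm (d v * ?D s v) <= abs (B * (d v * br v))" using eventually_ge_at_top[of 1]
  proof eventually_elim
   case (elim s)
   show ?case
   proof (rule AE_I2)
    fix v
    have "0 <= m s * K.u 0 (s - v)" using m_nonneg[of s] elim K.u_nonneg by simp
    then have "norm (d v * ?D s v) = abs (d v) * ?D s v" by (simp only: abs_mult[of "d v"] real_norm_def)
    also have "... <= abs (d v) * (B * br v)" by (intro mult_left_mono B(3) elim) auto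
    also have "... = abs (B * (d v * br v))" using B(1) by (simp add: abs_mult)
    finally show "norm (d v * ?D s v) <= abs (B * (d v * br v))" .
   qed
  qed
 qed measurable
 moreover have "(LBINT v. d v * ?D s v) = m s * (LBINT v. h v * f (s - v))" for s unfolding flip(2) using eq[of s] by (simp add: mult.left_commute)
 ultimately show "((\<lambda>s. m s * (LBINT v. h v * f (s - v))) \<longlongrightarrow> (LBINT v. d v) / ?B) at_top" by simp
qed

end

context implicit_renewal
begin

text \<open>Otherwise \<open>d\<close> vanishes almost everywhere, and so does \<open>f\<close>, its
  convolution with \<open>U 0\<close>. But by \<open>f_growth\<close> the function \<open>f\<close>
  is nonzero on the whole half-line left of s0.\<close>

lemma defect_integral_pos:
 assumes d0: "!!s. 0 <= d s" and s0: "0 < f s0"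
 shows "0 < (LBINT v. d v)"
proof (rule ccontr)
 interpret pair_sigma_finite lborel "U 0" ..
 assume "\<not> 0 < (LBINT v. d v)"
 moreover have "0 <= (LBINT v. d v)" using d0 by simp
 ultimately have "AE v in lborel. d v = 0" using integral_nonneg_eq_0_iff_AE[OF d_integrable(2)] d0 by (metis AE_I2 order.not_eq_order_implies_strict)
 then have z: "NE lborel d = 0" by (subst nn_integral_0_iff_AE) auto
 let ?A = "NE lborel f"
 have "?A = NI lborel (\<lambda>s. NE (U 0) (\<lambda>y. d (s - y)))" using renewal_equation(2) d0 by simp
 also have "... = NI (U 0) (\<lambda>y. NE lborel (\<lambda>s. d (s - y)))" by (rule Fubini'[symmetric]) measurable
 also have "... = NI (U 0) (\<lambda>y. 0)"
 proof (rule nn_integral_cong)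
  fix y :: real
  show "NE lborel (\<lambda>s. d (s - y)) = 0" using nn_integral_real_affine[of "\<lambda>s. ennreal (d s)" 1 "- y"] z by simp
 qed
 finally have "?A = 0" by simp
 then have "AE s in lborel. f s = 0" using f_nonneg by (subst (asm) nn_integral_0_iff_AE) (auto simp: ennreal_eq_0_iff antisym elim!: eventually_mono)
 moreover have "f s \<noteq> 0" if "s <= s0" for s using f_growth[OF that] s0 by auto
 ultimately have "AE s in lborel. \<not> s <= s0" by auto
 then have "emeasure lborel {..s0} = 0" by (subst (asm) AE_iff_measurable[OF _ refl]) (auto simp: atMost_def)
 then have "emeasure lborel {s0 - 1..s0} = 0" by (rule emeasure_eq_0[rotated]) auto
 then show False by simp
qed

abbreviation S :: "(real => real) => real => real" where "S h s \<equiv> (LBINT v. h v * f (s - v))"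

definition \<gamma> :: real where "\<gamma> = (LBINT v. d v) / (Gamma \<alpha> * Gamma (2 - \<alpha>))"

lemma smoothed_shift:
 assumes ker: "band_kernel h g T H"
 shows "((\<lambda>s. m s * S h (s + c)) \<longlongrightarrow> \<gamma>) at_top"
proof -
 have "((\<lambda>s. m (s + c) * S h (s + c)) \<longlongrightarrow> \<gamma>) at_top"
  unfolding \<gamma>_def by (rule filterlim_compose[OF smoothed_limit(2)[OF ker]]) real_asymp
 from tendsto_divide[OF this m_shift[of c]]
 have "((\<lambda>s. m (s + c) * S h (s + c) / (m (s + c) / m s)) \<longlongrightarrow> \<gamma>) at_top" by simp
 moreover have "\<forall>\<^sub>F s in at_top. m (s + c) * S h (s + c) / (m (s + c) / m s) = m s * S h (s + c)" using eventually_gt_at_top[of "- c"]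
 proof eventually_elim
  case (elim s)
  then show ?case using m_pos[of "s + c"] by simp
 qed
 ultimately show ?thesis by (auto dest: tendsto_cong)
qed

text \<open>By \<open>f_growth\<close> the values of \<open>f\<close> at most 2 \<eta> to the left
  of s are at least exp (- 2 * \<kappa> * \<eta>) * f s, and \<open>h\<close> centred at s - \<eta>
  puts mass at least 1 - \<eta> there.\<close>

lemma upper_estimate:
 assumes \<eta>: "0 < \<eta>"
 shows "\<forall>\<^sub>F s in at_top. (1 - \<eta>) * exp (- 2 * \<kappa> * \<eta>) * (m s * f s) <= \<gamma> + \<eta>"
proof -
 obtain h g T H where ker: "band_kernel h g T H" and tail: "(LBINT v. h v * ind {v. \<eta> < abs v} v) <= \<eta>" using band_kernel_exists[OF \<eta>] by blast
 interpret K: renewal_kernel F \<alpha> \<theta> h g T H by unfold_locales (rule ker)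
 have ii: "integrable lborel (\<lambda>v. h v * ind {v. \<eta> < abs v} v)" by (rule Lint_bound[OF K.h_integrable]) (auto simp: indicator_def)
 let ?A = "exp (- 2 * \<kappa> * \<eta>)"
 have low: "(1 - \<eta>) * ?A * f s <= S h (s - \<eta>)" for s
 proof -
  have "(1 - \<eta>) * (?A * f s) <= (LBINT v. h v - h v * ind {v. \<eta> < abs v} v) * (?A * f s)"
   using tail K.h_integrable ii K.h_integral f_nonneg by (intro mult_right_mono) auto
  also have "... = (LBINT v. (h v - h v * ind {v. \<eta> < abs v} v) * (?A * f s))" by simp
  also have "... <= S h (s - \<eta>)"
  proof (rule integral_mono)
   show "integrable lborel (\<lambda>v. (h v - h v * ind {v. \<eta> < abs v} v) * (?A * f s))" using K.h_integrable ii by simp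
   let ?B = "\<lambda>v. s - \<eta> - v"
   show "integrable lborel (\<lambda>v. h v * f (?B v))" by (rule smoothed_limit(1)[OF ker])
   fix v
   show "(h v - h v * ind {v. \<eta> < abs v} v) * (?A * f s) <= h v * f (?B v)"
   proof (cases "\<eta> < abs v")
    case False
    have "f s <= exp (\<kappa> * (s - ?B v)) * f (?B v)" using False by (intro f_growth) auto
    also have "... <= exp (2 * \<kappa> * \<eta>) * f (?B v)" using False kappa f_nonneg by (intro mult_right_mono) (auto)
    finally have "?A * f s <= ?A * (exp (2 * \<kappa> * \<eta>) * f (?B v))" by simp
    then have "?A * f s <= f (?B v)" by (simp add: mult.assoc[symmetric] mult_exp_exp)
    then show ?thesis using False K.h_nonneg[of v] by (simp add: mult_left_mono)
   qed (use K.h_nonneg f_nonneg in simp)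
  qed
  finally show ?thesis by simp
 qed
 have "\<forall>\<^sub>F s in at_top. m s * S h (s + - \<eta>) < \<gamma> + \<eta>" using smoothed_shift[OF ker, of "- \<eta>"] \<eta> by (intro order_tendstoD) auto
 then show ?thesis using eventually_ge_at_top[of 0]
 proof eventually_elim
  case (elim s)
  have "m s * ((1 - \<eta>) * ?A * f s) <= m s * S h (s - \<eta>)" using elim by (intro mult_left_mono low m_nonneg) auto
  then show ?case using elim(1) by (simp add: mult_ac)
 qed
qed

lemma f_bound: "\<exists>K>0. \<exists>t1\<ge>1. (\<forall>s. f s <= K) \<and> (\<forall>t\<ge>t1. f t <= K / m t)"
proof -
 define c where "c = (1 - 1/2) * exp (- 2 * \<kappa> * (1/2))"
 have c: "0 < c" by (simp add: c_def)
 obtain t0 where t0: "!!s. t0 <= s ==> c * (m s * f s) <= \<gamma> + 1/2" using upper_estimate[of "1/2"] unfolding c_def eventually_at_top_linorder by auto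
 define t1 where "t1 = max t0 1"
 have t1: "1 <= t1" "t0 <= t1" by (auto simp: t1_def)
 have m1: "0 < m t1" using t1 by (intro m_pos) auto
 define K0 where "K0 = abs (\<gamma> + 1/2) / c"
 have K0: "0 <= K0" using c by (simp add: K0_def)
 have up: "f t <= K0 / m t" if "t1 <= t" for t
 proof -
  have "m t * f t <= K0" using t0[of t] that t1 c by (simp add: K0_def pos_le_divide_eq mult_ac)
  then show ?thesis using m_pos[of t] that t1 by (simp add: pos_le_divide_eq mult.commute)
 qed
 define K where "K = K0 + K0 / m t1 + C * exp (\<beta> * t1) + 1"
 have p: "0 <= K0 / m t1" "0 <= C * exp (\<beta> * t1)" using K0 m1 C_nonneg by auto
 have "f s <= K" for s
 proof (cases "t1 <= s")
  case True
  have "K0 / m s <= K0 / m t1" using m1 m_mono[of t1 s] True t1 K0 by (intro divide_left_mono mult_pos_pos) auto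
  then show ?thesis using up[OF True] p K0 by (simp add: K_def)
 next
  case False
  have "C * exp (\<beta> * s) <= C * exp (\<beta> * t1)" using False \<beta> C_nonneg by (intro mult_left_mono) auto
  then show ?thesis using f_exp[of s] p K0 by (simp add: K_def)
 qed
 moreover have "f t <= K / m t" if "t1 <= t" for t
 proof -
  have "K0 / m t <= K / m t" using m_pos[of t] that t1 p by (intro divide_right_mono) (auto simp: K_def)
  then show ?thesis using up[OF that] by simp
 qed
 ultimately show ?thesis using p K0 t1 by (intro exI[of _ K] conjI exI[of _ t1]) (auto simp: K_def)
qed

text \<open>Here the part of \<open>h\<close> away from its centre must be bounded from above. For v
  <= s / 2 this uses \<open>f_bound\<close>, which rests on the upper estimate with \<eta> = 1/2;
  for v > s / 2 it uses the decay of \<open>h\<close>.\<close>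

lemma lower_estimate:
 "\<exists>K>0. \<forall>\<eta>>0. \<forall>\<^sub>F s in at_top. \<gamma> - \<eta> <= exp (2 * \<kappa> * \<eta>) * (m s * f s) + K * \<eta> + \<eta>"
proof -
 obtain K t1 where K: "0 < K" "1 <= t1" "!!s. f s <= K" "!!t. t1 <= t ==> f t <= K / m t" using f_bound by blast
 let ?A = "\<lambda>\<eta>. exp (2 * \<kappa> * \<eta>)"
 have main: "\<forall>\<^sub>F s in at_top. \<gamma> - \<eta> <= ?A \<eta> * (m s * f s) + 2 * K * \<eta> + \<eta>" if \<eta>: "0 < \<eta>" for \<eta>
 proof -
  obtain h g T H where ker: "band_kernel h g T H" and tail: "(LBINT v. h v * ind {v. \<eta> < abs v} v) <= \<eta>" using band_kernel_exists[OF \<eta>] by blast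
  interpret K: renewal_kernel F \<alpha> \<theta> h g T H by unfold_locales (rule ker)
  have ii: "integrable lborel (\<lambda>v. h v * ind {v. \<eta> < abs v} v)" by (rule Lint_bound[OF K.h_integrable]) (auto simp: indicator_def)
  define J where "J = (LBINT v. 1 / (1 + abs (v::real)) ^ 2)"
  have J: "0 <= J" unfolding J_def by simp
  have up: "S h (s + \<eta>) <= ?A \<eta> * f s + 2 * K / m s * \<eta> + K * H * 4 / s^2 * J" if s: "2 * t1 <= s" for s
  proof -
   have s0: "2 <= s" using s K by simp
   have ms: "0 < m s" using s0 by (intro m_pos) auto
   have "S h (s + \<eta>) <= (LBINT v. ?A \<eta> * f s * h v + 2 * K / m s * (h v * ind {v. \<eta> < abs v} v) + K * H * 4 / s^2 * (1 / br v ^ 2))"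
   proof (rule integral_mono)
    let ?B = "\<lambda>v. s + \<eta> - v"
    show "integrable lborel (\<lambda>v. h v * f (?B v))" by (rule smoothed_limit(1)[OF ker])
    show "integrable lborel (\<lambda>v. ?A \<eta> * f s * h v + 2 * K / m s * (h v * ind {v. \<eta> < abs v} v) + K * H * 4 / s^2 * (1 / br v ^ 2))"
     by (intro Lintable_add integrable_mult_right K.h_integrable ii integrable_rational_decay)
    fix v :: real
    have n1: "0 <= ?A \<eta> * f s * h v" using f_nonneg K.h_nonneg by simp
    have n2: "0 <= 2 * K / m s * (h v * ind {v. \<eta> < abs v} v)" using K ms K.h_nonneg by simp
    have n3: "0 <= K * H * 4 / s^2 * (1 / br v ^ 2)" using K K.H_nonneg by simp
    consider "abs v <= \<eta>" | "\<eta> < abs v" "v <= s / 2" | "s / 2 < v" by linarith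
    then have "h v * f (?B v) <= ?A \<eta> * f s * h v \<or> h v * f (?B v) <= 2 * K / m s * (h v * ind {v. \<eta> < abs v} v) \<or>
      h v * f (?B v) <= K * H * 4 / s^2 * (1 / br v ^ 2)"
    proof cases
     case 1
     have "f (?B v) <= exp (\<kappa> * (s + \<eta> - v - s)) * f s" using 1 by (intro f_growth) auto
     also have "... <= ?A \<eta> * f s" using 1 kappa f_nonneg by (intro mult_right_mono) (auto)
     finally show ?thesis using K.h_nonneg[of v] mult_left_mono by (fastforce simp: mult.commute)
    next
     case 2
     have t: "s / 2 <= s + \<eta> - v" "t1 <= s / 2" using 2 \<eta> s by auto
     have "m s <= 2 * m (s / 2)" using m_scale[of 2 "s / 2"] s0 by simp
     also have "... <= 2 * m (?B v)" using t s0 by (intro mult_left_mono m_mono) auto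
     finally have "K / m (?B v) <= K / (m s / 2)" using ms K by (intro divide_left_mono) (auto intro!: mult_pos_pos)
     then have "f (?B v) <= 2 * K / m s" using K(4)[OF order_trans[OF t(2,1)]] by (simp add: mult.commute)
     from mult_left_mono[OF this K.h_nonneg[of v]] show ?thesis using 2 by (simp add: mult.commute)
    next
     case 3
     have "(s / 2)^2 <= br v^2" using 3 s0 by simp
     then have "1 / br v^2 <= 4 / s^2" using s0 by (simp add: field_simps)
     then have "1 / br v^2 * (1 / br v^2) <= 4 / s^2 * (1 / br v^2)" by (intro mult_right_mono) auto
     then have "H * (1 / br v ^ 4) <= H * (4 / s^2 * (1 / br v^2))" using K.H_nonneg by (intro mult_left_mono) (auto simp flip: power_add)
     then have "h v <= H * (4 / s^2 * (1 / br v^2))" using K.h_le_div[of 4 v] by simp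
     then have "h v * f (?B v) <= H * (4 / s^2 * (1 / br v^2)) * K" using K K.H_nonneg f_nonneg by (intro mult_mono) auto
     then show ?thesis by (simp add: mult_ac)
    qed
    then show "h v * f (?B v) <= ?A \<eta> * f s * h v + 2 * K / m s * (h v * ind {v. \<eta> < abs v} v) + K * H * 4 / s^2 * (1 / br v ^ 2)" using n1 n2 n3 by auto
   qed
   also have "... = ?A \<eta> * f s + 2 * K / m s * (LBINT v. h v * ind {v. \<eta> < abs v} v) + K * H * 4 / s^2 * J"
   proof -
    note int = K.h_integrable ii integrable_rational_decay
    show ?thesis by (subst Bochner_Integration.integral_add, (intro Lintable_add integrable_mult_right int)+)+
      (simp only: integral_mult_right_zero K.h_integral J_def)
   qed
   also have "... <= ?A \<eta> * f s + 2 * K / m s * \<eta> + K * H * 4 / s^2 * J" using tail K ms by (intro add_mono mult_left_mono order.refl) auto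
   finally show ?thesis .
  qed
  have "\<forall>\<^sub>F s in at_top. \<gamma> - \<eta> < m s * S h (s + \<eta>)" using smoothed_shift[OF ker, of \<eta>] \<eta> by (intro order_tendstoD) auto
  moreover have "\<forall>\<^sub>F s in at_top. K * H * 4 * J / s < \<eta>"
  proof (rule order_tendstoD)
   show "((\<lambda>s. K * H * 4 * J / s) \<longlongrightarrow> 0) at_top" by (intro tendsto_divide_0[OF tendsto_const] filterlim_at_top_imp_at_infinity filterlim_ident)
  qed (rule \<eta>)
  ultimately show ?thesis using eventually_ge_at_top[of "2 * t1"]
  proof eventually_elim
   case (elim s)
   have s0: "2 <= s" using elim K by simp
   have ms: "0 < m s" "m s <= s" using s0 by (auto intro: m_pos m_le)
   have "m s * S h (s + \<eta>) <= m s * (?A \<eta> * f s + 2 * K / m s * \<eta> + K * H * 4 / s^2 * J)" using ms by (intro mult_left_mono up elim) auto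
   also have "... = ?A \<eta> * (m s * f s) + 2 * K * \<eta> + m s * (K * H * 4 / s^2 * J)" using ms by (simp add: distrib_left)
   also have "m s * (K * H * 4 / s^2 * J) <= s * (K * H * 4 / s^2 * J)" using ms K K.H_nonneg J by (intro mult_mono) auto
   also have "s * (K * H * 4 / s^2 * J) = K * H * 4 * J / s" by (simp add: power2_eq_square)
   finally show ?case using elim by simp
  qed
 qed
 show ?thesis using main K by (intro exI[of _ "2 * K"]) auto
qed

theorem implicit_renewal_limit:
 "((\<lambda>s. m s * f s) \<longlongrightarrow> (LBINT v. d v) / (Gamma \<alpha> * Gamma (2 - \<alpha>))) at_top" unfolding \<gamma>_def[symmetric]
proof (rule order_tendstoI)
 fix y assume y: "\<gamma> < y"
 let ?A = "\<lambda>\<eta>. (1 - \<eta>) * exp (- 2 * \<kappa> * \<eta>)"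
 have "((\<lambda>\<eta>. (\<gamma> + \<eta>) / ?A \<eta>) \<longlongrightarrow> \<gamma>) (at_right 0)" by (auto intro!: tendsto_eq_intros)
 then have "\<forall>\<^sub>F \<eta> in at_right 0. (\<gamma> + \<eta>) / ?A \<eta> < y \<and> \<eta> < 1 \<and> 0 < \<eta>"
  using y by (intro eventually_conj order_tendstoD eventually_at_rightI[of 0 1]) auto
 then obtain \<eta> where \<eta>: "(\<gamma> + \<eta>) / ?A \<eta> < y" "\<eta> < 1" "0 < \<eta>" using eventually_happens'[OF trivial_limit_at_right_real] by blast
 have c: "0 < (1 - \<eta>) * exp (- 2 * \<kappa> * \<eta>)" using \<eta> by simp
 show "\<forall>\<^sub>F s in at_top. m s * f s < y" using upper_estimate[OF \<eta>(3)]
 proof eventually_elim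
  case (elim s)
  then have "m s * f s <= (\<gamma> + \<eta>) / ?A \<eta>" using c by (simp only: pos_le_divide_eq mult.commute)
  then show ?case using \<eta> by simp
 qed
next
 fix y assume y: "y < \<gamma>"
 let ?C = "\<lambda>\<eta>. exp (2 * \<kappa> * \<eta>)"
 obtain K where K: "0 < K" "!!\<eta>. 0 < \<eta> ==> \<forall>\<^sub>F s in at_top. \<gamma> - \<eta> <= ?C \<eta> * (m s * f s) + K * \<eta> + \<eta>"
  using lower_estimate by blast
 let ?B = "\<lambda>\<eta>. \<gamma> - \<eta> - K * \<eta> - \<eta>"
 have "((\<lambda>\<eta>. ?B \<eta> / ?C \<eta>) \<longlongrightarrow> \<gamma>) (at_right 0)" by (auto intro!: tendsto_eq_intros)
 then have "\<forall>\<^sub>F \<eta> in at_right 0. y < ?B \<eta> / ?C \<eta> \<and> 0 < \<eta>"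
  using y by (intro eventually_conj order_tendstoD eventually_at_rightI[of 0 1]) auto
 then obtain \<eta> where \<eta>: "y < ?B \<eta> / ?C \<eta>" "0 < \<eta>" using eventually_happens'[OF trivial_limit_at_right_real] by blast
 show "\<forall>\<^sub>F s in at_top. y < m s * f s" using K(2)[OF \<eta>(2)]
 proof eventually_elim
  case (elim s)
  then have "?B \<eta> / ?C \<eta> <= m s * f s" by (simp add: pos_divide_le_eq mult.commute)
  then show ?case using \<eta> by simp
 qed
qed

end

section \<open>From the tail of the step law to its truncated mean\<close>

lemma exp_decay:
 assumes b: "0 < (b::real)"
 shows "\<exists>K>0. \<forall>u\<ge>0. exp (- b * u) * (1 + u) ^ 3 <= K"
proof (intro exI conjI allI impI)
 define c where "c = min 1 (b / 3)"
 have c: "0 < c" "c <= 1" "c <= b / 3" using b by (auto simp: c_def)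
 show "0 < (1 / c) ^ 3" using c by simp
 fix u :: real assume u: "0 <= u"
 have "c * (1 + u) <= 1 + b / 3 * u" using mult_right_mono[OF c(3) u] c by (simp add: distrib_left)
 also have "... <= exp (b / 3 * u)" by simp
 finally have "exp (- (b / 3 * u)) * (c * (1 + u)) <= exp (- (b / 3 * u)) * exp (b / 3 * u)" by simp
 then have "exp (- (b / 3 * u)) * (1 + u) <= 1 / c" using c by (simp add: exp_minus pos_le_divide_eq mult_ac)
 then have "(exp (- (b / 3 * u)) * (1 + u)) ^ 3 <= (1 / c) ^ 3" using u by (intro power_mono) auto
 then show "exp (- b * u) * (1 + u) ^ 3 <= (1 / c) ^ 3" by (simp add: power_mult_distrib exp_of_nat_mult[symmetric])
qed

text \<open>Layer cake: min (abs y) x is the length of the set of u in (0, x) with y <= - u or y >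
  u.\<close>

lemma (in real_distribution) trunc_mean_eq:
 assumes x: "0 <= x"
 shows "trunc_mean M x = (LBINT u. ind {0<..<x} u * (cdf M (- u) + (1 - cdf M u)))"
proof -
 interpret pair_sigma_finite M lborel ..
 let ?B = "\<lambda>y. NI lborel (\<lambda>u. ind {0<..<x} u * (ind {..-u} y + ind {u<..} y))"
 have inner: "?B y = ennreal (min (abs y) x)" for y :: real
 proof (cases "0 <= y")
  case True
  then have "?B y = NI lborel (\<lambda>u. ind {0<..<min y x} u)" by (intro nn_integral_cong) (auto simp: indicator_def)
  then show ?thesis using True x by simp
 next
  case False
  then have "?B y = NI lborel (\<lambda>u. ind (if - y < x then {0<..- y} else {0<..<x}) u)" by (intro nn_integral_cong) (auto simp: indicator_def)
  then show ?thesis using False x by simp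
 qed
 have c1: "cdf M u <= 1" "0 <= cdf M u" for u by (auto simp: cdf_def)
 have c2: "1 - cdf M u = measure M {u<..}" for u
 proof -
  have "UNIV - {u<..} = {..u}" by auto
  then show ?thesis using prob_compl[of "{u<..}"] by (simp add: cdf_def)
 qed
 have [measurable]: "cdf M \<in> borel_measurable borel" by (intro borel_measurable_mono monoI cdf_nondecreasing)
 let ?A = "\<lambda>u y. ind {z. snd z <= - fst z} (u, y) + ind {z. fst z < snd z} (u, y)"
 have "NE M (\<lambda>y. min (abs y) x) = NI M (\<lambda>y. NI lborel (\<lambda>u. ind {0<..<x} u * ?A u y))"
  unfolding inner[symmetric] by (intro nn_integral_cong) (auto simp: indicator_def)
 also have "... = NI lborel (\<lambda>u. NI M (\<lambda>y. ind {0<..<x} u * ?A u y))" by (rule Fubini'[symmetric]) measurable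
 also have "... = NE lborel (\<lambda>u. ind {0<..<x} u * (cdf M (- u) + (1 - cdf M u)))"
 proof (rule nn_integral_cong)
  fix u :: real
  let ?C = "NI M (\<lambda>y. ind {0<..<x} u * ?A u y)"
  have "?C
    = NI M (\<lambda>y. ind {0<..<x} u * (ind {..- u} y + ind {u<..} y))" by (intro nn_integral_cong) (auto simp: indicator_def)
  also have "... = ind {0<..<x} u * (emeasure M {..- u} + emeasure M {u<..})" by (subst nn_integral_cmult) (auto simp: nn_integral_add)
  also have "emeasure M {..- u} + emeasure M {u<..} = ennreal (cdf M (- u) + (1 - cdf M u))" unfolding c2 by (simp add: cdf_def emeasure_eq_measure)
  finally show "?C
    = ennreal (ind {0<..<x} u * (cdf M (- u) + (1 - cdf M u)))" by (auto simp: indicator_def)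
 qed
 finally show ?thesis unfolding trunc_mean_def using x c1 by (simp add: integral_eq_nn_integral)
qed

locale heavy_tail = real_distribution F for F :: "real measure" +
 fixes \<alpha> \<theta> :: real and l :: "real => real"
 assumes al: "0 < \<alpha>" "\<alpha> <= 1" and th: "0 < \<theta>"
  and ei: "integrable F (\<lambda>y. exp (- \<theta> * y))"
  and sv: "slowly_varying l" and tail: "!!x. 0 < x ==> 1 - cdf F x = l x * x powr (- \<alpha>)"
  and mean_inf: "NE F (\<lambda>y. max y 0) = \<infinity>"
begin

abbreviation "m \<equiv> trunc_mean F"

abbreviation "Q \<equiv> \<lambda>x. 1 - cdf F x"

lemma Q_measure: "Q u = measure F {u<..}"
proof -
 have "UNIV - {u<..} = {..u}" by auto
 then show ?thesis using prob_compl[of "{u<..}"] by (simp add: cdf_def)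
qed

lemma Q_antimono: "x <= y ==> Q y <= Q x" using cdf_nondecreasing by simp

lemma Q_pos: "0 < Q x"
proof -
 obtain a where a: "!!x. a <= x ==> 0 < l x" using sv by (auto simp: slowly_varying_def)
 define y where "y = max x (max a 1)"
 have "0 < Q y" using tail[of y] a[of y] by (simp add: y_def)
 also have "Q y <= Q x" by (rule Q_antimono) (simp add: y_def)
 finally show ?thesis .
qed

lemma cdf_meas [measurable]: "cdf F \<in> borel_measurable borel" by (intro borel_measurable_mono monoI cdf_nondecreasing)

lemma Q_rv: "0 < c ==> ((\<lambda>x. Q (c * x) / Q x) \<longlongrightarrow> c powr (- \<alpha>)) at_top"
proof -
 assume c: "0 < c"
 have "((\<lambda>x. l (c * x) / l x * c powr (- \<alpha>)) \<longlongrightarrow> 1 * c powr (- \<alpha>)) at_top"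
  using sv c by (intro tendsto_mult tendsto_const) (auto simp: slowly_varying_def)
 moreover have "\<forall>\<^sub>F x in at_top. l (c * x) / l x * c powr (- \<alpha>) = Q (c * x) / Q x"
  using eventually_gt_at_top[of 0] by eventually_elim (use c in \<open>simp add: tail powr_mult\<close>)
 ultimately show ?thesis by (auto dest: tendsto_cong)
qed

lemma left_tail: "\<exists>K>0. \<forall>u. cdf F (- u) <= K * exp (- \<theta> * u)"
proof -
 let ?A = "\<lambda>y. exp (- \<theta> * y)"
 define K where "K = (LINT y|F. ?A y) + 1"
 have K0: "0 <= (LINT y|F. ?A y)" by simp
 let ?B = "\<lambda>u. exp (- \<theta> * u)"
 have "cdf F (- u) <= K * ?B u" for u
 proof -
  have "cdf F (- u) = (LINT y|F. ind {..- u} y)" by (simp add: cdf_def)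
  also have "... <= (LINT y|F. ?B u * ?A y)"
  proof (rule integral_mono)
   fix y :: real
   show "ind {..- u} y <= ?B u * ?A y"
   proof (cases "y <= - u")
    case True
    then have "0 <= - \<theta> * u + - \<theta> * y" using mult_left_mono[of y "- u" \<theta>] th by simp
    then have "1 <= exp (- \<theta> * u + - \<theta> * y)" by simp
    then show ?thesis using True by (simp only: exp_add) simp
   qed simp
   show "integrable F (\<lambda>y. ?B u * ?A y)" by (intro integrable_mult_right ei)
  qed (auto intro!: integrable_real_indicator simp: less_top[symmetric])
  also have "... <= K * ?B u" unfolding K_def by simp
  finally show ?thesis .
 qed
 moreover have "0 < K" using K0 by (simp only: K_def)
 ultimately show ?thesis by blast
qed

lemma min_int: "0 <= x ==> integrable F (\<lambda>y. min (abs y) x)" by (rule integrable_const_bound[of _ x]) auto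

lemma m_mono: "0 <= x ==> x <= y ==> m x <= m y" unfolding trunc_mean_def by (intro integral_mono min_int) auto

lemma m_inf: "filterlim m at_top at_top"
proof -
 have "\<exists>n. Z < m (real n)" for Z
 proof (rule ccontr)
  assume "\<nexists>n. Z < m (real n)"
  then have Z: "m (real n) <= Z" for n by (auto simp: not_less)
  let ?A = "\<lambda>y. SUP n. ennreal (min (abs y) (real n))"
  have "NE F (\<lambda>y. max y 0) <= NI F (\<lambda>y. ?A y)"
  proof (rule nn_integral_mono)
   fix y :: real
   obtain n :: nat where "abs y <= real n" using real_arch_simple by blast
   then have "ennreal (max y 0) <= ennreal (min (abs y) (real n))" by simp
   also have "... <= ?A y" by (intro SUP_upper) auto
   finally show "ennreal (max y 0) <= ?A y" .
  qed
  also have "... = (SUP n. NE F (\<lambda>y. min (abs y) (real n)))" by (intro nn_integral_monotone_convergence_SUP) (auto simp: incseq_def le_fun_def)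
  also have "... <= ennreal Z"
  proof (rule SUP_least)
   fix n
   let ?B = "NE F (\<lambda>y. min (abs y) (real n))"
   have "?B = ennreal (m (real n))" unfolding trunc_mean_def by (intro nn_integral_eq_integral min_int) auto
   then show "?B <= ennreal Z" using Z[of n] by (simp add: ennreal_leI)
  qed
  finally show False using mean_inf by (simp add: top_unique)
 qed
 then show ?thesis unfolding filterlim_at_top_gt[where c = 0]
 proof (intro allI impI)
  fix Z :: real
  assume *: "!!Z. \<exists>n. Z < m (real n)"
  obtain n where "Z < m (real n)" using *[of Z] by blast
  then have "\<forall>x\<ge>real n. Z <= m x" using m_mono[of "real n"] by force
  then show "\<forall>\<^sub>F x in at_top. Z <= m x" unfolding eventually_at_top_linorder by blast
 qed
qed

text \<open>The density of m is G u = cdf F (- u) + Q u. Regular variation of Q gives G (c * u) = c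
  powr (- \<alpha>) * G u up to \<epsilon> * G u and an integrable error, which integrates to a
  constant and is negligible because m tends to infinity. The case \<alpha> = 1 is included.\<close>

lemma m_rv:
 assumes c: "0 < c"
 shows "((\<lambda>x. m (c * x) / m x) \<longlongrightarrow> c powr (1 - \<alpha>)) at_top"
proof (rule tendstoI)
 fix e :: real assume e: "0 < e"
 define \<epsilon> where "\<epsilon> = e / (2 * c)"
 have \<epsilon>: "0 < \<epsilon>" using e c by (simp add: \<epsilon>_def)
 let ?G = "\<lambda>u. cdf F (- u) + Q u"
 have G: "0 <= ?G u" "?G u <= 2" for u using Q_pos[of u] cdf_nonneg[of "- u"] cdf_bounded_prob[of "- u"] cdf_nonneg[of u] by linarith+
 obtain K where K: "0 < K" "!!u. cdf F (- u) <= K * exp (- \<theta> * u)" using left_tail by blast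
 obtain D1 where D1: "0 < D1" "!!u. 0 <= u ==> exp (- \<theta> * u) * (1 + u) ^ 3 <= D1" using exp_decay[OF th] by blast
 have "0 < \<theta> * c" using th c by simp
 then obtain D2 where D2: "0 < D2" "!!u. 0 <= u ==> exp (- (\<theta> * c) * u) * (1 + u) ^ 3 <= D2" using exp_decay by blast
 have "\<forall>\<^sub>F x in at_top. dist (Q (c * x) / Q x) (c powr (- \<alpha>)) < \<epsilon>" by (rule tendstoD[OF Q_rv[OF c] \<epsilon>])
 then obtain x0 where x0: "!!x. x0 <= x ==> dist (Q (c * x) / Q x) (c powr (- \<alpha>)) < \<epsilon>" unfolding eventually_at_top_linorder by blast
 define k where "k = c powr (- \<alpha>)"
 have k: "0 < k" using c by (simp add: k_def)
 \<comment> \<open>Covers u up to the threshold, where everything is bounded, and the left tails at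
   u and c * u, which decay exponentially.\<close>
 define w where "w = (\<lambda>u. (2 + k * 2) * ind {0..abs x0} u + K * (D2 + k * D1) * (1 / br u ^ 2))"
 have w_int: "integrable lborel w" unfolding w_def by (intro Lintable_add integrable_mult_right Icc_integrable integrable_rational_decay)
 have w0: "0 <= w u" for u using k K D1 D2 by (auto simp: w_def)
 have dec: "E <= D * (1 / br u ^ 2)" if "E * (1 + u) ^ 3 <= D" "0 <= u" "0 <= E" for E D u :: real
 proof -
  have "(1 + u) ^ 2 <= (1 + u) ^ 3" using that by (intro power_increasing) auto
  then have "E * (1 + u) ^ 2 <= E * (1 + u) ^ 3" using that by (intro mult_left_mono) auto
  then have "E * (1 + u) ^ 2 <= D" using that by simp
  then show ?thesis using that by (simp add: pos_le_divide_eq)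
 qed
 have point: "abs (?G (c * u) - k * ?G u) <= w u + \<epsilon> * ?G u" if u: "0 < u" for u
 proof (cases "u <= abs x0")
  case True
  have "k * ?G u <= k * 2" "0 <= k * ?G u" using G[of u] k by auto
  then have "abs (?G (c * u) - k * ?G u) <= 2 + k * 2" using G[of "c * u"] by simp
  also have "... <= w u" using True u k K D1 D2 by (simp add: w_def)
  also have "... <= w u + \<epsilon> * ?G u" using G[of u] \<epsilon> by simp
  finally show ?thesis .
 next
  case False
  then have "abs (Q (c * u) / Q u - k) < \<epsilon>" using x0[of u] by (simp add: dist_real_def k_def)
  then have "abs (Q (c * u) / Q u - k) * Q u <= \<epsilon> * Q u" using Q_pos[of u] by simp
  moreover have "abs (Q (c * u) / Q u - k) * Q u = abs (Q (c * u) - k * Q u)" using that Q_pos[of u] by (auto simp: field_simps)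
  ultimately have 1: "abs (Q (c * u) - k * Q u) <= \<epsilon> * Q u" by simp
  have "cdf F (- (c * u)) <= K * exp (- (\<theta> * c) * u)" using K(2)[of "c * u"] by (simp add: mult.assoc)
  also have "... <= K * (D2 * (1 / br u ^ 2))" using K(1) u by (intro mult_left_mono dec D2) auto
  finally have 2: "cdf F (- (c * u)) <= K * (D2 * (1 / br u ^ 2))" .
  have "k * cdf F (- u) <= k * (K * exp (- \<theta> * u))" using k by (intro mult_left_mono K(2)) auto
  also have "... <= k * (K * (D1 * (1 / br u ^ 2)))" using k K(1) u by (intro mult_left_mono dec D1) auto
  finally have 3: "k * cdf F (- u) <= k * (K * (D1 * (1 / br u ^ 2)))" .
  have 4: "0 <= cdf F (- (c * u))" "0 <= k * cdf F (- u)" "0 <= \<epsilon> * cdf F (- u)" using k \<epsilon> by (auto simp: cdf_nonneg)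
  have w: "w u = K * (D2 * (1 / br u ^ 2)) + k * (K * (D1 * (1 / br u ^ 2)))"
   using False by (simp only: w_def) (simp add: distrib_left distrib_right mult_ac add_divide_distrib)
  have tri: "abs (P + p - k * (R + r)) <= (s + t) + \<epsilon> * (R + r)"
   if "abs (p - k * r) <= \<epsilon> * r" "P <= s" "k * R <= t" "0 <= P" "0 <= k * R" "0 <= \<epsilon> * R" for P p R r s t
   using that unfolding distrib_left abs_le_iff by simp
  show ?thesis unfolding w by (rule tri[OF 1 2 3 4])
 qed
 have Gint: "integrable lborel (\<lambda>u. ind {0<..<x} u * ?G (b * u))" for x b
 proof (rule Lint_bound)
  show "integrable lborel (\<lambda>u. 2 * ind {0..x} u :: real)" by (intro integrable_mult_right Icc_integrable)
  show "AE u in lborel. norm (ind {0<..<x} u * ?G (b * u)) <= norm (2 * ind {0..x} u :: real)" using G by (auto simp: indicator_def)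
 qed measurable
 define Z where "Z = c * (LBINT u. w u)"
 have main: "abs (m (c * x) - c * k * m x) <= Z + e / 2 * m x" if x: "0 < x" for x
 proof -
  have m1: "m x = (LBINT u. ind {0<..<x} u * ?G u)" using x by (intro trunc_mean_eq) auto
  have "m (c * x) = (LBINT u. ind {0<..<c * x} u * ?G u)" using x c by (intro trunc_mean_eq) auto
  also have "... = c * (LBINT u. ind {0<..<c * x} (c * u) * ?G (c * u))" using lborel_integral_real_affine[of c "\<lambda>u. ind {0<..<c * x} u * ?G u" 0] c by simp
  also have "(LBINT u. ind {0<..<c * x} (c * u) * ?G (c * u)) = (LBINT u. ind {0<..<x} u * ?G (c * u))"
   using c by (intro Lint_cong) (auto simp: indicator_def zero_less_mult_iff)
  finally have m2: "m (c * x) = c * (LBINT u. ind {0<..<x} u * ?G (c * u))" .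
  let ?A = "\<lambda>u. ind {0<..<x} u * ?G u"
  have "m (c * x) - c * k * m x = c * (LBINT u. ind {0<..<x} u * ?G (c * u) - k * ?A u)"
   unfolding m1 m2 using Gint[of x c] Gint[of x 1] by (simp add: right_diff_distrib)
  then have "abs (m (c * x) - c * k * m x) = c * abs (\<integral>u. ind {0<..<x} u * ?G (c * u) - k * ?A u \<partial>lborel)" using c by (simp add: abs_mult)
  also have "... <= c * (LBINT u. abs (ind {0<..<x} u * ?G (c * u) - k * (?A u)))" using c by simp
  also have "... <= c * (LBINT u. w u + \<epsilon> * ?A u)"
  proof (intro mult_left_mono integral_mono)
   show "integrable lborel (\<lambda>u. abs (ind {0<..<x} u * ?G (c * u) - k * (?A u)))" using Gint[of x c] Gint[of x 1] by simp
   show "integrable lborel (\<lambda>u. w u + \<epsilon> * ?A u)" using w_int Gint[of x 1] by simp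
   fix u :: real
   show "abs (ind {0<..<x} u * ?G (c * u) - k * (?A u)) <= w u + \<epsilon> * ?A u" using point[of u] w0[of u] by (cases "u \<in> {0<..<x}") auto
  qed (use c in simp)
  also have "(LBINT u. w u + \<epsilon> * ?A u) = (LBINT u. w u) + \<epsilon> * (LBINT u. ind {0<..<x} u * ?G u)" using w_int Gint[of x 1] by simp
  also have "c * ... = Z + c * \<epsilon> * m x" unfolding m1 Z_def by (simp only: distrib_left mult.assoc)
  also have "c * \<epsilon> = e / 2" using c by (simp add: \<epsilon>_def)
  finally show ?thesis .
 qed
 have ck: "c * k = c powr (1 - \<alpha>)" using c by (simp add: k_def powr_diff powr_minus divide_inverse)
 have "\<forall>\<^sub>F x in at_top. max 0 (4 * Z / e) < m x" using m_inf by (rule filterlim_at_top_dense[THEN iffD1, rule_format])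
 then show "\<forall>\<^sub>F x in at_top. dist (m (c * x) / m x) (c powr (1 - \<alpha>)) < e" using eventually_gt_at_top[of 0]
 proof eventually_elim
  case (elim x)
  then have mx: "0 < m x" "4 * Z / e < m x" by auto
  have "Z < e / 4 * m x" using mx e by (simp add: field_simps)
  then have "abs (m (c * x) - c * k * m x) < e * m x" using main[OF elim(2)] mult_pos_pos[OF e mx(1)] by simp
  moreover have "m (c * x) / m x - c * k = (m (c * x) - c * k * m x) / m x" using mx by (simp add: diff_divide_distrib)
  ultimately show ?case using mx by (simp add: dist_real_def ck abs_divide pos_divide_less_eq)
 qed
qed

end

context heavy_tail
begin

lemma half_line_int: "integrable F (ind {x<..} :: real => real)" "integrable F (ind {..x} :: real => real)" by (auto simp: less_top[symmetric])

lemma Q_le: "0 < x ==> x * Q x <= m x"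
proof -
 assume x: "0 < x"
 have "x * Q x = (LINT y|F. x * ind {x<..} y)" by (simp only: Q_measure) simp
 also have "... <= m x" unfolding trunc_mean_def using x by (intro integral_mono min_int integrable_mult_right half_line_int) (auto simp: indicator_def)
 finally show ?thesis .
qed

lemma m_pos: "0 < x ==> 0 < m x" using Q_le[of x] mult_pos_pos[OF _ Q_pos, of x x] by simp

text \<open>Doubling x increases m by at least a fixed fraction of m x, since 2 powr (1 - \<alpha>)
  > 1, and by at most x * Q x plus an exponentially small contribution of the left tail.\<close>

lemma m_le_tail:
 assumes \<alpha>: "\<alpha> < 1"
 shows "\<exists>c>0. \<forall>\<^sub>F x in at_top. c * m x <= x * Q x"
proof -
 define b where "b = (2 powr (1 - \<alpha>) - 1) / 2"
 have b: "0 < b" using \<alpha> by (simp add: b_def)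
 obtain K where K: "0 < K" "!!u. cdf F (- u) <= K * exp (- \<theta> * u)" using left_tail by blast
 have 1: "\<forall>\<^sub>F x in at_top. 1 + b < m (2 * x) / m x" using m_rv[of 2] b by (intro order_tendstoD(1)) (auto simp: b_def field_simps)
 let ?A = "\<lambda>x. K * exp (- \<theta> * x)"
 have 2: "\<forall>\<^sub>F x in at_top. x * ?A x < b / 2 * m 1"
 proof (rule order_tendstoD(2))
  show "((\<lambda>x. x * ?A x) \<longlongrightarrow> 0) at_top" using th by real_asymp
  show "0 < b / 2 * m 1" using b m_pos[of 1] by simp
 qed
 have "\<forall>\<^sub>F x in at_top. b / 2 * m x <= x * Q x" using 1 2 eventually_ge_at_top[of 1]
 proof eventually_elim
  case (elim x)
  have mx: "0 < m x" "m 1 <= m x" using elim m_pos[of x] m_mono[of 1 x] by auto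
  have "m (2 * x) - m x = (LINT y|F. min (abs y) (2 * x) - min (abs y) x)" unfolding trunc_mean_def using elim by (simp add: min_int)
  also have "... <= (LINT y|F. x * ind {x<..} y + x * ind {..- x} y)"
   using elim by (intro integral_mono Lintable_diff Lintable_add integrable_mult_right half_line_int min_int)
    (auto simp: indicator_def)
  also have "... = x * Q x + x * cdf F (- x)"
   using half_line_int by (subst Bochner_Integration.integral_add) (use Q_measure[of x] in \<open>simp_all add: cdf_def\<close>)
  also have "... <= x * Q x + x * ?A x" using elim by (intro add_left_mono mult_left_mono K) auto
  finally have 3: "m (2 * x) - m x <= x * Q x + x * ?A x" .
  have "(1 + b) * m x < m (2 * x)" using elim(1) mx by (simp add: pos_less_divide_eq)
  then have "b * m x <= x * Q x + b / 2 * m 1" using 3 elim(2) by (simp add: distrib_right)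
  moreover have "b / 2 * m 1 <= b / 2 * m x" using b mx by simp
  ultimately show ?case by simp
 qed
 then show ?thesis using b by (intro exI[of _ "b / 2"]) auto
qed

text \<open>Translates hypothesis (3) from the tail to \<open>renewal_scale\<close>. Inside the
  integral a y <= 1 / Q y, because y * Q y <= m y; the prefactor goes the other way, 1 / (x * Q x)
  <= 1 / (c * m x), by \<open>m_le_tail\<close>.\<close>

lemma local_cond:
 assumes lim: "((\<lambda>\<delta>. Limsup at_top (\<lambda>x. ennreal (x * Q x) *
   reflected_integral F x 1 (\<delta> * x) (\<lambda>y. 1 / (y * (Q y)^2)))) \<longlongrightarrow> 0) (at_right 0)"
  and \<alpha>: "\<alpha> <= 1/2" and \<epsilon>: "0 < \<epsilon>"
 shows "\<exists>\<eta>>0. \<exists>x0. \<forall>x\<ge>x0.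
   NI F (\<lambda>w. ennreal ((renewal_scale F (x - w))^2 / (x - w)) * ind {w. 1 <= x - w \<and> x - w <= \<eta> * x} w)
    <= ennreal (\<epsilon> * renewal_scale F x / x)"
proof -
 obtain c where c: "0 < c" "\<forall>\<^sub>F x in at_top. c * m x <= x * Q x" using m_le_tail \<alpha> by auto
 let ?R = "\<lambda>\<delta> x. reflected_integral F x 1 (\<delta> * x) (\<lambda>y. 1 / (y * (Q y)^2))"
 let ?A = "ennreal (\<epsilon> * c)"
 let ?B = "\<lambda>x. ennreal (x * Q x)"
 have "\<forall>\<^sub>F \<delta> in at_right 0. Limsup at_top (\<lambda>x. ?B x * ?R \<delta> x) < ?A" using order_tendstoD(2)[OF lim, of "?A"] \<epsilon> c by simp
 moreover have "\<forall>\<^sub>F \<delta>::real in at_right 0. 0 < \<delta>" by (rule eventually_at_right_less)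
 ultimately have "\<forall>\<^sub>F \<delta> in at_right 0. Limsup at_top (\<lambda>x. ?B x * ?R \<delta> x) < ?A \<and> 0 < \<delta>" by (rule eventually_conj)
 then obtain \<eta> where \<eta>: "Limsup at_top (\<lambda>x. ?B x * ?R \<eta> x) < ?A" "0 < \<eta>" using eventually_happens'[OF trivial_limit_at_right_real] by blast
 have "\<forall>\<^sub>F x in at_top. ?B x * ?R \<eta> x < ?A" by (rule Limsup_lessD[OF \<eta>(1)])
 then have "\<forall>\<^sub>F x in at_top. NI F (\<lambda>w. ennreal ((renewal_scale F (x - w))^2 / (x - w)) * ind {w. 1 <= x - w \<and> x - w <= \<eta> * x} w)
    <= ennreal (\<epsilon> * renewal_scale F x / x)" using c(2) eventually_gt_at_top[of 0]
 proof eventually_elim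
  case (elim x)
  have xQ: "0 < x * Q x" and mx: "0 < m x" using elim Q_pos m_pos by auto
  have "NI F (\<lambda>w. ennreal ((renewal_scale F (x - w))^2 / (x - w)) * ind {w. 1 <= x - w \<and> x - w <= \<eta> * x} w) <= ?R \<eta> x"
   unfolding reflected_integral_def
  proof (rule nn_integral_mono)
   fix w :: real
   have "(renewal_scale F y)^2 / y <= 1 / (y * (Q y)^2)" if "1 <= y" for y
   proof -
    have "renewal_scale F y <= 1 / Q y" using Q_le[of y] Q_pos[of y] m_pos[of y] that by (simp add: renewal_scale_def field_simps)
    moreover have "0 <= renewal_scale F y" using m_pos[of y] that by (simp add: renewal_scale_def)
    ultimately have "(renewal_scale F y)^2 <= (1 / Q y)^2" by (intro power_mono)
    then have "(renewal_scale F y)^2 / y <= (1 / Q y)^2 / y" using that by (intro divide_right_mono) auto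
    then show ?thesis by (simp add: power_divide mult.commute)
   qed
   then show "ennreal ((renewal_scale F (x - w))^2 / (x - w)) * ind {w. 1 <= x - w \<and> x - w <= \<eta> * x} w
     <= ennreal (1 / ((x - w) * (Q (x - w))^2)) * ind {z. 1 <= x - z \<and> x - z <= \<eta> * x} w" by (cases "1 <= x - w") (auto intro!: mult_right_mono)
  qed
  also have "?R \<eta> x <= ennreal (\<epsilon> * c / (x * Q x))"
  proof -
   have "ennreal (1 / r) * (ennreal r * R) = R" if "0 < r" for r R using that by (simp add: mult.assoc[symmetric] ennreal_mult[symmetric])
   from this[OF xQ] have "?R \<eta> x = ennreal (1 / (x * Q x)) * (?B x * ?R \<eta> x)" by simp
   also have "... <= ennreal (1 / (x * Q x)) * ?A" using elim by (intro mult_left_mono) auto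
   also have "... = ennreal (\<epsilon> * c / (x * Q x))" using xQ \<epsilon> c by (simp add: ennreal_mult[symmetric])
   finally show ?thesis .
  qed
  also have "... <= ennreal (\<epsilon> * renewal_scale F x / x)"
  proof (rule ennreal_leI)
   have "\<epsilon> * c / (x * Q x) <= \<epsilon> * c / (c * m x)" using elim c \<epsilon> mx xQ by (intro divide_left_mono) auto
   then show "\<epsilon> * c / (x * Q x) <= \<epsilon> * renewal_scale F x / x" using c by (simp add: renewal_scale_def)
  qed
  finally show ?case .
 qed
 then show ?thesis using \<eta>(2) unfolding eventually_at_top_linorder by blast
qed

end

text \<open>Weighted inequality of arithmetic and geometric means for x powr \<kappa> and 1, strict
  for x other than 1, from the strict tangent inequality for exp at two points.\<close>

lemma powr_less_interpolation:
 fixes x :: real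
 assumes x: "0 <= x" "x \<noteq> 1" and q: "0 < q" "q < \<kappa>"
 shows "x powr q < q / \<kappa> * x powr \<kappa> + (1 - q / \<kappa>)"
proof (cases "x = 0")
 case False
 define v where "v = \<kappa> * ln x"
 define t where "t = q / \<kappa>"
 have t: "0 < t" "t < 1" using q by (auto simp: t_def)
 have v: "v \<noteq> 0" using x False q by (simp add: v_def)
 have strict: "1 + u < exp u" if "u \<noteq> 0" for u :: real using exp_ge_add_one_self[of u] ln_eq_minus_one[of "exp u"] that by (force simp: le_less)
 have "exp (t * v) * (1 + (1 - t) * v) < exp (t * v) * exp ((1 - t) * v)" using strict[of "(1 - t) * v"] v t by simp
 also have "... = exp v" by (simp add: mult_exp_exp left_diff_distrib)
 finally have 1: "exp (t * v) * (1 + (1 - t) * v) < exp v" .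
 have "exp (t * v) * (1 + - t * v) < exp (t * v) * exp (- t * v)" using strict[of "- t * v"] v t by simp
 also have "... = 1" by (simp add: mult_exp_exp)
 finally have 2: "exp (t * v) * (1 + - t * v) < 1" .
 have "exp (t * v) = t * (exp (t * v) * (1 + (1 - t) * v)) + (1 - t) * (exp (t * v) * (1 + - t * v))" by (simp add: algebra_simps)
 also have "... < t * exp v + (1 - t) * 1" using 1 2 t by (intro add_strict_mono mult_strict_left_mono) auto
 finally have "exp (t * v) < t * exp v + (1 - t)" by simp
 moreover have "t * v = q * ln x" using q by (simp add: t_def v_def)
 ultimately show ?thesis using False by (simp add: powr_def v_def t_def)
qed (use q in simp)

section \<open>The tilted law\<close>

locale tilting = prob_space M for M :: "'a measure" +
 fixes A :: "'a => real" and \<kappa> :: real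
 assumes A_meas [measurable]: "A \<in> borel_measurable M" and A_nonneg: "AE w in M. 0 <= A w"
  and A_not_1: "\<not> (AE w in M. A w = 1)" and kappa_pos: "0 < \<kappa>" and A_moment: "(LINT w|M. A w powr \<kappa>) = 1"
begin

abbreviation F :: "real measure" where "F \<equiv> tilted_log_law M A \<kappa>"

lemma A_int: "integrable M (\<lambda>w. A w powr \<kappa>)" using A_moment not_integrable_integral_eq by force

text \<open>Integrating the interpolation inequality gives at most 1, and equality would force A = 1
  almost surely.\<close>

lemma A_moment_less: "0 < q ==> q < \<kappa> ==> integrable M (\<lambda>w. A w powr q)" "0 < q ==> q < \<kappa> ==> (LINT w|M. A w powr q) < 1"
proof -
 assume q: "0 < q" "q < \<kappa>"
 let ?R = "\<lambda>w. q / \<kappa> * A w powr \<kappa> + (1 - q / \<kappa>)"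
 have le: "AE w in M. A w powr q <= ?R w" using A_nonneg
 proof eventually_elim
  case (elim w)
  then show ?case using powr_less_interpolation[of "A w" q \<kappa>] q by (cases "A w = 1") auto
 qed
 have R: "integrable M ?R" using A_int by simp
 show int: "integrable M (\<lambda>w. A w powr q)"
 proof (rule Lint_bound[OF R])
  show "AE w in M. norm (A w powr q) <= norm (?R w)" using le by auto
 qed measurable
 have RI: "(LINT w|M. ?R w) = 1" using A_int A_moment prob_space by simp
 let ?A = "LINT w|M. A w powr q"
 have "?A <= 1" using integral_mono_AE[OF int R le] unfolding RI .
 moreover have "?A \<noteq> 1"
 proof
  assume "?A = 1"
  then have "(LINT w|M. ?R w - A w powr q) = 0" using RI R int by simp
  then have "AE w in M. ?R w - A w powr q = 0" using le R int by (subst (asm) integral_nonneg_eq_0_iff_AE) auto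
  with A_nonneg have "AE w in M. A w = 1"
  proof eventually_elim
   case (elim w)
   then show ?case using powr_less_interpolation[of "A w" q \<kappa>] q by force
  qed
  then show False using A_not_1 by simp
 qed
 ultimately show "?A < 1" by simp
qed

lemma sets_F [simp, measurable_cong]: "sets F = sets borel" by (simp add: tilted_log_law_def)

lemma nn_integral_F:
 assumes [measurable]: "\<phi> \<in> borel_measurable borel"
 shows "NI F \<phi> = NI M (\<lambda>w. ennreal (A w powr \<kappa>) * \<phi> (ln (A w)))"
 unfolding tilted_log_law_def by (simp add: nn_integral_distr nn_integral_density)

lemma integral_F:
 fixes \<phi> :: "real => real"
 assumes [measurable]: "\<phi> \<in> borel_measurable borel"
 shows "integrable F \<phi> \<longleftrightarrow> integrable M (\<lambda>w. A w powr \<kappa> * \<phi> (ln (A w)))"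
  "(LINT y|F. \<phi> y) = (LINT w|M. A w powr \<kappa> * \<phi> (ln (A w)))"
 unfolding tilted_log_law_def by (simp_all add: integrable_distr_eq integral_distr integrable_density integral_density)

text \<open>The case A w = 0 is consistent: both sides are 0, since \<open>0 powr\<close> of any
  exponent is 0.\<close>

lemma tilted_power:
 "AE w in M. A w powr \<kappa> * exp (- \<beta> * ln (A w)) = A w powr (\<kappa> - \<beta>)" using A_nonneg
proof eventually_elim
 case (elim w)
 then show ?case by (cases "A w = 0") (auto simp: powr_def left_diff_distrib simp flip: exp_add)
qed

lemma real_distribution_F: "real_distribution F"
proof -
 have "emeasure F UNIV = NI F (\<lambda>y. 1)" using sets_eq_imp_space_eq[OF sets_F] by simp
 also have "... = NE M (\<lambda>w. A w powr \<kappa>)" by (subst nn_integral_F) auto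
 also have "... = 1" using A_moment by (subst nn_integral_eq_integral[OF A_int]) auto
 finally have "prob_space F" using sets_eq_imp_space_eq[OF sets_F] by (intro prob_spaceI) auto
 then show ?thesis by (simp add: real_distribution_def real_distribution_axioms_def)
qed

text \<open>The Laplace transform of the tilted law at \<beta> is the moment of A of order \<kappa>
  - \<beta>, below 1 for 0 < \<beta> <= \<kappa> / 2. A nonzero t with characteristic function 1
  would force cos (t * ln A) = 1 where A is nonzero, placing ln A on the lattice of span 2 * pi /
  abs t.\<close>

lemma tilted_renewal_law:
 assumes \<alpha>: "0 < \<alpha>" "\<alpha> <= 1"
  and mean: "NE M (\<lambda>z. A z powr \<kappa> * max (ln (A z)) 0) = \<infinity>"
  and sv: "slowly_varying l" and tail: "!!x. 0 < x ==> tilted_tail M A \<kappa> x = l x * x powr (- \<alpha>)"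
  and lim: "((\<lambda>\<delta>. Limsup at_top (\<lambda>x. ennreal (x * tilted_tail M A \<kappa> x) *
      reflected_integral F x 1 (\<delta> * x) (\<lambda>y. 1 / (y * (tilted_tail M A \<kappa> y)^2)))) \<longlongrightarrow> 0) (at_right 0)"
  and na: "nonarithmetic (distr (uniform_measure M {z \<in> space M. A z \<noteq> 0}) borel (\<lambda>z. ln (A z)))"
 shows "renewal_law F \<alpha> (\<kappa> / 2)" and "!!x. 0 <= x ==> truncated_mean M A \<kappa> x = trunc_mean F x"
proof -
 interpret F: real_distribution F by (rule real_distribution_F)
 have tail_eq: "tilted_tail M A \<kappa> x = 1 - cdf F x" for x by (simp add: tilted_tail_def tilted_cdf_def)
 have lap: "integrable F (\<lambda>y. exp (- \<beta> * y))" "(LINT y|F. exp (- \<beta> * y)) < 1" if \<beta>: "0 < \<beta>" "\<beta> <= \<kappa> / 2" for \<beta>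
 proof -
  have q: "0 < \<kappa> - \<beta>" "\<kappa> - \<beta> < \<kappa>" using \<beta> by auto
  have "integrable M (\<lambda>z. A z powr \<kappa> * exp (- \<beta> * ln (A z)))"
   using A_moment_less(1)[OF q] tilted_power[of \<beta>] by (subst integrable_cong_AE) auto
  then show "integrable F (\<lambda>y. exp (- \<beta> * y))" by (subst integral_F) auto
  have "(LINT y|F. exp (- \<beta> * y)) = (LINT z|M. A z powr (\<kappa> - \<beta>))"
   using tilted_power[of \<beta>] by (subst integral_F) (auto intro!: integral_cong_AE)
  then show "(LINT y|F. exp (- \<beta> * y)) < 1" using A_moment_less(2)[OF q] by simp
 qed
 interpret H: heavy_tail F \<alpha> "\<kappa> / 2" l
 proof
  show "NE F (\<lambda>y. max y 0) = \<infinity>" using mean by (subst nn_integral_F) (auto simp: ennreal_mult)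
  show "1 - cdf F x = l x * x powr (- \<alpha>)" if "0 < x" for x using tail[OF that] by (simp add: tail_eq)
  show "integrable F (\<lambda>y. exp (- (\<kappa> / 2) * y))" using kappa_pos by (intro lap) auto
 qed (use \<alpha> kappa_pos sv in auto)
 show "renewal_law F \<alpha> (\<kappa> / 2)"
 proof
  fix t :: real assume t: "t \<noteq> 0"
  show "char F t \<noteq> 1"
  proof
   assume 1: "char F t = 1"
   have ic: "integrable F (\<lambda>y. cos (t * y))" by (rule F.integrable_const_bound[of _ 1]) auto
   have "(LINT y|F. cos (t * y)) = Re (char F t)" unfolding char_def by (subst integral_Re[symmetric]) (auto intro: F.integrable_iexp simp: Re_exp)
   then have "(LINT y|F. 1 - cos (t * y)) = 0" using 1 ic F.prob_space by simp
   then have "AE y in F. 1 - cos (t * y) = 0" using ic by (subst (asm) integral_nonneg_eq_0_iff_AE) auto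
   then have "AE y in distr (density M (\<lambda>z. ennreal (A z powr \<kappa>))) borel (\<lambda>z. ln (A z)). cos (t * y) = 1" unfolding tilted_log_law_def by simp
   then have "AE z in M. 0 < ennreal (A z powr \<kappa>) --> cos (t * ln (A z)) = 1" by (subst (asm) AE_distr_iff) (auto simp: AE_density)
   then have lat: "AE z in M. A z \<noteq> 0 --> (\<exists>k::int. ln (A z) = 2 * pi / abs t * of_int k)"
   proof eventually_elim
    case (elim z)
    show ?case
    proof
     assume "A z \<noteq> 0"
     then have "cos (t * ln (A z)) = 1" using elim by simp
     then obtain n :: int where "t * ln (A z) = of_int n * (2 * pi)" by (auto simp: cos_one_2pi_int)
     then have "ln (A z) = 2 * pi / abs t * of_int (if 0 < t then n else - n)" using t by (auto simp: field_simps)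
     then show "\<exists>k::int. ln (A z) = 2 * pi / abs t * of_int k" by blast
    qed
   qed
   let ?E = "{z \<in> space M. A z \<noteq> 0}"
   have "emeasure M ?E \<noteq> 0"
   proof
    assume "emeasure M ?E = 0"
    then have "AE z in M. A z = 0" by (subst AE_iff_measurable[of ?E]) auto
    then have "(LINT z|M. A z powr \<kappa>) = (LINT z|M. 0)" by (intro integral_cong_AE) auto
    then show False using A_moment by simp
   qed
   then have "AE z in uniform_measure M ?E. \<exists>k::int. ln (A z) = 2 * pi / abs t * of_int k"
    using lat by (subst AE_uniform_measure) (auto simp: less_top[symmetric])
   then have "AE x in distr (uniform_measure M ?E) borel (\<lambda>z. ln (A z)). \<exists>k::int. x = 2 * pi / abs t * of_int k" by (subst AE_distr_iff) auto
   then show False using na t unfolding nonarithmetic_def by (auto dest!: spec[of _ "2 * pi / abs t"])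
  qed
 next
  fix \<epsilon> :: real assume "\<alpha> <= 1/2" "0 < \<epsilon>"
  then show "\<exists>\<eta>>0. \<exists>x0. \<forall>x\<ge>x0.
   NI F (\<lambda>w. ennreal ((renewal_scale F (x - w))^2 / (x - w)) * ind {w. 1 <= x - w \<and> x - w <= \<eta> * x} w)
    <= ennreal (\<epsilon> * renewal_scale F x / x)" using H.local_cond lim by (simp only: tail_eq)
 qed (use \<alpha> kappa_pos lap(2) H.ei H.m_rv H.m_inf in auto)
 show "truncated_mean M A \<kappa> x = trunc_mean F x" if x: "0 <= x" for x
  using x unfolding F.trunc_mean_eq[OF x] truncated_mean_def interval_lebesgue_integral_def set_lebesgue_integral_def
  by (simp add: zero_ereal_def tilted_cdf_def tilted_tail_def)
qed

end

lemma ennreal_le_mult_add: "x <= s * u + v ==> 0 <= s ==> 0 <= u ==> 0 <= v ==> ennreal x <= ennreal s * ennreal u + ennreal v"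
 by (simp add: ennreal_mult[symmetric] ennreal_plus[symmetric] del: ennreal_plus)

section \<open>The perpetuity: independence and moments\<close>

locale perpetuity = tilting M A \<kappa> for M :: "'a measure" and A :: "'a => real" and \<kappa> :: real +
 fixes B X :: "'a => real" and \<nu> \<alpha> :: real
 assumes B_meas [measurable]: "B \<in> borel_measurable M" and X_meas [measurable]: "X \<in> borel_measurable M"
  and nu: "\<kappa> < \<nu>" and B_moment: "integrable M (\<lambda>w. abs (B w) powr \<nu>)"
  and indep: "indep_set (sets (vimage_algebra (space M) (\<lambda>w. (A w, B w)) (borel \<Otimes>\<^sub>M borel)))
      (sets (vimage_algebra (space M) X borel))"
  and fixpoint: "distr M borel X = distr M borel (\<lambda>w. A w * X w + B w)"
  and law: "renewal_law F \<alpha> (\<kappa> / 2)"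
begin

lemma nn_integral_indep:
 assumes [measurable]: "\<phi> \<in> borel_measurable ((borel \<Otimes>\<^sub>M borel) \<Otimes>\<^sub>M borel)"
 shows "NI M (\<lambda>w. \<phi> ((A w, B w), X w)) = NI M (\<lambda>w. NI M (\<lambda>w'. \<phi> ((A w, B w), X w')))"
proof -
 interpret D: prob_space "distr M borel X" by (rule prob_space_distr) measurable
 let ?D = "borel \<Otimes>\<^sub>M borel"
 let ?A = "distr M ?D (\<lambda>w. (A w, B w))"
 interpret E: prob_space "?A" by (rule prob_space_distr) measurable
 let ?E = "\<lambda>w. ((A w, B w), X w)"
 let ?B = "distr M (?D \<Otimes>\<^sub>M borel) ?E"
 have iv: "?A \<Otimes>\<^sub>M distr M borel X = ?B"
 proof (rule pair_measure_eqI)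
  show "sigma_finite_measure (?A)" "sigma_finite_measure (distr M borel X)" by unfold_locales
  show "sets (?A \<Otimes>\<^sub>M distr M borel X) = sets (?B)" by simp
  fix S T assume "S \<in> sets (?A)" "T \<in> sets (distr M borel X)"
  then have S [measurable]: "S \<in> sets ?D" and T [measurable]: "T \<in> sets borel" by auto
  let ?C = "(\<lambda>w. (A w, B w)) -` S \<inter> space M"
  let ?G = "X -` T \<inter> space M"
  have eq: "?E -` (S \<times> T) \<inter> space M = ?C \<inter> ?G" by auto
  have "prob (?C \<inter> ?G) = prob ?C * prob ?G" by (intro indep_setD[OF indep] in_vimage_algebra) auto
  then show "emeasure (?A) S * emeasure (distr M borel X) T
    = emeasure (?B) (S \<times> T)" by (simp add: emeasure_distr eq emeasure_eq_measure ennreal_mult)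
 qed
 have "NI M (\<lambda>w. \<phi> ((A w, B w), X w)) = NI ?B \<phi>" by (simp add: nn_integral_distr)
 also have "... = NI (?A \<Otimes>\<^sub>M distr M borel X) \<phi>" unfolding iv ..
 also have "... = NI ?A (\<lambda>z. NI (distr M borel X) (\<lambda>x. \<phi> (z, x)))" by (rule D.nn_integral_fst[symmetric]) measurable
 also have "... = NI M (\<lambda>w. NI M (\<lambda>w'. \<phi> ((A w, B w), X w')))" by (simp add: nn_integral_distr)
 finally show ?thesis .
qed

lemma integral_indep:
 fixes \<phi> :: "(real \<times> real) \<times> real => real"
 assumes [measurable]: "\<phi> \<in> borel_measurable ((borel \<Otimes>\<^sub>M borel) \<Otimes>\<^sub>M borel)" and b: "!!z. 0 <= \<phi> z" "!!z. \<phi> z <= 1"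
 shows "(LINT w|M. \<phi> ((A w, B w), X w)) = (LINT w|M. \<integral>w'. \<phi> ((A w, B w), X w') \<partial>M)"
proof -
 have int: "integrable M g" if "g \<in> borel_measurable M" "!!w. 0 <= g w \<and> g w <= 1" for g :: "'a => real"
  by (rule integrable_const_bound[of _ 1]) (use that in auto)
 have i: "0 <= (LINT w'|M. \<phi> (z, X w')) \<and> (LINT w'|M. \<phi> (z, X w')) <= 1" for z
 proof -
  obtain a b' where [simp]: "z = (a, b')" by (cases z)
  have "(\<lambda>w'. \<phi> ((a, b'), X w')) \<in> borel_measurable M" by simp
  then have "integrable M (\<lambda>w'. \<phi> (z, X w'))" using b by (intro int) auto
  from integral_mono[OF this, of "\<lambda>_. 1"] show ?thesis using b prob_space by simp
 qed
 have "ennreal (LINT w|M. \<phi> ((A w, B w), X w)) = NE M (\<lambda>w. \<phi> ((A w, B w), X w))" using b by (intro nn_integral_eq_integral[symmetric] int) auto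
 also have "... = NI M (\<lambda>w. NE M (\<lambda>w'. \<phi> ((A w, B w), X w')))" by (rule nn_integral_indep) measurable
 also have "... = NE M (\<lambda>w. LINT w'|M. \<phi> ((A w, B w), X w'))" using b by (intro nn_integral_cong nn_integral_eq_integral int) auto
 also have "... = ennreal (LINT w|M. \<integral>w'. \<phi> ((A w, B w), X w') \<partial>M)" using i by (intro nn_integral_eq_integral int) auto
 finally show ?thesis using b by simp
qed

lemma nn_integral_fixpoint:
 assumes [measurable]: "\<phi> \<in> borel_measurable borel"
 shows "NI M (\<lambda>w. \<phi> (X w)) = NI M (\<lambda>w. \<phi> (A w * X w + B w))"
proof -
 have "NI M (\<lambda>w. \<phi> (X w)) = NI (distr M borel X) \<phi>" by (simp add: nn_integral_distr)
 also have "... = NI M (\<lambda>w. \<phi> (A w * X w + B w))" unfolding fixpoint by (simp add: nn_integral_distr)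
 finally show ?thesis .
qed

lemma B_moment_less: "0 < p ==> p <= \<nu> ==> integrable M (\<lambda>w. abs (B w) powr p)"
proof -
 assume p: "0 < p" "p <= \<nu>"
 show ?thesis
 proof (rule Lint_bound)
  show "integrable M (\<lambda>w. 1 + abs (B w) powr \<nu>)" using B_moment by simp
  show "AE w in M. norm (abs (B w) powr p) <= norm (1 + abs (B w) powr \<nu>)"
  proof (rule AE_I2)
   fix w
   have "abs (B w) powr p <= 1 + abs (B w) powr \<nu>"
   proof (cases "abs (B w) <= 1")
    case True
    then have "abs (B w) powr p <= 1" using p by (intro powr_le1) auto
    then show ?thesis by (simp add: add_increasing2)
   next
    case False
    then have "abs (B w) powr p <= abs (B w) powr \<nu>" using p by simp
    then show ?thesis by simp
   qed
   then show "norm (abs (B w) powr p) <= norm (1 + abs (B w) powr \<nu>)" by simp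
  qed
 qed measurable
qed

text \<open>A contraction, since E A powr p < 1. No moment of X is known in advance, so the
  recursion runs on truncations min (s * abs X powr p) K: each step multiplies s by c < 1 at cost s
  * b, the truncated term dies out along the iteration, and K is removed by monotone
  convergence.\<close>

lemma X_moment:
 assumes p: "0 < p" "p < \<kappa>"
 shows "integrable M (\<lambda>w. abs (X w) powr p)"
proof -
 define \<rho> where "\<rho> = (LINT w|M. A w powr p)"
 have \<rho>: "0 <= \<rho>" "\<rho> < 1" unfolding \<rho>_def using A_moment_less(2)[OF p] by auto
 have "((\<lambda>\<delta>. (1 + \<delta>) powr p * \<rho>) \<longlongrightarrow> \<rho>) (at_right 0)" by (auto intro!: tendsto_eq_intros)
 then have "\<forall>\<^sub>F \<delta> in at_right 0. (1 + \<delta>) powr p * \<rho> < 1 \<and> 0 < \<delta>"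
  using \<rho> by (intro eventually_conj order_tendstoD eventually_at_right_less) auto
 then obtain \<delta> where \<delta>: "(1 + \<delta>) powr p * \<rho> < 1" "0 < \<delta>" using eventually_happens'[OF trivial_limit_at_right_real] by blast
 define c where "c = (1 + \<delta>) powr p * \<rho>"
 have c: "0 <= c" "c < 1" using \<delta> \<rho> by (auto simp: c_def)
 define k where "k = (1 + 1 / \<delta>) powr p"
 have k: "0 <= k" by (simp add: k_def)
 define b where "b = (LINT w|M. k * abs (B w) powr p)"
 have b: "0 <= b" unfolding b_def using k by simp
 let ?D = "\<lambda>w. k * abs (B w) powr p"
 have bI: "NE M (\<lambda>w. ?D w) = ennreal b" unfolding b_def using k p nu by (intro nn_integral_eq_integral integrable_mult_right B_moment_less) auto
 \<comment> \<open>Valid for every p > 0, since one of x and y dominates the other up to the factor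
   \<delta>. The constant before abs x powr p is close to 1, which keeps \<open>c\<close> below
   1.\<close>
 have sum_le: "abs (x + y) powr p <= (1 + \<delta>) powr p * abs x powr p + k * abs y powr p" for x y :: real
 proof (cases "abs y <= \<delta> * abs x")
  case True
  then have "abs (x + y) <= (1 + \<delta>) * abs x" by (simp add: distrib_right)
  then have "abs (x + y) powr p <= ((1 + \<delta>) * abs x) powr p" using p by (intro powr_mono2) auto
  then show ?thesis using \<delta> k by (simp add: powr_mult add_increasing2)
 next
  case False
  then have "abs x <= abs y / \<delta>" using \<delta> by (simp add: pos_le_divide_eq mult.commute)
  then have "abs (x + y) <= (1 + 1 / \<delta>) * abs y" by (simp add: distrib_right)
  then have "abs (x + y) powr p <= ((1 + 1 / \<delta>) * abs y) powr p" using p by (intro powr_mono2) auto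
  then show ?thesis by (simp add: powr_mult k_def add_increasing)
 qed
 have step: "NE M (\<lambda>w. min (s * abs (X w) powr p) K) <= ennreal (s * b) + NE M (\<lambda>w. min (c * s * abs (X w) powr p) K)"
  if s: "0 <= s" and K: "0 <= K" for s K
 proof -
  let ?W = "\<lambda>a. (1 + \<delta>) powr p * a powr p"
  let ?E = "\<lambda>w. s * abs (A w * X w + B w) powr p"
  have "NE M (\<lambda>w. min (s * abs (X w) powr p) K) = NE M (\<lambda>w. min (?E w) K)" by (rule nn_integral_fixpoint) measurable
  also have "... <= NI M (\<lambda>w. ennreal s * ennreal (?D w) + ennreal (min (s * ?W (abs (A w)) * abs (X w) powr p) K))"
  proof (rule nn_integral_mono)
   fix w
   have "s * abs (A w * X w + B w) powr p <= s * (?W (abs (A w)) * abs (X w) powr p + k * abs (B w) powr p)"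
    using sum_le[of "A w * X w" "B w"] s by (intro mult_left_mono) (auto simp: abs_mult powr_mult)
   moreover have "0 <= s * ?D w" using s k by simp
   ultimately have "min (?E w) K <= s * ?D w + min (s * ?W (abs (A w)) * abs (X w) powr p) K" by (auto simp: min_def distrib_left)
   then show "ennreal (min (?E w) K)
     <= ennreal s * ennreal (?D w) + ennreal (min (s * ?W (abs (A w)) * abs (X w) powr p) K)" by (rule ennreal_le_mult_add) (use s k K in simp_all)
  qed
  also have "... = ennreal s * ennreal b + NE M (\<lambda>w. min (s * ?W (abs (A w)) * abs (X w) powr p) K)"
   by (subst nn_integral_add) (auto simp: nn_integral_cmult bI)
  also have "NE M (\<lambda>w. min (s * ?W (abs (A w)) * abs (X w) powr p) K)
    = NI M (\<lambda>w. NE M (\<lambda>w'. min (s * ?W (abs (A w)) * abs (X w') powr p) K))"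
   using nn_integral_indep[of "\<lambda>z. ennreal (min (s * ?W (abs (fst (fst z))) * abs (snd z) powr p) K)"] by simp
  also have "... = NI M (\<lambda>w'. NE M (\<lambda>w. min (s * ?W (abs (A w)) * abs (X w') powr p) K))"
  proof -
   interpret pair_sigma_finite M M ..
   show ?thesis by (rule Fubini'[symmetric]) measurable
  qed
  \<comment> \<open>The mean of a minimum is at most the minimum of the means; averaging over A here
    replaces its power by \<rho>.\<close>
  also have "... <= NE M (\<lambda>w. min (c * s * abs (X w) powr p) K)"
  proof (rule nn_integral_mono)
   fix w'
   let ?x = "abs (X w') powr p"
   let ?A = "NE M (\<lambda>w. min (s * ?W (abs (A w)) * ?x) K)"
   have "?A <= NE M (\<lambda>w. s * (1 + \<delta>) powr p * ?x * A w powr p)"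
    using A_nonneg by (intro nn_integral_mono_AE) (auto elim!: eventually_mono intro!: ennreal_leI simp: mult_ac)
   also have "... = ennreal (s * (1 + \<delta>) powr p * ?x * \<rho>)"
    unfolding \<rho>_def using s by (subst nn_integral_eq_integral) (auto intro!: integrable_mult_right A_moment_less p)
   finally have 1: "?A <= ennreal (c * s * ?x)" by (simp add: c_def mult_ac)
   have "?A <= NE M (\<lambda>w. K)" by (intro nn_integral_mono ennreal_leI) auto
   then have 2: "?A <= ennreal K" by (simp add: emeasure_space_1)
   show "?A <= ennreal (min (c * s * ?x) K)" using 1 2 by (auto simp: min_def)
  qed
  finally show ?thesis using s b by (simp add: ennreal_mult)
 qed
 let ?B = "\<lambda>w. abs (X w) powr p"
 let ?I = "\<lambda>K. NE M (\<lambda>w. min (?B w) K)"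
 have iter: "?I K <= ennreal (b * (\<Sum>j<n. c ^ j)) + NE M (\<lambda>w. min (c ^ n * abs (X w) powr p) K)"
  if K: "0 <= K" for K n
 proof (induction n)
  case (Suc n)
  have "ennreal (b * (\<Sum>j<n. c ^ j)) + NE M (\<lambda>w. min (c ^ n * abs (X w) powr p) K)
    <= ennreal (b * (\<Sum>j<n. c ^ j)) + (ennreal (c ^ n * b) + NE M (\<lambda>w. min (c * c ^ n * abs (X w) powr p) K))"
   using c K by (intro add_left_mono step) auto
  also have "... = ennreal (b * (\<Sum>j<Suc n. c ^ j)) + NE M (\<lambda>w. min (c ^ Suc n * abs (X w) powr p) K)"
   using b c by (simp add: add.assoc[symmetric] ennreal_plus[symmetric] sum_nonneg distrib_left del: ennreal_plus)
  finally show ?case using Suc by simp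
 qed simp
 have bound: "?I K <= ennreal (b / (1 - c))" if K: "0 <= K" for K
 proof -
  have "(\<lambda>n. \<integral>w. min (c ^ n * abs (X w) powr p) K \<partial>M) \<longlonglongrightarrow> (LINT w|M. 0)"
  proof (rule integral_dominated_convergence)
   show "integrable M (\<lambda>w. K)" by simp
   show "AE w in M. (\<lambda>n. min (c ^ n * abs (X w) powr p) K) \<longlonglongrightarrow> 0"
   proof (rule AE_I2)
    fix w
    have "(\<lambda>n. min (c ^ n * abs (X w) powr p) K) \<longlonglongrightarrow> min (0 * abs (X w) powr p) K"
     using c by (intro tendsto_min tendsto_mult LIMSEQ_power_zero tendsto_const) auto
    then show "(\<lambda>n. min (c ^ n * abs (X w) powr p) K) \<longlonglongrightarrow> 0" using K by simp
   qed
  qed (use K c in auto)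
  then have lim: "(\<lambda>n. b / (1 - c) + (LINT w|M. min (c ^ n * abs (X w) powr p) K)) \<longlonglongrightarrow> b / (1 - c) + 0"
   by (intro tendsto_add tendsto_const) simp
  have mi: "integrable M (\<lambda>w. min (c ^ n * abs (X w) powr p) K)" for n using c K by (intro integrable_const_bound[of _ K]) auto
  have m1: "NE M (\<lambda>w. min (c ^ n * abs (X w) powr p) K) = ennreal (LINT w|M. min (c ^ n * abs (X w) powr p) K)" for n
   using c K by (intro nn_integral_eq_integral mi) auto
  have m0: "0 <= (LINT w|M. min (c ^ n * abs (X w) powr p) K)" for n using c K by simp
  let ?C = "LINT w|M. min (c ^ 0 * abs (X w) powr p) K"
  have "?C <= b / (1 - c) + (LINT w|M. min (c ^ n * abs (X w) powr p) K)" for n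
  proof -
   have "(\<Sum>j<n. c ^ j) <= 1 / (1 - c)" using c by (simp add: sum_gp_strict divide_right_mono)
   then have "b * (\<Sum>j<n. c ^ j) <= b / (1 - c)" using b mult_left_mono by fastforce
   moreover have "ennreal ?C <= ennreal (b * (\<Sum>j<n. c ^ j) + (LINT w|M. min (c ^ n * abs (X w) powr p) K))"
    using iter[OF K, of n] m0[of n] b c unfolding m1[symmetric] by (simp add: m1 sum_nonneg)
   then have "?C <= b * (\<Sum>j<n. c ^ j) + (LINT w|M. min (c ^ n * abs (X w) powr p) K)"
    using m0[of n] b c by (subst (asm) ennreal_le_iff) (auto intro!: add_nonneg_nonneg mult_nonneg_nonneg sum_nonneg)
   ultimately show ?thesis by simp
  qed
  then have "?C <= b / (1 - c) + 0" by (intro LIMSEQ_le_const[OF lim]) auto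
  then show ?thesis using m1[of 0] by (simp add: ennreal_leI)
 qed
 let ?G = "\<lambda>w. SUP n. ennreal (min (?B w) (real n))"
 have "NE M (\<lambda>w. ?B w) <= NI M (\<lambda>w. ?G w)"
 proof (rule nn_integral_mono)
  fix w
  obtain n :: nat where "abs (X w) powr p <= real n" using real_arch_simple by blast
  then have "ennreal (?B w) <= ennreal (min (?B w) (real n))" by simp
  also have "... <= ?G w" by (intro SUP_upper) auto
  finally show "ennreal (?B w) <= ?G w" .
 qed
 also have "... = (SUP n. NE M (\<lambda>w. min (?B w) (real n)))" by (intro nn_integral_monotone_convergence_SUP) (auto simp: incseq_def le_fun_def)
 also have "... <= ennreal (b / (1 - c))" by (intro SUP_least bound) auto
 finally show ?thesis by (intro integrableI_nonneg) (auto intro: le_less_trans)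
qed

lemma nn_integral_product:
 assumes [measurable]: "\<phi> \<in> borel_measurable (borel \<Otimes>\<^sub>M borel)" "\<psi> \<in> borel_measurable borel"
 shows "NI M (\<lambda>w. \<phi> (A w, B w) * \<psi> (X w)) = NI M (\<lambda>w. \<phi> (A w, B w)) * NI M (\<lambda>w. \<psi> (X w))"
 using nn_integral_indep[of "\<lambda>z. \<phi> (fst z) * \<psi> (snd z)"] by (simp add: nn_integral_cmult nn_integral_multc)

lemma integrable_product:
 assumes [measurable]: "\<phi> \<in> borel_measurable (borel \<Otimes>\<^sub>M borel)" "\<psi> \<in> borel_measurable borel"
  and \<phi>: "integrable M (\<lambda>w. \<phi> (A w, B w))" "!!z. 0 <= \<phi> z" and \<psi>: "integrable M (\<lambda>w. \<psi> (X w))" "!!z. 0 <= (\<psi> z :: real)"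
 shows "integrable M (\<lambda>w. \<phi> (A w, B w) * \<psi> (X w) :: real)"
proof (rule integrableI_nonneg)
 let ?A = "NE M (\<lambda>w. \<phi> (A w, B w) * \<psi> (X w))"
 have "?A = NE M (\<lambda>w. \<phi> (A w, B w)) * NE M (\<lambda>w. \<psi> (X w))"
  using nn_integral_product[of "\<lambda>z. ennreal (\<phi> z)" "\<lambda>x. ennreal (\<psi> x)"] \<phi>(2) \<psi>(2) by (simp add: ennreal_mult)
 also have "... < \<infinity>" using \<phi> \<psi> by (simp add: nn_integral_eq_integral ennreal_mult_less_top)
 finally show "?A < \<infinity>" .
qed (use \<phi> \<psi> in auto)

end

section \<open>Increments of powers and exceedance integrals\<close>

abbreviation pos_powr :: "real => real => real" where "pos_powr q x \<equiv> max x 0 powr q"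

lemma powr_diff_le_concave:
 fixes u w :: real
 assumes "0 <= u" "u <= w" "0 < q" "q <= 1"
 shows "w powr q - u powr q <= (w - u) powr q"
proof (cases "w = 0")
 case False
 then have w: "0 < w" using assms by simp
 have le: "t / w <= (t / w) powr q" if "0 <= t" "t <= w" for t
 proof -
  have "(t / w) powr 1 <= (t / w) powr q" using that w assms by (intro powr_mono') auto
  then show ?thesis using that by simp
 qed
 have "1 = u / w + (w - u) / w" using w by (simp add: add_divide_distrib[symmetric])
 also have "... <= (u / w) powr q + ((w - u) / w) powr q" using assms by (intro add_mono le) auto
 also have "... = (u powr q + (w - u) powr q) / w powr q" by (simp add: powr_divide add_divide_distrib)
 finally show ?thesis using w by simp
qed (use assms in auto)

lemma powr_diff_le_convex:
 fixes u w :: real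
 assumes "0 <= u" "u <= w" "1 < q"
 shows "w powr q - u powr q <= q * (w - u) * w powr (q - 1)"
proof (cases "w = 0")
 case False
 then have w: "0 < w" using assms by simp
 have "u / w <= 1 / q * (u / w) powr q + (1 - 1 / q)" using powr_less_interpolation[of "u / w" 1 q] assms by (cases "u / w = 1") auto
 from mult_left_mono[OF this, of q] have "q * (u / w) <= (u / w) powr q + (q - 1)" using assms by (simp add: right_diff_distrib distrib_left)
 then have "1 - (u / w) powr q <= q * (w - u) / w" using w by (simp add: diff_divide_distrib right_diff_distrib)
 from mult_left_mono[OF this, of "w powr q"] have "w powr q - w powr q * (u / w) powr q <= w powr q * (q * (w - u) / w)" by (simp add: right_diff_distrib)
 then show ?thesis using w by (simp add: powr_divide powr_diff mult_ac)
qed (use assms in auto)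

lemma pos_powr_diff_concave: "0 < q ==> q <= 1 ==> abs (pos_powr q (z + b) - pos_powr q z) <= abs b powr q"
proof -
 assume q: "0 < q" "q <= 1"
 have main: "abs (pos_powr q x - pos_powr q y) <= abs (x - y) powr q" if "y <= x" for x y :: real
 proof -
  have "pos_powr q y <= pos_powr q x" using that q by (intro powr_mono2) auto
  moreover have "pos_powr q x - pos_powr q y <= (max x 0 - max y 0) powr q" using that q by (intro powr_diff_le_concave) auto
  moreover have "(max x 0 - max y 0) powr q <= abs (x - y) powr q" using that q by (intro powr_mono2) auto
  ultimately show ?thesis by simp
 qed
 show ?thesis using main[of z "z + b"] main[of "z + b" z] by (cases "b <= 0") (auto)
qed

lemma pos_powr_diff_convex:
 assumes q: "1 < q"
 shows "abs (pos_powr q (z + b) - pos_powr q z) <= q * 2 powr (q - 1) * (abs b * abs z powr (q - 1) + abs b powr q)"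
proof -
 have main: "abs (pos_powr q x - pos_powr q y) <= q * abs (x - y) * (max (abs x) (abs y)) powr (q - 1)" if "y <= x" for x y :: real
 proof -
  have "pos_powr q y <= pos_powr q x" using that q by (intro powr_mono2) auto
  moreover have "pos_powr q x - pos_powr q y <= q * (max x 0 - max y 0) * (max x 0) powr (q - 1)" using that q by (intro powr_diff_le_convex) auto
  moreover have "q * (max x 0 - max y 0) * (max x 0) powr (q - 1) <= q * abs (x - y) * (max (abs x) (abs y)) powr (q - 1)"
   using that q by (intro mult_mono powr_mono2) auto
  ultimately show ?thesis by simp
 qed
 let ?A = "max (abs (z + b)) (abs z)"
 have "abs (pos_powr q (z + b) - pos_powr q z) <= q * abs b * ?A powr (q - 1)"
 proof (cases "b <= 0")
  case True
  then show ?thesis using main[of "z + b" z] by (subst abs_minus_commute) (simp add: max.commute)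
 next
  case False
  then show ?thesis using main[of z "z + b"] by simp
 qed
 also have "... <= q * abs b * (2 powr (q - 1) * (abs z powr (q - 1) + abs b powr (q - 1)))"
 proof (intro mult_left_mono)
  have "?A powr (q - 1) <= (2 * max (abs z) (abs b)) powr (q - 1)" using q by (intro powr_mono2) auto
  also have "... <= 2 powr (q - 1) * (abs z powr (q - 1) + abs b powr (q - 1))" by (cases "abs z <= abs b") (simp_all add: powr_mult)
  finally show "?A powr (q - 1) <= 2 powr (q - 1) * (abs z powr (q - 1) + abs b powr (q - 1))" .
 qed (use q in auto)
 also have "... = q * 2 powr (q - 1) * (abs b * abs z powr (q - 1) + abs b powr q)" by (cases "b = 0") (simp_all add: distrib_left powr_diff mult_ac)
 finally show ?thesis .
qed

text \<open>A Young inequality with constants 1: comparing b with a powr \<sigma> decides which term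
  on the right dominates.\<close>

lemma young_powr:
 fixes a b :: real
 assumes "0 <= a" "0 <= b" "0 < \<sigma>" "0 < p"
 shows "b * a powr p <= a powr (p + \<sigma>) + b powr ((p + \<sigma>) / \<sigma>)"
proof (cases "b <= a powr \<sigma>")
 case True
 then have "b * a powr p <= a powr \<sigma> * a powr p" by (intro mult_right_mono) auto
 then show ?thesis by (simp add: powr_add mult.commute add_increasing2)
next
 case False
 then have b: "0 < b" "a powr \<sigma> <= b" using powr_ge_zero[of a \<sigma>] by linarith+
 have "a = (a powr \<sigma>) powr (1 / \<sigma>)" using assms by (simp add: powr_powr)
 also have "... <= b powr (1 / \<sigma>)" using assms b by (intro powr_mono2) auto
 finally have "a powr p <= (b powr (1 / \<sigma>)) powr p" using assms by (intro powr_mono2) auto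
 then have "b * a powr p <= b * b powr (p / \<sigma>)" using b by (intro mult_left_mono) (auto simp: powr_powr)
 also have "... = b powr ((p + \<sigma>) / \<sigma>)" using assms by (simp add: add_divide_distrib powr_add)
 finally show ?thesis by (simp add: add_increasing)
qed

text \<open>\<open>exceeds b s\<close> indicates \<open>y > exp s\<close> or, for \<open>b = False\<close>, \<open>y \<ge> exp s\<close>, so that both tails of the theorem are covered.\<close>

definition exceeds :: "bool => real => real => real" where
 "exceeds b s y = (if (if b then exp s < y else exp s <= y) then 1 else 0)"

lemma exceeds_meas [measurable]:
 assumes [measurable]: "f \<in> borel_measurable N" "g \<in> borel_measurable N"
 shows "(\<lambda>x. exceeds b (f x) (g x)) \<in> borel_measurable N" unfolding exceeds_def by simp

lemma exceeds_bounds: "0 <= exceeds b s y" "exceeds b s y <= 1" by (auto simp: exceeds_def)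

lemma exceeds_mono: "z <= y ==> exceeds b s z <= exceeds b s y" by (auto simp: exceeds_def)

lemma exceeds_antimono: "s <= t ==> exceeds b t y <= exceeds b s y" using exp_le_cancel_iff[of s t] by (auto simp: exceeds_def simp del: exp_le_cancel_iff)

lemma exceeds_scale: "0 < a ==> exceeds b (s - ln a) x = exceeds b s (a * x)" by (simp add: exceeds_def exp_diff pos_divide_less_eq pos_divide_le_eq mult.commute)

lemma exceeds_markov: "0 < p ==> exceeds b s x <= exp (- p * s) * abs x powr p"
proof (cases "exceeds b s x = 0")
 case False
 assume p: "0 < p"
 have "exp s <= abs x" using False by (auto simp: exceeds_def split: if_splits)
 then have "exp s powr p <= abs x powr p" using p by (intro powr_mono2) auto
 then have "exp (- p * s) * exp (p * s) <= exp (- p * s) * abs x powr p" by (intro mult_left_mono) (auto simp: powr_def)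
 then have "1 <= exp (- p * s) * abs x powr p" by (simp add: mult_exp_exp)
 then show ?thesis using exceeds_bounds(2)[of b s x] by simp
qed simp

text \<open>Source of the expectations in the theorem and of the factor 1 / \<kappa>: integrating
  exp (r * s) over the levels s exceeded by y. Strict and weak exceedance differ only at s = ln
  y.\<close>

lemma exp_exceeds_integral:
 assumes r: "0 < r"
 shows "integrable lborel (\<lambda>s. exp (r * s) * exceeds b s y)" "(LBINT s. exp (r * s) * exceeds b s y) = pos_powr r y / r"
proof -
 let ?A = "NE lborel (\<lambda>s. exp (r * s) * exceeds b s y)"
 have nn: "?A = ennreal (pos_powr r y / r)"
 proof (cases "0 < y")
  case True
  define L where "L = ln y"
  have y: "y = exp L" using True by (simp add: L_def)
  have "?A = NI lborel (\<lambda>s. ennreal (exp (r * s)) * ind {..L} s)" using AE_lborel_singleton[of L]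
   by (intro nn_integral_cong_AE) (auto elim!: eventually_mono simp: exceeds_def y indicator_def)
  also have "... = NI lborel (\<lambda>u. ennreal (exp (- r * u)) * ind {- L..} u)"
   using nn_integral_real_affine[of "\<lambda>s. ennreal (exp (r * s)) * ind {..L} s" "- 1" 0] by (auto simp: indicator_def intro!: nn_integral_cong)
  also have "... = ennreal (0 - - exp (- r * - L) / r)"
  proof (rule nn_integral_FTC_atLeast)
   show "((\<lambda>u. - exp (- r * u) / r) \<longlongrightarrow> 0) at_top" using r by real_asymp
   show "((\<lambda>u. - exp (- r * u) / r) has_real_derivative exp (- r * u)) (at u)" for u using r by (auto intro!: derivative_eq_intros)
  qed auto
  also have "... = ennreal (pos_powr r y / r)" by (simp add: y powr_def)
  finally show ?thesis .
 next
  case False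
  then have "exceeds b s y = 0" for s using exp_gt_zero[of s] by (auto simp: exceeds_def simp del: exp_gt_zero)
  then show ?thesis using False by simp
 qed
 show "integrable lborel (\<lambda>s. exp (r * s) * exceeds b s y)" using nn exceeds_bounds by (intro integrableI_nonneg) auto
 show "(LBINT s. exp (r * s) * exceeds b s y) = pos_powr r y / r" using nn exceeds_bounds r by (subst integral_eq_nn_integral) auto
qed

lemma exp_exceeds_diff:
 assumes r: "0 < r"
 shows "NE lborel (\<lambda>s. exp (r * s) * abs (exceeds b s y - exceeds b s z)) = ennreal (abs (pos_powr r y - pos_powr r z) / r)"
proof -
 let ?A = "\<lambda>y z. NE lborel (\<lambda>s. exp (r * s) * abs (exceeds b s y - exceeds b s z))"
 have main: "?A y z = ennreal (abs (pos_powr r y - pos_powr r z) / r)" if "z <= y" for y z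
 proof -
  have le: "exceeds b s z <= exceeds b s y" for s by (rule exceeds_mono[OF that])
  have int: "integrable lborel (\<lambda>s. exp (r * s) * exceeds b s y - exp (r * s) * exceeds b s z)" by (intro Lintable_diff exp_exceeds_integral r)
  have "?A y z = NE lborel (\<lambda>s. exp (r * s) * exceeds b s y - exp (r * s) * exceeds b s z)" using le by (simp add: right_diff_distrib[symmetric])
  also have "... = ennreal (LBINT s. exp (r * s) * exceeds b s y - exp (r * s) * exceeds b s z)" using le by (intro nn_integral_eq_integral int) (auto)
  also have "(LBINT s. exp (r * s) * exceeds b s y - exp (r * s) * exceeds b s z) = pos_powr r y / r - pos_powr r z / r" using exp_exceeds_integral[OF r] by simp
  also have "... = abs (pos_powr r y - pos_powr r z) / r" using powr_mono2[of r "max z 0" "max y 0"] that r by (simp add: diff_divide_distrib)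
  finally show ?thesis .
 qed
 show ?thesis using main[of z y] main[of y z] by (cases "z <= y") (auto simp: abs_minus_commute)
qed

text \<open>Trades the weight \<open>br s\<close> for a small change of the exponent, upwards for s
  >= 0 and downwards for s < 0. This is why moments of increments are needed on both sides of
  \<kappa>.\<close>

lemma exp_weight_interpolation:
 assumes "q' < \<kappa>" "\<kappa> < q"
 shows "\<exists>C>0. \<forall>s::real. exp (\<kappa> * s) * br s <= C * (exp (q * s) + exp (q' * s))"
proof (intro exI conjI allI)
 define c where "c = min (q - \<kappa>) (\<kappa> - q')"
 have c: "0 < c" "\<kappa> + c <= q" "q' <= \<kappa> - c" using assms by (auto simp: c_def)
 show "0 < 1 + 1 / c" using c by (simp add: add_pos_pos)
 fix s :: real
 have "1 + abs s <= (1 + 1 / c) * (1 + c * abs s)" using c by (simp add: field_simps)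
 also have "... <= (1 + 1 / c) * exp (c * abs s)" using c by (intro mult_left_mono) auto
 finally have "exp (\<kappa> * s) * br s <= exp (\<kappa> * s) * ((1 + 1 / c) * exp (c * abs s))" by simp
 also have "... = (1 + 1 / c) * exp (\<kappa> * s + c * abs s)" by (simp add: exp_add)
 also have "... <= (1 + 1 / c) * (exp (q * s) + exp (q' * s))"
 proof (rule mult_left_mono)
  show "exp (\<kappa> * s + c * abs s) <= exp (q * s) + exp (q' * s)"
  proof (cases "0 <= s")
   case True
   then have "exp (\<kappa> * s + c * abs s) <= exp (q * s)" using mult_right_mono[OF c(2) True] by (simp add: distrib_right)
   then show ?thesis by (simp add: add_increasing2)
  next
   case False
   then have "exp (\<kappa> * s + c * abs s) <= exp (q' * s)" using mult_right_mono[OF c(3), of "- s"] by (simp add: left_diff_distrib)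
   then show ?thesis by (simp add: add_increasing)
  qed
 qed (use c in simp)
 finally show "exp (\<kappa> * s) * br s <= (1 + 1 / c) * (exp (q * s) + exp (q' * s))" .
qed

context perpetuity
begin

lemma AX_moment: "0 < p ==> p < \<kappa> ==> integrable M (\<lambda>w. abs (A w * X w) powr p)"
proof -
 assume p: "0 < p" "p < \<kappa>"
 have "integrable M (\<lambda>w. abs (A w) powr p)"
 proof (subst integrable_cong_AE)
  show "AE w in M. abs (A w) powr p = A w powr p" using A_nonneg by auto
  show "integrable M (\<lambda>w. A w powr p)" by (rule A_moment_less(1)[OF p])
 qed measurable
 then have "integrable M (\<lambda>w. abs (fst (A w, B w)) powr p * abs (X w) powr p)"
  using X_moment[OF p] by (intro integrable_product[where \<phi> = "\<lambda>z. abs (fst z) powr p"]) auto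
 then show ?thesis by (simp add: abs_mult powr_mult)
qed

lemma low_diff_moment: "integrable M (\<lambda>w. pos_powr (\<kappa> / 2) (A w * X w + B w) - pos_powr (\<kappa> / 2) (A w * X w))"
proof -
 have p: "0 < \<kappa> / 2" "\<kappa> / 2 < \<kappa>" using kappa_pos by auto
 have le: "pos_powr (\<kappa> / 2) y <= abs y powr (\<kappa> / 2)" for y using p by (intro powr_mono2) auto
 have "integrable (distr M borel X) (\<lambda>y. abs y powr (\<kappa> / 2))" using X_moment[OF p] by (subst integrable_distr_eq) auto
 then have "integrable M (\<lambda>w. abs (A w * X w + B w) powr (\<kappa> / 2))" unfolding fixpoint by (subst (asm) integrable_distr_eq) auto
 then have 1: "integrable M (\<lambda>w. pos_powr (\<kappa> / 2) (A w * X w + B w))" by (rule Lint_bound) (use le in auto)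
 have "integrable M (\<lambda>w. pos_powr (\<kappa> / 2) (A w * X w))" by (rule Lint_bound[OF AX_moment[OF p]]) (use le in auto)
 with 1 show ?thesis by simp
qed

text \<open>Above \<kappa> the two terms need not be integrable separately. For \<kappa> < 1 the
  increment is at most a power of abs B. Otherwise the mean value bound produces abs B * abs (A X)
  powr (q - 1): here q - 1 < \<kappa>, so the factor in X is integrable, and
  \<open>young_powr\<close> splits abs B * A powr (q - 1) into A powr \<kappa> and a power of abs
  B.\<close>

lemma high_diff_moment: "\<exists>q>\<kappa>. integrable M (\<lambda>w. pos_powr q (A w * X w + B w) - pos_powr q (A w * X w))"
proof (cases "\<kappa> < 1")
 case True
 define q where "q = min 1 \<nu>"
 have q: "\<kappa> < q" "0 < q" "q <= 1" "q <= \<nu>" using True nu kappa_pos by (auto simp: q_def)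
 have "integrable M (\<lambda>w. pos_powr q (A w * X w + B w) - pos_powr q (A w * X w))" using pos_powr_diff_concave[OF q(2,3)]
  by (intro Lint_bound[OF B_moment_less[OF q(2,4)]]) auto
 then show ?thesis using q by blast
next
 case False
 \<comment> \<open>\<delta> < 1 keeps q - 1 below \<kappa>; \<delta> <= 1 - \<kappa> / \<nu> keeps
   the exponents \<kappa> / (1 - \<delta>) and q of abs B at most \<nu>.\<close>
 define \<delta> where "\<delta> = min (1 / 2) (1 - \<kappa> / \<nu>)"
 have \<nu>: "1 < \<nu>" using False nu by simp
 have \<delta>: "0 < \<delta>" "\<delta> < 1" "\<kappa> / \<nu> <= 1 - \<delta>" using nu \<nu> by (auto simp: \<delta>_def)
 define q where "q = \<kappa> + \<delta>"
 have q: "\<kappa> < q" "1 < q" "0 < q - 1" "q - 1 < \<kappa>" using False \<delta> by (auto simp: q_def)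
 have r: "\<kappa> / (1 - \<delta>) <= \<nu>" using \<delta> \<nu> by (simp add: pos_divide_le_eq mult.commute)
 have "\<delta> <= (\<nu> - \<kappa>) / \<nu>" using \<delta> \<nu> by (simp add: diff_divide_distrib)
 also have "... <= \<nu> - \<kappa>" using \<nu> nu by (simp add: divide_le_eq mult_left_mono[of 1 \<nu> "\<nu> - \<kappa>", simplified])
 finally have q\<nu>: "q <= \<nu>" by (simp add: q_def)
 have BA: "integrable M (\<lambda>w. abs (B w) * abs (A w) powr (q - 1))"
 proof (rule Lint_bound)
  let ?A = "\<kappa> / (1 - \<delta>)"
  show "integrable M (\<lambda>w. A w powr \<kappa> + abs (B w) powr ?A)" using r \<delta> kappa_pos by (intro Lintable_add A_int B_moment_less) auto
  show "AE w in M. norm (abs (B w) * abs (A w) powr (q - 1)) <= norm (A w powr \<kappa> + abs (B w) powr ?A)" using A_nonneg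
  proof eventually_elim
   case (elim w)
   have "q - 1 + (1 - \<delta>) = \<kappa>" by (simp add: q_def)
   then have "abs (B w) * A w powr (q - 1) <= A w powr \<kappa> + abs (B w) powr ?A"
    using young_powr[of "A w" "abs (B w)" "1 - \<delta>" "q - 1"] elim q \<delta> by simp
   then show ?case using elim by simp
  qed
 qed measurable
 have "integrable M (\<lambda>w. (abs (snd (A w, B w)) * abs (fst (A w, B w)) powr (q - 1)) * abs (X w) powr (q - 1))"
  using BA X_moment[OF q(3,4)] by (intro integrable_product[where \<phi> = "\<lambda>z. abs (snd z) * abs (fst z) powr (q - 1)"]) auto
 then have "integrable M (\<lambda>w. abs (B w) * abs (A w * X w) powr (q - 1))" by (simp add: abs_mult powr_mult mult.assoc)
 then have dom: "integrable M (\<lambda>w. q * 2 powr (q - 1) * (abs (B w) * abs (A w * X w) powr (q - 1) + abs (B w) powr q))"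
  using q q\<nu> by (intro integrable_mult_right Lintable_add B_moment_less) auto
 have "integrable M (\<lambda>w. pos_powr q (A w * X w + B w) - pos_powr q (A w * X w))"
 proof (rule Lint_bound[OF dom])
  show "AE w in M. norm (pos_powr q (A w * X w + B w) - pos_powr q (A w * X w))
    <= norm (q * 2 powr (q - 1) * (abs (B w) * abs (A w * X w) powr (q - 1) + abs (B w) powr q))" using order_trans[OF pos_powr_diff_convex[OF q(2)] abs_ge_self]
  by simp
 qed measurable
 then show ?thesis using q by blast
qed

end

section \<open>Tail functions of the solution and their defects\<close>

context perpetuity
begin

abbreviation Y :: "'a => real" where "Y \<equiv> \<lambda>w. A w * X w + B w"

abbreviation Z :: "'a => real" where "Z \<equiv> \<lambda>w. A w * X w"

lemma exceeds_integrable: "W \<in> borel_measurable M ==> integrable M (\<lambda>w. exceeds b s (W w))"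
 by (rule integrable_const_bound[of _ 1]) (use exceeds_bounds in auto)

text \<open>The weighted exponential is interpolated between an exponent above \<kappa> and \<kappa>
  / 2. At both exponents the integral over s is a difference of powers by
  \<open>exp_exceeds_diff\<close>, and the two moment lemmas apply.\<close>

lemma weighted_diff_integrable:
 "integrable (lborel \<Otimes>\<^sub>M M) (\<lambda>(s, w). exp (\<kappa> * s) * br s * (exceeds b s (Y w) - exceeds b s (Z w)))"
proof (rule integrableI_bounded)
 interpret pair_sigma_finite lborel M ..
 obtain q where q: "\<kappa> < q" "integrable M (\<lambda>w. pos_powr q (Y w) - pos_powr q (Z w))" using high_diff_moment by blast
 have r: "0 < q" "0 < \<kappa> / 2" "\<kappa> / 2 < \<kappa>" using q kappa_pos by auto
 let ?E = "\<lambda>s. exp (\<kappa> / 2 * s)"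
 obtain C where C: "0 < C" "!!s. exp (\<kappa> * s) * br s <= C * (exp (q * s) + ?E s)" using exp_weight_interpolation[OF r(3) q(1)] by blast
 let ?D = "\<lambda>s w. abs (exceeds b s (Y w) - exceeds b s (Z w))"
 let ?A = "NE (lborel \<Otimes>\<^sub>M M) (\<lambda>x. norm (case x of (s, w) => exp (\<kappa> * s) * br s * (exceeds b s (Y w) - exceeds b s (Z w))))"
 let ?B = "\<lambda>w s. ennreal (exp (\<kappa> * s) * br s * ?D s w)"
 have "?A
   = NI M (\<lambda>w. NI lborel (\<lambda>s. ?B w s))" by (subst nn_integral_snd[symmetric]) (simp_all add: abs_mult)
 also have "... <= NI M (\<lambda>w. ennreal C * (ennreal (abs (pos_powr q (Y w) - pos_powr q (Z w)) / q) + ennreal (abs (pos_powr (\<kappa> / 2) (Y w) - pos_powr (\<kappa> / 2) (Z w)) / (\<kappa> / 2))))"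
 proof (rule nn_integral_mono)
  fix w
  let ?C = "\<lambda>s. ennreal (exp (q * s) * ?D s w) + ennreal (?E s * ?D s w)"
  let ?G = "NI lborel (\<lambda>s. ?B w s)"
  have "?G
    <= NI lborel (\<lambda>s. ennreal C * ?C s)"
  proof (rule nn_integral_mono)
   fix s
   have "exp (\<kappa> * s) * br s * ?D s w <= C * (exp (q * s) + ?E s) * ?D s w" by (intro mult_right_mono C) auto
   also have "... = C * (exp (q * s) * ?D s w + ?E s * ?D s w)" by (simp only: distrib_left distrib_right mult.assoc)
   finally show "?B w s <= ennreal C * ?C s" using C(1) by (subst ennreal_plus[symmetric], simp, simp, subst ennreal_mult[symmetric]) (auto intro!: ennreal_leI)
  qed
  also have "... = ennreal C * (ennreal (abs (pos_powr q (Y w) - pos_powr q (Z w)) / q) + ennreal (abs (pos_powr (\<kappa> / 2) (Y w) - pos_powr (\<kappa> / 2) (Z w)) / (\<kappa> / 2)))"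
   unfolding exp_exceeds_diff[OF r(1), of b, symmetric] exp_exceeds_diff[OF r(2), of b, symmetric]
   by (subst nn_integral_cmult, measurable, subst nn_integral_add, measurable)
  finally show "?G
    <= ennreal C * (ennreal (abs (pos_powr q (Y w) - pos_powr q (Z w)) / q) + ennreal (abs (pos_powr (\<kappa> / 2) (Y w) - pos_powr (\<kappa> / 2) (Z w)) / (\<kappa> / 2)))" .
 qed
 also have "... = ennreal C * (NE M (\<lambda>w. abs (pos_powr q (Y w) - pos_powr q (Z w)) / q) + NE M (\<lambda>w. abs (pos_powr (\<kappa> / 2) (Y w) - pos_powr (\<kappa> / 2) (Z w)) / (\<kappa> / 2)))"
  by (subst nn_integral_cmult, measurable, subst nn_integral_add, measurable)
 also have "... < \<infinity>"
 proof -
  have "NE M (\<lambda>w. abs (g w) / r) < \<infinity>" if "integrable M g" "0 < r" for g r using that by (subst nn_integral_eq_integral) auto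
  from this[OF q(2) r(1)] this[OF low_diff_moment r(2)] show ?thesis by (simp add: ennreal_mult_less_top)
 qed
 finally show "?A < \<infinity>" .
qed measurable

definition f :: "bool => real => real" where
 "f b s = exp (\<kappa> * s) * (LINT w|M. exceeds b s (X w))"

lemma f_fixpoint: "f b s = exp (\<kappa> * s) * (LINT w|M. exceeds b s (Y w))"
proof -
 have "(LINT w|M. exceeds b s (X w)) = (LINT x|distr M borel X. exceeds b s x)" by (subst integral_distr) auto
 also have "... = (LINT w|M. exceeds b s (Y w))" unfolding fixpoint by (subst integral_distr) auto
 finally show ?thesis by (simp add: f_def)
qed

lemma f_meas [measurable]: "f b \<in> borel_measurable borel" unfolding f_def[abs_def] by simp

text \<open>Undoing the tilt turns the shift by ln A into multiplication of an independent copy of X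
  by A; independence then identifies the product with A X in law. Where A = 0 both sides vanish, as
  0 exceeds no exp s.\<close>

lemma f_transfer: "(LINT w|F. f b (s - w)) = exp (\<kappa> * s) * (LINT r|M. exceeds b s (Z r))"
proof -
 have "(LINT w|F. f b (s - w)) = (LINT r|M. A r powr \<kappa> * f b (s - ln (A r)))" by (subst integral_F) auto
 also have "... = (LINT r|M. exp (\<kappa> * s) * (LINT r'|M. exceeds b s (A r * X r')))"
 proof (rule integral_cong_AE)
  show "AE r in M. A r powr \<kappa> * f b (s - ln (A r)) = exp (\<kappa> * s) * (LINT r'|M. exceeds b s (A r * X r'))" using A_nonneg
  proof eventually_elim
   case (elim r)
   show ?case
   proof (cases "A r = 0")
    case True
    have "exceeds b s 0 = 0" using exp_gt_zero[of s] by (simp add: exceeds_def del: exp_gt_zero)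
    then show ?thesis using True by simp
   next
    case False
    then have a: "0 < A r" using elim by simp
    have "A r powr \<kappa> * exp (\<kappa> * (s - ln (A r))) = exp (\<kappa> * s)" using a by (simp add: powr_def right_diff_distrib flip: exp_add)
    then show ?thesis using a by (simp add: f_def exceeds_scale)
   qed
  qed
 qed measurable
 also have "... = exp (\<kappa> * s) * (LINT r|M. \<integral>r'. exceeds b s (A r * X r') \<partial>M)" by simp
 also have "(LINT r|M. \<integral>r'. exceeds b s (A r * X r') \<partial>M) = (LINT r|M. exceeds b s (Z r))"
  using integral_indep[of "\<lambda>z. exceeds b s (fst (fst z) * snd z)"] exceeds_bounds by simp
 finally show ?thesis .
qed

text \<open>Applies the implicit renewal theorem to \<open>f b\<close>. The defect is integrated
  over s by Fubini and \<open>exp_exceeds_integral\<close>; the exponential bound on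
  \<open>f b\<close> is Markov's inequality with the moment of order \<kappa> / 2.\<close>

lemma tail_limit:
 shows "integrable M (\<lambda>z. pos_powr \<kappa> (Y z) - pos_powr \<kappa> (Z z))"
  and "((\<lambda>s. trunc_mean F s * f b s) \<longlongrightarrow> C_const \<alpha> / \<kappa> * (LINT z|M. pos_powr \<kappa> (Y z) - pos_powr \<kappa> (Z z))) at_top"
proof -
 interpret pair_sigma_finite lborel M ..
 interpret L: renewal_law F \<alpha> "\<kappa> / 2" by (rule law)
 let ?G = "\<lambda>s z. exceeds b s (Y z) - exceeds b s (Z z)"
 have defect: "f b s - (LINT w|F. f b (s - w)) = exp (\<kappa> * s) * (LINT z|M. ?G s z)" for s
  unfolding f_transfer by (simp add: f_fixpoint exceeds_integrable right_diff_distrib)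
 have int: "integrable (lborel \<Otimes>\<^sub>M M) (\<lambda>(s, z). exp (\<kappa> * s) * ?G s z)"
 proof (rule Lint_bound[OF weighted_diff_integrable[of b]])
  let ?A = "\<lambda>x. case x of (s, z) => exp (\<kappa> * s) * ?G s z"
  show "AE x in lborel \<Otimes>\<^sub>M M. norm (?A x) <= norm (case x of (s, z) => exp (\<kappa> * s) * br s * ?G s z)"
  proof (intro AE_I2)
   have "exp (\<kappa> * s) * 1 * g <= exp (\<kappa> * s) * br s * g" if "0 <= g" for s g :: real using that by (intro mult_right_mono mult_left_mono) auto
   then show "norm (?A x) <= norm (case x of (s, z) => exp (\<kappa> * s) * br s * ?G s z)" for x
    by (cases x) (simp only: prod.case real_norm_def abs_mult abs_exp_cancel, simp add: abs_of_nonneg)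
  qed
 qed measurable
 have slice: "(LBINT s. exp (\<kappa> * s) * ?G s z) = (pos_powr \<kappa> (Y z) - pos_powr \<kappa> (Z z)) / \<kappa>" for z
  using exp_exceeds_integral[OF kappa_pos] by (simp add: right_diff_distrib diff_divide_distrib)
 have "integrable M (\<lambda>z. \<integral>s. exp (\<kappa> * s) * ?G s z \<partial>lborel)" using integrable_snd[OF int] by simp
 then have "integrable M (\<lambda>z. (pos_powr \<kappa> (Y z) - pos_powr \<kappa> (Z z)) / \<kappa>)" by (simp only: slice)
 then have "integrable M (\<lambda>z. \<kappa> * ((pos_powr \<kappa> (Y z) - pos_powr \<kappa> (Z z)) / \<kappa>))" by (rule integrable_mult_right)
 then show "integrable M (\<lambda>z. pos_powr \<kappa> (Y z) - pos_powr \<kappa> (Z z))" using kappa_pos by simp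
 define c where "c = (LINT z|M. abs (X z) powr (\<kappa> / 2))"
 interpret R: implicit_renewal F \<alpha> "\<kappa> / 2" "f b" \<kappa> c "\<kappa> / 2"
 proof
  show "f b \<in> borel_measurable borel" by simp
  show "0 <= f b s" for s using exceeds_bounds by (auto simp: f_def)
  show "f b t <= exp (\<kappa> * (t - s)) * f b s" if "s <= t" for s t
  proof -
   have "(LINT z|M. exceeds b t (X z)) <= (LINT z|M. exceeds b s (X z))" by (intro integral_mono exceeds_integrable exceeds_antimono that) auto
   then have "exp (\<kappa> * t) * (LINT z|M. exceeds b t (X z)) <= exp (\<kappa> * t) * (LINT z|M. exceeds b s (X z))" by simp
   then show ?thesis by (simp add: f_def mult.assoc[symmetric] mult_exp_exp right_diff_distrib)
  qed
  show "f b s <= c * exp (\<kappa> / 2 * s)" for s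
  proof -
   have "(LINT z|M. exceeds b s (X z)) <= (LINT z|M. exp (- (\<kappa> / 2) * s) * abs (X z) powr (\<kappa> / 2))"
    using kappa_pos by (intro integral_mono exceeds_integrable exceeds_markov integrable_mult_right X_moment) auto
   then have "exp (\<kappa> * s) * (LINT z|M. exceeds b s (X z)) <= exp (\<kappa> * s) * (exp (- (\<kappa> / 2) * s) * c)" unfolding c_def by simp
   also have "... = c * exp (\<kappa> / 2 * s)" by (simp add: mult.assoc[symmetric] mult_exp_exp)
   finally show ?thesis by (simp add: f_def)
  qed
  have "integrable lborel (\<lambda>s. \<integral>z. exp (\<kappa> * s) * br s * ?G s z \<partial>M)" using integrable_fst[OF weighted_diff_integrable[of b]] by simp
  then show "integrable lborel (\<lambda>v. (f b v - (LINT w|F. f b (v - w))) * br v)" unfolding defect by (simp add: mult_ac)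
 qed (use kappa_pos in auto)
 have "(LBINT v. R.d v) = (LBINT s. \<integral>z. exp (\<kappa> * s) * ?G s z \<partial>M)" by (simp add: R.d_def R.Tf_def defect)
 also have "... = (LINT z|M. \<integral>s. exp (\<kappa> * s) * ?G s z \<partial>lborel)" by (rule Fubini_integral[symmetric, OF int])
 also have "... = (LINT z|M. pos_powr \<kappa> (Y z) - pos_powr \<kappa> (Z z)) / \<kappa>" by (simp only: slice integral_divide_zero)
 finally show "((\<lambda>s. trunc_mean F s * f b s) \<longlongrightarrow> C_const \<alpha> / \<kappa> * (LINT z|M. pos_powr \<kappa> (Y z) - pos_powr \<kappa> (Z z))) at_top"
  using R.implicit_renewal_limit by (simp add: C_const_def mult.commute)
qed

end

section \<open>Positivity of the limit\<close>

context perpetuity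
begin

text \<open>The probability that the multiplicative walk started at q exceeds 1 within n steps, by
  recursion on the first step and hence without a path space.\<close>

primrec vN :: "nat => real => real" where
 "vN 0 q = (if 1 < q then 1 else 0)"
| "vN (Suc n) q = (if 1 < q then 1 else (LINT w|M. vN n (q * A w)))"

lemma vN_meas [measurable]: "vN n \<in> borel_measurable borel"
proof (induction n)
 case 0
 show ?case by simp
next
 case (Suc n)
 note [measurable] = Suc
 show ?case by simp
qed

lemma unit_integrable: "g \<in> borel_measurable M ==> (!!w. 0 <= g w) ==> (!!w. g w <= (1::real)) ==> integrable M g" by (rule integrable_const_bound[of _ 1]) auto

lemma unit_integral: "g \<in> borel_measurable M ==> (!!w. 0 <= g w) ==> (!!w. g w <= (1::real)) ==> 0 <= (LINT w|M. g w) \<and> (LINT w|M. g w) <= 1"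
 using integral_mono[OF unit_integrable[of g], of "\<lambda>_. 1"] prob_space by simp

lemma vN_bounds: "0 <= vN n q \<and> vN n q <= 1" by (induction n arbitrary: q) (auto intro: unit_integral[THEN conjunct2])

lemma vN_integrable: "integrable M (\<lambda>w. vN n (q * A w))" using vN_bounds by (intro unit_integrable) auto

lemma vN_incr: "vN n q <= vN (Suc n) q"
proof (induction n arbitrary: q)
 case 0
 show ?case by simp
next
 case (Suc n)
 have "(LINT w|M. vN n (q * A w)) <= (LINT w|M. vN (Suc n) (q * A w))" by (intro integral_mono vN_integrable Suc)
 then show ?case by simp
qed

lemma vN_mono: "q <= r ==> vN n q <= vN n r"
proof (induction n arbitrary: q r)
 case (Suc n)
 have "(LINT w|M. vN n (q * A w)) <= (LINT w|M. vN n (r * A w))" using A_nonneg Suc(2) by (intro integral_mono_AE vN_integrable) (auto intro!: Suc(1) mult_right_mono)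
 moreover have "(LINT w|M. vN n (q * A w)) <= 1" using vN_bounds by (intro unit_integral[THEN conjunct2]) auto
 ultimately show ?case using Suc(2) by auto
qed auto

text \<open>The function q powr (\<kappa> / 2) is superharmonic for the walk, because the moment of
  A of order \<kappa> / 2 is below 1, and it is at least 1 for q > 1.\<close>

lemma vN_markov: "\<exists>c. \<forall>n q. 0 <= q --> vN n q <= c * q powr (\<kappa> / 2)"
proof -
 define p where "p = \<kappa> / 2"
 define \<rho> where "\<rho> = (LINT w|M. A w powr p)"
 have p: "0 < p" "p < \<kappa>" using kappa_pos by (auto simp: p_def)
 have \<rho>: "0 <= \<rho>" "\<rho> < 1" unfolding \<rho>_def using A_moment_less(2)[OF p] by auto
 define c where "c = 1 / (1 - \<rho>)"
 have c: "1 <= c" "0 < c" "c * \<rho> = c - 1" using \<rho> by (auto simp: c_def field_simps)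
 have one: "1 <= c * q powr p" if "1 < q" for q
 proof -
  have "1 * 1 <= c * q powr p" using that p c by (intro mult_mono ge_one_powr_ge_zero) auto
  then show ?thesis by simp
 qed
 have "vN n q <= c * q powr p" if "0 <= q" for n q using that
 proof (induction n arbitrary: q)
  case 0
  then show ?case using one[of q] c by auto
 next
  case (Suc n)
  show ?case
  proof (cases "1 < q")
   case False
   have "(LINT w|M. vN n (q * A w)) <= (LINT w|M. c * q powr p * A w powr p)"
   proof (rule integral_mono_AE[OF vN_integrable])
    show "integrable M (\<lambda>w. c * q powr p * A w powr p)" by (intro integrable_mult_right A_moment_less p)
    show "AE w in M. vN n (q * A w) <= c * q powr p * A w powr p" using A_nonneg
    proof eventually_elim
     case (elim w)
     then show ?case using Suc.IH[of "q * A w"] Suc.prems by (simp add: powr_mult mult.assoc)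
    qed
   qed
   also have "... = q powr p * (c * \<rho>)" by (simp add: \<rho>_def)
   also have "... <= q powr p * c" unfolding c(3) by (intro mult_left_mono) auto
   finally show ?thesis using False by (simp add: mult.commute)
  qed (use one in simp)
 qed
 then show ?thesis unfolding p_def by blast
qed

definition v :: "real => real" where "v q = lim (\<lambda>n. vN n q)"

lemma v_lim: "(\<lambda>n. vN n q) \<longlonglongrightarrow> v q"
proof -
 have "incseq (\<lambda>n. vN n q)" by (intro incseq_SucI vN_incr)
 moreover have "Bseq (\<lambda>n. vN n q)" by (rule BseqI'[of _ 1]) (use vN_bounds in auto)
 ultimately have "convergent (\<lambda>n. vN n q)" by (intro Bseq_monoseq_convergent) (auto simp: incseq_imp_monoseq)
 then show ?thesis unfolding v_def by (simp add: convergent_LIMSEQ_iff)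
qed

lemma v_meas [measurable]: "v \<in> borel_measurable borel" unfolding v_def[abs_def] by simp

lemma v_bounds: "0 <= v q" "v q <= 1" using vN_bounds by (auto intro!: LIMSEQ_le_const[OF v_lim] LIMSEQ_le_const2[OF v_lim])

lemma v_mono: "q <= r ==> v q <= v r" using vN_mono by (intro LIMSEQ_le[OF v_lim v_lim]) auto

lemma v_one: "1 < q ==> v q = 1"
proof -
 assume "1 < q"
 then have "vN n q = 1" for n by (cases n) auto
 then show ?thesis using v_lim[of q] by (simp add: LIMSEQ_const_iff)
qed

lemma v_eq: "q <= 1 ==> v q = (LINT z|M. v (q * A z))"
proof -
 assume q: "q <= 1"
 have "(\<lambda>n. \<integral>z. vN n (q * A z) \<partial>M) \<longlonglongrightarrow> (LINT z|M. v (q * A z))"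
  by (rule integral_dominated_convergence[where w = "\<lambda>_. 1"]) (use v_lim vN_bounds in auto)
 then have "(\<lambda>n. vN (Suc n) q) \<longlonglongrightarrow> (LINT z|M. v (q * A z))" using q by simp
 moreover have "(\<lambda>n. vN (Suc n) q) \<longlonglongrightarrow> v q" by (rule LIMSEQ_Suc[OF v_lim])
 ultimately show ?thesis by (rule LIMSEQ_unique[rotated])
qed

definition fv :: "real => real" where "fv s = exp (\<kappa> * s) * v (exp (- s))"

text \<open>By \<open>v_eq\<close> the defect vanishes for s >= 0. For s < 0 the walk starts above
  1, so the defect lies between 0 and exp (\<kappa> * s), which gives integrability. Being
  nonnegative, it has positive integral by \<open>defect_integral_pos\<close>, as fv (- 1) >
  0.\<close>

lemma fv_limit: "\<exists>\<gamma>>0. ((\<lambda>s. trunc_mean F s * fv s) \<longlongrightarrow> \<gamma>) at_top"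
proof -
 interpret L: renewal_law F \<alpha> "\<kappa> / 2" by (rule law)
 obtain c where c: "!!n q. 0 <= q ==> vN n q <= c * q powr (\<kappa> / 2)" using vN_markov by blast
 have vc: "v q <= c * q powr (\<kappa> / 2)" if "0 <= q" for q using c[OF that] by (intro LIMSEQ_le_const2[OF v_lim]) auto
 have v0: "v 0 = 0" using vc[of 0] v_bounds(1)[of 0] by simp
 have [measurable]: "fv \<in> borel_measurable borel" unfolding fv_def[abs_def] by simp
 let ?A = "\<lambda>s. LINT w|F. fv (s - w)"
 let ?B = "\<lambda>s. LINT z|M. v (exp (- s) * A z)"
 let ?C = "\<lambda>s. exp (\<kappa> * s)"
 have T: "?A s = ?C s * ?B s" for s
 proof -
  have "?A s = (LINT z|M. A z powr \<kappa> * fv (s - ln (A z)))" by (subst integral_F) auto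
  also have "... = (LINT z|M. ?C s * v (exp (- s) * A z))"
  proof (rule integral_cong_AE)
   show "AE z in M. A z powr \<kappa> * fv (s - ln (A z)) = ?C s * v (exp (- s) * A z)" using A_nonneg
   proof eventually_elim
    case (elim z)
    show ?case
    proof (cases "A z = 0")
     case False
     then have a: "0 < A z" using elim by simp
     have "A z powr \<kappa> * exp (\<kappa> * (s - ln (A z))) = ?C s" using a by (simp add: powr_def right_diff_distrib flip: exp_add)
     moreover have "exp (- (s - ln (A z))) = exp (- s) * A z" using a by (simp add: exp_diff exp_minus field_simps)
     ultimately show ?thesis by (simp only: fv_def mult.assoc[symmetric])
    qed (simp add: v0)
   qed
  qed measurable
  also have "... = ?C s * ?B s" by simp
  finally show ?thesis .
 qed
 have d: "0 <= fv s - ?A s \<and> fv s - ?A s <= (if s < 0 then (?C s) else 0)" for s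
 proof (cases "s < 0")
  case True
  have "0 <= ?B s \<and> ?B s <= 1" using v_bounds by (intro unit_integral) auto
  then show ?thesis using True v_one[of "exp (- s)"] unfolding T by (simp add: fv_def)
 next
  case False
  then show ?thesis using v_eq[of "exp (- s)"] unfolding T by (simp add: fv_def)
 qed
 interpret R: implicit_renewal F \<alpha> "\<kappa> / 2" fv \<kappa> c "\<kappa> / 2"
 proof
  show "0 <= fv s" for s using v_bounds by (simp add: fv_def)
  show "fv t <= exp (\<kappa> * (t - s)) * fv s" if "s <= t" for s t
  proof -
   have "exp (\<kappa> * t) * v (exp (- t)) <= exp (\<kappa> * t) * v (exp (- s))" using that by (intro mult_left_mono v_mono) auto
   then show ?thesis by (simp add: fv_def mult.assoc[symmetric] mult_exp_exp right_diff_distrib)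
  qed
  show "fv s <= c * exp (\<kappa> / 2 * s)" for s
  proof -
   have "?C s * v (exp (- s)) <= ?C s * (c * exp (- s) powr (\<kappa> / 2))" by (intro mult_left_mono vc) auto
   also have "... = c * exp (\<kappa> * s + - s * (\<kappa> / 2))" by (simp add: powr_def mult_exp_exp)
   also have "\<kappa> * s + - s * (\<kappa> / 2) = \<kappa> / 2 * s" by simp
   finally show ?thesis by (simp add: fv_def)
  qed
  obtain K where K: "0 < K" "!!u. 0 <= u ==> exp (- \<kappa> * u) * (1 + u) ^ 3 <= K" using exp_decay[OF kappa_pos] by blast
  show "integrable lborel (\<lambda>s. (fv s - ?A s) * br s)"
  proof (rule Lint_bound)
   show "integrable lborel (\<lambda>s. K * (1 / br s ^ 2))" by (intro integrable_mult_right integrable_rational_decay)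
   show "AE s in lborel. norm ((fv s - ?A s) * br s) <= norm (K * (1 / br s ^ 2))"
   proof (rule AE_I2)
    fix s :: real
    have "(fv s - ?A s) * br s <= K * (1 / br s ^ 2)"
    proof (cases "s < 0")
     case True
     have "(fv s - ?A s) * (br s * br s ^ 2) <= ?C s * (br s * br s ^ 2)" using d[of s] True by simp
     also have "... <= K" using K(2)[of "- s"] True by (simp add: power3_eq_cube power2_eq_square)
     finally show ?thesis by (simp add: pos_le_divide_eq mult.assoc)
    next
     case False
     then have "fv s - ?A s = 0" using d[of s] by simp
     then show ?thesis using K(1) by simp
    qed
    then show "norm ((fv s - ?A s) * br s) <= norm (K * (1 / br s ^ 2))" using d[of s] K(1) by simp
   qed
  qed measurable
 qed (use kappa_pos in auto)
 have "0 < (LBINT s. R.d s)"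
 proof (rule R.defect_integral_pos)
  show "0 <= R.d s" for s using d[of s] by (simp add: R.d_def R.Tf_def)
  show "0 < fv (- 1)" using v_one[of "exp 1"] by (simp add: fv_def)
 qed
 moreover have "0 < Gamma \<alpha> * Gamma (2 - \<alpha>)" using L.alpha by simp
 ultimately show ?thesis using R.implicit_renewal_limit by (intro exI conjI) (auto intro: divide_pos_pos)
qed

lemma median: "\<exists>x0. 1 / 2 <= prob {w \<in> space M. X w <= x0} \<and> 1 / 2 <= prob {w \<in> space M. x0 <= X w}"
proof -
 interpret D: real_distribution "distr M borel X" by simp
 let ?D = "distr M borel X"
 have "\<forall>\<^sub>F x in at_top. 1 / 2 < cdf ?D x" using D.cdf_lim_at_top_prob by (rule order_tendstoD) simp
 then obtain x1 where x1: "1 / 2 < cdf ?D x1" by (meson eventually_at_top_linorder order.refl)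
 have "\<forall>\<^sub>F x in at_bot. cdf ?D x < 1 / 2" using D.cdf_lim_at_bot by (rule order_tendstoD) simp
 then obtain x2 where x2: "!!x. x <= x2 ==> cdf ?D x < 1 / 2" by (auto simp: eventually_at_bot_linorder)
 define S where "S = {x. 1 / 2 <= cdf ?D x}"
 have S: "x1 \<in> S" "bdd_below S" using x1 x2 by (auto simp: S_def intro!: bdd_belowI[of _ x2]) (meson not_le order_less_imp_le)
 define x0 where "x0 = Inf S"
 have above: "1 / 2 <= cdf ?D x" if x: "x0 < x" for x
 proof -
  have "S \<noteq> {}" using S by auto
  then obtain y where "y \<in> S" "y < x" using x S(2) cInf_less_iff[of S x] unfolding x0_def by auto
  then show ?thesis using D.cdf_nondecreasing[of y x] by (simp add: S_def)
 qed
 have below: "cdf ?D x < 1 / 2" if "x < x0" for x using that cInf_lower[of x S] S unfolding x0_def S_def by force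
 have "1 / 2 <= cdf ?D x0"
 proof (rule tendsto_lowerbound)
  show "(cdf ?D \<longlongrightarrow> cdf ?D x0) (at_right x0)" using D.cdf_is_right_cont[of x0] by (simp add: continuous_within)
  show "\<forall>\<^sub>F x in at_right x0. 1 / 2 <= cdf ?D x" using above by (auto simp: eventually_at_right_field intro: exI[of _ "x0 + 1"])
 qed simp
 moreover have "measure ?D {..<x0} <= 1 / 2"
 proof (rule tendsto_upperbound)
  show "(cdf ?D \<longlongrightarrow> measure ?D {..<x0}) (at_left x0)" by (rule D.cdf_at_left)
  show "\<forall>\<^sub>F x in at_left x0. cdf ?D x <= 1 / 2" using below by (auto simp: eventually_at_left_field less_imp_le intro: exI[of _ "x0 - 1"])
 qed simp
 moreover have "cdf ?D x0 = prob {w \<in> space M. X w <= x0}" by (simp add: cdf_def measure_distr Int_def conj_commute)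
 moreover have "measure ?D {..<x0} = 1 - prob {w \<in> space M. x0 <= X w}"
 proof -
  have "{w \<in> space M. X w < x0} = space M - {w \<in> space M. x0 <= X w}" by auto
  moreover have "measure ?D {..<x0} = prob {w \<in> space M. X w < x0}" by (simp add: measure_distr Int_def conj_commute)
  ultimately show ?thesis by (simp only:) (rule prob_compl, measurable)
 qed
 ultimately show ?thesis by auto
qed

text \<open>If \<open>|y + q x\<^sub>0|\<close> exceeds \<open>t\<close> for a median \<open>x\<^sub>0\<close> of \<open>X\<close> then \<open>|y + q X|\<close>
 does so with probability at least one half, and one step of the recursion moves \<open>y + q x\<^sub>0\<close> by \<open>q (A x\<^sub>0 + B - x\<^sub>0)\<close>.\<close>

lemma tail_lower_bound:
 assumes nondeg: "!!x. prob {w \<in> space M. A w * x + B w = x} < 1"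
 shows "\<exists>p0>0. \<exists>\<epsilon>>0. \<forall>t>0. p0 * v (\<epsilon> / t) <= prob {w \<in> space M. t < abs (X w)}"
proof -
 obtain x0 where x0: "1 / 2 <= prob {w \<in> space M. X w <= x0}" "1 / 2 <= prob {w \<in> space M. x0 <= X w}" using median by blast
 let ?W = "\<lambda>w. abs (A w * x0 + B w - x0)"
 \<comment> \<open>Nondegeneracy at the point \<open>x0\<close>: the displacement A x0 + B - x0 is
   nonzero with positive probability, hence exceeds some 1 / (n + 1) in modulus with positive
   probability.\<close>
 have "\<exists>n. 0 < prob {w \<in> space M. 1 / real (Suc n) < ?W w}"
 proof (rule ccontr)
  assume "\<nexists>n. 0 < prob {w \<in> space M. 1 / real (Suc n) < ?W w}"
  then have "prob {w \<in> space M. 1 / real (Suc n) < ?W w} = 0" for n by (simp add: zero_less_measure_iff)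
  then have "AE w in M. \<not> 1 / real (Suc n) < ?W w" for n by (subst AE_iff_measurable[OF _ refl]) (auto simp: emeasure_eq_measure)
  then have "AE w in M. \<forall>n. \<not> 1 / real (Suc n) < ?W w" by (simp add: AE_all_countable)
  then have "AE w in M. A w * x0 + B w = x0"
  proof eventually_elim
   case (elim w)
   show ?case
   proof (rule ccontr)
    assume "A w * x0 + B w \<noteq> x0"
    then have "0 < ?W w" by simp
    then obtain n where "1 / real (Suc n) < ?W w" by (rule nat_approx_posE)
    then show False using elim by blast
   qed
  qed
  then have "prob {w \<in> space M. A w * x0 + B w = x0} = 1" by (subst prob_Collect_eq_1) auto
  then show False using nondeg[of x0] by simp
 qed
 then obtain n where n: "0 < prob {w \<in> space M. 1 / real (Suc n) < ?W w}" by blast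
 define \<epsilon> where "\<epsilon> = 1 / real (Suc n)"
 have \<epsilon>: "0 < \<epsilon>" "0 < prob {w \<in> space M. \<epsilon> < ?W w}" using n by (simp_all add: \<epsilon>_def)
 define p0 where "p0 = prob {w \<in> space M. \<epsilon> < ?W w}"
 have p0: "0 < p0" "p0 <= 1" using \<epsilon> by (auto simp: p0_def)
 let ?C = "\<lambda>t. \<epsilon> / 2 / t"
 have "p0 / 2 * v (?C t) <= prob {w \<in> space M. t < abs (X w)}" if t: "0 < t" for t
 proof -
  define \<phi> where "\<phi> = (\<lambda>x::real. if t < abs x then 1 else 0 :: real)"
  have [measurable]: "\<phi> \<in> borel_measurable borel" unfolding \<phi>_def by simp
  have \<phi>: "0 <= \<phi> x" "\<phi> x <= 1" for x by (auto simp: \<phi>_def)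
  define e where "e = (\<lambda>y q. \<integral>w. \<phi> (y + q * X w) \<partial>M)"
  have [measurable]: "(\<lambda>w. e (g w) (k w)) \<in> borel_measurable M" if [measurable]: "g \<in> borel_measurable M" "k \<in> borel_measurable M" for g k
   unfolding e_def by simp
  have e01: "0 <= e y q" "e y q <= 1" for y q unfolding e_def using \<phi> by (auto intro!: unit_integral[THEN conjunct1] unit_integral[THEN conjunct2])
  let ?A = "\<lambda>q y. LINT w|M. e (y + q * B w) (q * A w)"
  \<comment> \<open>The fixed-point equation moves (y, q) to (y + q * B, q * A); \<open>e\<close> is
    harmonic for this chain, whose second coordinate is the multiplicative walk.\<close>
  have rec: "e y q = ?A q y" for y q
  proof -
   have "e y q = (LINT x|distr M borel X. \<phi> (y + q * x))" unfolding e_def by (subst integral_distr) auto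
   also have "... = (LINT w|M. \<phi> (y + q * (A w * X w + B w)))" unfolding fixpoint by (subst integral_distr) auto
   also have "... = (LINT w|M. \<integral>w'. \<phi> (y + q * (A w * X w' + B w)) \<partial>M)"
    using integral_indep[of "\<lambda>z. \<phi> (y + q * (fst (fst z) * snd z + snd (fst z)))"] \<phi> by simp
   also have "... = ?A q y" unfolding e_def by (simp add: algebra_simps)
   finally show ?thesis .
  qed
  have half: "1 / 2 <= e y q" if q: "0 <= q" "t < abs (y + q * x0)" for y q
  proof -
   have low: "prob S <= e y q" if "S \<in> events" "!!w. w \<in> S ==> t < abs (y + q * X w)" for S
   proof -
    have "prob S = (LINT w|M. ind S w)" using that(1) by simp
    also have "... <= e y q" unfolding e_def using that \<phi> by (intro integral_mono unit_integrable) (auto simp: indicator_def \<phi>_def)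
    finally show ?thesis .
   qed
   show ?thesis
   proof (cases "0 <= y + q * x0")
    case True
    have "prob {w \<in> space M. x0 <= X w} <= e y q"
    proof (rule low)
     fix w assume "w \<in> {w \<in> space M. x0 <= X w}"
     then have "q * x0 <= q * X w" using q by (intro mult_left_mono) auto
     then show "t < abs (y + q * X w)" using True q by simp
    qed measurable
    then show ?thesis using x0 by simp
   next
    case False
    have "prob {w \<in> space M. X w <= x0} <= e y q"
    proof (rule low)
     fix w assume "w \<in> {w \<in> space M. X w <= x0}"
     then have "q * X w <= q * x0" using q by (intro mult_left_mono) auto
     then show "t < abs (y + q * X w)" using False q by simp
    qed measurable
    then show ?thesis using x0 by simp
   qed
  qed
  \<comment> \<open>If y + q * x0 has modulus at most t, then with probability \<open>p0\<close> the
    next step displaces it by more than 2 t, hence beyond t, where \<open>half\<close>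
    applies.\<close>
  have large: "p0 / 2 <= e y q" if q: "0 <= q" "2 * t < q * \<epsilon>" for y q
  proof (cases "t < abs (y + q * x0)")
   case True
   then show ?thesis using half[OF q(1) True] p0 by simp
  next
   case False
   have "p0 / 2 = (LINT w|M. 1 / 2 * ind {w \<in> space M. \<epsilon> < ?W w} w)" by (simp add: p0_def)
   also have "... <= ?A q y"
   proof (rule integral_mono_AE)
    show "integrable M (\<lambda>w. 1 / 2 * ind {w \<in> space M. \<epsilon> < ?W w} w :: real)" by (intro unit_integrable) (auto simp: indicator_def)
    show "integrable M (\<lambda>w. e (y + q * B w) (q * A w))" by (intro unit_integrable e01) measurable
    show "AE w in M. 1 / 2 * ind {w \<in> space M. \<epsilon> < ?W w} w <= e (y + q * B w) (q * A w)" using A_nonneg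
    proof eventually_elim
     case (elim w)
     show ?case
     proof (cases "\<epsilon> < ?W w")
      case True
      then have "q * \<epsilon> <= q * ?W w" using q by (intro mult_left_mono) auto
      also have "... = abs ((y + q * B w + q * A w * x0) - (y + q * x0))"
      proof -
       have "(y + q * B w + q * A w * x0) - (y + q * x0) = q * (A w * x0 + B w - x0)" by (simp add: algebra_simps)
       then show ?thesis using q(1) by (simp only: abs_mult)
      qed
      finally have "t < abs (y + q * B w + q * A w * x0)" using q False by simp
      then have "1 / 2 <= e (y + q * B w) (q * A w)" using q elim by (intro half) auto
      then show ?thesis by (simp add: indicator_def)
     next
      case False
      then show ?thesis using e01 by simp
     qed
    qed
   qed
   finally show ?thesis by (simp add: rec[symmetric])
  qed
  \<comment> \<open>The scaling makes q * (\<epsilon> / 2 / t) > 1 the condition 2 t < q *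
    \<epsilon> of \<open>large\<close>; below that level both sides are averaged over one
    step.\<close>
  have ind: "p0 / 2 * vN n (q * ?C t) <= e y q" if "0 <= q" for n y q using that
  proof (induction n arbitrary: y q)
   case 0
   then show ?case using large[of q y] e01[of y q] t by simp
  next
   case (Suc n)
   show ?case
   proof (cases "1 < q * ?C t")
    case True
    then show ?thesis using large[of q y] Suc t by simp
   next
    case False
    let ?B = "\<lambda>w. vN n (q * ?C t * A w)"
    have "p0 / 2 * (LINT w|M. ?B w) = (LINT w|M. p0 / 2 * ?B w)" by simp
    also have "... <= ?A q y"
    proof (rule integral_mono_AE)
     show "integrable M (\<lambda>w. p0 / 2 * ?B w)" by (intro integrable_mult_right vN_integrable)
     show "integrable M (\<lambda>w. e (y + q * B w) (q * A w))" by (intro unit_integrable e01) measurable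
     show "AE w in M. p0 / 2 * ?B w <= e (y + q * B w) (q * A w)" using A_nonneg
     proof eventually_elim
      case (elim w)
      then show ?case using Suc.IH[of "q * A w" "y + q * B w"] Suc.prems by (simp add: mult_ac)
     qed
    qed
    finally show ?thesis using False by (simp add: rec[symmetric])
   qed
  qed
  have "p0 / 2 * vN n (?C t) <= prob {w \<in> space M. t < abs (X w)}" for n
  proof -
   have "e 0 1 = (LINT w|M. ind {w \<in> space M. t < abs (X w)} w)" unfolding e_def by (intro Lint_cong) (auto simp: \<phi>_def)
   then show ?thesis using ind[of 1 n 0] by simp
  qed
  then show ?thesis by (intro LIMSEQ_le_const2[OF tendsto_mult[OF tendsto_const v_lim]]) auto
 qed
 then show ?thesis using p0 \<epsilon>(1) by (intro exI[of _ "p0 / 2"] conjI exI[of _ "\<epsilon> / 2"]) auto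
qed

text \<open>At t = exp s the lower bound is a multiple of v (\<epsilon> * exp (- s)), the walk's
  exceedance function shifted by ln \<epsilon>. By \<open>m_shift\<close> the shift only changes the
  constant in \<open>fv_limit\<close>.\<close>

lemma tail_limit_pos:
 assumes nondeg: "!!x. prob {w \<in> space M. A w * x + B w = x} < 1"
  and lim: "((\<lambda>s. trunc_mean F s * (exp (\<kappa> * s) * prob {w \<in> space M. exp s < abs (X w)})) \<longlongrightarrow> c) at_top"
 shows "0 < c"
proof -
 interpret L: renewal_law F \<alpha> "\<kappa> / 2" by (rule law)
 obtain p0 \<epsilon> where p: "0 < p0" "0 < \<epsilon>" "!!t. 0 < t ==> p0 * v (\<epsilon> / t) <= prob {w \<in> space M. t < abs (X w)}"
  using tail_lower_bound[OF nondeg] by blast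
 obtain \<gamma> where \<gamma>: "0 < \<gamma>" "((\<lambda>s. L.m s * fv s) \<longlongrightarrow> \<gamma>) at_top" using fv_limit by blast
 define k where "k = p0 * exp (\<kappa> * ln \<epsilon>)"
 have k: "0 < k" using p by (simp add: k_def)
 let ?A = "\<lambda>s. s + - ln \<epsilon>"
 have "((\<lambda>s. L.m (?A s) * fv (?A s) / (L.m (?A s) / L.m s)) \<longlongrightarrow> \<gamma> / 1) at_top"
  by (intro tendsto_divide L.m_shift filterlim_compose[OF \<gamma>(2)]) (real_asymp, simp)
 moreover have "\<forall>\<^sub>F s in at_top. L.m (?A s) * fv (?A s) / (L.m (?A s) / L.m s) = L.m s * fv (s - ln \<epsilon>)"
  using eventually_gt_at_top[of "ln \<epsilon>"]
 proof eventually_elim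
  case (elim s)
  then show ?case using L.m_pos[of "s - ln \<epsilon>"] by simp
 qed
 ultimately have "((\<lambda>s. L.m s * fv (s - ln \<epsilon>)) \<longlongrightarrow> \<gamma>) at_top" by (auto dest: tendsto_cong)
 then have low: "((\<lambda>s. k * (L.m s * fv (s - ln \<epsilon>))) \<longlongrightarrow> k * \<gamma>) at_top" by (intro tendsto_mult tendsto_const)
 have "\<forall>\<^sub>F s in at_top. k * (L.m s * fv (s - ln \<epsilon>)) <= L.m s * (exp (\<kappa> * s) * prob {w \<in> space M. exp s < abs (X w)})"
  using eventually_ge_at_top[of 0]
 proof eventually_elim
  case (elim s)
  have "exp (- (s - ln \<epsilon>)) = \<epsilon> / exp s" using p by (simp add: exp_diff)
  moreover have "exp (\<kappa> * ln \<epsilon>) * exp (\<kappa> * (s - ln \<epsilon>)) = exp (\<kappa> * s)" by (simp add: mult_exp_exp right_diff_distrib)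
  ultimately have "k * fv (s - ln \<epsilon>) = exp (\<kappa> * s) * (p0 * v (\<epsilon> / exp s))" by (simp add: fv_def k_def)
  also have "... <= exp (\<kappa> * s) * prob {w \<in> space M. exp s < abs (X w)}" by (intro mult_left_mono p) auto
  finally have "L.m s * (k * fv (s - ln \<epsilon>)) <= L.m s * (exp (\<kappa> * s) * prob {w \<in> space M. exp s < abs (X w)})"
   using elim by (intro mult_left_mono L.m_nonneg) auto
  then show ?case by (simp add: mult.left_commute)
 qed
 then have "k * \<gamma> <= c" by (rule tendsto_le[OF _ lim low, rotated]) simp
 then show ?thesis using mult_pos_pos[OF k \<gamma>(1)] by simp
qed

end

section \<open>Reflection and assembly of the two tails\<close>

context perpetuity
begin

text \<open>Changing the signs of B and X preserves the equation, so the left tail of X becomes a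
  right tail. Independence is inherited because the generated sigma-algebras can only
  shrink.\<close>

lemma reflect: "perpetuity M A \<kappa> (\<lambda>w. - B w) (\<lambda>w. - X w) \<nu> \<alpha>"
proof (intro perpetuity.intro tilting_axioms perpetuity_axioms.intro)
 have sub: "sets (vimage_algebra (space M) (\<lambda>w. g (k w)) R) \<subseteq> sets (vimage_algebra (space M) k R)"
  if [measurable]: "k \<in> M \<rightarrow>\<^sub>M R" "g \<in> R \<rightarrow>\<^sub>M R" for g k and R :: "'b measure"
 proof (rule sets_image_in_sets)
  have "k \<in> vimage_algebra (space M) k R \<rightarrow>\<^sub>M R" using measurable_space[OF that(1)] by (intro measurable_vimage_algebra1) auto
  then show "(\<lambda>w. g (k w)) \<in> vimage_algebra (space M) k R \<rightarrow>\<^sub>M R" by simp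
 qed simp
 let ?A = "sets (vimage_algebra (space M) (\<lambda>w. (A w, - B w)) (borel \<Otimes>\<^sub>M borel))"
 let ?B = "\<lambda>w. - X w"
 show "indep_set ?A (sets (vimage_algebra (space M) ?B borel))" unfolding indep_set_def
 proof (rule indep_sets_mono_sets[OF indep[unfolded indep_set_def]])
  fix i
  show "case_bool ?A (sets (vimage_algebra (space M) ?B borel)) i
    \<subseteq> case_bool (sets (vimage_algebra (space M) (\<lambda>w. (A w, B w)) (borel \<Otimes>\<^sub>M borel))) (sets (vimage_algebra (space M) X borel)) i"
   using sub[of "\<lambda>w. (A w, B w)" "borel \<Otimes>\<^sub>M borel" "\<lambda>z. (fst z, - snd z)"] sub[of X borel uminus] by (cases i) simp_all
 qed
 have "distr M borel ?B = distr (distr M borel X) borel uminus" by (subst distr_distr) (auto simp: comp_def)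
 also have "... = distr M borel (uminus \<circ> Y)" unfolding fixpoint by (rule distr_distr) measurable
 also have "uminus \<circ> Y = (\<lambda>w. A w * - X w + - B w)" by auto
 finally show "distr M borel ?B = distr M borel (\<lambda>w. A w * - X w + - B w)" .
qed (simp_all add: nu B_moment law)

lemma f_eq_prob:
 "f True s = exp (\<kappa> * s) * prob {w \<in> space M. exp s < X w}"
 "f False s = exp (\<kappa> * s) * prob {w \<in> space M. exp s <= X w}"
proof -
 have "(LINT w|M. exceeds True s (X w)) = (LINT w|M. ind {w \<in> space M. exp s < X w} w)"
  "(LINT w|M. exceeds False s (X w)) = (LINT w|M. ind {w \<in> space M. exp s <= X w} w)" by (auto intro!: Lint_cong simp: exceeds_def indicator_def)
 then show "f True s = exp (\<kappa> * s) * prob {w \<in> space M. exp s < X w}" "f False s = exp (\<kappa> * s) * prob {w \<in> space M. exp s <= X w}"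
  by (simp_all add: f_def)
qed

text \<open>The substitution s = ln x. Both kinds of exceedance have the same limit; the strict one
  is for the right tail, the weak one for the reflected left tail.\<close>

lemma tail_limit_powr:
 assumes "!!x. 0 <= x ==> truncated_mean M A \<kappa> x = trunc_mean F x"
 shows "((\<lambda>x. truncated_mean M A \<kappa> (ln x) * x powr \<kappa> * prob {w \<in> space M. x < X w}) \<longlongrightarrow>
   C_const \<alpha> / \<kappa> * (LINT w|M. pos_powr \<kappa> (Y w) - pos_powr \<kappa> (Z w))) at_top"
  and "((\<lambda>x. truncated_mean M A \<kappa> (ln x) * x powr \<kappa> * prob {w \<in> space M. x <= X w}) \<longlongrightarrow>
   C_const \<alpha> / \<kappa> * (LINT w|M. pos_powr \<kappa> (Y w) - pos_powr \<kappa> (Z w))) at_top"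
proof -
 let ?A = "LINT w|M. pos_powr \<kappa> (Y w) - pos_powr \<kappa> (Z w)"
 have lim: "((\<lambda>x. trunc_mean F (ln x) * f b (ln x)) \<longlongrightarrow> C_const \<alpha> / \<kappa> * ?A) at_top" for b
  by (rule filterlim_compose[OF tail_limit(2) ln_at_top])
 show "((\<lambda>x. truncated_mean M A \<kappa> (ln x) * x powr \<kappa> * prob {w \<in> space M. x < X w}) \<longlongrightarrow>
   C_const \<alpha> / \<kappa> * ?A) at_top" by (rule Lim_transform_eventually[OF lim[of True]], rule eventually_mono[OF eventually_ge_at_top[of 1]])
   (simp add: f_eq_prob assms powr_def)
 show "((\<lambda>x. truncated_mean M A \<kappa> (ln x) * x powr \<kappa> * prob {w \<in> space M. x <= X w}) \<longlongrightarrow>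
   C_const \<alpha> / \<kappa> * ?A) at_top" by (rule Lim_transform_eventually[OF lim[of False]], rule eventually_mono[OF eventually_ge_at_top[of 1]])
   (simp add: f_eq_prob assms powr_def)
qed

end

theorem theorem1:
  fixes M :: "'a measure" and A B X :: "'a \<Rightarrow> real" and \<kappa> \<alpha> \<nu> :: real and l :: "real \<Rightarrow> real"
  assumes "prob_space M"
    and "A \<in> borel_measurable M" and "B \<in> borel_measurable M" and "X \<in> borel_measurable M"
    and "AE \<omega> in M. 0 \<le> A \<omega>" and "\<not> (AE \<omega> in M. A \<omega> = 1)"
    and "0 < \<kappa>" and "0 < \<alpha>" and "\<alpha> \<le> 1"
    and "(\<integral>\<omega>. A \<omega> powr \<kappa> \<partial>M) = 1"
    and "(\<integral>\<^sup>+\<omega>. ennreal (A \<omega> powr \<kappa> * max (ln (A \<omega>)) 0) \<partial>M) = \<infinity>"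
    and "slowly_varying l"
    and "\<And>x. 0 < x \<Longrightarrow> tilted_tail M A \<kappa> x = l x * x powr (- \<alpha>)"
    and "((\<lambda>\<delta>. Limsup at_top (\<lambda>x. ennreal (x * tilted_tail M A \<kappa> x) *
            reflected_integral (tilted_log_law M A \<kappa>) x 1 (\<delta> * x)
              (\<lambda>y. 1 / (y * (tilted_tail M A \<kappa> y)\<^sup>2)))) \<longlongrightarrow> 0) (at_right 0)"
    and "nonarithmetic
           (distr (uniform_measure M {\<omega> \<in> space M. A \<omega> \<noteq> 0}) borel (\<lambda>\<omega>. ln (A \<omega>)))"
    and "\<kappa> < \<nu>" and "integrable M (\<lambda>\<omega>. \<bar>B \<omega>\<bar> powr \<nu>)"
    and "\<And>x. \<P>(\<omega> in M. A \<omega> * x + B \<omega> = x) < 1"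
    and "prob_space.indep_set M
           (sets (vimage_algebra (space M) (\<lambda>\<omega>. (A \<omega>, B \<omega>)) (borel \<Otimes>\<^sub>M borel)))
           (sets (vimage_algebra (space M) X borel))"
    and "distr M borel X = distr M borel (\<lambda>\<omega>. A \<omega> * X \<omega> + B \<omega>)"
  shows "integrable M (\<lambda>\<omega>. max (A \<omega> * X \<omega> + B \<omega>) 0 powr \<kappa> - max (A \<omega> * X \<omega>) 0 powr \<kappa>) \<and>
    integrable M (\<lambda>\<omega>. max (- (A \<omega> * X \<omega> + B \<omega>)) 0 powr \<kappa> - max (- (A \<omega> * X \<omega>)) 0 powr \<kappa>) \<and>
    ((\<lambda>x. truncated_mean M A \<kappa> (ln x) * x powr \<kappa> * \<P>(\<omega> in M. X \<omega> > x)) \<longlongrightarrow>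
       C_const \<alpha> / \<kappa> *
         (\<integral>\<omega>. max (A \<omega> * X \<omega> + B \<omega>) 0 powr \<kappa> - max (A \<omega> * X \<omega>) 0 powr \<kappa> \<partial>M)) at_top \<and>
    ((\<lambda>x. truncated_mean M A \<kappa> (ln x) * x powr \<kappa> * \<P>(\<omega> in M. X \<omega> \<le> - x)) \<longlongrightarrow>
       C_const \<alpha> / \<kappa> *
         (\<integral>\<omega>. max (- (A \<omega> * X \<omega> + B \<omega>)) 0 powr \<kappa> - max (- (A \<omega> * X \<omega>)) 0 powr \<kappa> \<partial>M)) at_top \<and>
    (\<integral>\<omega>. max (A \<omega> * X \<omega> + B \<omega>) 0 powr \<kappa> - max (A \<omega> * X \<omega>) 0 powr \<kappa> \<partial>M) +
    (\<integral>\<omega>. max (- (A \<omega> * X \<omega> + B \<omega>)) 0 powr \<kappa> - max (- (A \<omega> * X \<omega>)) 0 powr \<kappa> \<partial>M) > 0"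
  proof -
  interpret T: tilting M A \<kappa> by (intro tilting.intro tilting_axioms.intro assms)
  have law: "renewal_law T.F \<alpha> (\<kappa> / 2)" by (rule T.tilted_renewal_law(1)) (fact assms)+
  have mean: "truncated_mean M A \<kappa> x = trunc_mean T.F x" if "0 \<le> x" for x
    by (rule T.tilted_renewal_law(2)) (fact assms that)+
  interpret P: perpetuity M A \<kappa> B X \<nu> \<alpha>
    by (intro perpetuity.intro T.tilting_axioms perpetuity_axioms.intro assms law)
  interpret N: perpetuity M A \<kappa> "\<lambda>\<omega>. - B \<omega>" "\<lambda>\<omega>. - X \<omega>" \<nu> \<alpha> by (rule P.reflect)
  interpret L: renewal_law "T.F" \<alpha> "\<kappa> / 2" by (rule law)
  have neg: "A \<omega> * - X \<omega> = - (A \<omega> * X \<omega>)" "- (A \<omega> * X \<omega>) + - B \<omega> = - (A \<omega> * X \<omega> + B \<omega>)" for \<omega> by simp_all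
  let ?p = "\<integral>\<omega>. max (A \<omega> * X \<omega> + B \<omega>) 0 powr \<kappa> - max (A \<omega> * X \<omega>) 0 powr \<kappa> \<partial>M"
  let ?n = "\<integral>\<omega>. max (- (A \<omega> * X \<omega> + B \<omega>)) 0 powr \<kappa> - max (- (A \<omega> * X \<omega>)) 0 powr \<kappa> \<partial>M"
  \<comment> \<open>The strict right tails of X and of its reflection add up to the tail of the
    modulus. Its limit is C_const \<alpha> / \<kappa> times the sum of the two expectations, so
    \<open>tail_limit_pos\<close> gives the positivity of that sum.\<close>
  have split: "P.f True s + N.f True s = exp (\<kappa> * s) * \<P>(\<omega> in M. exp s < \<bar>X \<omega>\<bar>)" for s
  proof -
    have "{\<omega> \<in> space M. exp s < \<bar>X \<omega>\<bar>} = {\<omega> \<in> space M. exp s < X \<omega>} \<union> {\<omega> \<in> space M. exp s < - X \<omega>}" by auto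
    moreover have "\<not> (exp s < X \<omega> \<and> exp s < - X \<omega>)" for \<omega> using exp_gt_zero[of s] by linarith
    ultimately have "\<P>(\<omega> in M. exp s < \<bar>X \<omega>\<bar>) = \<P>(\<omega> in M. exp s < X \<omega>) + \<P>(\<omega> in M. exp s < - X \<omega>)"
      by (simp only:) (rule T.finite_measure_Union, auto)
    then show ?thesis by (simp only: P.f_eq_prob N.f_eq_prob distrib_left)
  qed
  have "((\<lambda>s. L.m s * (exp (\<kappa> * s) * \<P>(\<omega> in M. exp s < \<bar>X \<omega>\<bar>))) \<longlongrightarrow> C_const \<alpha> / \<kappa> * ?p + C_const \<alpha> / \<kappa> * ?n) at_top"
    using tendsto_add[OF P.tail_limit(2)[of True] N.tail_limit(2)[of True]]
    unfolding neg distrib_left[symmetric] split by (simp only: distrib_left)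
  from P.tail_limit_pos[OF assms(18) this] have "0 < C_const \<alpha> / \<kappa> * (?p + ?n)" by (simp only: distrib_left)
  moreover have "0 < C_const \<alpha> / \<kappa>" using assms(7,8,9) by (simp add: C_const_def Gamma_real_pos)
  ultimately have pos: "0 < ?p + ?n" by (simp only: zero_less_mult_iff) simp
  have left: "\<P>(\<omega> in M. X \<omega> \<le> - x) = \<P>(\<omega> in M. x \<le> - X \<omega>)" for x
    by (rule arg_cong[where f = "measure M"]) auto
  show ?thesis
    unfolding left using P.tail_limit(1) N.tail_limit(1) P.tail_limit_powr(1)[OF mean] N.tail_limit_powr(2)[OF mean] pos
    unfolding neg by blast
qed


end
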